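(* Let $L>0$, $D>0$, $b_1\in\mathbb R$, $b_2>0$, $U,\beta,k_0\ge0$, $p_0\in L^2(0,L)$, and suppose $\alpha>0$. Then the beam problem $$\begin{cases}(1-\alpha\partial_x^2)w_{tt}+D\partial_x^4w+k_0(1-\alpha\partial_x^2)w_t+(b_1-b_2\|w_x\|^2)w_{xx}=p_0(x)-\beta(w_t+Uw_x) & x\in(0,L),\ t>0,\\ w(t=0)=w_0,\quad w_t(t=0)=w_1,\\ w(0)=w_x(0)=0,\quad w_{xx}(L)=0,\\ -\alpha\partial_x[w_{tt}+k_0w_t]+D\partial_x^3w+(b_1-b_2\|w_x\|^2)w_x=0\ \text{ at } x=L\end{cases}$$ is semigroup well-posed on $\mathscr H_\alpha$, with the domain of the evolution generator given by $$\mathscr D(\mathbb A)=\{(w,v): w\in H^2_*\cap H^3(0,L),\ w_{xx}(L)=0,\ v\in H^2_*\}.$$ In addition, every such solution satisfies, for all $T\ge0$, the energy identity $$\mathcal E(T)+(k_0+\beta)\int_0^T\|w_t(s)\|^2ds+\alpha k_0\int_0^T\|w_{tx}(s)\|^2ds=\mathcal E(0)+\int_0^T\big(p_0-\beta Uw_x(s),\,w_t(s)\big)ds.$$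
   Context: $(\cdot,\cdot)$ and $\|\cdot\|$ are the inner product and norm of $L^2(0,L)$. $H^2_*=\{v\in H^2(0,L): v(0)=v_x(0)=0\}$ with inner product $(v,w)_{H^2_*}=D(v_{xx},w_{xx})$; $H^1_*=\{v\in H^1(0,L): v(0)=0\}$. For $\alpha>0$, $L_\alpha=H^1_*$ with norm $\|v\|_{L_\alpha}^2=\alpha\|v_x\|^2+\|v\|^2$, and $\mathscr H_\alpha=H^2_*\times L_\alpha$ with $\|(w_0,w_1)\|_{\mathscr H_\alpha}^2=D\|w_{0,xx}\|^2+\alpha\|w_{1,x}\|^2+\|w_1\|^2$. $C_w([0,T];X)$ denotes weakly continuous $X$-valued functions. Total energy: $\mathcal E(t)=\tfrac12\|w_t\|^2+\tfrac\alpha2\|w_{tx}\|^2+\tfrac12D\|w_{xx}\|^2+\tfrac14b_2\|w_x\|^4-\tfrac12b_1\|w_x\|^2$. Weak solution on $[0,T]$: $w\in H^1(0,T;L^2(0,L))$ with $w\in L^\infty(0,T;H^2_* )\cap C_w([0,T];H^2_* )$, $w_t\in L^\infty(0,T;L_\alpha)\cap C_w([0,T];L_\alpha)$; for every $\phi\in H^2_*$, $$\frac{d}{dt}\big[(w_t,\phi)+\alpha(w_{tx},\phi_x)\big]+(w,\phi)_{H^2_*}+(b_2\|w_x\|^2-b_1)(w_x,\phi_x)+k_0(w_t,\phi)+\alpha k_0(w_{tx},\phi_x)=(p_0,\phi)-\beta(w_t,\phi)-\beta U(w_x,\phi)$$ in $\mathscr D'(0,T)$; and $(w,\chi)_{H^2_*}|_{t\to0^+}=(w_0,\chi)_{H^2_*}$,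 $(w_t,\psi)|_{t\to0^+}=(w_1,\psi)$ for all $\chi\in H^2_*$, $\psi\in L^2(0,L)$. Strong solution on $[0,T]$: a weak solution with, in addition, $w\in L^\infty(0,T;W)$, where $W=\{v\in H^2_*\cap H^3(0,L): v_{xx}(L)=0\}$, $w_t\in L^\infty(0,T;H^2_* )$, and the right derivative $\frac{d^+}{dt^+}w_t$ is right-continuous and $L^\infty(0,T)$ with values in $H^1_*$. Semigroup well-posedness: there is a family of (nonlinear) locally Lipschitz operators $t\mapsto\mathcal S(t)$ on $\mathscr H_\alpha$ (a semigroup) such that for every $y_0=(w_0,w_1)\in\mathscr H_\alpha$ the function $t\mapsto\mathcal S(t)y_0=(w(t),w_t(t))$ (i) is in $C([0,T];\mathscr H_\alpha)$, (ii) is a weak solution of the problem, and (iii) is a strong $C([0,T];\mathscr H_\alpha)$ limit of strong solutions of the problem, on every $[0,T]$, $T>0$. In particular, solutions are unique and depend continuously in $C([0,T];\mathscr H_\alpha)$ on the initial data from $\mathscr H_\alpha$. Furthermore, there is a subset $\mathscr D(\mathbb A)\subset\mathscr H_\alpha$ (the domain of the evolution generator), invariant under the flow, such that all solutions originating in it are strong solutions. "Such solutions" are the functions $\mathcal S(t)y_0$, $y_0\in\mathscr H_\alpha$. *)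

theory Defs
  imports "HOL-Analysis.Analysis"
begin

section \<open>The Hilbert space of square-integrable functions on the line\<close>

text \<open>Classes of Borel functions modulo almost-everywhere equality; \<^term>\<open>rep_l2\<close> below picks an
  arbitrary representative.\<close>


definition sq_integrable :: "(real \<Rightarrow> real) \<Rightarrow> bool"
  where "sq_integrable f \<longleftrightarrow> f \<in> borel_measurable lborel \<and> integrable lborel (\<lambda>x. (f x)\<^sup>2)"

definition l2_eq :: "(real \<Rightarrow> real) \<Rightarrow> (real \<Rightarrow> real) \<Rightarrow> bool"
  where "l2_eq f g \<longleftrightarrow> sq_integrable f \<and> sq_integrable g \<and> (AE x in lborel. f x = g x)"

quotient_type l2 = "real \<Rightarrow> real" / partial: l2_eq
proof (rule part_equivpI)
  show "\<exists>f. l2_eq f f"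
    by (rule exI[of _ "\<lambda>_. 0"]) (simp add: l2_eq_def sq_integrable_def)
  show "symp l2_eq" by (auto simp: symp_def l2_eq_def elim: eventually_mono)
  show "transp l2_eq" unfolding transp_def l2_eq_def by (auto elim: eventually_elim2)
qed

lemma sq_integrable_mult:
  assumes "sq_integrable f" "sq_integrable g"
  shows "integrable lborel (\<lambda>x. f x * g x)"
proof (rule Bochner_Integration.integrable_bound)
  show "integrable lborel (\<lambda>x. (f x)\<^sup>2 + (g x)\<^sup>2)"
    using assms by (auto simp: sq_integrable_def)
  show "(\<lambda>x. f x * g x) \<in> borel_measurable lborel"
    using assms by (auto simp: sq_integrable_def)
  have "\<bar>f x * g x\<bar> \<le> (f x)\<^sup>2 + (g x)\<^sup>2" for x
  proof -
    have "0 \<le> \<bar>f x\<bar> * \<bar>g x\<bar>" by simp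
    moreover have "2 * (\<bar>f x\<bar> * \<bar>g x\<bar>) \<le> (f x)\<^sup>2 + (g x)\<^sup>2"
      using sum_squares_bound[of "\<bar>f x\<bar>" "\<bar>g x\<bar>"] by (simp add: mult.assoc)
    ultimately show ?thesis unfolding abs_mult by linarith
  qed
  then show "AE x in lborel. norm (f x * g x) \<le> norm ((f x)\<^sup>2 + (g x)\<^sup>2)" by simp
qed

lemma sq_integrable_add:
  assumes "sq_integrable f" "sq_integrable g"
  shows "sq_integrable (\<lambda>x. f x + g x)"
  using assms sq_integrable_mult[OF assms]
  by (auto simp: sq_integrable_def power2_sum mult.assoc)

lemma sq_integrable_scale:
  assumes "sq_integrable f" shows "sq_integrable (\<lambda>x. c * f x)"
  using assms by (auto simp: sq_integrable_def power_mult_distrib)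

lemma sq_integrable_diff:
  assumes "sq_integrable f" "sq_integrable g"
  shows "sq_integrable (\<lambda>x. f x - g x)"
  using sq_integrable_add[OF assms(1) sq_integrable_scale[OF assms(2), of "-1"]] by simp

instantiation l2 :: real_vector
begin

lift_definition zero_l2 :: l2 is "\<lambda>_. 0"
  by (simp add: l2_eq_def sq_integrable_def)

lift_definition plus_l2 :: "l2 \<Rightarrow> l2 \<Rightarrow> l2" is "\<lambda>f g x. f x + g x"
  by (auto simp: l2_eq_def sq_integrable_add elim: eventually_elim2)

lift_definition minus_l2 :: "l2 \<Rightarrow> l2 \<Rightarrow> l2" is "\<lambda>f g x. f x - g x"
  by (auto simp: l2_eq_def sq_integrable_diff elim: eventually_elim2)

lift_definition uminus_l2 :: "l2 \<Rightarrow> l2" is "\<lambda>f x. - f x"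
  by (auto simp: l2_eq_def sq_integrable_def elim: eventually_mono)

lift_definition scaleR_l2 :: "real \<Rightarrow> l2 \<Rightarrow> l2" is "\<lambda>c f x. c * f x"
  by (auto simp: l2_eq_def sq_integrable_scale elim: eventually_mono)

instance
proof
  fix f g h :: l2 and a b :: real
  show "f + g + h = f + (g + h)"
    by transfer (auto simp: l2_eq_def algebra_simps intro!: sq_integrable_add)
  show "f + g = g + f"
    by transfer (auto simp: l2_eq_def algebra_simps intro!: sq_integrable_add)
  show "0 + f = f" by transfer (auto simp: l2_eq_def)
  show "- f + f = 0" by transfer (auto simp: l2_eq_def sq_integrable_def)
  show "f - g = f + - g"
    by transfer (auto simp: l2_eq_def intro: sq_integrable_diff)
  show "a *\<^sub>R (f + g) = a *\<^sub>R f + a *\<^sub>R g"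
    by transfer (auto simp: l2_eq_def distrib_left intro!: sq_integrable_add sq_integrable_scale)
  show "(a + b) *\<^sub>R f = a *\<^sub>R f + b *\<^sub>R f"
    by transfer (auto simp: l2_eq_def distrib_right intro!: sq_integrable_add sq_integrable_scale)
  show "a *\<^sub>R b *\<^sub>R f = (a * b) *\<^sub>R f"
    by transfer (auto simp: l2_eq_def mult.assoc intro!: sq_integrable_scale)
  show "1 *\<^sub>R f = f" by transfer (auto simp: l2_eq_def)
qed

end

instantiation l2 :: real_inner
begin

lift_definition inner_l2 :: "l2 \<Rightarrow> l2 \<Rightarrow> real" is "\<lambda>f g. \<integral>x. f x * g x \<partial>lborel"
proof -
  fix f f' g g' assume "l2_eq f f'" "l2_eq g g'"
  then show "(\<integral>x. f x * g x \<partial>lborel) = (\<integral>x. f' x * g' x \<partial>lborel)"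
    unfolding l2_eq_def sq_integrable_def
    by (intro integral_cong_AE) (auto elim: eventually_elim2)
qed

definition norm_l2 :: "l2 \<Rightarrow> real" where "norm_l2 f = sqrt (inner f f)"

definition sgn_l2 :: "l2 \<Rightarrow> l2" where "sgn_l2 f = inverse (norm f) *\<^sub>R f"

definition dist_l2 :: "l2 \<Rightarrow> l2 \<Rightarrow> real" where "dist_l2 f g = norm (f - g)"

definition uniformity_l2 :: "(l2 \<times> l2) filter"
  where "uniformity_l2 = (INF e\<in>{0 <..}. principal {(x, y). dist x y < e})"

definition open_l2 :: "l2 set \<Rightarrow> bool"
  where "open_l2 U \<longleftrightarrow> (\<forall>x\<in>U. \<forall>\<^sub>F (x', y) in uniformity. x' = x \<longrightarrow> y \<in> U)"

instance
proof
  fix f g h :: l2 and r :: real and U :: "l2 set"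
  show "sgn f = inverse (norm f) *\<^sub>R f" by (rule sgn_l2_def)
  show "dist f g = norm (f - g)" by (rule dist_l2_def)
  show "(uniformity :: (l2 \<times> l2) filter) = (INF e\<in>{0 <..}. principal {(x, y). dist x y < e})"
    by (rule uniformity_l2_def)
  show "open U \<longleftrightarrow> (\<forall>x\<in>U. \<forall>\<^sub>F (x', y) in uniformity. x' = x \<longrightarrow> y \<in> U)"
    by (rule open_l2_def)
  show "inner f g = inner g f" by transfer (simp add: mult.commute)
  show "inner (f + g) h = inner f h + inner g h"
    by transfer (auto simp: l2_eq_def distrib_right sq_integrable_mult)
  show "inner (r *\<^sub>R f) g = r * inner f g"
    by transfer (simp add: mult.assoc)
  show "0 \<le> inner f f" by transfer simp
  show "inner f f = 0 \<longleftrightarrow> f = 0"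
  proof (transfer)
    fix f assume "l2_eq f f"
    then have f: "sq_integrable f" "integrable lborel (\<lambda>x. f x * f x)"
      by (auto simp: l2_eq_def sq_integrable_def power2_eq_square)
    have "(\<integral>x. f x * f x \<partial>lborel) = 0 \<longleftrightarrow> (AE x in lborel. f x * f x = 0)"
      by (rule integral_nonneg_eq_0_iff_AE[OF f(2)]) simp
    with f(1) show "(\<integral>x. f x * f x \<partial>lborel) = 0 \<longleftrightarrow> l2_eq f (\<lambda>_. 0)"
      by (simp add: l2_eq_def) (simp add: sq_integrable_def)
  qed
  show "norm f = sqrt (inner f f)" by (rule norm_l2_def)
qed

end

subsection \<open>Separability\<close>

text \<open>Needed for the Bochner integral of \<open>l2\<close>-valued functions.\<close>

lemma l2_eq_rep: "l2_eq (rep_l2 f) (rep_l2 f)"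
  using Quotient_rep_reflp[OF Quotient_l2] .

lemma sq_integrable_rep: "sq_integrable (rep_l2 f)"
  using l2_eq_rep[of f] by (simp add: l2_eq_def)

lemma abs_rep_l2: "abs_l2 (rep_l2 f) = f"
  using Quotient_abs_rep[OF Quotient_l2] .

lemma abs_l2_eq: "sq_integrable f \<Longrightarrow> sq_integrable g \<Longrightarrow> (AE x in lborel. f x = g x) \<Longrightarrow> abs_l2 f = abs_l2 g"
  using Quotient_rel_abs[OF Quotient_l2] by (simp add: l2_eq_def)

lemma l2_eq_self: "l2_eq f f \<longleftrightarrow> sq_integrable f"
  by (simp add: l2_eq_def)

lemma abs_l2_add: "sq_integrable f \<Longrightarrow> sq_integrable g \<Longrightarrow> abs_l2 (\<lambda>x. f x + g x) = abs_l2 f + abs_l2 g"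
  by (simp add: plus_l2.abs_eq l2_eq_self)

lemma abs_l2_diff: "sq_integrable f \<Longrightarrow> sq_integrable g \<Longrightarrow> abs_l2 (\<lambda>x. f x - g x) = abs_l2 f - abs_l2 g"
  by (simp add: minus_l2.abs_eq l2_eq_self)

lemma abs_l2_scale: "sq_integrable f \<Longrightarrow> abs_l2 (\<lambda>x. c * f x) = c *\<^sub>R abs_l2 f"
  by (simp add: scaleR_l2.abs_eq l2_eq_self)

lemma abs_l2_zero: "abs_l2 (\<lambda>_. 0) = 0"
  by (simp add: zero_l2_def)

lemma norm_abs_l2: "sq_integrable f \<Longrightarrow> (norm (abs_l2 f))\<^sup>2 = (\<integral>x. (f x)\<^sup>2 \<partial>lborel)"
  by (simp only: power2_norm_eq_inner inner_l2.abs_eq l2_eq_self) (simp only: power2_eq_square)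

lemma l2_tendsto:
  assumes "\<And>n. sq_integrable (f n)" "sq_integrable g"
    and "(\<lambda>n. \<integral>x. (f n x - g x)\<^sup>2 \<partial>lborel) \<longlonglongrightarrow> 0"
  shows "(\<lambda>n. abs_l2 (f n)) \<longlonglongrightarrow> abs_l2 g"
proof -
  have "(\<lambda>n. (norm (abs_l2 (f n) - abs_l2 g))\<^sup>2) \<longlonglongrightarrow> 0"
    using assms by (simp add: norm_abs_l2 sq_integrable_diff flip: abs_l2_diff)
  then have "(\<lambda>n. sqrt ((norm (abs_l2 (f n) - abs_l2 g))\<^sup>2)) \<longlonglongrightarrow> sqrt 0"
    by (rule tendsto_real_sqrt)
  then have "(\<lambda>n. norm (abs_l2 (f n) - abs_l2 g)) \<longlonglongrightarrow> 0" by simp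
  then show ?thesis by (rule LIM_zero_cancel[OF tendsto_norm_zero_cancel])
qed

lemma l2_dominated_convergence:
  assumes f: "\<And>n. f n \<in> borel_measurable lborel" and g: "sq_integrable g" and h: "sq_integrable h"
    and bound: "\<And>n x. \<bar>f n x\<bar> \<le> h x" and lim: "\<And>x. (\<lambda>n. f n x) \<longlonglongrightarrow> g x"
  shows "(\<lambda>n. abs_l2 (f n)) \<longlonglongrightarrow> abs_l2 g"
proof (rule l2_tendsto)
  have h0: "0 \<le> h x" for x using bound[of 0 x] by linarith
  have sq: "integrable lborel (\<lambda>x. (h x)\<^sup>2)" using h by (simp add: sq_integrable_def)
  show sf: "sq_integrable (f n)" for n
    unfolding sq_integrable_def
  proof (intro conjI f Bochner_Integration.integrable_bound[OF sq])
    show "AE x in lborel. norm ((f n x)\<^sup>2) \<le> norm ((h x)\<^sup>2)"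
    proof (intro AE_I2)
      fix x
      have "\<bar>f n x\<bar> \<le> \<bar>h x\<bar>" using bound[of n x] h0[of x] by simp
      then show "norm ((f n x)\<^sup>2) \<le> norm ((h x)\<^sup>2)" by (simp add: abs_le_square_iff)
    qed
    show "(\<lambda>x. (f n x)\<^sup>2) \<in> borel_measurable lborel" using f[of n] by measurable
  qed
  show "sq_integrable g" by (rule g)
  have gb: "\<bar>g x\<bar> \<le> h x" for x
    by (rule LIMSEQ_le_const2[OF tendsto_rabs[OF lim]]) (use bound in auto)
  have "(\<lambda>n. \<integral>x. (f n x - g x)\<^sup>2 \<partial>lborel) \<longlonglongrightarrow> (\<integral>x. 0 \<partial>(lborel :: real measure))"
  proof (rule integral_dominated_convergence[where w = "\<lambda>x. 4 * (h x)\<^sup>2"])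
    show "(\<lambda>x. (f n x - g x)\<^sup>2) \<in> borel_measurable lborel" for n
      using f[of n] g unfolding sq_integrable_def
      by (intro borel_measurable_power borel_measurable_diff) auto
    show "integrable lborel (\<lambda>x. 4 * (h x)\<^sup>2)" using sq by simp
    have "(\<lambda>n. (f n x - g x)\<^sup>2) \<longlonglongrightarrow> (g x - g x)\<^sup>2" for x
      by (intro tendsto_intros lim)
    then show "AE x in lborel. (\<lambda>n. (f n x - g x)\<^sup>2) \<longlonglongrightarrow> 0" by simp
    have "(f n x - g x)\<^sup>2 \<le> (2 * h x)\<^sup>2" for n x
    proof -
      have "\<bar>f n x - g x\<bar> \<le> \<bar>2 * h x\<bar>" using bound[of n x] gb[of x] h0[of x] by linarith
      then show ?thesis by (simp only: abs_le_square_iff)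
    qed
    then show "AE x in lborel. norm ((f n x - g x)\<^sup>2) \<le> 4 * (h x)\<^sup>2" for n
      by (simp add: power_mult_distrib)
    show "(\<lambda>x. 0) \<in> borel_measurable lborel" by simp
  qed
  then show "(\<lambda>n. \<integral>x. (f n x - g x)\<^sup>2 \<partial>lborel) \<longlonglongrightarrow> 0" by simp
qed

abbreviation ind_l2 :: "real set \<Rightarrow> l2" where "ind_l2 A \<equiv> abs_l2 (indicat_real A)"

lemma sq_integrable_ind:
  assumes "A \<in> sets borel" "A \<subseteq> {a..b}"
  shows "sq_integrable (indicat_real A)"
proof -
  have "emeasure lborel A \<le> emeasure lborel {a..b}"
    using assms by (intro emeasure_mono) auto
  also have "\<dots> < \<infinity>" by (simp add: emeasure_lborel_Icc_eq)
  finally have "integrable lborel (indicat_real A)"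
    using assms by (intro integrable_real_indicator) auto
  moreover have "(\<lambda>x. (indicat_real A x)\<^sup>2) = indicat_real A"
    by (auto simp: indicator_def)
  ultimately show ?thesis using assms by (simp add: sq_integrable_def)
qed

definition rat_step :: "(rat \<times> rat \<times> rat) list \<Rightarrow> l2"
  where "rat_step xs = (\<Sum>(c, a, b)\<leftarrow>xs. of_rat c *\<^sub>R ind_l2 {of_rat a..of_rat b})"

lemma rat_step_closure_add:
  assumes "f \<in> closure (range rat_step)" "g \<in> closure (range rat_step)"
  shows "f + g \<in> closure (range rat_step)"
proof -
  obtain x y where x: "\<And>n. x n \<in> range rat_step" "x \<longlonglongrightarrow> f"
    and y: "\<And>n. y n \<in> range rat_step" "y \<longlonglongrightarrow> g"
    using assms by (auto simp: closure_sequential)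
  have "x n + y n \<in> range rat_step" for n
  proof -
    obtain xs ys where "x n = rat_step xs" "y n = rat_step ys" using x(1)[of n] y(1)[of n] by auto
    then have "x n + y n = rat_step (xs @ ys)" by (simp add: rat_step_def)
    then show ?thesis by blast
  qed
  with tendsto_add[OF x(2) y(2)] show ?thesis
    unfolding closure_sequential by (intro exI[of _ "\<lambda>n. x n + y n"]) auto
qed

lemma rat_step_scale: "of_rat q *\<^sub>R rat_step xs = rat_step (map (\<lambda>(c, ab). (q * c, ab)) xs)"
  by (induction xs) (auto simp: rat_step_def scaleR_add_right of_rat_mult)

lemma rat_step_closure_scale:
  assumes "f \<in> closure (range rat_step)"
  shows "c *\<^sub>R f \<in> closure (range rat_step)"
proof -
  obtain x where x: "\<And>n. x n \<in> range rat_step" "x \<longlonglongrightarrow> f"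
    using assms by (auto simp: closure_sequential)
  have "\<exists>q::rat. c < of_rat q \<and> of_rat q < c + 1 / Suc n" for n
    using of_rat_dense[of c "c + 1 / Suc n"] by auto
  then obtain q :: "nat \<Rightarrow> rat" where q: "\<And>n. c < of_rat (q n)" "\<And>n. of_rat (q n) < c + 1 / Suc n"
    by metis
  have "(\<lambda>n. of_rat (q n)) \<longlonglongrightarrow> c"
  proof (rule tendsto_sandwich[where f = "\<lambda>_. c" and h = "\<lambda>n. c + 1 / Suc n"])
    have "(\<lambda>n. c + 1 / Suc n) \<longlonglongrightarrow> c + 0"
      by (intro tendsto_add tendsto_const LIMSEQ_Suc[OF lim_1_over_n])
    then show "(\<lambda>n. c + 1 / Suc n) \<longlonglongrightarrow> c" by simp
  qed (use q in \<open>auto intro!: always_eventually less_imp_le\<close>)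
  from tendsto_scaleR[OF this x(2)] have lim: "(\<lambda>n. of_rat (q n) *\<^sub>R x n) \<longlonglongrightarrow> c *\<^sub>R f" .
  have "of_rat (q n) *\<^sub>R x n \<in> range rat_step" for n
    using x(1)[of n] by (auto simp: rat_step_scale)
  with lim show ?thesis
    unfolding closure_sequential by (intro exI[of _ "\<lambda>n. of_rat (q n) *\<^sub>R x n"]) auto
qed

lemma rat_step_closure_zero: "0 \<in> closure (range rat_step)"
proof -
  have "0 = rat_step []" by (simp add: rat_step_def)
  then show ?thesis by (metis closure_subset rangeI subsetD)
qed

lemma rat_step_closure_sum:
  "finite I \<Longrightarrow> (\<And>i. i \<in> I \<Longrightarrow> f i \<in> closure (range rat_step)) \<Longrightarrow> sum f I \<in> closure (range rat_step)"
  by (induction I rule: finite_induct) (auto intro: rat_step_closure_zero rat_step_closure_add)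

lemma rat_step_closure_lim:
  assumes "\<And>n. f n \<in> closure (range rat_step)" "f \<longlonglongrightarrow> g"
  shows "g \<in> closure (range rat_step)"
  using closed_sequentially[OF closed_closure] assms by blast

lemma rat_step_closure_interval: "ind_l2 {a..b} \<in> closure (range rat_step)"
proof -
  have "\<exists>q::rat. a - 1 / Suc n < of_rat q \<and> of_rat q < a" for n
    using of_rat_dense[of "a - 1 / Suc n" a] by auto
  then obtain q :: "nat \<Rightarrow> rat" where q: "\<And>n. a - 1 / Suc n < of_rat (q n)" "\<And>n. of_rat (q n) < a"
    by metis
  have "\<exists>q::rat. b < of_rat q \<and> of_rat q < b + 1 / Suc n" for n
    using of_rat_dense[of b "b + 1 / Suc n"] by auto
  then obtain r :: "nat \<Rightarrow> rat" where r: "\<And>n. b < of_rat (r n)" "\<And>n. of_rat (r n) < b + 1 / Suc n"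
    by metis
  let ?J = "\<lambda>n. {of_rat (q n)..of_rat (r n)} :: real set"
  have le1: "1 / real (Suc n) \<le> 1" for n by simp
  have sub: "?J n \<subseteq> {a - 1..b + 1}" for n
  proof -
    have "a - 1 \<le> of_rat (q n)" "of_rat (r n) \<le> b + 1"
      using q(1)[of n] r(2)[of n] le1[of n] by linarith+
    then show ?thesis by auto
  qed
  have "ind_l2 (?J n) \<in> closure (range rat_step)" for n
  proof -
    have "ind_l2 (?J n) = rat_step [(1, q n, r n)]" by (simp add: rat_step_def)
    then show ?thesis by (metis closure_subset rangeI subsetD)
  qed
  moreover have "(\<lambda>n. ind_l2 (?J n)) \<longlonglongrightarrow> ind_l2 {a..b}"
  proof (rule l2_dominated_convergence[where h = "indicat_real {a - 1..b + 1}"])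
    show "sq_integrable (indicat_real {a..b})" "sq_integrable (indicat_real {a - 1..b + 1})"
      by (rule sq_integrable_ind, auto)+
    show "\<bar>indicat_real (?J n) x\<bar> \<le> indicat_real {a - 1..b + 1} x" for n x
      using sub[of n] by (auto simp: indicator_def)
    show "(\<lambda>n. indicat_real (?J n) x) \<longlonglongrightarrow> indicat_real {a..b} x" for x
    proof (cases "x \<in> {a..b}")
      case True
      then have "indicat_real (?J n) x = indicat_real {a..b} x" for n
        using q(2)[of n] r(1)[of n] by auto
      then show ?thesis by simp
    next
      case False
      define e where "e = max (a - x) (x - b)"
      have e: "0 < e" using False by (auto simp: e_def)
      then have "\<forall>\<^sub>F n in sequentially. 1 / Suc n < e"
        using order_tendstoD(2)[OF LIMSEQ_Suc[OF lim_1_over_n]] by blast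
      then have "\<forall>\<^sub>F n in sequentially. indicat_real (?J n) x = indicat_real {a..b} x"
      proof eventually_elim
        case (elim n)
        then have "x \<notin> ?J n"
          using q(1)[of n] r(2)[of n] False by (auto simp: e_def max_def split: if_splits)
        with False show ?case by simp
      qed
      then show ?thesis by (rule tendsto_eventually)
    qed
  qed simp
  ultimately show ?thesis by (rule rat_step_closure_lim)
qed

lemma rat_step_closure_ind:
  assumes "A \<in> sets borel"
  shows "ind_l2 (A \<inter> {-r..r}) \<in> closure (range rat_step)"
proof -
  have borel: "sigma_sets UNIV (range (\<lambda>a. {..a::real})) = sets borel"
    by (simp add: borel_eq_atMost)
  have I: "sq_integrable (indicat_real (A \<inter> {-r..r}))" if "A \<in> sets borel" for A
    using that by (intro sq_integrable_ind[of _ "-r" r]) auto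
  have "Int_stable (range (\<lambda>a. {..a::real}))" by (auto simp: Int_stable_def)
  moreover have "range (\<lambda>a. {..a::real}) \<subseteq> Pow UNIV" by simp
  moreover have "A \<in> sigma_sets UNIV (range (\<lambda>a. {..a::real}))" using assms borel by simp
  ultimately show ?thesis
  proof (induction rule: sigma_sets_induct_disjoint)
    case (basic A)
    then obtain a where "A = {..a}" by auto
    then have "A \<inter> {-r..r} = {-r..min a r}" by auto
    then show ?case by (simp add: rat_step_closure_interval)
  next
    case empty
    then show ?case by (simp add: rat_step_closure_zero abs_l2_zero)
  next
    case (compl A)
    then have A: "A \<in> sets borel" by (simp add: borel)
    have "indicat_real ((UNIV - A) \<inter> {-r..r}) = (\<lambda>x. indicat_real (UNIV \<inter> {-r..r}) x - indicat_real (A \<inter> {-r..r}) x)"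
      by (auto simp: indicator_def)
    then have "ind_l2 ((UNIV - A) \<inter> {-r..r}) = ind_l2 (UNIV \<inter> {-r..r}) - ind_l2 (A \<inter> {-r..r})"
      using abs_l2_diff[OF I[of UNIV] I[OF A]] by simp
    also have "\<dots> = ind_l2 {-r..r} + (-1) *\<^sub>R ind_l2 (A \<inter> {-r..r})" by simp
    also have "\<dots> \<in> closure (range rat_step)"
      by (intro rat_step_closure_add rat_step_closure_scale rat_step_closure_interval compl)
    finally show ?case .
  next
    case (union A)
    then have A: "A i \<in> sets borel" for i using borel by auto
    have fin: "ind_l2 ((\<Union>i<n. A i) \<inter> {-r..r}) \<in> closure (range rat_step)" for n
    proof (induction n)
      case 0
      then show ?case by (simp add: rat_step_closure_zero abs_l2_zero)
    next
      case (Suc n)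
      have "A i \<inter> A n = {}" if "i < n" for i
        using union(1) that by (simp add: disjoint_family_on_def)
      then have "(\<Union>i<n. A i) \<inter> A n = {}" by blast
      then have "indicat_real ((\<Union>i<Suc n. A i) \<inter> {-r..r}) =
          (\<lambda>x. indicat_real ((\<Union>i<n. A i) \<inter> {-r..r}) x + indicat_real (A n \<inter> {-r..r}) x)"
        by (auto simp: indicator_def less_Suc_eq fun_eq_iff)
      then have "ind_l2 ((\<Union>i<Suc n. A i) \<inter> {-r..r}) =
          ind_l2 ((\<Union>i<n. A i) \<inter> {-r..r}) + ind_l2 (A n \<inter> {-r..r})"
        using A by (simp add: abs_l2_add[OF I I])
      with Suc union(3)[of n] show ?case by (simp add: rat_step_closure_add)
    qed
    have "(\<lambda>n. ind_l2 ((\<Union>i<n. A i) \<inter> {-r..r})) \<longlonglongrightarrow> ind_l2 ((\<Union>i. A i) \<inter> {-r..r})"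
    proof (rule l2_dominated_convergence[where h = "indicat_real (UNIV \<inter> {-r..r})"])
      show "sq_integrable (indicat_real (UNIV \<inter> {-r..r}))" by (rule I) simp
      show "sq_integrable (indicat_real ((\<Union>i. A i) \<inter> {-r..r}))" using A by (intro I) auto
      show "indicat_real ((\<Union>i<n. A i) \<inter> {-r..r}) \<in> borel_measurable lborel" for n
        using A by auto
      show "\<bar>indicat_real ((\<Union>i<n. A i) \<inter> {-r..r}) x\<bar> \<le> indicat_real (UNIV \<inter> {-r..r}) x" for n x
        by (auto simp: indicator_def)
      show "(\<lambda>n. indicat_real ((\<Union>i<n. A i) \<inter> {-r..r}) x) \<longlonglongrightarrow> indicat_real ((\<Union>i. A i) \<inter> {-r..r}) x" for x
      proof (cases "x \<in> (\<Union>i. A i)")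
        case True
        then obtain i where i: "x \<in> A i" by auto
        have "\<forall>\<^sub>F n in sequentially. indicat_real ((\<Union>i<n. A i) \<inter> {-r..r}) x = indicat_real ((\<Union>i. A i) \<inter> {-r..r}) x"
          using eventually_gt_at_top[of i] by eventually_elim (use i in \<open>auto simp: indicator_def\<close>)
        then show ?thesis by (rule tendsto_eventually)
      next
        case False
        then have "indicat_real ((\<Union>i<n. A i) \<inter> {-r..r}) x = indicat_real ((\<Union>i. A i) \<inter> {-r..r}) x" for n
          by (auto simp: indicator_def)
        then show ?thesis by simp
      qed
    qed
    with fin show ?case by (rule rat_step_closure_lim)
  qed
qed

lemma rat_step_dense: "closure (range rat_step) = UNIV"
proof -
  have "g \<in> closure (range rat_step)" for g
  proof -
    let ?f = "rep_l2 g"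
    have f: "?f \<in> borel_measurable lborel" "sq_integrable ?f"
      using sq_integrable_rep[of g] by (auto simp: sq_integrable_def)
    obtain F where F: "\<And>i. simple_function lborel (F i)"
      "\<And>x. x \<in> space lborel \<Longrightarrow> (\<lambda>i. F i x) \<longlonglongrightarrow> ?f x"
      "\<And>i x. x \<in> space lborel \<Longrightarrow> dist (F i x) 0 \<le> 2 * dist (?f x) 0"
      using borel_measurable_implies_sequence_metric[OF f(1), of 0] by metis
    let ?G = "\<lambda>i x. F i x * indicat_real {-real i..real i} x"
    have simple: "abs_l2 (?G i) \<in> closure (range rat_step)" for i
    proof -
      have fin: "finite (range (F i))"
        using F(1)[of i] by (auto simp: simple_function_def)
      have meas: "F i -` {y} \<in> sets borel" for y
        using borel_measurable_simple_function[OF F(1)[of i]] by (simp add: measurable_sets_borel)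
      define J where "J y = F i -` {y} \<inter> {-real i..real i}" for y
      have sq: "sq_integrable (indicat_real (J y))" for y
        by (rule sq_integrable_ind[of _ "-real i" "real i"]) (use meas in \<open>auto simp: J_def\<close>)
      have sum: "sq_integrable (\<lambda>x. \<Sum>y\<in>Y. y * indicat_real (J y) x) \<and>
          abs_l2 (\<lambda>x. \<Sum>y\<in>Y. y * indicat_real (J y) x) = (\<Sum>y\<in>Y. y *\<^sub>R ind_l2 (J y))"
        if "finite Y" for Y
        using that
      proof (induction Y rule: finite_induct)
        case empty
        then show ?case by (simp add: abs_l2_zero) (simp add: sq_integrable_def)
      next
        case (insert y Y)
        then show ?case
          by (simp add: sq_integrable_add sq_integrable_scale sq abs_l2_add abs_l2_scale
              del: sum_mult_indicator)
      qed
      have "(\<lambda>x. \<Sum>y\<in>range (F i). y * indicat_real (J y) x) = ?G i"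
      proof
        fix x
        have "(\<Sum>y\<in>range (F i). y * indicat_real (J y) x) =
            (\<Sum>y\<in>range (F i). if y = F i x then F i x * indicat_real {-real i..real i} x else 0)"
          by (rule sum.cong) (auto simp: indicator_def J_def)
        also have "\<dots> = ?G i x" using fin by simp
        finally show "(\<Sum>y\<in>range (F i). y * indicat_real (J y) x) = ?G i x" .
      qed
      with sum[OF fin] have "abs_l2 (?G i) = (\<Sum>y\<in>range (F i). y *\<^sub>R ind_l2 (J y))" by simp
      also have "\<dots> \<in> closure (range rat_step)"
        unfolding J_def by (intro rat_step_closure_sum rat_step_closure_scale rat_step_closure_ind fin meas)
      finally show ?thesis .
    qed
    have "(\<lambda>i. abs_l2 (?G i)) \<longlonglongrightarrow> abs_l2 ?f"
    proof (rule l2_dominated_convergence[where h = "\<lambda>x. 2 * \<bar>?f x\<bar>"])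
      show "?G n \<in> borel_measurable lborel" for n
        using borel_measurable_simple_function[OF F(1)[of n]] by measurable
      show "sq_integrable ?f" by (rule f(2))
      show "sq_integrable (\<lambda>x. 2 * \<bar>?f x\<bar>)"
        using f by (intro sq_integrable_scale) (auto simp: sq_integrable_def)
      show "\<bar>?G n x\<bar> \<le> 2 * \<bar>?f x\<bar>" for n x
        using F(3)[of x n] by (auto simp: indicator_def)
      show "(\<lambda>n. ?G n x) \<longlonglongrightarrow> ?f x" for x
      proof -
        obtain N where N: "\<bar>x\<bar> \<le> real N" using real_arch_simple by blast
        have "\<forall>\<^sub>F n in sequentially. F n x = ?G n x"
          using eventually_ge_at_top[of N] by eventually_elim (use N in \<open>auto simp: indicator_def\<close>)
        moreover have "(\<lambda>n. F n x) \<longlonglongrightarrow> ?f x" by (rule F(2)) simp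
        ultimately show ?thesis by (rule Lim_transform_eventually[rotated])
      qed
    qed
    with simple have "abs_l2 ?f \<in> closure (range rat_step)" by (rule rat_step_closure_lim)
    then show ?thesis by (simp add: abs_rep_l2)
  qed
  then show ?thesis by auto
qed

instance l2 :: second_countable_topology
proof
  let ?B = "(\<lambda>(d, r). ball d (of_rat r)) ` (range rat_step \<times> (UNIV :: rat set))"
  have "countable ?B" by auto
  moreover have "topological_basis ?B"
  proof (rule topological_basisI)
    fix U :: "l2 set" and g assume "open U" "g \<in> U"
    then obtain e where e: "0 < e" "ball g e \<subseteq> U" by (auto simp: open_contains_ball)
    have "0 < e / 2" using e by simp
    then obtain d where d: "d \<in> range rat_step" "dist d g < e / 2"
      using rat_step_dense closure_approachable[of g "range rat_step"] by blast
    obtain r :: rat where r: "dist d g < of_rat r" "of_rat r < e / 2"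
      using of_rat_dense[OF d(2)] by blast
    have "ball d (of_rat r) \<subseteq> ball g e"
    proof
      fix x assume "x \<in> ball d (of_rat r)"
      then have "dist d x < of_rat r" by simp
      then show "x \<in> ball g e"
        using dist_triangle[of g x d] d(2) r by (simp add: dist_commute)
    qed
    moreover have "g \<in> ball d (of_rat r)" using r by simp
    ultimately show "\<exists>V\<in>?B. g \<in> V \<and> V \<subseteq> U" using d(1) e(2) by blast
  qed auto
  ultimately show "\<exists>B :: l2 set set. countable B \<and> open = generate_topology B"
    by (auto intro!: exI[of _ ?B] topological_basis_imp_subbasis)
qed

section \<open>Distributional derivatives\<close>

text \<open>\<^term>\<open>test_function a b \<phi>\<close>: \<open>\<phi>\<close> is smooth with compact support in the open interval \<open>(a, b)\<close>.\<close>

definition test_function :: "real \<Rightarrow> real \<Rightarrow> (real \<Rightarrow> real) \<Rightarrow> bool"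
  where "test_function a b \<phi> \<longleftrightarrow>
    (\<forall>n x. (deriv ^^ n) \<phi> differentiable (at x)) \<and>
    (\<exists>c d. a < c \<and> d < b \<and> (\<forall>x. x \<notin> {c..d} \<longrightarrow> \<phi> x = 0))"

text \<open>\<open>u' = v\<close> in the sense of distributions on \<open>(a, b)\<close>, for locally integrable \<open>u\<close> and \<open>v\<close> with
  scalar or vector values.\<close>

definition distr_deriv ::
  "real \<Rightarrow> real \<Rightarrow> (real \<Rightarrow> 'b::{real_normed_vector, second_countable_topology}) \<Rightarrow> (real \<Rightarrow> 'b) \<Rightarrow> bool"
  where "distr_deriv a b u v \<longleftrightarrow>
    (\<forall>c d. a < c \<and> d < b \<longrightarrow>
      integrable (lebesgue_on {c..d}) u \<and> integrable (lebesgue_on {c..d}) v) \<and>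
    (\<forall>\<phi>. test_function a b \<phi> \<longrightarrow>
      (\<integral>x. deriv \<phi> x *\<^sub>R u x \<partial>lebesgue_on {a<..<b}) =
      - (\<integral>x. \<phi> x *\<^sub>R v x \<partial>lebesgue_on {a<..<b}))"

section \<open>Function spaces on the beam\<close>

text \<open>\<open>L\<^sup>2(0, L)\<close> is the closed subspace of \<open>L\<^sup>2(\<real>)\<close> of classes vanishing outside \<open>(0, L)\<close>
  (extension by zero), with the inner product and norm it inherits.\<close>

definition L2_on :: "real \<Rightarrow> l2 set"
  where "L2_on L = {f. AE x in lborel. x \<notin> {0<..<L} \<longrightarrow> rep_l2 f x = 0}"

definition weak_deriv :: "real \<Rightarrow> l2 \<Rightarrow> l2 \<Rightarrow> bool"
  where "weak_deriv L f g \<longleftrightarrow>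
    f \<in> L2_on L \<and> g \<in> L2_on L \<and> distr_deriv 0 L (rep_l2 f) (rep_l2 g)"

text \<open>Meaningful only if a weak derivative in \<open>L\<^sup>2(0, L)\<close> exists; it is then unique.\<close>

definition Dx :: "real \<Rightarrow> l2 \<Rightarrow> l2"
  where "Dx L f = (THE g. weak_deriv L f g)"

primrec sobolev :: "real \<Rightarrow> nat \<Rightarrow> l2 set"
  where
    "sobolev L 0 = L2_on L"
  | "sobolev L (Suc k) = {f \<in> L2_on L. \<exists>g\<in>sobolev L k. weak_deriv L f g}"

definition sobolev_norm :: "real \<Rightarrow> nat \<Rightarrow> l2 \<Rightarrow> real"
  where "sobolev_norm L k f = sqrt (\<Sum>i\<le>k. (norm ((Dx L ^^ i) f))\<^sup>2)"

text \<open>The value at \<open>x \<in> [0, L]\<close> of the representative that is continuous on \<open>[0, L]\<close>, which exists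
  for elements of \<open>H\<^sup>1(0, L)\<close>.\<close>

definition point_value :: "real \<Rightarrow> l2 \<Rightarrow> real \<Rightarrow> real"
  where "point_value L f x = (THE r. \<exists>u. continuous_on {0..L} u \<and>
    (AE y in lborel. y \<in> {0<..<L} \<longrightarrow> rep_l2 f y = u y) \<and> u x = r)"

definition H1s :: "real \<Rightarrow> l2 set"
  where "H1s L = {v \<in> sobolev L 1. point_value L v 0 = 0}"

definition H2s :: "real \<Rightarrow> l2 set"
  where "H2s L = {v \<in> sobolev L 2. point_value L v 0 = 0 \<and> point_value L (Dx L v) 0 = 0}"

definition H2s_inner :: "real \<Rightarrow> real \<Rightarrow> l2 \<Rightarrow> l2 \<Rightarrow> real"
  where "H2s_inner L D v w = D * (Dx L (Dx L v) \<bullet> Dx L (Dx L w))"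

definition H2s_norm :: "real \<Rightarrow> real \<Rightarrow> l2 \<Rightarrow> real"
  where "H2s_norm L D v = sqrt (H2s_inner L D v v)"

text \<open>\<open>L\<^sub>\<alpha>\<close> is \<^const>\<open>H1s\<close> with the following inner product and norm.\<close>

definition La_inner :: "real \<Rightarrow> real \<Rightarrow> l2 \<Rightarrow> l2 \<Rightarrow> real"
  where "La_inner L \<alpha> v w = \<alpha> * (Dx L v \<bullet> Dx L w) + v \<bullet> w"

definition La_norm :: "real \<Rightarrow> real \<Rightarrow> l2 \<Rightarrow> real"
  where "La_norm L \<alpha> v = sqrt (\<alpha> * (norm (Dx L v))\<^sup>2 + (norm v)\<^sup>2)"

definition H_space :: "real \<Rightarrow> (l2 \<times> l2) set"
  where "H_space L = H2s L \<times> H1s L"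

definition H_norm :: "real \<Rightarrow> real \<Rightarrow> real \<Rightarrow> l2 \<times> l2 \<Rightarrow> real"
  where "H_norm L D \<alpha> y =
    sqrt (D * (norm (Dx L (Dx L (fst y))))\<^sup>2 + \<alpha> * (norm (Dx L (snd y)))\<^sup>2 + (norm (snd y))\<^sup>2)"

definition W_space :: "real \<Rightarrow> l2 set"
  where "W_space L = {v \<in> H2s L \<inter> sobolev L 3. point_value L (Dx L (Dx L v)) L = 0}"

section \<open>Functions of time\<close>

text \<open>In this section \<open>X\<close> is the carrier of a function space and \<open>N\<close> its norm.\<close>

definition strongly_measurable :: "real \<Rightarrow> l2 set \<Rightarrow> (l2 \<Rightarrow> real) \<Rightarrow> (real \<Rightarrow> l2) \<Rightarrow> bool"
  where "strongly_measurable T X N u \<longleftrightarrow>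
    (\<exists>s. (\<forall>n. simple_function (lebesgue_on {0<..<T}) (s n) \<and> s n ` {0<..<T} \<subseteq> X) \<and>
      (AE t in lebesgue_on {0<..<T}. u t \<in> X \<and> (\<lambda>n. N (s n t - u t)) \<longlonglongrightarrow> 0))"

definition Linf_time :: "real \<Rightarrow> l2 set \<Rightarrow> (l2 \<Rightarrow> real) \<Rightarrow> (real \<Rightarrow> l2) \<Rightarrow> bool"
  where "Linf_time T X N u \<longleftrightarrow>
    strongly_measurable T X N u \<and> (\<exists>C. AE t in lebesgue_on {0<..<T}. N (u t) \<le> C)"

definition L2_time :: "real \<Rightarrow> l2 set \<Rightarrow> (l2 \<Rightarrow> real) \<Rightarrow> (real \<Rightarrow> l2) \<Rightarrow> bool"
  where "L2_time T X N u \<longleftrightarrow>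
    strongly_measurable T X N u \<and> integrable (lebesgue_on {0<..<T}) (\<lambda>t. (N (u t))\<^sup>2)"

text \<open>\<open>w \<in> H\<^sup>1(0, T; L\<^sup>2(0, L))\<close> with weak time derivative \<open>v\<close>.\<close>

definition H1_time_L2 :: "real \<Rightarrow> real \<Rightarrow> (real \<Rightarrow> l2) \<Rightarrow> (real \<Rightarrow> l2) \<Rightarrow> bool"
  where "H1_time_L2 L T w v \<longleftrightarrow>
    L2_time T (L2_on L) norm w \<and> L2_time T (L2_on L) norm v \<and> distr_deriv 0 T w v"

text \<open>\<open>C\<^sub>w([0, T]; X)\<close> for a Hilbert space with inner product \<open>ip\<close>, whose bounded functionals are
  the \<open>ip \<cdot> g\<close> with \<open>g \<in> X\<close>.\<close>

definition weakly_continuous :: "real \<Rightarrow> l2 set \<Rightarrow> (l2 \<Rightarrow> l2 \<Rightarrow> real) \<Rightarrow> (real \<Rightarrow> l2) \<Rightarrow> bool"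
  where "weakly_continuous T X ip u \<longleftrightarrow>
    (\<forall>t\<in>{0..T}. u t \<in> X) \<and> (\<forall>g\<in>X. continuous_on {0..T} (\<lambda>t. ip (u t) g))"

definition C_H :: "real \<Rightarrow> real \<Rightarrow> real \<Rightarrow> real \<Rightarrow> (real \<Rightarrow> l2 \<times> l2) \<Rightarrow> bool"
  where "C_H L D \<alpha> T y \<longleftrightarrow>
    (\<forall>t\<in>{0..T}. y t \<in> H_space L) \<and>
    (\<forall>t\<in>{0..T}. ((\<lambda>s. H_norm L D \<alpha> (y s - y t)) \<longlongrightarrow> 0) (at t within {0..T}))"

section \<open>The beam problem\<close>

definition energy :: "real \<Rightarrow> real \<Rightarrow> real \<Rightarrow> real \<Rightarrow> real \<Rightarrow> l2 \<times> l2 \<Rightarrow> real"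
  where "energy L D \<alpha> b1 b2 = (\<lambda>(w, v).
    1/2 * (norm v)\<^sup>2 + \<alpha>/2 * (norm (Dx L v))\<^sup>2 + 1/2 * D * (norm (Dx L (Dx L w)))\<^sup>2 +
    1/4 * b2 * (norm (Dx L w)) ^ 4 - 1/2 * b1 * (norm (Dx L w))\<^sup>2)"

text \<open>The weak solution is \<open>w\<close>; \<open>v\<close> is the (unique) weakly continuous representative of \<open>w\<^sub>t\<close>.
  The variational identity is solved for the time derivative.\<close>

definition weak_solution ::
  "real \<Rightarrow> real \<Rightarrow> real \<Rightarrow> real \<Rightarrow> real \<Rightarrow> real \<Rightarrow> real \<Rightarrow> real \<Rightarrow> l2 \<Rightarrow>
   real \<Rightarrow> l2 \<times> l2 \<Rightarrow> (real \<Rightarrow> l2) \<Rightarrow> (real \<Rightarrow> l2) \<Rightarrow> bool"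
  where "weak_solution L D \<alpha> b1 b2 U \<beta> k0 p0 T y0 w v \<longleftrightarrow>
    H1_time_L2 L T w v \<and>
    Linf_time T (H2s L) (H2s_norm L D) w \<and> weakly_continuous T (H2s L) (H2s_inner L D) w \<and>
    Linf_time T (H1s L) (La_norm L \<alpha>) v \<and> weakly_continuous T (H1s L) (La_inner L \<alpha>) v \<and>
    (\<forall>\<phi>\<in>H2s L. distr_deriv 0 T
      (\<lambda>t. v t \<bullet> \<phi> + \<alpha> * (Dx L (v t) \<bullet> Dx L \<phi>))
      (\<lambda>t. p0 \<bullet> \<phi> - \<beta> * (v t \<bullet> \<phi>) - \<beta> * U * (Dx L (w t) \<bullet> \<phi>) -
        (H2s_inner L D (w t) \<phi> +
         (b2 * (norm (Dx L (w t)))\<^sup>2 - b1) * (Dx L (w t) \<bullet> Dx L \<phi>) +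
         k0 * (v t \<bullet> \<phi>) + \<alpha> * k0 * (Dx L (v t) \<bullet> Dx L \<phi>)))) \<and>
    (\<forall>\<eta>\<in>H2s L. ((\<lambda>t. H2s_inner L D (w t) \<eta>) \<longlongrightarrow> H2s_inner L D (fst y0) \<eta>) (at_right 0)) \<and>
    (\<forall>\<psi>\<in>L2_on L. ((\<lambda>t. v t \<bullet> \<psi>) \<longlongrightarrow> snd y0 \<bullet> \<psi>) (at_right 0))"

text \<open>\<open>z\<close> is the right derivative of \<open>v = w\<^sub>t\<close>, taken in \<open>H\<^sup>1\<^sub>*\<close>.\<close>

definition strong_solution ::
  "real \<Rightarrow> real \<Rightarrow> real \<Rightarrow> real \<Rightarrow> real \<Rightarrow> real \<Rightarrow> real \<Rightarrow> real \<Rightarrow> l2 \<Rightarrow>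
   real \<Rightarrow> l2 \<times> l2 \<Rightarrow> (real \<Rightarrow> l2) \<Rightarrow> (real \<Rightarrow> l2) \<Rightarrow> bool"
  where "strong_solution L D \<alpha> b1 b2 U \<beta> k0 p0 T y0 w v \<longleftrightarrow>
    weak_solution L D \<alpha> b1 b2 U \<beta> k0 p0 T y0 w v \<and>
    Linf_time T (W_space L) (sobolev_norm L 3) w \<and>
    Linf_time T (H2s L) (H2s_norm L D) v \<and>
    (\<exists>z.
      (\<forall>t\<in>{0..<T}. z t \<in> H1s L \<and>
        ((\<lambda>h. sobolev_norm L 1 ((1 / h) *\<^sub>R (v (t + h) - v t) - z t)) \<longlongrightarrow> 0) (at_right 0)) \<and>
      (\<forall>t\<in>{0..<T}. ((\<lambda>s. sobolev_norm L 1 (z s - z t)) \<longlongrightarrow> 0) (at_right t)) \<and>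
      Linf_time T (H1s L) (sobolev_norm L 1) z)"

section \<open>Semigroup well-posedness\<close>

definition is_semigroup :: "real \<Rightarrow> (real \<Rightarrow> l2 \<times> l2 \<Rightarrow> l2 \<times> l2) \<Rightarrow> bool"
  where "is_semigroup L S \<longleftrightarrow>
    (\<forall>t\<ge>0. \<forall>y\<in>H_space L. S t y \<in> H_space L) \<and>
    (\<forall>y\<in>H_space L. S 0 y = y) \<and>
    (\<forall>s\<ge>0. \<forall>t\<ge>0. \<forall>y\<in>H_space L. S (s + t) y = S s (S t y))"

text \<open>As usual for nonlinear semigroups, locally Lipschitz means Lipschitz on bounded sets.\<close>

definition locally_Lipschitz_H :: "real \<Rightarrow> real \<Rightarrow> real \<Rightarrow> (l2 \<times> l2 \<Rightarrow> l2 \<times> l2) \<Rightarrow> bool"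
  where "locally_Lipschitz_H L D \<alpha> F \<longleftrightarrow>
    (\<forall>R. \<exists>K. \<forall>y\<in>H_space L. \<forall>z\<in>H_space L.
      H_norm L D \<alpha> y \<le> R \<longrightarrow> H_norm L D \<alpha> z \<le> R \<longrightarrow>
      H_norm L D \<alpha> (F y - F z) \<le> K * H_norm L D \<alpha> (y - z))"

text \<open>Domain of the infinitesimal generator \<open>y \<mapsto> lim\<^bsub>h\<rightarrow>0+\<^esub> (S h y - y) / h\<close>.\<close>

definition generator_domain ::
  "real \<Rightarrow> real \<Rightarrow> real \<Rightarrow> (real \<Rightarrow> l2 \<times> l2 \<Rightarrow> l2 \<times> l2) \<Rightarrow> (l2 \<times> l2) set"
  where "generator_domain L D \<alpha> S = {y \<in> H_space L. \<exists>z\<in>H_space L.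
    ((\<lambda>h. H_norm L D \<alpha> ((1 / h) *\<^sub>R (S h y - y) - z)) \<longlongrightarrow> 0) (at_right 0)}"

text \<open>\<open>DA\<close> is the domain of the evolution generator.  The last conjuncts are, in order: the three
  properties of trajectories, uniqueness of weak solutions, continuous dependence in
  \<open>C([0, T]; \<H>\<^sub>\<alpha>)\<close>, and the statements about \<open>DA\<close>.\<close>

definition semigroup_well_posed ::
  "real \<Rightarrow> real \<Rightarrow> real \<Rightarrow> real \<Rightarrow> real \<Rightarrow> real \<Rightarrow> real \<Rightarrow> real \<Rightarrow> l2 \<Rightarrow>
   (real \<Rightarrow> l2 \<times> l2 \<Rightarrow> l2 \<times> l2) \<Rightarrow> (l2 \<times> l2) set \<Rightarrow> bool"
  where "semigroup_well_posed L D \<alpha> b1 b2 U \<beta> k0 p0 S DA \<longleftrightarrow>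
    is_semigroup L S \<and>
    (\<forall>t\<ge>0. locally_Lipschitz_H L D \<alpha> (S t)) \<and>
    (\<forall>y0\<in>H_space L. \<forall>T>0.
      C_H L D \<alpha> T (\<lambda>t. S t y0) \<and>
      weak_solution L D \<alpha> b1 b2 U \<beta> k0 p0 T y0 (\<lambda>t. fst (S t y0)) (\<lambda>t. snd (S t y0)) \<and>
      (\<exists>(x :: nat \<Rightarrow> l2 \<times> l2) w v.
        (\<forall>n. x n \<in> H_space L \<and>
          strong_solution L D \<alpha> b1 b2 U \<beta> k0 p0 T (x n) (w n) (v n) \<and>
          C_H L D \<alpha> T (\<lambda>t. (w n t, v n t))) \<and>
        (\<forall>\<epsilon>>0. \<forall>\<^sub>F n in sequentially. \<forall>t\<in>{0..T}. H_norm L D \<alpha> ((w n t, v n t) - S t y0) < \<epsilon>))) \<and>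
    (\<forall>y0\<in>H_space L. \<forall>T>0. \<forall>w v.
      weak_solution L D \<alpha> b1 b2 U \<beta> k0 p0 T y0 w v \<longrightarrow> (\<forall>t\<in>{0..T}. (w t, v t) = S t y0)) \<and>
    (\<forall>y0\<in>H_space L. \<forall>T>0. \<forall>\<epsilon>>0. \<exists>\<delta>>0. \<forall>z0\<in>H_space L.
      H_norm L D \<alpha> (z0 - y0) < \<delta> \<longrightarrow> (\<forall>t\<in>{0..T}. H_norm L D \<alpha> (S t z0 - S t y0) < \<epsilon>)) \<and>
    DA \<subseteq> H_space L \<and>
    DA = generator_domain L D \<alpha> S \<and>
    (\<forall>t\<ge>0. \<forall>y\<in>DA. S t y \<in> DA) \<and>
    (\<forall>y\<in>DA. \<forall>T>0.
      strong_solution L D \<alpha> b1 b2 U \<beta> k0 p0 T y (\<lambda>t. fst (S t y)) (\<lambda>t. snd (S t y)))"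

end

theory Submission
  imports Defs "HOL-Computational_Algebra.Polynomial"
begin

text \<open>Put \<open>V g (x) = \<integral>\<^sub>0\<^sup>x g\<close>. Then \<open>H\<^sup>1\<^sub>* = V L\<^sup>2\<close> and \<open>H\<^sup>2\<^sub>* = V V L\<^sup>2\<close>, and with \<open>g = w\<^sub>x\<^sub>x\<close>,
  \<open>h = w\<^sub>t\<^sub>x\<close>, \<open>M = \<alpha> + V\<^sup>* V\<close> the beam problem reads \<open>V g\<^sub>t = h\<close>, \<open>M h\<^sub>t = - D f + \<dots>\<close> for
  \<open>g = V\<^sup>* f\<close>; the boundary conditions at \<open>L\<close>, the natural one included, are encoded in \<open>V\<^sup>*\<close>. The
  linear part is skew-adjoint for the energy inner product, and the remaining terms are locally
  Lipschitz on \<open>\<H>\<^sub>\<alpha>\<close>.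

  For a skew-adjoint \<open>A\<close> and Lipschitz \<open>F\<close>, the equation with \<open>A\<close> replaced by its Yosida
  approximation is an ordinary differential equation, and its solutions converge uniformly as long
  as the initial value is in the domain; density gives the general case. Weak solutions are unique
  because applying the resolvent to them yields functions whose norm can be differentiated. The same
  device shows that the energy identity holds for every weak solution. As the quartic term dominates,
  the energy bounds the norm, so local Lipschitz continuity suffices.

  A weak solution of the beam problem in the sense of distributions is a weak solution of the abstract
  equation: its pairings with test elements are weakly continuous with a continuous weak derivative,
  hence differentiable everywhere.\<close>

section \<open>Differential inequalities and ordinary differential equations\<close>

text \<open>The rotational inertia decides the setting. For \<alpha> > 0 the operator
  \<open>M\<close> is bounded and coercive, so its inverse is bounded, and the stretching term (b1 -
  b2 |w_x|^2) w_xx, whose pairing with a test function only involves w_x, becomes a bounded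
  perturbation; the bending term alone stays unbounded. Skew-adjointness then comes down to one
  coercive equation: eliminating f from the resolvent system leaves l^2 D \<psi> + V* M V \<psi> on
  the left, for either sign of l.

  The abstract theory lives on a complete inner product type, whereas beam states form only a closed
  subspace of L^2 x L^2 x L^2. Everything is therefore extended to the whole product through an
  orthogonal projection \<open>P\<close>, and invariance of the states with \<open>P y = y\<close>
  is proved at the end.

  The difference of two weak solutions has a norm that is not known to be differentiable, and the
  estimate for its image under the resolvent contains the norm without the resolvent. This is why
  comparison uses an iterated form of Gronwall's argument. The a priori bound is uniform over balls
  of initial data, so a single truncation of F serves a whole ball; this yields the local Lipschitz
  dependence.\<close>

lemma deriv_within_nonincreasing:
  fixes f :: "real \<Rightarrow> real"
  assumes "a \<le> b" and d: "\<And>t. t \<in> {a..b} \<Longrightarrow> (f has_real_derivative f' t) (at t within {a..b})"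
    and le: "\<And>t. t \<in> {a..b} \<Longrightarrow> f' t \<le> 0"
  shows "f b \<le> f a"
proof (rule DERIV_nonpos_imp_decreasing_open[OF \<open>a \<le> b\<close>])
  fix x assume x: "a < x" "x < b"
  then have "(f has_real_derivative f' x) (at x)"
    using d[of x] by (simp add: at_within_Icc_at)
  then show "\<exists>y. (f has_real_derivative y) (at x) \<and> y \<le> 0" using le[of x] x by auto
next
  show "continuous_on {a..b} f"
    using d by (intro DERIV_continuous_on)
qed

lemma deriv_within_bound:
  fixes f g :: "real \<Rightarrow> real"
  assumes "a \<le> b" and "\<And>t. t \<in> {a..b} \<Longrightarrow> (f has_real_derivative f' t) (at t within {a..b})"
    and "\<And>t. t \<in> {a..b} \<Longrightarrow> (g has_real_derivative g' t) (at t within {a..b})"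
    and "\<And>t. t \<in> {a..b} \<Longrightarrow> f' t \<le> g' t"
  shows "f b - f a \<le> g b - g a"
proof -
  have "f b - g b \<le> f a - g a"
    by (rule deriv_within_nonincreasing[of a b "\<lambda>t. f t - g t" "\<lambda>t. f' t - g' t"])
      (use assms in \<open>auto intro!: DERIV_diff\<close>)
  then show ?thesis by simp
qed

text \<open>f(s) exp(-k s) - c s is nonincreasing, because exp(-k s) \<le> 1 turns the inhomogeneity
  into at most c. The bound is coarser than the sharp one with (exp(k t) - 1) / k, but needs no case
  distinction for k = 0.\<close>

lemma gronwall_deriv:
  fixes f :: "real \<Rightarrow> real"
  assumes t: "t \<in> {0..T}" and d: "\<And>t. t \<in> {0..T} \<Longrightarrow> (f has_real_derivative f' t) (at t within {0..T})"
    and le: "\<And>t. t \<in> {0..T} \<Longrightarrow> f' t \<le> k * f t + c" and c: "0 \<le> c" and k: "0 \<le> k"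
  shows "f t \<le> (f 0 + c * t) * exp (k * t)"
proof -
  let ?g = "\<lambda>s. f s * exp (- k * s) - c * s"
  have "?g t \<le> ?g 0"
  proof (rule deriv_within_nonincreasing[of 0 t ?g "\<lambda>s. (f' s - k * f s) * exp (- k * s) - c"])
    show "0 \<le> t" using t by simp
  next
    fix s assume s: "s \<in> {0..t}"
    have "(f has_real_derivative f' s) (at s within {0..t})"
      using d[of s] s t by (auto intro: DERIV_subset)
    then show "(?g has_real_derivative (f' s - k * f s) * exp (- k * s) - c) (at s within {0..t})"
      by (auto intro!: derivative_eq_intros simp: algebra_simps)
    have "(f' s - k * f s) * exp (- k * s) \<le> c * 1"
    proof (cases "f' s - k * f s \<ge> 0")
      case True
      then show ?thesis using le[of s] s t k c by (intro mult_mono) auto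
    next
      case False
      then have "(f' s - k * f s) * exp (- k * s) \<le> 0" by (simp add: mult_nonpos_nonneg)
      then show ?thesis using c by linarith
    qed
    then show "(f' s - k * f s) * exp (- k * s) - c \<le> 0" by simp
  qed
  then have "f t * exp (- k * t) \<le> f 0 + c * t" by simp
  then have "f t * exp (- k * t) * exp (k * t) \<le> (f 0 + c * t) * exp (k * t)"
    by (intro mult_right_mono) auto
  then show ?thesis by (simp add: mult.assoc flip: exp_add)
qed

text \<open>Weak equations are scalar equations for pairings with a fixed element, so this is the
  only limit theorem needed to pass from approximate to exact solutions.\<close>

lemma limit_has_real_derivative:
  fixes f :: "nat \<Rightarrow> real \<Rightarrow> real"
  assumes d: "\<And>n t. t \<in> {a..b} \<Longrightarrow> (f n has_real_derivative f' n t) (at t within {a..b})"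
    and u: "uniform_limit {a..b} f' g' sequentially"
    and l: "\<And>t. t \<in> {a..b} \<Longrightarrow> (\<lambda>n. f n t) \<longlonglongrightarrow> g t" and t: "t \<in> {a..b}"
  shows "(g has_real_derivative g' t) (at t within {a..b})"
proof -
  have "\<exists>h. \<forall>x\<in>{a..b}. (\<lambda>n. f n x) \<longlonglongrightarrow> h x \<and> (h has_derivative (\<lambda>s. g' x * s)) (at x within {a..b})"
  proof (rule has_derivative_sequence[of _ f "\<lambda>n x s. f' n x * s" "\<lambda>x s. g' x * s" t "g t"])
    show "(f n has_derivative (\<lambda>s. f' n x * s)) (at x within {a..b})" if "x \<in> {a..b}" for n x
      using d[OF that, of n] by (simp add: has_field_derivative_def)
    show "(\<lambda>n. f n t) \<longlonglongrightarrow> g t" "t \<in> {a..b}" using l t by auto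
    fix e :: real assume e: "0 < e"
    show "\<forall>\<^sub>F n in sequentially. \<forall>x\<in>{a..b}. \<forall>h. norm (f' n x * h - g' x * h) \<le> e * norm h"
      using uniform_limitD[OF u e]
    proof eventually_elim
      case (elim n) note en = this
      have "norm (f' n x * h - g' x * h) \<le> e * norm h" if "x \<in> {a..b}" for x h
      proof -
        have "norm (f' n x * h - g' x * h) = \<bar>f' n x - g' x\<bar> * \<bar>h\<bar>"
          by (simp add: abs_mult flip: left_diff_distrib)
        also have "\<dots> \<le> e * \<bar>h\<bar>" using elim that by (intro mult_right_mono) (auto simp: dist_real_def less_imp_le)
        finally show ?thesis by simp
      qed
      then show ?case by blast
    qed
  qed (rule convex_real_interval)
  then obtain h where h: "\<And>x. x \<in> {a..b} \<Longrightarrow> (\<lambda>n. f n x) \<longlonglongrightarrow> h x"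
    "\<And>x. x \<in> {a..b} \<Longrightarrow> (h has_derivative (\<lambda>s. g' x * s)) (at x within {a..b})" by blast
  have hg: "h x = g x" if "x \<in> {a..b}" for x
    using LIMSEQ_unique[OF h(1)[OF that] l[OF that]] .
  have "(h has_real_derivative g' t) (at t within {a..b})"
    using h(2)[OF t] by (simp add: has_field_derivative_def)
  then show ?thesis
    by (rule has_field_derivative_transform_within[where d = 1]) (use t hg in auto)
qed

text \<open>Picard iteration. The factorial bound on successive differences is summable on every
  interval, so no smallness of time is required and a single curve solves the equation on all of [0,
  \<infinity>).\<close>

lemma lipschitz_ode_exists:
  fixes G :: "'a::banach \<Rightarrow> 'a"
  assumes K: "K-lipschitz_on UNIV G"
  shows "\<exists>u. u 0 = y0 \<and>
    (\<forall>T. \<forall>t\<in>{0..T}. (u has_vector_derivative G (u t)) (at t within {0..T}))"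
proof -
  have K0: "0 \<le> K" and KL: "norm (G x - G y) \<le> K * norm (x - y)" for x y
    using K lipschitz_on_normD[OF K] lipschitz_on_nonneg[OF K] by auto
  have Gc: "continuous_on UNIV G" by (rule lipschitz_on_continuous_on[OF K])
  define p where "p = rec_nat (\<lambda>_. y0) (\<lambda>_ q (t::real). y0 + integral {0..t} (\<lambda>s. G (q s)))"
  have p0: "p 0 = (\<lambda>_. y0)" by (simp add: p_def)
  have pS: "p (Suc n) = (\<lambda>t. y0 + integral {0..t} (\<lambda>s. G (p n s)))" for n by (simp add: p_def)
  have pc: "continuous_on {0..T} (p n)" for n T
  proof (induction n)
    case 0 then show ?case by (simp add: p0)
  next
    case (Suc n)
    have "(\<lambda>s. G (p n s)) integrable_on {0..T}"
      by (intro integrable_continuous_real continuous_on_compose2[OF Gc Suc]) auto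
    from indefinite_integral_continuous_1[OF this] show ?case
      unfolding pS by (intro continuous_intros)
  qed
  have Gpc: "continuous_on {0..T} (\<lambda>s. G (p n s))" for n T
    by (intro continuous_on_compose2[OF Gc pc]) auto
  have Gpi: "(\<lambda>s. G (p n s)) integrable_on {0..T}" for n T
    by (intro integrable_continuous_real Gpc)
  define C where "C = norm (G y0)"
  have diff: "norm (p (Suc n) t - p n t) \<le> C * K ^ n * t ^ Suc n / fact (Suc n)" if "t \<ge> 0" for n t
    using that
  proof (induction n arbitrary: t)
    case 0
    then show ?case by (simp add: pS p0 C_def integral_const_real mult.commute)
  next
    case (Suc n)
    let ?h = "\<lambda>s. K * (C * K ^ n * s ^ Suc n / fact (Suc n))"
    have hi: "(?h has_integral (C * K ^ Suc n * t ^ Suc (Suc n) / fact (Suc (Suc n)) - C * K ^ Suc n * 0 ^ Suc (Suc n) / fact (Suc (Suc n)))) {0..t}"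
    proof (rule fundamental_theorem_of_calculus[OF Suc.prems])
      fix s assume "s \<in> {0..t}"
      have f: "fact (Suc (Suc n)) = (real (Suc (Suc n))) * fact (Suc n)" by (simp only: fact_Suc of_nat_mult)
      show "((\<lambda>t. C * K ^ Suc n * t ^ Suc (Suc n) / fact (Suc (Suc n))) has_vector_derivative ?h s) (at s within {0..t})"
        unfolding has_real_derivative_iff_has_vector_derivative[symmetric] f
        by (rule derivative_eq_intros refl | simp del: fact_Suc of_nat_Suc power_Suc)+ (simp del: fact_Suc of_nat_Suc)
    qed
    have "p (Suc (Suc n)) t - p (Suc n) t = integral {0..t} (\<lambda>s. G (p (Suc n) s) - G (p n s))"
      using integral_diff[OF Gpi[of "Suc n" t] Gpi[of n t]] by (simp add: pS)
    also have "norm \<dots> \<le> integral {0..t} ?h"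
    proof (rule integral_norm_bound_integral)
      show "(\<lambda>s. G (p (Suc n) s) - G (p n s)) integrable_on {0..t}" by (intro integrable_diff Gpi)
      show "?h integrable_on {0..t}" using hi by blast
      fix s assume "s \<in> {0..t}"
      then show "norm (G (p (Suc n) s) - G (p n s)) \<le> ?h s"
        using order_trans[OF KL mult_left_mono[OF Suc.IH[of s] K0]] by simp
    qed
    also have "integral {0..t} ?h = C * K ^ Suc n * t ^ Suc (Suc n) / fact (Suc (Suc n))"
      using integral_unique[OF hi] by simp
    finally show ?case .
  qed
  define u where "u t = lim (\<lambda>n. p n t)" for t
  have ul: "uniform_limit {0..T} p u sequentially" for T
  proof -
    have s: "summable (\<lambda>n. C * K ^ n * \<bar>T\<bar> ^ Suc n / fact (Suc n))"
    proof -
      have "summable (\<lambda>n. inverse (fact n) * (K * \<bar>T\<bar>) ^ n)" by (rule summable_exp)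
      then have "summable (\<lambda>n. C * \<bar>T\<bar> * (inverse (fact n) * (K * \<bar>T\<bar>) ^ n))" by (rule summable_mult)
      then show ?thesis
      proof (rule summable_comparison_test'[where N = 0])
        fix n
        have "C * K ^ n * \<bar>T\<bar> ^ Suc n / fact (Suc n) \<le> C * K ^ n * \<bar>T\<bar> ^ Suc n / fact n"
          by (intro divide_left_mono fact_mono) (auto simp: C_def K0)
        also have "\<dots> = C * \<bar>T\<bar> * (inverse (fact n) * (K * \<bar>T\<bar>) ^ n)"
          by (simp add: field_simps power_mult_distrib)
        finally show "norm (C * K ^ n * \<bar>T\<bar> ^ Suc n / fact (Suc n)) \<le> C * \<bar>T\<bar> * (inverse (fact n) * (K * \<bar>T\<bar>) ^ n)"
          by (simp add: C_def K0 del: fact_Suc)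
      qed
    qed
    have "uniform_limit {0..T} (\<lambda>n t. \<Sum>i<n. p (Suc i) t - p i t) (\<lambda>t. suminf (\<lambda>i. p (Suc i) t - p i t)) sequentially"
    proof (rule Weierstrass_m_test[OF _ s])
      fix n t assume t: "t \<in> {0..T}"
      then have "norm (p (Suc n) t - p n t) \<le> C * K ^ n * t ^ Suc n / fact (Suc n)" using diff by auto
      also have "\<dots> \<le> C * K ^ n * \<bar>T\<bar> ^ Suc n / fact (Suc n)"
        using t K0 by (intro divide_right_mono mult_left_mono power_mono) (auto simp: C_def)
      finally show "norm (p (Suc n) t - p n t) \<le> C * K ^ n * \<bar>T\<bar> ^ Suc n / fact (Suc n)" .
    qed
    then have "uniform_limit {0..T} (\<lambda>n t. p n t - p 0 t) (\<lambda>t. suminf (\<lambda>i. p (Suc i) t - p i t)) sequentially"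
      by (simp only: sum_lessThan_telescope[of "\<lambda>i. p i t" for t])
    from uniform_limit_add[OF this uniform_limit_const[of "\<lambda>t. y0"]]
    have *: "uniform_limit {0..T} p (\<lambda>t. suminf (\<lambda>i. p (Suc i) t - p i t) + y0) sequentially"
      by (simp add: p0)
    have "u t = suminf (\<lambda>i. p (Suc i) t - p i t) + y0" if "t \<in> {0..T}" for t
      unfolding u_def using tendsto_uniform_limitI[OF * that] by (rule limI)
    then show ?thesis using * by (auto intro: uniform_limit_cong'[THEN iffD1, rotated -1])
  qed
  have uc: "continuous_on {0..T} u" for T
    by (rule uniform_limit_theorem[OF _ ul]) (auto simp: pc)
  have Guc: "continuous_on {0..T} (\<lambda>s. G (u s))" for T
    by (intro continuous_on_compose2[OF Gc uc]) auto
  have ui: "u t = y0 + integral {0..t} (\<lambda>s. G (u s))" if "t \<ge> 0" for t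
  proof -
    have "(\<lambda>n. p (Suc n) t - (y0 + integral {0..t} (\<lambda>s. G (u s)))) \<longlonglongrightarrow> 0"
    proof (rule tendstoI)
      fix e :: real assume e: "0 < e"
      \<comment> \<open>The summand 1 keeps d defined for K t = 0 and makes K d t strictly smaller
        than e.\<close>
      define d where "d = e / (K * t + 1)"
      have Kt: "0 \<le> K * t" using K0 that by simp
      then have d: "0 < d" using e by (simp add: d_def)
      show "\<forall>\<^sub>F n in sequentially. dist (p (Suc n) t - (y0 + integral {0..t} (\<lambda>s. G (u s)))) 0 < e"
        using uniform_limitD[OF ul[of t] d]
      proof eventually_elim
        case (elim n)
        have "p (Suc n) t - (y0 + integral {0..t} (\<lambda>s. G (u s))) = integral {0..t} (\<lambda>s. G (p n s) - G (u s))"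
          using integral_diff[OF Gpi[of n t] integrable_continuous_real[OF Guc[of t]]] by (simp add: pS)
        also have "norm \<dots> \<le> K * d * (t - 0)"
        proof (rule integral_bound[OF that])
          show "continuous_on {0..t} (\<lambda>s. G (p n s) - G (u s))" by (intro continuous_intros Gpc Guc)
          fix s assume "s \<in> {0..t}"
          then have "norm (p n s - u s) \<le> d" using elim by (auto simp: dist_norm less_imp_le)
          then show "norm (G (p n s) - G (u s)) \<le> K * d" using KL[of "p n s" "u s"] K0
            by (meson mult_left_mono order_trans)
        qed
        also have "\<dots> = d * (K * t + 1) - d" by (simp add: algebra_simps)
        also have "\<dots> < e" using Kt d by (simp add: d_def)
        finally show ?case by simp
      qed
    qed
    then have "(\<lambda>n. p (Suc n) t) \<longlonglongrightarrow> y0 + integral {0..t} (\<lambda>s. G (u s))"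
      by (rule LIM_zero_cancel)
    moreover have "(\<lambda>n. p (Suc n) t) \<longlonglongrightarrow> u t"
      using tendsto_uniform_limitI[OF ul[of t], of t] that by (intro LIMSEQ_Suc) auto
    ultimately show ?thesis using LIMSEQ_unique by blast
  qed
  show ?thesis
  proof (intro exI[of _ u] conjI allI ballI)
    show "u 0 = y0" using ui[of 0] by simp
    fix T t :: real assume t: "t \<in> {0..T}"
    have "((\<lambda>t. y0 + integral {0..t} (\<lambda>s. G (u s))) has_vector_derivative 0 + G (u t)) (at t within {0..T})"
      by (intro has_vector_derivative_add has_vector_derivative_const integral_has_vector_derivative Guc t)
    then have *: "((\<lambda>t. y0 + integral {0..t} (\<lambda>s. G (u s))) has_vector_derivative G (u t)) (at t within {0..T})"
      by simp
    show "(u has_vector_derivative G (u t)) (at t within {0..T})"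
      by (rule has_vector_derivative_transform[OF t _ *]) (use ui in auto)
  qed
qed

section \<open>Skew-adjoint operators and weak solutions\<close>

lemma quadratic_bound_deriv_zero:
  fixes r :: "real \<Rightarrow> real"
  assumes "\<And>s. s \<in> S \<Longrightarrow> \<bar>r s\<bar> \<le> c * (s - t)\<^sup>2" and t: "t \<in> S"
  shows "(r has_real_derivative 0) (at t within S)"
proof -
  have rt: "r t = 0" using assms(1)[OF t] by simp
  have "((\<lambda>s. (r s - r t) / (s - t)) \<longlongrightarrow> 0) (at t within S)"
  proof (rule Lim_null_comparison)
    show "\<forall>\<^sub>F s in at t within S. norm ((r s - r t) / (s - t)) \<le> c * \<bar>s - t\<bar>"
      unfolding eventually_at_filter
    proof (intro always_eventually allI impI)
      fix s assume "s \<noteq> t" "s \<in> S"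
      then show "norm ((r s - r t) / (s - t)) \<le> c * \<bar>s - t\<bar>"
        using assms(1)[of s] rt by (simp add: divide_simps power2_eq_square mult.assoc)
    qed
    show "((\<lambda>s. c * \<bar>s - t\<bar>) \<longlongrightarrow> 0) (at t within S)"
      by (auto intro!: tendsto_eq_intros)
  qed
  then show ?thesis by (simp add: has_field_derivative_iff)
qed

lemma norm_le_if_inner_le:
  fixes z :: "'a::real_inner"
  assumes "z \<bullet> z \<le> C * norm z" "0 \<le> C" shows "norm z \<le> C"
proof (cases "z = 0")
  case False
  then show ?thesis using assms(1) by (simp add: power2_norm_eq_inner[symmetric] power2_eq_square)
qed (use assms in simp)

lemma norm_diff_sq:
  fixes x y :: "'a::real_inner"
  shows "(norm (x - y))\<^sup>2 = (norm x)\<^sup>2 + (norm y)\<^sup>2 - 2 * (x \<bullet> y)"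
  unfolding power2_norm_eq_inner using inner_commute[of x y] by (simp add: inner_diff_left inner_diff_right)

text \<open>Pairing with the increment \<open>z t - z s\<close> itself reduces the claim to a scalar
  mean value inequality; one factor of its norm is then cancelled.\<close>

lemma weak_deriv_lipschitz:
  fixes z z' :: "real \<Rightarrow> 'a::real_inner"
  assumes d: "\<And>t \<psi>. t \<in> {a..b} \<Longrightarrow> ((\<lambda>s. z s \<bullet> \<psi>) has_real_derivative z' t \<bullet> \<psi>) (at t within {a..b})"
    and C: "\<And>t. t \<in> {a..b} \<Longrightarrow> norm (z' t) \<le> C" and st: "s \<in> {a..b}" "t \<in> {a..b}"
  shows "norm (z t - z s) \<le> C * \<bar>t - s\<bar>"
proof -
  have C0: "0 \<le> C" using C[OF st(1)] norm_ge_zero order_trans by blast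
  have *: "norm (z t - z s) \<le> C * (t - s)" if st: "a \<le> s" "s \<le> t" "t \<le> b" for s t
  proof (rule norm_le_if_inner_le)
    let ?\<psi> = "z t - z s"
    have "z t \<bullet> ?\<psi> - z s \<bullet> ?\<psi> \<le> C * norm ?\<psi> * t - C * norm ?\<psi> * s"
    proof (rule deriv_within_bound[of s t "\<lambda>\<tau>. z \<tau> \<bullet> ?\<psi>" "\<lambda>\<tau>. z' \<tau> \<bullet> ?\<psi>" "\<lambda>\<tau>. C * norm ?\<psi> * \<tau>" "\<lambda>_. C * norm ?\<psi>"])
      fix \<tau> assume \<tau>: "\<tau> \<in> {s..t}"
      show "((\<lambda>\<tau>. z \<tau> \<bullet> ?\<psi>) has_real_derivative z' \<tau> \<bullet> ?\<psi>) (at \<tau> within {s..t})"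
        using d[of \<tau> ?\<psi>] \<tau> st by (auto intro: DERIV_subset)
      show "z' \<tau> \<bullet> ?\<psi> \<le> C * norm ?\<psi>"
        using C[of \<tau>] \<tau> st norm_cauchy_schwarz[of "z' \<tau>" ?\<psi>]
        by (smt (verit, best) atLeastAtMost_iff mult_right_mono norm_ge_zero)
    qed (use st in \<open>auto intro!: derivative_eq_intros\<close>)
    then show "?\<psi> \<bullet> ?\<psi> \<le> C * (t - s) * norm ?\<psi>" by (simp add: inner_diff_left algebra_simps)
    show "0 \<le> C * (t - s)" using C0 st by simp
  qed
  show ?thesis using *[of s t] *[of t s] st by (cases "s \<le> t") (auto simp: norm_minus_commute)
qed

text \<open>|z s|^2 is |z s - z t|^2 plus 2 (z s, z t) - |z t|^2. The first part is quadratically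
  small at t by the Lipschitz bound, and the second is a pairing with the fixed vector
  \<open>z t\<close>, so weak differentiability suffices.\<close>

lemma weak_deriv_norm_sq:
  fixes z z' :: "real \<Rightarrow> 'a::real_inner"
  assumes d: "\<And>t \<psi>. t \<in> {a..b} \<Longrightarrow> ((\<lambda>s. z s \<bullet> \<psi>) has_real_derivative z' t \<bullet> \<psi>) (at t within {a..b})"
    and C: "\<And>t. t \<in> {a..b} \<Longrightarrow> norm (z' t) \<le> C" and t: "t \<in> {a..b}"
  shows "((\<lambda>s. (norm (z s))\<^sup>2) has_real_derivative 2 * (z' t \<bullet> z t)) (at t within {a..b})"
proof -
  have "((\<lambda>s. (norm (z s - z t))\<^sup>2) has_real_derivative 0) (at t within {a..b})"
  proof (rule quadratic_bound_deriv_zero[OF _ t, where c = "C\<^sup>2"])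
    fix s assume s: "s \<in> {a..b}"
    have "(norm (z s - z t))\<^sup>2 \<le> (C * \<bar>s - t\<bar>)\<^sup>2"
      using weak_deriv_lipschitz[OF d C t s] by (intro power_mono) auto
    then show "\<bar>(norm (z s - z t))\<^sup>2\<bar> \<le> C\<^sup>2 * (s - t)\<^sup>2" by (simp add: power_mult_distrib)
  qed
  moreover have "((\<lambda>s. 2 * (z s \<bullet> z t) - z t \<bullet> z t) has_real_derivative 2 * (z' t \<bullet> z t) - 0) (at t within {a..b})"
    by (intro DERIV_diff DERIV_cmult DERIV_const d t)
  ultimately have "((\<lambda>s. (norm (z s - z t))\<^sup>2 + (2 * (z s \<bullet> z t) - z t \<bullet> z t)) has_real_derivative 0 + (2 * (z' t \<bullet> z t) - 0)) (at t within {a..b})"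
    by (rule DERIV_add)
  moreover have "(\<lambda>s. (norm (z s - z t))\<^sup>2 + (2 * (z s \<bullet> z t) - z t \<bullet> z t)) = (\<lambda>s. (norm (z s))\<^sup>2)"
    by (auto simp: power2_norm_eq_inner inner_diff_left inner_diff_right inner_commute)
  ultimately show ?thesis by simp
qed

text \<open>Solvability of x - l A x = f for both signs of l is what separates skew-adjoint from
  merely skew-symmetric. Density of \<open>D\<close> and closedness of \<open>A\<close> are derived
  from it.\<close>

locale skew_adjoint =
  fixes D :: "'a::{real_inner,banach} set" and A :: "'a \<Rightarrow> 'a"
  assumes subspace_D: "subspace D"
    and A_add: "x \<in> D \<Longrightarrow> y \<in> D \<Longrightarrow> A (x + y) = A x + A y"
    and A_scale: "x \<in> D \<Longrightarrow> A (c *\<^sub>R x) = c *\<^sub>R A x"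
    and skew: "x \<in> D \<Longrightarrow> y \<in> D \<Longrightarrow> A x \<bullet> y = - (x \<bullet> A y)"
    and range_resolvent: "l \<noteq> 0 \<Longrightarrow> \<exists>x\<in>D. x - l *\<^sub>R A x = f"
begin

lemma D_add: "x \<in> D \<Longrightarrow> y \<in> D \<Longrightarrow> x + y \<in> D"
  and D_scale: "x \<in> D \<Longrightarrow> c *\<^sub>R x \<in> D"
  and D_diff: "x \<in> D \<Longrightarrow> y \<in> D \<Longrightarrow> x - y \<in> D"
  using subspace_D by (auto intro: subspace_add subspace_scale subspace_diff)

lemma A_diff: "x \<in> D \<Longrightarrow> y \<in> D \<Longrightarrow> A (x - y) = A x - A y"
  using A_add[of x "- 1 *\<^sub>R y"] A_scale[of y "-1"] D_scale[of y "-1"] by simp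

lemma skew_self: "x \<in> D \<Longrightarrow> A x \<bullet> x = 0"
  using skew[of x x] inner_commute[of x "A x"] by linarith

text \<open>Skewness removes the cross term. The identity gives injectivity of 1 - l A and
  contractivity of its inverse at once, for either sign of l.\<close>

lemma norm_resolvent_sq: "x \<in> D \<Longrightarrow> (norm (x - l *\<^sub>R A x))\<^sup>2 = (norm x)\<^sup>2 + l\<^sup>2 * (norm (A x))\<^sup>2"
  using skew_self[of x] by (simp add: norm_diff_sq inner_commute[of x] power_mult_distrib)

section \<open>Resolvent and Yosida approximation\<close>

definition J :: "real \<Rightarrow> 'a \<Rightarrow> 'a"
  where "J l f = (THE x. x \<in> D \<and> x - l *\<^sub>R A x = f)"

lemma J_unique:
  assumes "x \<in> D" "y \<in> D" "x - l *\<^sub>R A x = y - l *\<^sub>R A y" shows "x = y"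
proof -
  have "(x - y) - l *\<^sub>R A (x - y) = 0" using assms by (simp add: A_diff algebra_simps)
  then have "(norm (x - y))\<^sup>2 + l\<^sup>2 * (norm (A (x - y)))\<^sup>2 = 0"
    using norm_resolvent_sq[OF D_diff[OF assms(1,2)], of l] by simp
  moreover have "0 \<le> l\<^sup>2 * (norm (A (x - y)))\<^sup>2" by simp
  ultimately have "(norm (x - y))\<^sup>2 \<le> 0" by linarith
  then show ?thesis by simp
qed

lemma J_eqI: "x \<in> D \<Longrightarrow> x - l *\<^sub>R A x = f \<Longrightarrow> J l f = x"
  unfolding J_def by (rule the_equality) (auto intro: J_unique)

lemma J_D: "l \<noteq> 0 \<Longrightarrow> J l f \<in> D"
  and J_eq: "l \<noteq> 0 \<Longrightarrow> J l f - l *\<^sub>R A (J l f) = f"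
proof -
  assume "l \<noteq> 0"
  then obtain x where "x \<in> D" "x - l *\<^sub>R A x = f" using range_resolvent by blast
  then show "J l f \<in> D" "J l f - l *\<^sub>R A (J l f) = f" using J_eqI[of x l f] by auto
qed

lemma norm_J: "l \<noteq> 0 \<Longrightarrow> norm (J l f) \<le> norm f"
proof (rule power2_le_imp_le)
  assume l: "l \<noteq> 0"
  have "(norm f)\<^sup>2 = (norm (J l f))\<^sup>2 + l\<^sup>2 * (norm (A (J l f)))\<^sup>2"
    using norm_resolvent_sq[OF J_D[OF l], of f l] unfolding J_eq[OF l] .
  moreover have "0 \<le> l\<^sup>2 * (norm (A (J l f)))\<^sup>2" by simp
  ultimately show "(norm (J l f))\<^sup>2 \<le> (norm f)\<^sup>2" by linarith
qed simp

lemma J_add: "l \<noteq> 0 \<Longrightarrow> J l (f + g) = J l f + J l g"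
proof (rule J_eqI)
  assume l: "l \<noteq> 0"
  then show "J l f + J l g \<in> D" by (intro D_add J_D)
  have "J l f + J l g - l *\<^sub>R A (J l f + J l g) = (J l f - l *\<^sub>R A (J l f)) + (J l g - l *\<^sub>R A (J l g))"
    by (simp add: A_add[OF J_D[OF l] J_D[OF l]] scaleR_add_right)
  then show "J l f + J l g - l *\<^sub>R A (J l f + J l g) = f + g"
    unfolding J_eq[OF l] .
qed

lemma J_scale: "l \<noteq> 0 \<Longrightarrow> J l (c *\<^sub>R f) = c *\<^sub>R J l f"
proof (rule J_eqI)
  assume l: "l \<noteq> 0"
  then show "c *\<^sub>R J l f \<in> D" by (intro D_scale J_D)
  have "c *\<^sub>R J l f - l *\<^sub>R A (c *\<^sub>R J l f) = c *\<^sub>R (J l f - l *\<^sub>R A (J l f))"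
    by (simp add: A_scale[OF J_D[OF l]] scaleR_diff_right mult.commute)
  then show "c *\<^sub>R J l f - l *\<^sub>R A (c *\<^sub>R J l f) = c *\<^sub>R f"
    unfolding J_eq[OF l] .
qed

lemma J_diff: "l \<noteq> 0 \<Longrightarrow> J l (f - g) = J l f - J l g"
  using J_add[of l f "-1 *\<^sub>R g"] J_scale[of l "-1" g] by simp

text \<open>The adjoint of the resolvent is the resolvent with l reflected. It lets an equation that
  may only be tested with elements of \<open>D\<close> be tested with arbitrary vectors, once
  \<open>J l\<close> has been applied.\<close>

lemma J_adjoint: "l \<noteq> 0 \<Longrightarrow> J l f \<bullet> g = f \<bullet> J (- l) g"
proof -
  assume l: "l \<noteq> 0"
  let ?x = "J l f" and ?y = "J (- l) g"
  have D: "?x \<in> D" "?y \<in> D" using l J_D by auto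
  have "?x \<bullet> g = ?x \<bullet> (?y + l *\<^sub>R A ?y)" using J_eq[of "- l" g] l by simp
  also have "\<dots> = (?x - l *\<^sub>R A ?x) \<bullet> ?y"
    using skew[OF D] by (simp add: inner_add_right inner_diff_left)
  also have "\<dots> = f \<bullet> ?y" using J_eq[of l f] l by simp
  finally show ?thesis .
qed

definition Yos :: "real \<Rightarrow> 'a \<Rightarrow> 'a" where "Yos l x = A (J l x)"

lemma Yos_eq: "l \<noteq> 0 \<Longrightarrow> Yos l x = (1 / l) *\<^sub>R (J l x - x)"
proof -
  assume l: "l \<noteq> 0"
  have "l *\<^sub>R A (J l x) = J l x - x" using J_eq[OF l, of x] by (metis diff_diff_eq2 diff_add_cancel add_diff_cancel_left' add.commute)
  then have "(1 / l) *\<^sub>R (l *\<^sub>R A (J l x)) = (1 / l) *\<^sub>R (J l x - x)" by simp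
  then show ?thesis using l by (simp add: Yos_def)
qed

lemma J_Yos: "l \<noteq> 0 \<Longrightarrow> J l x = x + l *\<^sub>R Yos l x"
  by (simp add: Yos_eq)

lemma Yos_diff: "l \<noteq> 0 \<Longrightarrow> Yos l (x - y) = Yos l x - Yos l y"
  by (simp add: Yos_eq J_diff algebra_simps)

lemma norm_Yos: "l \<noteq> 0 \<Longrightarrow> norm (Yos l x) \<le> 2 / \<bar>l\<bar> * norm x"
proof -
  assume l: "l \<noteq> 0"
  have "norm (J l x - x) \<le> 2 * norm x"
    using norm_triangle_ineq4[of "J l x" x] norm_J[OF l, of x] by simp
  then show ?thesis using l by (simp add: Yos_eq divide_simps)
qed

lemma Yos_commute: "x \<in> D \<Longrightarrow> l \<noteq> 0 \<Longrightarrow> Yos l x = J l (A x)"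
proof -
  assume x: "x \<in> D" and l: "l \<noteq> 0"
  have "J l (x - l *\<^sub>R A x) = x" using J_eqI[OF x] by simp
  then have "J l x - l *\<^sub>R J l (A x) = x" by (simp only: J_diff[OF l] J_scale[OF l])
  then have "l *\<^sub>R J l (A x) = J l x - x" by (metis diff_diff_eq2 add_diff_cancel_left')
  then have "l *\<^sub>R J l (A x) = l *\<^sub>R Yos l x" using J_Yos[OF l, of x] by simp
  then show ?thesis using l by simp
qed

lemma norm_Yos_le: "x \<in> D \<Longrightarrow> l \<noteq> 0 \<Longrightarrow> norm (Yos l x) \<le> norm (A x)"
  by (simp add: Yos_commute norm_J)

lemma Yos_adjoint: "l \<noteq> 0 \<Longrightarrow> Yos l x \<bullet> y = - (x \<bullet> Yos (- l) y)"
  using J_adjoint[of l x y] by (simp add: Yos_eq inner_diff_left inner_diff_right)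

text \<open>Write x as \<open>J l x - l *\<^sub>R Yos l x\<close>: the first part pairs to zero by
  skewness, and what remains is - l |Yos l x|^2.\<close>

lemma Yos_dissipative: "l > 0 \<Longrightarrow> Yos l x \<bullet> x \<le> 0"
proof -
  assume l: "l > 0"
  have "Yos l x \<bullet> x = Yos l x \<bullet> (J l x - l *\<^sub>R Yos l x)" using J_Yos[of l x] l by simp
  also have "\<dots> = - l * (norm (Yos l x))\<^sup>2"
    using skew_self[OF J_D[of l x]] l by (simp add: Yos_def inner_diff_right power2_norm_eq_inner)
  finally show ?thesis using l by (simp add: mult_nonneg_nonneg)
qed

text \<open>Skewness applied to the difference of two resolvents of the same x. All monotonicity of
  the Yosida approximation in its parameter comes from this identity.\<close>

lemma Yos_pair: "l > 0 \<Longrightarrow> m > 0 \<Longrightarrow>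
  l * (norm (Yos l x))\<^sup>2 + m * (norm (Yos m x))\<^sup>2 = (l + m) * (Yos l x \<bullet> Yos m x)"
proof -
  assume l: "l > 0" and m: "m > 0"
  have D: "J l x \<in> D" "J m x \<in> D" using J_D l m by auto
  have "(Yos l x - Yos m x) \<bullet> (J l x - J m x) = 0"
    using skew_self[OF D_diff[OF D]] by (simp add: Yos_def A_diff D)
  then have "(Yos l x - Yos m x) \<bullet> (l *\<^sub>R Yos l x - m *\<^sub>R Yos m x) = 0"
    using J_Yos[of l x] J_Yos[of m x] l m by simp
  then show ?thesis
    using inner_commute[of "Yos l x" "Yos m x"]
    by (simp add: power2_norm_eq_inner inner_diff_left inner_diff_right algebra_simps)
qed

text \<open>x n is recovered from x n - A (x n) by the contraction \<open>J 1\<close>, so limits of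
  the graph stay in the range of \<open>J 1\<close>.\<close>

lemma A_closed:
  assumes "\<And>n. x n \<in> D" "x \<longlonglongrightarrow> a" "(\<lambda>n. A (x n)) \<longlonglongrightarrow> b"
  shows "a \<in> D \<and> A a = b"
proof -
  have "J 1 (x n - A (x n)) = x n" for n
    using J_eqI[OF assms(1)[of n] refl, of 1] by simp
  moreover have "(\<lambda>n. J 1 (x n - A (x n))) \<longlonglongrightarrow> J 1 (a - b)"
  proof (rule LIM_zero_cancel, rule Lim_null_comparison)
    show "\<forall>\<^sub>F n in sequentially. norm (J 1 (x n - A (x n)) - J 1 (a - b)) \<le> norm (x n - A (x n) - (a - b))"
    proof (intro always_eventually allI)
      fix n
      show "norm (J 1 (x n - A (x n)) - J 1 (a - b)) \<le> norm (x n - A (x n) - (a - b))"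
        using norm_J[of 1 "x n - A (x n) - (a - b)"] by (simp add: J_diff)
    qed
    show "(\<lambda>n. norm (x n - A (x n) - (a - b))) \<longlonglongrightarrow> 0"
      by (intro tendsto_norm_zero LIM_zero tendsto_diff assms)
  qed
  ultimately have "x \<longlonglongrightarrow> J 1 (a - b)" by simp
  then have "J 1 (a - b) = a" using assms(2) by (rule LIMSEQ_unique)
  then show ?thesis using J_D[of 1 "a - b"] J_eq[of 1 "a - b"] by simp
qed

definition lam :: "nat \<Rightarrow> real" where "lam n = 1 / real (Suc n)"

lemma lam_pos [simp]: "0 < lam n" and lam_nonzero [simp]: "lam n \<noteq> 0"
  by (auto simp: lam_def)

text \<open>The absolute value lets the same lemma serve norms that increase (\<open>Yos\<close>)
  and norms that decrease (\<open>lam n\<close> times \<open>Yos\<close>).\<close>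

lemma incseq_Cauchy:
  fixes z :: "nat \<Rightarrow> 'a"
  assumes mono: "\<And>n m. n \<le> m \<Longrightarrow> (norm (z n - z m))\<^sup>2 \<le> \<bar>(norm (z m))\<^sup>2 - (norm (z n))\<^sup>2\<bar>"
    and cv: "convergent (\<lambda>n. (norm (z n))\<^sup>2)"
  shows "convergent z"
proof -
  have "Cauchy (\<lambda>n. (norm (z n))\<^sup>2)" using cv by (rule convergent_Cauchy)
  have "Cauchy z"
  proof (rule CauchyI')
    fix e :: real assume e: "0 < e"
    then obtain M where M: "\<And>m n. m \<ge> M \<Longrightarrow> n \<ge> M \<Longrightarrow> norm ((norm (z m))\<^sup>2 - (norm (z n))\<^sup>2) < e\<^sup>2"
      using CauchyD[OF \<open>Cauchy (\<lambda>n. (norm (z n))\<^sup>2)\<close>, of "e\<^sup>2"] by auto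
    show "\<exists>M. \<forall>m\<ge>M. \<forall>n>m. dist (z m) (z n) < e"
    proof (intro exI[of _ M] allI impI)
      fix m n assume "M \<le> m" "m < n"
      then have "(norm (z m - z n))\<^sup>2 < e\<^sup>2" using mono[of m n] M[of n m] by auto
      then show "dist (z m) (z n) < e" unfolding dist_norm using e by (simp add: power2_less_imp_less)
    qed
  qed
  then show ?thesis by (rule Cauchy_convergent)
qed

text \<open>With p, q, r the two squared norms and the pairing, \<open>Yos_pair\<close> gives (l +
  m) |Yos l x - Yos m x|^2 = (l - m) (q - p). Nonnegativity of the left side forces p \<le> q, and l
  - m \<le> l + m gives the estimate. The same computation with l^2 p and m^2 q handles l Yos l
  x.\<close>

lemma Yos_diff_norm:
  assumes "l > 0" "m > 0" "m \<le> l"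
  shows "norm (Yos l x) \<le> norm (Yos m x)"
    and "(norm (Yos l x - Yos m x))\<^sup>2 \<le> (norm (Yos m x))\<^sup>2 - (norm (Yos l x))\<^sup>2"
    and "norm (l *\<^sub>R Yos l x) \<ge> norm (m *\<^sub>R Yos m x)"
    and "(norm (l *\<^sub>R Yos l x - m *\<^sub>R Yos m x))\<^sup>2 \<le> (norm (l *\<^sub>R Yos l x))\<^sup>2 - (norm (m *\<^sub>R Yos m x))\<^sup>2"
proof -
  define p q r where "p = (norm (Yos l x))\<^sup>2" and "q = (norm (Yos m x))\<^sup>2" and "r = Yos l x \<bullet> Yos m x"
  have pair: "l * p + m * q = (l + m) * r" using Yos_pair[of l m x] assms by (simp add: p_def q_def r_def)
  have d: "(norm (Yos l x - Yos m x))\<^sup>2 = p + q - 2 * r"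
    by (simp add: p_def q_def r_def norm_diff_sq)
  have s: "(l + m) * (p + q - 2 * r) = (l - m) * (q - p)"
    using pair by (simp add: algebra_simps)
  have nn: "0 \<le> p + q - 2 * r" using d by (metis zero_le_power2)
  have lm: "0 < l + m" using assms by simp
  have pq: "p \<le> q"
  proof (cases "l = m")
    case True then show ?thesis by (simp add: p_def q_def)
  next
    case False
    then have "0 < l - m" using assms by simp
    moreover have "0 \<le> (l - m) * (q - p)" using s nn lm 
      by (metis mult_nonneg_nonneg order_less_imp_le)
    ultimately show ?thesis by (simp add: zero_le_mult_iff)
  qed
  then show 1: "norm (Yos l x) \<le> norm (Yos m x)" by (simp add: p_def q_def)
  have "(l + m) * (p + q - 2 * r) \<le> (l + m) * (q - p)"
    unfolding s using assms pq by (intro mult_right_mono) auto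
  then show "(norm (Yos l x - Yos m x))\<^sup>2 \<le> (norm (Yos m x))\<^sup>2 - (norm (Yos l x))\<^sup>2"
    using lm d by (simp add: p_def q_def)
  have e: "(norm (l *\<^sub>R Yos l x - m *\<^sub>R Yos m x))\<^sup>2 = l\<^sup>2 * p + m\<^sup>2 * q - 2 * l * m * r"
    by (simp add: p_def q_def r_def norm_diff_sq power_mult_distrib mult.assoc)
  have n1: "(norm (l *\<^sub>R Yos l x))\<^sup>2 = l\<^sup>2 * p" and n2: "(norm (m *\<^sub>R Yos m x))\<^sup>2 = m\<^sup>2 * q"
    by (auto simp: p_def q_def power_mult_distrib)
  have s2: "(l + m) * (l\<^sup>2 * p + m\<^sup>2 * q - 2 * l * m * r) = (l - m) * (l\<^sup>2 * p - m\<^sup>2 * q)"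
  proof -
    have "(l + m) * (l\<^sup>2 * p + m\<^sup>2 * q - 2 * l * m * r) = (l + m) * (l\<^sup>2 * p + m\<^sup>2 * q) - 2 * l * m * (l * p + m * q)"
      unfolding pair by (simp add: algebra_simps)
    then show ?thesis by (simp add: algebra_simps power2_eq_square)
  qed
  have nn2: "0 \<le> l\<^sup>2 * p + m\<^sup>2 * q - 2 * l * m * r" using e by (metis zero_le_power2)
  have lp: "m\<^sup>2 * q \<le> l\<^sup>2 * p"
  proof (cases "l = m")
    case True then show ?thesis by (simp add: p_def q_def)
  next
    case False
    then have "0 < l - m" using assms by simp
    moreover have "0 \<le> (l - m) * (l\<^sup>2 * p - m\<^sup>2 * q)" using s2 nn2 lm 
      by (metis mult_nonneg_nonneg order_less_imp_le)
    ultimately show ?thesis by (simp add: zero_le_mult_iff)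
  qed
  then show "norm (l *\<^sub>R Yos l x) \<ge> norm (m *\<^sub>R Yos m x)"
    unfolding n1[symmetric] n2[symmetric] by (rule power2_le_imp_le) simp
  have "(l + m) * (l\<^sup>2 * p + m\<^sup>2 * q - 2 * l * m * r) \<le> (l + m) * (l\<^sup>2 * p - m\<^sup>2 * q)"
    unfolding s2 using assms lp by (intro mult_right_mono) auto
  then show "(norm (l *\<^sub>R Yos l x - m *\<^sub>R Yos m x))\<^sup>2 \<le> (norm (l *\<^sub>R Yos l x))\<^sup>2 - (norm (m *\<^sub>R Yos m x))\<^sup>2"
    unfolding e n1 n2 using lm by simp
qed

lemma lambda_mono: "n \<le> m \<Longrightarrow> lam m \<le> lam n"
  unfolding lam_def by (intro divide_left_mono) auto

lemma lambda_tendsto: "lam \<longlonglongrightarrow> 0"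
  using LIMSEQ_Suc[OF lim_1_over_n] by (simp add: lam_def[abs_def])

text \<open>The norms are monotone, so boundedness makes them converge, and the difference estimate
  upgrades this to strong convergence of the vectors. Closedness of A finishes; no weak compactness
  is involved.\<close>

lemma D_if_Yos_bounded:
  assumes "\<And>n. norm (Yos (lam n) x) \<le> C"
  shows "x \<in> D" "(\<lambda>n. Yos (lam n) x) \<longlonglongrightarrow> A x"
proof -
  have l: "lam n > 0" for n by simp
  have "incseq (\<lambda>n. (norm (Yos (lam n) x))\<^sup>2)"
    by (intro monoI power_mono Yos_diff_norm(1) lambda_mono l) auto
  moreover have "norm ((norm (Yos (lam n) x))\<^sup>2) \<le> C\<^sup>2" for n
    using power_mono[OF assms norm_ge_zero] by simp
  ultimately have "convergent (\<lambda>n. (norm (Yos (lam n) x))\<^sup>2)"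
    by (intro Bseq_monoseq_convergent BseqI'[of _ "C\<^sup>2"] incseq_imp_monoseq)
  then have "convergent (\<lambda>n. Yos (lam n) x)"
  proof (rule incseq_Cauchy[rotated])
    fix n m :: nat assume "n \<le> m"
    from Yos_diff_norm(2)[OF l l lambda_mono[OF this], of x]
    show "(norm (Yos (lam n) x - Yos (lam m) x))\<^sup>2 \<le> \<bar>(norm (Yos (lam m) x))\<^sup>2 - (norm (Yos (lam n) x))\<^sup>2\<bar>"
      by linarith
  qed
  then obtain b where b: "(\<lambda>n. Yos (lam n) x) \<longlonglongrightarrow> b" by (auto simp: convergent_def)
  have "(\<lambda>n. x + lam n *\<^sub>R Yos (lam n) x) \<longlonglongrightarrow> x + 0 *\<^sub>R b"
    by (intro tendsto_intros b lambda_tendsto)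
  then have "(\<lambda>n. J (lam n) x) \<longlonglongrightarrow> x" by (simp add: J_Yos)
  from A_closed[OF J_D this] b have "x \<in> D \<and> A x = b" by (simp add: Yos_def)
  then show "x \<in> D" "(\<lambda>n. Yos (lam n) x) \<longlonglongrightarrow> A x" using b by auto
qed

text \<open>Write p = x - A x with x in \<open>D\<close>. Pairing with x gives |x|^2 = 0 by
  skewness.\<close>

lemma orth_D_zero: assumes "\<And>\<phi>. \<phi> \<in> D \<Longrightarrow> p \<bullet> \<phi> = 0" shows "p = 0"
proof -
  let ?x = "J 1 p"
  have x: "?x \<in> D" "?x - A ?x = p" using J_D[of 1 p] J_eq[of 1 p] by auto
  have "(?x - A ?x) \<bullet> ?x = 0" using assms[OF x(1)] x(2) by simp
  then have "?x \<bullet> ?x = 0" using skew_self[OF x(1)] by (simp add: inner_diff_left)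
  then have "?x = 0" by simp
  moreover have "A 0 = 0" using A_scale[OF x(1), of 0] by simp
  ultimately show ?thesis using x(2) by (metis diff_0_right)
qed

text \<open>The defect \<open>J (lam n) x - x\<close> equals \<open>lam n\<close> times
  \<open>Yos (lam n) x\<close>; its norm decreases, so it converges to some p. Against \<phi> in
  \<open>D\<close> the operator moves to \<phi> and the factor \<open>lam n\<close> survives, so p
  is orthogonal to \<open>D\<close> and vanishes.\<close>

lemma J_tendsto: "(\<lambda>n. J (lam n) x) \<longlonglongrightarrow> x"
proof -
  have l: "lam n > 0" for n by simp
  let ?p = "\<lambda>n. lam n *\<^sub>R Yos (lam n) x"
  have "decseq (\<lambda>n. (norm (?p n))\<^sup>2)"
    by (intro decseq_SucI power_mono Yos_diff_norm(3) lambda_mono l) auto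
  then obtain L where "(\<lambda>n. (norm (?p n))\<^sup>2) \<longlonglongrightarrow> L"
    by (rule decseq_convergent[of _ 0]) simp_all
  then have "convergent (\<lambda>n. (norm (?p n))\<^sup>2)" by (auto simp: convergent_def)
  then have "convergent ?p"
  proof (rule incseq_Cauchy[rotated])
    fix n m :: nat assume "n \<le> m"
    from Yos_diff_norm(4)[OF l l lambda_mono[OF this], of x]
    show "(norm (?p n - ?p m))\<^sup>2 \<le> \<bar>(norm (?p m))\<^sup>2 - (norm (?p n))\<^sup>2\<bar>" by linarith
  qed
  then obtain p where p: "?p \<longlonglongrightarrow> p" by (auto simp: convergent_def)
  have "p \<bullet> \<phi> = 0" if \<phi>: "\<phi> \<in> D" for \<phi>
  proof -
    have "(\<lambda>n. ?p n \<bullet> \<phi>) \<longlonglongrightarrow> 0"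
    proof (rule Lim_null_comparison)
      have "norm (?p n \<bullet> \<phi>) \<le> lam n * (norm x * norm (A \<phi>))" for n
      proof -
        have "Yos (lam n) x \<bullet> \<phi> = - (J (lam n) x \<bullet> A \<phi>)"
          unfolding Yos_def using skew[OF J_D \<phi>] by simp
        moreover have "\<bar>J (lam n) x \<bullet> A \<phi>\<bar> \<le> norm x * norm (A \<phi>)"
          using Cauchy_Schwarz_ineq2[of "J (lam n) x" "A \<phi>"] norm_J[of "lam n" x]
          by (meson lam_nonzero mult_right_mono norm_ge_zero order_trans)
        ultimately show ?thesis by (simp add: abs_mult abs_of_pos)
      qed
      then show "\<forall>\<^sub>F n in sequentially. norm (?p n \<bullet> \<phi>) \<le> lam n * (norm x * norm (A \<phi>))" by simp
      show "(\<lambda>n. lam n * (norm x * norm (A \<phi>))) \<longlonglongrightarrow> 0"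
        using tendsto_mult_right[OF lambda_tendsto, of "norm x * norm (A \<phi>)"] by simp
    qed
    moreover have "(\<lambda>n. ?p n \<bullet> \<phi>) \<longlonglongrightarrow> p \<bullet> \<phi>" by (intro tendsto_intros p)
    ultimately show ?thesis using LIMSEQ_unique by blast
  qed
  then have "p = 0" by (rule orth_D_zero)
  then have "(\<lambda>n. x + ?p n) \<longlonglongrightarrow> x + 0" using p by (intro tendsto_intros) auto
  then show ?thesis by (simp add: J_Yos)
qed

lemma D_dense: "\<exists>x. (\<forall>n. x n \<in> D) \<and> x \<longlonglongrightarrow> y"
  by (rule exI[of _ "\<lambda>n. J (lam n) y"]) (simp add: J_D J_tendsto)

text \<open>The operator falls on the test element, with a sign from skewness, so the values of y
  need not lie in \<open>D\<close>. The equation is required at every time, one-sidedly at the ends,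
  rather than almost everywhere.\<close>

definition wsol :: "('a \<Rightarrow> 'a) \<Rightarrow> real \<Rightarrow> (real \<Rightarrow> 'a) \<Rightarrow> bool"
  where "wsol F T y \<longleftrightarrow> bounded (y ` {0..T}) \<and> (\<forall>\<phi>\<in>D. \<forall>t\<in>{0..T}.
    ((\<lambda>s. y s \<bullet> \<phi>) has_real_derivative - (y t \<bullet> A \<phi>) + F (y t) \<bullet> \<phi>) (at t within {0..T}))"

lemma wsol_deriv: "wsol F T y \<Longrightarrow> \<phi> \<in> D \<Longrightarrow> t \<in> {0..T} \<Longrightarrow>
    ((\<lambda>s. y s \<bullet> \<phi>) has_real_derivative - (y t \<bullet> A \<phi>) + F (y t) \<bullet> \<phi>) (at t within {0..T})"
  by (simp add: wsol_def)

lemma wsol_bounded: "wsol F T y \<Longrightarrow> \<exists>B. \<forall>t\<in>{0..T}. norm (y t) \<le> B"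
  unfolding wsol_def bounded_iff by blast

lemma wsol_subset: "wsol F T y \<Longrightarrow> t \<le> T \<Longrightarrow> wsol F t y"
  unfolding wsol_def
  by (auto intro: bounded_subset[of "y ` {0..T}"] DERIV_subset[of _ _ _ "{0..T}"] image_mono)

lemma wsol_cong:
  assumes "wsol F T y" and "\<And>t. t \<in> {0..T} \<Longrightarrow> F (y t) = G (y t)"
  shows "wsol G T y"
  using assms unfolding wsol_def by metis

lemma wsol_shift:
  assumes y: "wsol F T y" and h: "h \<in> {0..T}"
  shows "wsol F (T - h) (\<lambda>s. y (s + h))"
  unfolding wsol_def
proof (intro conjI ballI)
  have im: "(\<lambda>s. y (s + h)) ` {0..T - h} \<subseteq> y ` {0..T}" using h by force
  show "bounded ((\<lambda>s. y (s + h)) ` {0..T - h})"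
    using y im unfolding wsol_def by (blast intro: bounded_subset)
  fix \<phi> t assume \<phi>: "\<phi> \<in> D" and t: "t \<in> {0..T - h}"
  have "((\<lambda>s. y s \<bullet> \<phi>) has_real_derivative - (y (t + h) \<bullet> A \<phi>) + F (y (t + h)) \<bullet> \<phi>) (at (t + h) within {0..T})"
    by (rule wsol_deriv[OF y \<phi>]) (use t h in auto)
  then have "((\<lambda>s. y s \<bullet> \<phi>) has_real_derivative - (y (t + h) \<bullet> A \<phi>) + F (y (t + h)) \<bullet> \<phi>) (at (t + h) within (\<lambda>s. s + h) ` {0..T - h})"
    by (rule DERIV_subset) (use h in auto)
  then have "(((\<lambda>s. y s \<bullet> \<phi>) \<circ> (\<lambda>s. s + h)) has_real_derivative (- (y (t + h) \<bullet> A \<phi>) + F (y (t + h)) \<bullet> \<phi>) * 1) (at t within {0..T - h})"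
    by (rule DERIV_image_chain) (auto intro!: derivative_eq_intros)
  then show "((\<lambda>s. y (s + h) \<bullet> \<phi>) has_real_derivative - (y (t + h) \<bullet> A \<phi>) + F (y (t + h)) \<bullet> \<phi>) (at t within {0..T - h})"
    by (simp add: o_def)
qed

text \<open>The resolvent turns the weak equation into one with values in \<open>D\<close>.\<close>

lemma wsol_J_deriv:
  assumes y: "wsol F T y" and l: "l \<noteq> 0" and t: "t \<in> {0..T}"
  shows "((\<lambda>s. J l (y s) \<bullet> \<psi>) has_real_derivative (Yos l (y t) + J l (F (y t))) \<bullet> \<psi>) (at t within {0..T})"
proof -
  have "- (y t \<bullet> A (J (- l) \<psi>)) + F (y t) \<bullet> J (- l) \<psi> = (Yos l (y t) + J l (F (y t))) \<bullet> \<psi>"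
    using Yos_adjoint[OF l, of "y t" \<psi>] J_adjoint[OF l, of "F (y t)" \<psi>]
    by (simp add: inner_add_left Yos_def)
  then show ?thesis
    using wsol_deriv[OF y J_D[of "- l" \<psi>] t] l by (simp add: J_adjoint)
qed

text \<open>For the difference d the squared norm of \<open>J l (d s)\<close> is differentiable, and
  A drops out by skewness, but its derivative is estimated by 2 k |d s|^2, without the resolvent.
  Gronwall does not apply to such an inequality directly; instead a bound for |d|^2 is integrated to
  a better one and the resolvent is removed by l \<rightarrow> 0 at each stage. Iteration produces
  the exponential series.\<close>

lemma wsol_compare:
  assumes y: "wsol F T y" and z: "wsol F T z" and k: "0 \<le> k"
    and L: "\<And>t. t \<in> {0..T} \<Longrightarrow> norm (F (y t) - F (z t)) \<le> k * norm (y t - z t)"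
    and t: "t \<in> {0..T}"
  shows "norm (y t - z t) \<le> exp (k * t) * norm (y 0 - z 0)"
proof -
  define d where "d t = y t - z t" for t
  obtain B1 B2 where B: "\<And>t. t \<in> {0..T} \<Longrightarrow> norm (y t) \<le> B1" "\<And>t. t \<in> {0..T} \<Longrightarrow> norm (z t) \<le> B2"
    using wsol_bounded[OF y] wsol_bounded[OF z] by blast
  define B where "B = B1 + B2"
  have dB: "norm (d t) \<le> B" if "t \<in> {0..T}" for t
    using B[OF that] norm_triangle_ineq4[of "y t" "z t"] by (simp add: d_def B_def)
  have B0: "0 \<le> B" using dB[OF t] norm_ge_zero order_trans by blast
  have J_der: "((\<lambda>s. (norm (J l (d s)))\<^sup>2) has_real_derivative 2 * (J l (F (y s) - F (z s)) \<bullet> J l (d s))) (at s within {0..T})"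
    if l: "l \<noteq> 0" and s: "s \<in> {0..T}" for l s
  proof -
    let ?d' = "\<lambda>t. Yos l (d t) + J l (F (y t) - F (z t))"
    have "((\<lambda>s. (norm (J l (d s)))\<^sup>2) has_real_derivative 2 * (?d' s \<bullet> J l (d s))) (at s within {0..T})"
    proof (rule weak_deriv_norm_sq[OF _ _ s, where C = "2 / \<bar>l\<bar> * B + k * B"])
      fix t \<psi> assume t: "t \<in> {0..T}"
      show "((\<lambda>s. J l (d s) \<bullet> \<psi>) has_real_derivative ?d' t \<bullet> \<psi>) (at t within {0..T})"
        using DERIV_diff[OF wsol_J_deriv[OF y l t, of \<psi>] wsol_J_deriv[OF z l t, of \<psi>]]
        by (simp add: d_def J_diff[OF l] Yos_diff[OF l] inner_diff_left inner_add_left algebra_simps)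
      have "norm (Yos l (d t)) \<le> 2 / \<bar>l\<bar> * B"
        using order_trans[OF norm_Yos[OF l, of "d t"] mult_left_mono[OF dB[OF t]]] l by simp
      moreover have "norm (J l (F (y t) - F (z t))) \<le> k * B"
        using order_trans[OF norm_J[OF l] order_trans[OF L[OF t] mult_left_mono[OF dB[OF t] k, unfolded d_def]]] .
      ultimately show "norm (?d' t) \<le> 2 / \<bar>l\<bar> * B + k * B"
        by (rule norm_triangle_mono)
    qed
    moreover have "Yos l (d s) \<bullet> J l (d s) = 0" unfolding Yos_def by (rule skew_self[OF J_D[OF l]])
    ultimately show ?thesis by (simp add: inner_add_left)
  qed
  \<comment> \<open>A partial sum of the series of |d 0|^2 exp(2 k t) plus a remainder that starts
    as the crude bound \<open>B\<^sup>2\<close>. It is chosen so that the derivative of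
    \<open>g (Suc n)\<close> is 2 k times \<open>g n\<close>.\<close>
  define g where "g n t = (norm (d 0))\<^sup>2 * (\<Sum>j<n. (2 * k * t) ^ j / fact j) + B\<^sup>2 * (2 * k * t) ^ n / fact n" for n t
  have g_der: "((\<lambda>t. g (Suc n) t) has_real_derivative 2 * k * g n t) (at t within S)" for n t S
  proof -
    have 1: "((\<lambda>t. (2 * k * t) ^ Suc j / fact (Suc j)) has_real_derivative 2 * k * ((2 * k * t) ^ j / fact j)) (at t within S)" for j
      unfolding fact_Suc by (rule derivative_eq_intros refl | simp del: of_nat_Suc power_Suc)+
    have "((\<lambda>t. (norm (d 0))\<^sup>2 * (1 + (\<Sum>j<n. (2 * k * t) ^ Suc j / fact (Suc j))) + B\<^sup>2 * ((2 * k * t) ^ Suc n / fact (Suc n)))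
      has_real_derivative (norm (d 0))\<^sup>2 * (0 + (\<Sum>j<n. 2 * k * ((2 * k * t) ^ j / fact j))) + B\<^sup>2 * (2 * k * ((2 * k * t) ^ n / fact n))) (at t within S)"
      by (intro DERIV_add DERIV_cmult DERIV_sum DERIV_const 1)
    moreover have "g (Suc n) = (\<lambda>t. (norm (d 0))\<^sup>2 * (1 + (\<Sum>j<n. (2 * k * t) ^ Suc j / fact (Suc j))) + B\<^sup>2 * ((2 * k * t) ^ Suc n / fact (Suc n)))"
      unfolding g_def fun_eq_iff by (simp only: sum.lessThan_Suc_shift) simp
    moreover have "(norm (d 0))\<^sup>2 * (0 + (\<Sum>j<n. 2 * k * ((2 * k * t) ^ j / fact j))) + B\<^sup>2 * (2 * k * ((2 * k * t) ^ n / fact n)) = 2 * k * g n t"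
      unfolding g_def by (simp only: sum_distrib_left[symmetric]) (simp add: algebra_simps)
    ultimately show ?thesis by simp
  qed
  have g0: "g (Suc n) 0 = (norm (d 0))\<^sup>2" for n
    unfolding g_def by (simp only: sum.lessThan_Suc_shift) simp
  have "(norm (d t))\<^sup>2 \<le> g n t" if "t \<in> {0..T}" for n t
    using that
  proof (induction n arbitrary: t)
    case 0
    then show ?case using power_mono[OF dB norm_ge_zero, of t 2] by (simp add: g_def)
  next
    case (Suc n)
    have "(norm (J (lam m) (d t)))\<^sup>2 \<le> g (Suc n) t" for m
    proof -
      have "(norm (J (lam m) (d t)))\<^sup>2 - (norm (J (lam m) (d 0)))\<^sup>2 \<le> g (Suc n) t - g (Suc n) 0"
      proof (rule deriv_within_bound)
        show "0 \<le> t" using Suc.prems by simp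
        fix s assume s: "s \<in> {0..t}"
        then have sT: "s \<in> {0..T}" using Suc.prems by simp
        show "((\<lambda>s. (norm (J (lam m) (d s)))\<^sup>2) has_real_derivative 2 * (J (lam m) (F (y s) - F (z s)) \<bullet> J (lam m) (d s))) (at s within {0..t})"
          using J_der[OF lam_nonzero sT, of m] Suc.prems by (auto intro: DERIV_subset)
        show "(g (Suc n) has_real_derivative 2 * k * g n s) (at s within {0..t})"
          using g_der[of n s] by simp
        have "J (lam m) (F (y s) - F (z s)) \<bullet> J (lam m) (d s) \<le> (k * norm (d s)) * norm (d s)"
          by (rule order_trans[OF norm_cauchy_schwarz mult_mono[OF order_trans[OF norm_J[OF lam_nonzero] L[OF sT, folded d_def]] norm_J[OF lam_nonzero]]])
            (simp_all add: k)
        also have "\<dots> = k * (norm (d s))\<^sup>2" by (simp add: power2_eq_square)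
        also have "\<dots> \<le> k * g n s" by (intro mult_left_mono Suc.IH sT k)
        finally show "2 * (J (lam m) (F (y s) - F (z s)) \<bullet> J (lam m) (d s)) \<le> 2 * k * g n s" by simp
      qed
      moreover have "(norm (J (lam m) (d 0)))\<^sup>2 \<le> (norm (d 0))\<^sup>2"
        by (intro power_mono norm_J) auto
      ultimately show ?thesis using g0[of n] by linarith
    qed
    moreover have "(\<lambda>m. (norm (J (lam m) (d t)))\<^sup>2) \<longlonglongrightarrow> (norm (d t))\<^sup>2"
      by (intro tendsto_intros J_tendsto)
    ultimately show ?case by (intro LIMSEQ_le_const2) auto
  qed
  moreover have "(\<lambda>n. g n t) \<longlonglongrightarrow> (norm (d 0))\<^sup>2 * exp (2 * k * t) + B\<^sup>2 * 0"
  proof -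
    have s: "(\<lambda>j. (2 * k * t) ^ j / fact j) sums exp (2 * k * t)"
      using exp_converges[of "2 * k * t"] by (simp add: divide_inverse mult.commute)
    then have "(\<lambda>n. \<Sum>j<n. (2 * k * t) ^ j / fact j) \<longlonglongrightarrow> exp (2 * k * t)" by (simp add: sums_def)
    moreover have "(\<lambda>j. (2 * k * t) ^ j / fact j) \<longlonglongrightarrow> 0"
      using s sums_summable summable_LIMSEQ_zero by blast
    ultimately have "(\<lambda>n. (norm (d 0))\<^sup>2 * (\<Sum>j<n. (2 * k * t) ^ j / fact j) + B\<^sup>2 * ((2 * k * t) ^ n / fact n))
      \<longlonglongrightarrow> (norm (d 0))\<^sup>2 * exp (2 * k * t) + B\<^sup>2 * 0"
      by (intro tendsto_intros)
    then show ?thesis by (simp add: g_def)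
  qed
  ultimately have "(norm (d t))\<^sup>2 \<le> (norm (d 0))\<^sup>2 * exp (2 * k * t) + B\<^sup>2 * 0"
    using t by (intro LIMSEQ_le_const) auto
  also have "\<dots> = (exp (k * t) * norm (d 0))\<^sup>2"
    by (simp add: power_mult_distrib power2_eq_square[of "exp _"] flip: exp_add)
  finally show ?thesis unfolding d_def by (rule power2_le_imp_le) simp
qed

text \<open>Since A only acts on the test element, uniform convergence of the solutions is enough;
  no control of A along the sequence enters.\<close>

lemma wsol_limit:
  assumes y: "\<And>n. wsol F T (y n)" and u: "uniform_limit {0..T} y z sequentially"
    and L: "\<And>n t. t \<in> {0..T} \<Longrightarrow> norm (F (y n t) - F (z t)) \<le> k * norm (y n t - z t)" and k: "0 \<le> k"
  shows "wsol F T z"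
  unfolding wsol_def
proof (intro conjI ballI)
  have "\<exists>n. \<forall>t\<in>{0..T}. dist (y n t) (z t) < 1"
    using eventually_happens'[OF _ uniform_limitD[OF u zero_less_one]] by simp
  then obtain n where n: "\<And>t. t \<in> {0..T} \<Longrightarrow> dist (y n t) (z t) < 1" by blast
  obtain B where B: "\<And>t. t \<in> {0..T} \<Longrightarrow> norm (y n t) \<le> B" using wsol_bounded[OF y] by blast
  have "norm (z t) \<le> B + 1" if "t \<in> {0..T}" for t
    using n[OF that] B[OF that] norm_triangle_ineq3[of "y n t" "z t"] by (simp add: dist_norm)
  then show "bounded (z ` {0..T})" unfolding bounded_iff by blast
  fix \<phi> t assume \<phi>: "\<phi> \<in> D" and t: "t \<in> {0..T}"
  show "((\<lambda>s. z s \<bullet> \<phi>) has_real_derivative - (z t \<bullet> A \<phi>) + F (z t) \<bullet> \<phi>) (at t within {0..T})"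
  proof (rule limit_has_real_derivative[OF wsol_deriv[OF y \<phi>] _ _ t])
    show "(\<lambda>n. y n t \<bullet> \<phi>) \<longlonglongrightarrow> z t \<bullet> \<phi>" if "t \<in> {0..T}" for t
      by (intro tendsto_intros tendsto_uniform_limitI[OF u that])
    show "uniform_limit {0..T} (\<lambda>n t. - (y n t \<bullet> A \<phi>) + F (y n t) \<bullet> \<phi>) (\<lambda>t. - (z t \<bullet> A \<phi>) + F (z t) \<bullet> \<phi>) sequentially"
    proof (rule uniform_limitI)
      fix e :: real assume e: "0 < e"
      \<comment> \<open>A Lipschitz constant of the right side of the weak equation as a function of
        the state, increased by 1 to be positive.\<close>
      define c where "c = norm (A \<phi>) + k * norm \<phi> + 1"
      have c: "0 < c" unfolding c_def using k by (intro add_nonneg_pos add_nonneg_nonneg) auto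
      then have "0 < e / c" using e by simp
      from uniform_limitD[OF u this]
      show "\<forall>\<^sub>F n in sequentially. \<forall>t\<in>{0..T}. dist (- (y n t \<bullet> A \<phi>) + F (y n t) \<bullet> \<phi>) (- (z t \<bullet> A \<phi>) + F (z t) \<bullet> \<phi>) < e"
      proof (eventually_elim, intro ballI)
        fix n t assume a: "\<forall>x\<in>{0..T}. dist (y n x) (z x) < e / c" and t: "t \<in> {0..T}"
        let ?d = "norm (y n t - z t)"
        have "dist (- (y n t \<bullet> A \<phi>) + F (y n t) \<bullet> \<phi>) (- (z t \<bullet> A \<phi>) + F (z t) \<bullet> \<phi>)
          = \<bar>(F (y n t) - F (z t)) \<bullet> \<phi> - (y n t - z t) \<bullet> A \<phi>\<bar>"
          by (simp add: dist_real_def inner_diff_left algebra_simps)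
        also have "\<dots> \<le> \<bar>(F (y n t) - F (z t)) \<bullet> \<phi>\<bar> + \<bar>(y n t - z t) \<bullet> A \<phi>\<bar>" by (rule abs_triangle_ineq4)
        also have "\<dots> \<le> k * ?d * norm \<phi> + ?d * norm (A \<phi>)"
          by (intro add_mono order_trans[OF Cauchy_Schwarz_ineq2] mult_right_mono L t) auto
        also have "\<dots> \<le> ?d * c" by (simp add: c_def algebra_simps)
        also have "\<dots> < e" using a t c by (auto simp: dist_norm pos_less_divide_eq)
        finally show "dist (- (y n t \<bullet> A \<phi>) + F (y n t) \<bullet> \<phi>) (- (z t \<bullet> A \<phi>) + F (z t) \<bullet> \<phi>) < e" .
      qed
    qed
  qed
qed

text \<open>A solution that is Lipschitz from the right at \<open>t\<close> lies in the domain at time \<open>t\<close>.\<close>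

lemma D_if_lipschitz:
  assumes C0: "0 \<le> C"
    and C: "\<And>\<phi>. \<phi> \<in> D \<Longrightarrow> - (x \<bullet> A \<phi>) + f \<bullet> \<phi> \<le> C * norm \<phi>"
  shows "x \<in> D" "norm (A x + f) \<le> C"
proof -
  \<comment> \<open>The hypothesis is tested with \<open>J (- lam n)\<close> applied to
    \<open>Yos (lam n) x\<close>: by \<open>Yos_adjoint\<close> the A-term is then the squared norm
    of \<open>Yos (lam n) x\<close>.\<close>
  have "norm (Yos (lam n) x) \<le> C + norm f" for n
  proof (rule norm_le_if_inner_le)
    let ?\<psi> = "Yos (lam n) x"
    let ?\<phi> = "J (- lam n) ?\<psi>"
    have "?\<psi> \<bullet> ?\<psi> = - (x \<bullet> A ?\<phi>)"
      using Yos_adjoint[OF lam_nonzero, of n x ?\<psi>] by (simp add: Yos_def)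
    also have "\<dots> \<le> C * norm ?\<phi> - f \<bullet> ?\<phi>"
      using C[OF J_D, of "- lam n" ?\<psi>] by simp
    also have "\<dots> \<le> C * norm ?\<phi> + norm f * norm ?\<phi>"
      using Cauchy_Schwarz_ineq2[of f ?\<phi>] by linarith
    also have "\<dots> = (C + norm f) * norm ?\<phi>" by (simp add: algebra_simps)
    also have "\<dots> \<le> (C + norm f) * norm ?\<psi>"
      using norm_J[of "- lam n" ?\<psi>] C0 by (intro mult_left_mono) auto
    finally show "?\<psi> \<bullet> ?\<psi> \<le> (C + norm f) * norm ?\<psi>" .
    show "0 \<le> C + norm f" using C0 by simp
  qed
  then show x: "x \<in> D" by (rule D_if_Yos_bounded)
  show "norm (A x + f) \<le> C"
  proof (rule norm_le_if_inner_le[OF _ C0])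
    let ?z = "A x + f"
    \<comment> \<open>\<open>?z\<close> itself need not belong to the domain, so it is replaced by
      its resolvents, which do and which converge to it.\<close>
    have "?z \<bullet> J (lam n) ?z \<le> C * norm ?z" for n
    proof -
      have "?z \<bullet> J (lam n) ?z = - (x \<bullet> A (J (lam n) ?z)) + f \<bullet> J (lam n) ?z"
        using skew[OF x J_D[OF lam_nonzero], of n ?z] by (simp add: inner_add_left)
      also have "\<dots> \<le> C * norm (J (lam n) ?z)" by (rule C[OF J_D[OF lam_nonzero]])
      also have "\<dots> \<le> C * norm ?z" using norm_J[of "lam n" ?z] C0 by (intro mult_left_mono) auto
      finally show ?thesis .
    qed
    moreover have "(\<lambda>n. ?z \<bullet> J (lam n) ?z) \<longlonglongrightarrow> ?z \<bullet> ?z" by (intro tendsto_intros J_tendsto)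
    ultimately show "?z \<bullet> ?z \<le> C * norm ?z" by (intro LIMSEQ_le_const2) auto
  qed
qed

text \<open>A form of the Radon-Riesz property. Density of \<open>D\<close> and eventual boundedness
  extend the weak convergence to the test vector x, and |q - x|^2 \<le> c^2 + |x|^2 - 2 (q, x) then
  tends to 0.\<close>

lemma tendsto_if_weak_and_norm:
  assumes w: "\<And>\<phi>. \<phi> \<in> D \<Longrightarrow> ((\<lambda>h. q h \<bullet> \<phi>) \<longlongrightarrow> x \<bullet> \<phi>) F"
    and n: "\<forall>\<^sub>F h in F. norm (q h) \<le> c h" and c: "(c \<longlongrightarrow> norm x) F"
  shows "(q \<longlongrightarrow> x) F"
proof -
  have bd: "\<forall>\<^sub>F h in F. c h < norm x + 1" using c by (rule order_tendstoD) simp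
  have wx: "((\<lambda>h. q h \<bullet> x) \<longlongrightarrow> x \<bullet> x) F"
  proof (rule tendstoI)
    fix e :: real assume e: "0 < e"
    define b where "b = 2 * norm x + 2"
    have b: "0 < b" unfolding b_def by (simp add: add_nonneg_pos)
    obtain X where X: "\<And>n. X n \<in> D" "X \<longlonglongrightarrow> x" using D_dense by blast
    obtain m where m: "norm (X m - x) < e / (2 * b)"
      using LIMSEQ_D[OF X(2), of "e / (2 * b)"] e b by auto
    have "\<forall>\<^sub>F h in F. dist (q h \<bullet> X m) (x \<bullet> X m) < e / 2"
      using tendstoD[OF w[OF X(1)], of "e / 2"] e by simp
    with n bd show "\<forall>\<^sub>F h in F. dist (q h \<bullet> x) (x \<bullet> x) < e"
    proof eventually_elim
      case (elim h)
      have "q h \<bullet> x - x \<bullet> x = (q h \<bullet> X m - x \<bullet> X m) - (q h - x) \<bullet> (X m - x)"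
        by (simp add: inner_diff_left inner_diff_right)
      moreover have "\<bar>(q h - x) \<bullet> (X m - x)\<bar> \<le> b * (e / (2 * b))"
      proof (rule order_trans[OF Cauchy_Schwarz_ineq2 mult_mono])
        show "norm (q h - x) \<le> b" using elim norm_triangle_ineq4[of "q h" x] unfolding b_def by linarith
      qed (use m b in auto)
      moreover have "b * (e / (2 * b)) = e / 2" using b by simp
      ultimately show ?case using elim(3) unfolding dist_real_def by linarith
    qed
  qed
  have "((\<lambda>h. (norm (q h - x))\<^sup>2) \<longlongrightarrow> 0) F"
  proof (rule tendsto_sandwich[of "\<lambda>_. 0"])
    show "\<forall>\<^sub>F h in F. (norm (q h - x))\<^sup>2 \<le> (c h)\<^sup>2 + (norm x)\<^sup>2 - 2 * (q h \<bullet> x)"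
      using n
    proof eventually_elim
      case (elim h)
      then show ?case unfolding norm_diff_sq using power_mono[OF elim norm_ge_zero, of 2] by simp
    qed
    have "((\<lambda>h. (c h)\<^sup>2 + (norm x)\<^sup>2 - 2 * (q h \<bullet> x)) \<longlongrightarrow> (norm x)\<^sup>2 + (norm x)\<^sup>2 - 2 * (x \<bullet> x)) F"
      by (intro tendsto_intros c wx)
    then show "((\<lambda>h. (c h)\<^sup>2 + (norm x)\<^sup>2 - 2 * (q h \<bullet> x)) \<longlongrightarrow> 0) F"
      by (simp add: power2_norm_eq_inner)
  qed auto
  then have "((\<lambda>h. sqrt ((norm (q h - x))\<^sup>2)) \<longlongrightarrow> sqrt 0) F" by (rule tendsto_real_sqrt)
  then have "((\<lambda>h. norm (q h - x)) \<longlongrightarrow> 0) F" by simp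
  then show ?thesis by (rule Lim_null[THEN iffD2, OF tendsto_norm_zero_cancel])
qed

text \<open>After applying the resolvent, A contributes nothing to the derivative of the squared
  norm. The resolvent is removed in the integrated identity, where bounded pointwise convergence of
  the integrands is enough; continuity of F (y t) paired with y t then returns the derivative at
  every time.\<close>

lemma wsol_norm_sq_deriv:
  assumes y: "wsol F T y" and yc: "continuous_on {0..T} y" and Fc: "continuous_on {0..T} (\<lambda>t. F (y t))"
    and t: "t \<in> {0..T}"
  shows "((\<lambda>s. (norm (y s))\<^sup>2) has_real_derivative 2 * (F (y t) \<bullet> y t)) (at t within {0..T})"
proof -
  have "compact ((\<lambda>t. F (y t)) ` {0..T})" "compact (y ` {0..T})"
    using Fc yc by (auto intro: compact_continuous_image)
  then obtain B C where B: "\<And>t. t \<in> {0..T} \<Longrightarrow> norm (F (y t)) \<le> B" and C: "\<And>t. t \<in> {0..T} \<Longrightarrow> norm (y t) \<le> C"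
    by (metis bounded_iff compact_imp_bounded imageI)
  have BC: "0 \<le> B" "0 \<le> C" using B[OF t] C[OF t] norm_ge_zero order_trans by blast+
  let ?d = "\<lambda>n t. 2 * (J (lam n) (F (y t)) \<bullet> J (lam n) (y t))"
  have der: "((\<lambda>s. (norm (J (lam n) (y s)))\<^sup>2) has_real_derivative ?d n s) (at s within {0..T})"
    if s: "s \<in> {0..T}" for n s
  proof -
    have "((\<lambda>s. (norm (J (lam n) (y s)))\<^sup>2) has_real_derivative
        2 * ((Yos (lam n) (y s) + J (lam n) (F (y s))) \<bullet> J (lam n) (y s))) (at s within {0..T})"
    proof (rule weak_deriv_norm_sq[OF wsol_J_deriv[OF y lam_nonzero] _ s, where C = "2 / \<bar>lam n\<bar> * C + B"])
      fix t assume t: "t \<in> {0..T}"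
      show "norm (Yos (lam n) (y t) + J (lam n) (F (y t))) \<le> 2 / \<bar>lam n\<bar> * C + B"
        by (intro norm_triangle_mono order_trans[OF norm_Yos[OF lam_nonzero]] mult_left_mono C[OF t]
            order_trans[OF norm_J[OF lam_nonzero]] B[OF t]) simp
    qed
    moreover have "Yos (lam n) (y s) \<bullet> J (lam n) (y s) = 0"
      unfolding Yos_def by (rule skew_self[OF J_D[OF lam_nonzero]])
    ultimately show ?thesis by (simp add: inner_add_left)
  qed
  have int: "(norm (y s))\<^sup>2 = (norm (y 0))\<^sup>2 + integral {0..s} (\<lambda>t. 2 * (F (y t) \<bullet> y t))"
    if s: "s \<in> {0..T}" for s
  proof -
    have hi: "(?d n has_integral ((norm (J (lam n) (y s)))\<^sup>2 - (norm (J (lam n) (y 0)))\<^sup>2)) {0..s}" for n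
    proof (rule fundamental_theorem_of_calculus)
      show "0 \<le> s" using s by simp
      fix r assume "r \<in> {0..s}"
      then show "((\<lambda>s. (norm (J (lam n) (y s)))\<^sup>2) has_vector_derivative ?d n r) (at r within {0..s})"
        unfolding has_real_derivative_iff_has_vector_derivative[symmetric]
        using der[of r n] s by (auto intro: DERIV_subset)
    qed
    have l1: "(\<lambda>n. integral {0..s} (?d n)) \<longlonglongrightarrow> integral {0..s} (\<lambda>t. 2 * (F (y t) \<bullet> y t))"
    proof (rule dominated_convergence(2)[where h = "\<lambda>_. 2 * (B * C)"])
      show "?d n integrable_on {0..s}" for n using hi by blast
      fix r assume r: "r \<in> {0..s}"
      then have rT: "r \<in> {0..T}" using s by simp
      show "norm (?d n r) \<le> 2 * (B * C)" for n
      proof -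
        have "\<bar>J (lam n) (F (y r)) \<bullet> J (lam n) (y r)\<bar> \<le> B * C"
          by (rule order_trans[OF Cauchy_Schwarz_ineq2], intro mult_mono BC order_trans[OF norm_J[OF lam_nonzero]] B C rT) simp
        then show ?thesis by (simp add: abs_mult)
      qed
      show "(\<lambda>n. ?d n r) \<longlonglongrightarrow> 2 * (F (y r) \<bullet> y r)" by (intro tendsto_intros J_tendsto)
    qed (intro integrable_continuous_real continuous_on_const)
    have l2: "(\<lambda>n. integral {0..s} (?d n)) \<longlonglongrightarrow> (norm (y s))\<^sup>2 - (norm (y 0))\<^sup>2"
      unfolding integral_unique[OF hi] by (intro tendsto_intros J_tendsto)
    show ?thesis using LIMSEQ_unique[OF l1 l2] by linarith
  qed
  have "((\<lambda>s. (norm (y 0))\<^sup>2 + integral {0..s} (\<lambda>t. 2 * (F (y t) \<bullet> y t))) has_real_derivative 0 + 2 * (F (y t) \<bullet> y t)) (at t within {0..T})"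
    unfolding has_real_derivative_iff_has_vector_derivative
    by (intro has_vector_derivative_add has_vector_derivative_const integral_has_vector_derivative continuous_intros Fc yc t)
  then have "((\<lambda>s. (norm (y 0))\<^sup>2 + integral {0..s} (\<lambda>t. 2 * (F (y t) \<bullet> y t))) has_real_derivative 2 * (F (y t) \<bullet> y t)) (at t within {0..T})"
    by simp
  then show ?thesis
    by (rule has_field_derivative_transform_within[OF _ zero_less_one t]) (rule int[symmetric])
qed

end

section \<open>One-sided difference quotients\<close>

lemma right_quotient_tendsto:
  fixes f :: "real \<Rightarrow> real"
  assumes d: "(f has_real_derivative d) (at t within {0..T})" and t: "t \<in> {0..<T}"
  shows "((\<lambda>h. (f (t + h) - f t) / h) \<longlongrightarrow> d) (at_right 0)"
proof -
  have 1: "((\<lambda>y. (f y - f t) / (y - t)) \<longlongrightarrow> d) (at t within {0..T})"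
    using d by (simp add: has_field_derivative_iff)
  have 2: "filterlim (\<lambda>h. t + h) (at t within {0..T}) (at_right 0)"
    unfolding filterlim_at
  proof
    have "((\<lambda>h. t + h) \<longlongrightarrow> t + 0) (at_right 0)" by (intro tendsto_intros)
    then show "((\<lambda>h. t + h) \<longlongrightarrow> t) (at_right 0)" by simp
    have "\<forall>\<^sub>F h in at_right 0. h \<in> {0<..<T - t}"
      using eventually_at_right[of 0 "T - t"] t by (intro eventually_at_right_real) auto
    then show "\<forall>\<^sub>F h in at_right 0. t + h \<in> {0..T} \<and> t + h \<noteq> t"
      by eventually_elim (use t in auto)
  qed
  show ?thesis using filterlim_compose[OF 1 2] by simp
qed

text \<open>Turns an increment bound to the right of t into a bound on the weak derivative as a
  functional of \<psi>, the form from which \<open>D_if_lipschitz\<close> draws membership in the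
  domain. Letting c depend on h yields the sharp constant in the limit.\<close>

lemma deriv_le_lipschitz:
  fixes u :: "real \<Rightarrow> 'a::real_inner"
  assumes d: "((\<lambda>s. u s \<bullet> \<psi>) has_real_derivative d) (at t within {0..T})" and t: "t \<in> {0..<T}"
    and le: "\<forall>\<^sub>F h in at_right 0. norm (u (t + h) - u t) \<le> h * c h" and c: "(c \<longlongrightarrow> c0) (at_right 0)"
  shows "d \<le> c0 * norm \<psi>"
proof (rule tendsto_le[OF _ tendsto_mult[OF c tendsto_const] right_quotient_tendsto[OF d t]])
  have "\<forall>\<^sub>F h::real in at_right 0. 0 < h" by (simp add: eventually_at_filter)
  with le show "\<forall>\<^sub>F h in at_right 0. (u (t + h) \<bullet> \<psi> - u t \<bullet> \<psi>) / h \<le> c h * norm \<psi>"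
  proof eventually_elim
    case (elim h)
    have "u (t + h) \<bullet> \<psi> - u t \<bullet> \<psi> = (u (t + h) - u t) \<bullet> \<psi>" by (simp add: inner_diff_left)
    also have "\<dots> \<le> norm (u (t + h) - u t) * norm \<psi>" by (rule norm_cauchy_schwarz)
    also have "\<dots> \<le> h * c h * norm \<psi>" using elim by (intro mult_right_mono) auto
    finally show ?case using elim by (simp add: divide_le_eq mult.commute mult.left_commute)
  qed
qed simp

lemma norm_sq_has_real_derivative:
  fixes u :: "real \<Rightarrow> 'a::real_inner"
  assumes "(u has_vector_derivative u') (at t within S)"
  shows "((\<lambda>s. (norm (u s))\<^sup>2) has_real_derivative 2 * (u' \<bullet> u t)) (at t within S)"
  using bounded_bilinear.has_vector_derivative[OF bounded_bilinear_inner assms assms]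
  by (simp add: has_real_derivative_iff_has_vector_derivative power2_norm_eq_inner inner_commute[of "u t"])

lemma uniform_limit_lipschitz:
  assumes G: "K-lipschitz_on UNIV G" and u: "uniform_limit X u v F"
  shows "uniform_limit X (\<lambda>n x. G (u n x)) (\<lambda>x. G (v x)) F"
proof (rule uniform_limitI)
  fix e :: real assume e: "0 < e"
  have K: "0 \<le> K" by (rule lipschitz_on_nonneg[OF G])
  then have "0 < e / (K + 1)" using e by simp
  from uniform_limitD[OF u this] show "\<forall>\<^sub>F n in F. \<forall>x\<in>X. dist (G (u n x)) (G (v x)) < e"
  proof (eventually_elim, intro ballI)
    fix n x assume a: "\<forall>x\<in>X. dist (u n x) (v x) < e / (K + 1)" and x: "x \<in> X"
    have "dist (G (u n x)) (G (v x)) \<le> K * dist (u n x) (v x)" by (rule lipschitz_onD[OF G]) auto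
    also have "\<dots> \<le> (K + 1) * dist (u n x) (v x)" by (simp add: distrib_right)
    also have "\<dots> < e" using a x K by (simp add: pos_less_divide_eq mult.commute)
    finally show "dist (G (u n x)) (G (v x)) < e" .
  qed
qed

lemma uniformly_Cauchy_uniform_limit:
  fixes u :: "nat \<Rightarrow> 'b \<Rightarrow> 'a::banach"
  assumes "uniformly_Cauchy_on X u"
  shows "uniform_limit X u (\<lambda>x. lim (\<lambda>n. u n x)) sequentially"
  using assms uniformly_convergent_eq_Cauchy uniformly_convergent_uniform_limit_iff by blast

section \<open>Existence for initial values in the domain\<close>

context skew_adjoint
begin

text \<open>Let u n solve u' = Yos (lam n) u + G u. Comparing u n with its time translates bounds |u
  n'| by exp(K t) |u n'(0)|, and |Yos (lam n) y0| \<le> |A y0| makes this uniform in n: here y0 in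
  \<open>D\<close> is used. Hence Yos (lam n) (u n) is bounded, and skewness bounds |u n - u m|^2 by
  a multiple of lam n + lam m. The last conjunct keeps the initial rate |A y0 + G y0| without loss,
  which later gives right derivatives and right continuity.\<close>

lemma lipschitz_solution_D:
  assumes G: "K-lipschitz_on UNIV G" and y0: "y0 \<in> D"
  shows "\<exists>u. u 0 = y0 \<and> (\<forall>T. wsol G T u) \<and> (\<forall>T. continuous_on {0..T} u) \<and>
    (\<forall>h\<ge>0. norm (u h - y0) \<le> h * (exp (K * h) * norm (A y0 + G y0)))"
proof -
  have K: "0 \<le> K" by (rule lipschitz_on_nonneg[OF G])
  have GL: "norm (G x - G y) \<le> K * norm (x - y)" for x y
    using lipschitz_on_normD[OF G, of x y] by simp
  define B where "B n x = Yos (lam n) x + G x" for n x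
  have "\<exists>u. u 0 = y0 \<and> (\<forall>T. \<forall>t\<in>{0..T}. (u has_vector_derivative B n (u t)) (at t within {0..T}))" for n
  proof (rule lipschitz_ode_exists)
    show "(2 / \<bar>lam n\<bar> + K)-lipschitz_on UNIV (B n)"
    proof (rule lipschitz_onI)
      fix x y
      have "norm (Yos (lam n) (x - y)) \<le> 2 / \<bar>lam n\<bar> * norm (x - y)" by (rule norm_Yos) simp
      then have "norm (Yos (lam n) (x - y) + (G x - G y)) \<le> 2 / \<bar>lam n\<bar> * norm (x - y) + K * norm (x - y)"
        using GL by (rule norm_triangle_mono)
      then show "dist (B n x) (B n y) \<le> (2 / \<bar>lam n\<bar> + K) * dist x y"
        by (simp add: B_def dist_norm Yos_diff algebra_simps)
    qed (use K in simp)
  qed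
  then obtain u where u0: "\<And>n. u n 0 = y0"
    and ud: "\<And>n T t. t \<in> {0..T} \<Longrightarrow> (u n has_vector_derivative B n (u n t)) (at t within {0..T})"
    by metis
  have uc: "continuous_on {0..T} (u n)" for n T
    using ud has_vector_derivative_continuous by (metis continuous_on_eq_continuous_within)
  have uweak: "((\<lambda>s. u n s \<bullet> \<psi>) has_real_derivative B n (u n t) \<bullet> \<psi>) (at t within {0..T})"
    if "t \<in> {0..T}" for n t T \<psi>
    unfolding has_real_derivative_iff_has_vector_derivative
    by (rule bounded_linear.has_vector_derivative[OF bounded_linear_inner_left ud[OF that]])
  \<comment> \<open>The one-sided constant K does not depend on n, although the Lipschitz constant
    of \<open>B n\<close> grows like 2 / lam n.\<close>
  have Bdiss: "(B n x - B n y) \<bullet> (x - y) \<le> K * (norm (x - y))\<^sup>2" for n x y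
  proof -
    have "(B n x - B n y) \<bullet> (x - y) = Yos (lam n) (x - y) \<bullet> (x - y) + (G x - G y) \<bullet> (x - y)"
      by (simp add: B_def Yos_diff inner_diff_left inner_add_left)
    also have "\<dots> \<le> 0 + K * norm (x - y) * norm (x - y)"
      by (intro add_mono Yos_dissipative lam_pos order_trans[OF norm_cauchy_schwarz] mult_right_mono GL) simp
    finally show ?thesis by (simp add: power2_eq_square mult.assoc)
  qed
  \<comment> \<open>The equation is autonomous, so translates solve it too, and the one-sided
    estimate applies to their difference.\<close>
  have shift: "norm (u n (t + h) - u n t) \<le> exp (K * t) * norm (u n h - y0)" if t: "0 \<le> t" and h: "0 \<le> h" for n t h
  proof -
    let ?d = "\<lambda>s. u n (s + h) - u n s"
    have "(norm (?d t))\<^sup>2 \<le> ((norm (?d 0))\<^sup>2 + 0 * t) * exp (2 * K * t)"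
    proof (rule gronwall_deriv)
      show "t \<in> {0..t}" using t by simp
      fix s assume s: "s \<in> {0..t}"
      have im: "(\<lambda>s. s + h) ` {0..t} \<subseteq> {0..t + h}" using h by auto
      have "((u n \<circ> (\<lambda>s. s + h)) has_vector_derivative 1 *\<^sub>R B n (u n (s + h))) (at s within {0..t})"
      proof (rule vector_diff_chain_within)
        show "((\<lambda>s. s + h) has_vector_derivative 1) (at s within {0..t})"
          by (auto intro!: derivative_eq_intros)
        show "(u n has_vector_derivative B n (u n (s + h))) (at (s + h) within (\<lambda>s. s + h) ` {0..t})"
          by (rule has_vector_derivative_within_subset[OF ud im]) (use s h in auto)
      qed
      then have "(?d has_vector_derivative B n (u n (s + h)) - B n (u n s)) (at s within {0..t})"
        by (intro has_vector_derivative_diff ud s) (simp add: o_def)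
      then show "((\<lambda>s. (norm (?d s))\<^sup>2) has_real_derivative 2 * ((B n (u n (s + h)) - B n (u n s)) \<bullet> ?d s)) (at s within {0..t})"
        by (rule norm_sq_has_real_derivative)
      show "2 * ((B n (u n (s + h)) - B n (u n s)) \<bullet> ?d s) \<le> 2 * K * (norm (?d s))\<^sup>2 + 0"
        using Bdiss[of n "u n (s + h)" "u n s"] by simp
    qed (use K in auto)
    also have "\<dots> = (exp (K * t) * norm (u n h - y0))\<^sup>2"
      by (simp add: u0 power_mult_distrib power2_eq_square[of "exp _"] flip: exp_add)
    finally show ?thesis by (rule power2_le_imp_le) simp
  qed
  \<comment> \<open>The velocity at t is bounded through \<open>shift\<close> by increments at time
    0, whose rate is at most norm (B n y0) + e' for small h because \<open>B n\<close> is continuous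
    along u n.\<close>
  have Bbound: "norm (B n (u n t)) \<le> exp (K * t) * norm (B n y0)" if t: "0 \<le> t" for n t
  proof (rule field_le_epsilon)
    fix e :: real assume e: "0 < e"
    define e' where "e' = e / exp (K * t)"
    have e': "0 < e'" using e by (simp add: e'_def)
    have Bc: "continuous_on {0..1} (\<lambda>s. norm (B n (u n s)))"
    proof -
      have "continuous_on UNIV (B n)"
      proof (rule lipschitz_on_continuous_on[where L = "2 / \<bar>lam n\<bar> + K"], rule lipschitz_onI)
        fix x y
        have "norm (Yos (lam n) (x - y)) \<le> 2 / \<bar>lam n\<bar> * norm (x - y)" by (rule norm_Yos) simp
        then have "norm (Yos (lam n) (x - y) + (G x - G y)) \<le> 2 / \<bar>lam n\<bar> * norm (x - y) + K * norm (x - y)"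
          using GL by (rule norm_triangle_mono)
        then show "dist (B n x) (B n y) \<le> (2 / \<bar>lam n\<bar> + K) * dist x y"
          by (simp add: B_def dist_norm Yos_diff algebra_simps)
      qed (use K in simp)
      then show ?thesis by (intro continuous_on_norm continuous_on_compose2[OF _ uc]) auto
    qed
    then obtain d where d: "0 < d" "\<And>s. s \<in> {0..1} \<Longrightarrow> dist s 0 < d \<Longrightarrow> dist (norm (B n (u n s))) (norm (B n (u n 0))) < e'"
      unfolding continuous_on_iff using e' by (metis atLeastAtMost_iff order_refl zero_le_one)
    have near: "norm (u n h - y0) \<le> (norm (B n y0) + e') * h" if h: "0 < h" "h < min 1 d" for h
    proof -
      have "norm (u n h - u n 0) \<le> (norm (B n y0) + e') * \<bar>h - 0\<bar>"
      proof (rule weak_deriv_lipschitz[OF uweak])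
        fix s assume s: "s \<in> {0..h}"
        then have "\<bar>norm (B n (u n s)) - norm (B n (u n 0))\<bar> < e'" using d(2)[of s] h by (auto simp: dist_real_def)
        then show "norm (B n (u n s)) \<le> norm (B n y0) + e'" unfolding u0 by linarith
      qed (use h in auto)
      then show ?thesis using h by (simp add: u0)
    qed
    have "B n (u n t) \<bullet> B n (u n t) \<le> (exp (K * t) * (norm (B n y0) + e')) * norm (B n (u n t))"
    proof (rule deriv_le_lipschitz[OF uweak _ _ tendsto_const])
      show "t \<in> {0..t + 1}" "t \<in> {0..<t + 1}" using t by auto
      have "\<forall>\<^sub>F h in at_right 0. h \<in> {0<..<min 1 d}"
        using d by (intro eventually_at_right_real) auto
      then show "\<forall>\<^sub>F h in at_right 0. norm (u n (t + h) - u n t) \<le> h * (exp (K * t) * (norm (B n y0) + e'))"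
      proof eventually_elim
        case (elim h)
        then have "norm (u n (t + h) - u n t) \<le> exp (K * t) * norm (u n h - y0)" by (intro shift t) auto
        also have "\<dots> \<le> exp (K * t) * ((norm (B n y0) + e') * h)" using elim by (intro mult_left_mono near) auto
        finally show ?case by (simp add: mult_ac)
      qed
    qed
    then have "norm (B n (u n t)) \<le> exp (K * t) * (norm (B n y0) + e')"
      by (rule norm_le_if_inner_le) (use e' in auto)
    also have "\<dots> = exp (K * t) * norm (B n y0) + e" by (simp add: e'_def distrib_left)
    finally show "norm (B n (u n t)) \<le> exp (K * t) * norm (B n y0) + e" .
  qed
  define N where "N = norm (A y0) + norm (G y0)"
  have N0: "0 \<le> N" by (simp add: N_def)
  have BN: "norm (B n y0) \<le> N" for n
    unfolding B_def N_def by (intro norm_triangle_mono norm_Yos_le y0) auto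
  have Blim: "(\<lambda>n. norm (B n y0)) \<longlonglongrightarrow> norm (A y0 + G y0)"
    unfolding B_def Yos_commute[OF y0 lam_nonzero] by (intro tendsto_intros J_tendsto)
  have ulip: "norm (u n h - y0) \<le> h * (exp (K * h) * norm (B n y0))" if h: "0 \<le> h" for n h
  proof -
    have "norm (u n h - u n 0) \<le> (exp (K * h) * norm (B n y0)) * \<bar>h - 0\<bar>"
    proof (rule weak_deriv_lipschitz[OF uweak])
      fix s assume s: "s \<in> {0..h}"
      then have "norm (B n (u n s)) \<le> exp (K * s) * norm (B n y0)" by (intro Bbound) auto
      also have "\<dots> \<le> exp (K * h) * norm (B n y0)" using s K by (intro mult_right_mono) (auto intro: mult_left_mono)
      finally show "norm (B n (u n s)) \<le> exp (K * h) * norm (B n y0)" .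
    qed (use h in auto)
    then show ?thesis using h by (simp add: u0 mult_ac)
  qed
  \<comment> \<open>A bound for Yos (u n t) = u n' - G (u n): the first summand controls the
    velocity, the rest controls G at distance at most T exp(K T) N from y0.\<close>
  define M where "M T = exp (K * T) * N + (norm (G y0) + K * (T * (exp (K * T) * N)))" for T
  have YM: "norm (Yos (lam n) (u n t)) \<le> M T" if t: "t \<in> {0..T}" for n t T
  proof -
    have e: "exp (K * t) * norm (B n y0) \<le> exp (K * T) * N"
      using t K by (intro mult_mono BN) (auto intro: mult_left_mono)
    have "norm (G (u n t)) \<le> norm (G y0) + norm (G (u n t) - G y0)"
      using norm_triangle_ineq[of "G y0" "G (u n t) - G y0"] by simp
    also have "\<dots> \<le> norm (G y0) + K * (T * (exp (K * T) * N))"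
    proof -
      have "norm (u n t - y0) \<le> T * (exp (K * T) * N)"
        using t N0 by (intro order_trans[OF ulip mult_mono] e) auto
      then show ?thesis using GL[of "u n t" y0] K by (meson add_left_mono mult_left_mono order_trans)
    qed
    finally have g: "norm (G (u n t)) \<le> norm (G y0) + K * (T * (exp (K * T) * N))" .
    have "Yos (lam n) (u n t) = B n (u n t) - G (u n t)" by (simp add: B_def)
    also have "norm \<dots> \<le> norm (B n (u n t)) + norm (G (u n t))" by (rule norm_triangle_ineq4)
    also have "\<dots> \<le> M T" unfolding M_def using t
      by (intro add_mono order_trans[OF Bbound e] g) auto
    finally show ?thesis .
  qed
  have M0: "0 \<le> M T" if "0 \<le> T" for T unfolding M_def using that N0 K by auto
  have cauchy: "(norm (u n t - u m t))\<^sup>2 \<le> (4 * (M T)\<^sup>2 * T * exp (2 * K * T)) * (lam n + lam m)" if t: "t \<in> {0..T}" for n m t T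
  proof -
    let ?c = "4 * (M T)\<^sup>2 * (lam n + lam m)"
    have c0: "0 \<le> ?c" by (intro mult_nonneg_nonneg add_nonneg_nonneg) (auto simp: less_imp_le)
    have "(norm (u n t - u m t))\<^sup>2 \<le> ((norm (u n 0 - u m 0))\<^sup>2 + ?c * t) * exp (2 * K * t)"
    proof (rule gronwall_deriv[OF t])
      fix s assume s: "s \<in> {0..T}"
      show "((\<lambda>s. (norm (u n s - u m s))\<^sup>2) has_real_derivative 2 * ((B n (u n s) - B m (u m s)) \<bullet> (u n s - u m s))) (at s within {0..T})"
        by (intro norm_sq_has_real_derivative has_vector_derivative_diff ud s)
      let ?a = "Yos (lam n) (u n s)" and ?b = "Yos (lam m) (u m s)"
      have T0: "0 \<le> T" using s by simp
      \<comment> \<open>Skewness at the difference of the resolvents, not of the solutions;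
        replacing u by J u leaves only terms with a factor lam n or lam m.\<close>
      have "(?a - ?b) \<bullet> (J (lam n) (u n s) - J (lam m) (u m s)) = 0"
        using skew_self[OF D_diff[OF J_D[OF lam_nonzero] J_D[OF lam_nonzero]], of n "u n s" m "u m s"]
        by (simp add: Yos_def A_diff J_D)
      then have "(?a - ?b) \<bullet> (u n s - u m s) = - ((?a - ?b) \<bullet> (lam n *\<^sub>R ?a - lam m *\<^sub>R ?b))"
        unfolding J_Yos[OF lam_nonzero] by (simp add: inner_diff_left inner_diff_right inner_add_right algebra_simps)
      also have "\<dots> \<le> norm (?a - ?b) * norm (lam n *\<^sub>R ?a - lam m *\<^sub>R ?b)"
        using Cauchy_Schwarz_ineq2[of "?a - ?b" "lam n *\<^sub>R ?a - lam m *\<^sub>R ?b"] by linarith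
      also have "\<dots> \<le> (M T + M T) * (lam n * M T + lam m * M T)"
      proof (rule mult_mono)
        show "norm (?a - ?b) \<le> M T + M T"
          by (rule order_trans[OF norm_triangle_ineq4 add_mono[OF YM[OF s] YM[OF s]]])
        have "norm (lam n *\<^sub>R ?a) \<le> lam n * M T" "norm (lam m *\<^sub>R ?b) \<le> lam m * M T"
          using YM[OF s, of n] YM[OF s, of m] lam_pos[of n] lam_pos[of m] by (simp_all add: abs_of_pos)
        then show "norm (lam n *\<^sub>R ?a - lam m *\<^sub>R ?b) \<le> lam n * M T + lam m * M T"
          using norm_triangle_ineq4[of "lam n *\<^sub>R ?a" "lam m *\<^sub>R ?b"] by linarith
      qed (use M0[OF T0] in auto)
      also have "\<dots> = ?c / 2" by (simp add: power2_eq_square algebra_simps)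
      finally have 1: "(?a - ?b) \<bullet> (u n s - u m s) \<le> ?c / 2" .
      have 2: "(G (u n s) - G (u m s)) \<bullet> (u n s - u m s) \<le> K * (norm (u n s - u m s))\<^sup>2"
        using order_trans[OF norm_cauchy_schwarz mult_right_mono[OF GL norm_ge_zero], of "u n s" "u m s" "u n s - u m s"]
        by (simp add: power2_eq_square mult.assoc)
      have "(B n (u n s) - B m (u m s)) \<bullet> (u n s - u m s) = (?a - ?b) \<bullet> (u n s - u m s) + (G (u n s) - G (u m s)) \<bullet> (u n s - u m s)"
        by (simp add: B_def inner_diff_left inner_add_left)
      then show "2 * ((B n (u n s) - B m (u m s)) \<bullet> (u n s - u m s)) \<le> 2 * K * (norm (u n s - u m s))\<^sup>2 + ?c"
        using 1 2 by linarith
    qed (use c0 K in auto)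
    also have "\<dots> = ?c * t * exp (2 * K * t)" by (simp add: u0)
    also have "\<dots> \<le> ?c * T * exp (2 * K * T)"
      using t c0 K by (intro mult_mono mult_left_mono) (auto intro: mult_left_mono)
    finally show ?thesis by (simp add: mult_ac)
  qed
  define v where "v t = lim (\<lambda>n. u n t)" for t
  have ul: "uniform_limit {0..T} u v sequentially" for T
    unfolding v_def
  proof (rule uniformly_Cauchy_uniform_limit, rule uniformly_Cauchy_onI)
    fix e :: real assume e: "0 < e"
    define c where "c = 4 * (M T)\<^sup>2 * \<bar>T\<bar> * exp (2 * K * T)"
    have c: "0 \<le> c" unfolding c_def by auto
    have "0 < e\<^sup>2 / (2 * c + 1)" using e c by auto
    then obtain N where N: "\<And>n. n \<ge> N \<Longrightarrow> \<bar>lam n\<bar> < e\<^sup>2 / (2 * c + 1)"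
      using LIMSEQ_D[OF lambda_tendsto] by (metis diff_zero real_norm_def)
    show "\<exists>M. \<forall>t\<in>{0..T}. \<forall>m\<ge>M. \<forall>n\<ge>M. dist (u m t) (u n t) < e"
    proof (intro exI[of _ N] ballI allI impI)
      fix t m n assume t: "t \<in> {0..T}" and mn: "N \<le> m" "N \<le> n"
      have "(norm (u m t - u n t))\<^sup>2 \<le> c * (lam m + lam n)" using cauchy[OF t, of m n] t by (simp add: c_def)
      also have "\<dots> \<le> c * (2 * (e\<^sup>2 / (2 * c + 1)))" using N[OF mn(1)] N[OF mn(2)] c by (intro mult_left_mono) auto
      also have "\<dots> < e\<^sup>2" using c e by (simp add: divide_simps) 
      finally show "dist (u m t) (u n t) < e" using e by (simp add: dist_norm power2_less_imp_less)
    qed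
  qed
  have lim: "(\<lambda>n. u n t) \<longlonglongrightarrow> v t" if "0 \<le> t" for t
    using tendsto_uniform_limitI[OF ul[of t], of t] that by simp
  have vc: "continuous_on {0..T} v" for T
    by (rule uniform_limit_theorem[OF _ ul]) (auto simp: uc)
  show ?thesis
  proof (intro exI[of _ v] conjI allI impI)
    show "v 0 = y0" using lim[of 0] unfolding u0 by (simp add: LIMSEQ_const_iff)
    show "continuous_on {0..T} v" for T by (rule vc)
    show "norm (v h - y0) \<le> h * (exp (K * h) * norm (A y0 + G y0))" if h: "0 \<le> h" for h
    proof (rule LIMSEQ_le)
      show "(\<lambda>n. norm (u n h - y0)) \<longlonglongrightarrow> norm (v h - y0)" by (intro tendsto_intros lim h)
      show "(\<lambda>n. h * (exp (K * h) * norm (B n y0))) \<longlonglongrightarrow> h * (exp (K * h) * norm (A y0 + G y0))"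
        by (intro tendsto_intros Blim)
    qed (use ulip[OF h] in auto)
    fix T
    \<comment> \<open>In the weak form of the approximate equation A \<phi> is paired with J (lam n)
      (u n), so it is this sequence whose uniform limit is needed.\<close>
    have wl: "uniform_limit {0..T} (\<lambda>n t. J (lam n) (u n t)) v sequentially"
    proof -
      have "uniform_limit {0..T} (\<lambda>n t. lam n *\<^sub>R Yos (lam n) (u n t)) (\<lambda>_. 0) sequentially"
      proof (rule uniform_limitI)
        fix e :: real assume e: "0 < e"
        define c where "c = \<bar>M T\<bar> + 1"
        have c: "0 < c" by (simp add: c_def)
        then have "\<forall>\<^sub>F n in sequentially. lam n < e / c" using e by (intro order_tendstoD[OF lambda_tendsto]) simp
        then show "\<forall>\<^sub>F n in sequentially. \<forall>t\<in>{0..T}. dist (lam n *\<^sub>R Yos (lam n) (u n t)) 0 < e"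
        proof (eventually_elim, intro ballI)
          fix n t assume n: "lam n < e / c" and t: "t \<in> {0..T}"
          have "norm (Yos (lam n) (u n t)) \<le> c" using YM[OF t, of n] by (simp add: c_def)
          then have "norm (lam n *\<^sub>R Yos (lam n) (u n t)) \<le> lam n * c" by (simp add: abs_of_pos)
          also have "\<dots> < e" using n c by (simp add: pos_less_divide_eq)
          finally show "dist (lam n *\<^sub>R Yos (lam n) (u n t)) 0 < e" by simp
        qed
      qed
      from uniform_limit_add[OF ul[of T] this] show ?thesis by (simp add: J_Yos)
    qed
    show "wsol G T v"
      unfolding wsol_def
    proof (intro conjI ballI)
      show "bounded (v ` {0..T})" by (intro compact_imp_bounded compact_continuous_image vc) simp
      fix \<phi> t assume \<phi>: "\<phi> \<in> D" and t: "t \<in> {0..T}"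
      show "((\<lambda>s. v s \<bullet> \<phi>) has_real_derivative - (v t \<bullet> A \<phi>) + G (v t) \<bullet> \<phi>) (at t within {0..T})"
      proof (rule limit_has_real_derivative[OF uweak _ _ t])
        show "(\<lambda>n. u n s \<bullet> \<phi>) \<longlonglongrightarrow> v s \<bullet> \<phi>" if "s \<in> {0..T}" for s
          using that by (intro tendsto_intros lim) auto
        have "B n (u n t) \<bullet> \<phi> = - (J (lam n) (u n t) \<bullet> A \<phi>) + G (u n t) \<bullet> \<phi>" for n t
          using skew[OF J_D[OF lam_nonzero] \<phi>, of n "u n t"] by (simp add: B_def Yos_def inner_add_left)
        moreover have "uniform_limit {0..T} (\<lambda>n t. - (J (lam n) (u n t) \<bullet> A \<phi>) + G (u n t) \<bullet> \<phi>)
            (\<lambda>t. - (v t \<bullet> A \<phi>) + G (v t) \<bullet> \<phi>) sequentially"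
          by (intro uniform_limit_add uniform_limit_uminus bounded_linear.uniform_limit[OF bounded_linear_inner_left]
              wl uniform_limit_lipschitz[OF G ul])
        ultimately show "uniform_limit {0..T} (\<lambda>n t. B n (u n t) \<bullet> \<phi>) (\<lambda>t. - (v t \<bullet> A \<phi>) + G (v t) \<bullet> \<phi>) sequentially"
          by simp
      qed
    qed
  qed
qed

end

section \<open>Locally Lipschitz perturbations\<close>

definition radial :: "real \<Rightarrow> 'a::real_normed_vector \<Rightarrow> 'a"
  where "radial R x = (if norm x \<le> R then x else (R / norm x) *\<^sub>R x)"

lemma radial_id: "norm x \<le> R \<Longrightarrow> radial R x = x"
  by (simp add: radial_def)

lemma norm_radial: "0 \<le> R \<Longrightarrow> norm (radial R x) \<le> R"
  by (simp add: radial_def)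

text \<open>One factor accounts for the increment of the point and the other for the change of the
  scaling factor, so the argument holds in every normed space.\<close>

lemma radial_lipschitz:
  assumes R: "0 < R" shows "norm (radial R x - radial R y) \<le> 2 * norm (x - y)"
proof -
  define s where "s x = (if norm x \<le> R then 1 else R / norm x)" for x :: 'a
  have rs: "radial R x = s x *\<^sub>R x" for x by (simp add: radial_def s_def)
  have s01: "0 \<le> s x" "s x \<le> 1" for x using R by (auto simp: s_def divide_le_eq)
  have tri: "\<bar>norm x - norm y\<bar> \<le> norm (x - y)" by (rule norm_triangle_ineq3)
  have "\<bar>s x - s y\<bar> * norm y \<le> \<bar>norm x - norm y\<bar>"
  proof (cases "norm x \<le> R"; cases "norm y \<le> R")
    assume a: "norm x \<le> R" "\<not> norm y \<le> R"
    then have "0 < norm y" using R by linarith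
    then have "(1 - R / norm y) * norm y = norm y - R" by (simp add: field_simps)
    moreover have "0 \<le> 1 - R / norm y" using a \<open>0 < norm y\<close> by simp
    ultimately show ?thesis using a by (simp add: s_def)
  next
    assume a: "\<not> norm x \<le> R" "norm y \<le> R"
    then have x: "0 < norm x" using R by linarith
    have "(1 - R / norm x) * norm y \<le> (1 - R / norm x) * R" using a x by (intro mult_left_mono) auto
    also have "\<dots> = (norm x - R) * (R / norm x)" using x by (simp add: field_simps)
    also have "\<dots> \<le> (norm x - R) * 1" using a x by (intro mult_left_mono) auto
    also have "\<dots> \<le> norm x - norm y" using a by simp
    finally have "(1 - R / norm x) * norm y \<le> norm x - norm y" .
    moreover have "0 \<le> 1 - R / norm x" using a x by simp
    ultimately show ?thesis using a by (simp add: s_def abs_minus_commute)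
  next
    assume a: "\<not> norm x \<le> R" "\<not> norm y \<le> R"
    then have xy: "0 < norm x" "0 < norm y" using R by linarith+
    have "(R / norm x - R / norm y) * norm y = (norm y - norm x) * (R / norm x)"
      using xy by (simp add: field_simps)
    then have "\<bar>R / norm x - R / norm y\<bar> * norm y = \<bar>norm y - norm x\<bar> * (R / norm x)"
      using xy R by (metis abs_mult abs_of_nonneg abs_of_pos divide_pos_pos)
    also have "\<dots> \<le> \<bar>norm y - norm x\<bar> * 1" using a xy by (intro mult_left_mono) auto
    finally show ?thesis using a by (simp add: s_def abs_minus_commute)
  qed (simp add: s_def)
  moreover have "radial R x - radial R y = s x *\<^sub>R (x - y) + (s x - s y) *\<^sub>R y"
    by (simp add: rs algebra_simps)
  moreover have "norm (s x *\<^sub>R (x - y) + (s x - s y) *\<^sub>R y) \<le> s x * norm (x - y) + \<bar>s x - s y\<bar> * norm y"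
    using norm_triangle_ineq[of "s x *\<^sub>R (x - y)" "(s x - s y) *\<^sub>R y"] s01[of x] by simp
  moreover have "s x * norm (x - y) \<le> 1 * norm (x - y)" by (intro mult_right_mono s01) simp
  ultimately show ?thesis using tri by simp
qed

lemma lipschitz_radial:
  assumes R: "0 < R" and F: "K-lipschitz_on (cball 0 R) F"
  shows "(K * 2)-lipschitz_on UNIV (\<lambda>x. F (radial R x))"
proof (rule lipschitz_onI)
  have K: "0 \<le> K" by (rule lipschitz_on_nonneg[OF F])
  then show "0 \<le> K * 2" by simp
  fix x y
  have "dist (F (radial R x)) (F (radial R y)) \<le> K * dist (radial R x) (radial R y)"
    using norm_radial[of R] R by (intro lipschitz_onD[OF F]) auto
  also have "\<dots> \<le> K * (2 * dist x y)"
    unfolding dist_norm by (intro mult_left_mono radial_lipschitz R K)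
  finally show "dist (F (radial R x)) (F (radial R y)) \<le> K * 2 * dist x y" by simp
qed

lemma continuous_if_lipschitz_on_balls:
  fixes F :: "'a::real_normed_vector \<Rightarrow> 'b::metric_space"
  assumes "\<And>R. \<exists>K. K-lipschitz_on (cball 0 R) F"
  shows "continuous_on UNIV F"
proof (rule continuous_at_imp_continuous_on, rule ballI)
  fix x :: 'a
  obtain K where K: "K-lipschitz_on (cball 0 (norm x + 1)) F" using assms by blast
  have "continuous_on (ball 0 (norm x + 1)) F"
    by (rule continuous_on_subset[OF lipschitz_on_continuous_on[OF K] ball_subset_cball])
  then show "isCont F x" by (simp add: continuous_on_eq_continuous_at)
qed

section \<open>Globally Lipschitz perturbations: existence and regularity\<close>

context skew_adjoint
begin

lemma lipschitz_compare:
  assumes G: "K-lipschitz_on UNIV G" and "wsol G T y" "wsol G T z" "t \<in> {0..T}"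
  shows "norm (y t - z t) \<le> exp (K * t) * norm (y 0 - z 0)"
  by (rule wsol_compare[OF assms(2,3) lipschitz_on_nonneg[OF G] _ assms(4)])
    (rule lipschitz_on_normD[OF G], auto)

text \<open>Approximating initial values in \<open>D\<close> give solutions that are uniformly
  Cauchy on [0, T] by comparison. The limit is taken pointwise in time, so that one curve serves all
  T.\<close>

lemma lipschitz_solution:
  assumes G: "K-lipschitz_on UNIV G"
  shows "\<exists>u. u 0 = y0 \<and> (\<forall>T. wsol G T u) \<and> (\<forall>T. continuous_on {0..T} u)"
proof -
  have K: "0 \<le> K" by (rule lipschitz_on_nonneg[OF G])
  obtain Y where Y: "\<And>n. Y n \<in> D" "Y \<longlonglongrightarrow> y0" using D_dense by blast
  have "\<exists>u. u 0 = Y n \<and> (\<forall>T. wsol G T u) \<and> (\<forall>T. continuous_on {0..T} u)" for n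
    using lipschitz_solution_D[OF G Y(1)[of n]] by blast
  then obtain u where u0: "\<And>n. u n 0 = Y n" and uw: "\<And>n T. wsol G T (u n)"
    and uc: "\<And>n T. continuous_on {0..T} (u n)" by metis
  define v where "v t = lim (\<lambda>n. u n t)" for t
  have ul: "uniform_limit {0..T} u v sequentially" for T
    unfolding v_def
  proof (rule uniformly_Cauchy_uniform_limit, rule uniformly_Cauchy_onI)
    fix e :: real assume e: "0 < e"
    then have "0 < e / exp (K * \<bar>T\<bar>)" by simp
    moreover have "Cauchy Y" using Y(2) by (rule LIMSEQ_imp_Cauchy)
    ultimately obtain N where N: "\<And>m n. N \<le> m \<Longrightarrow> N \<le> n \<Longrightarrow> dist (Y m) (Y n) < e / exp (K * \<bar>T\<bar>)"
      using metric_CauchyD by blast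
    show "\<exists>M. \<forall>t\<in>{0..T}. \<forall>m\<ge>M. \<forall>n\<ge>M. dist (u m t) (u n t) < e"
    proof (intro exI[of _ N] ballI allI impI)
      fix t m n assume t: "t \<in> {0..T}" and mn: "N \<le> m" "N \<le> n"
      have "norm (u m t - u n t) \<le> exp (K * t) * norm (u m 0 - u n 0)"
        by (rule lipschitz_compare[OF G uw uw t])
      also have "\<dots> \<le> exp (K * \<bar>T\<bar>) * norm (Y m - Y n)"
        unfolding u0 using t K by (intro mult_right_mono) (auto intro: mult_left_mono)
      also have "\<dots> < e" using N[OF mn] by (simp add: dist_norm pos_less_divide_eq mult.commute)
      finally show "dist (u m t) (u n t) < e" by (simp add: dist_norm)
    qed
  qed
  show ?thesis
  proof (intro exI[of _ v] conjI allI)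
    have "(\<lambda>n. u n 0) \<longlonglongrightarrow> v 0" using tendsto_uniform_limitI[OF ul[of 0], of 0] by simp
    then show "v 0 = y0" unfolding u0 by (rule LIMSEQ_unique[OF _ Y(2)])
    show "continuous_on {0..T} v" for T by (rule uniform_limit_theorem[OF _ ul]) (auto simp: uc)
    show "wsol G T v" for T
      by (rule wsol_limit[OF uw ul lipschitz_on_normD[OF G] K]) auto
  qed
qed

text \<open>By uniqueness u is the solution constructed from Yosida approximations, which carries
  this estimate.\<close>

lemma lipschitz_solution_near_0:
  assumes G: "K-lipschitz_on UNIV G" and u: "wsol G T u" and u0: "u 0 \<in> D" and h: "h \<in> {0..T}"
  shows "norm (u h - u 0) \<le> h * (exp (K * h) * norm (A (u 0) + G (u 0)))"
proof -
  obtain v where v: "v 0 = u 0" "wsol G T v"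
    "\<And>h. h \<ge> 0 \<Longrightarrow> norm (v h - u 0) \<le> h * (exp (K * h) * norm (A (u 0) + G (u 0)))"
    using lipschitz_solution_D[OF G u0] by blast
  have "norm (u h - v h) \<le> exp (K * h) * norm (u 0 - v 0)" by (rule lipschitz_compare[OF G u v(2) h])
  then have "u h = v h" using v(1) by simp
  then show ?thesis using v(3)[of h] h by simp
qed

text \<open>Comparing u with its translate bounds the increment from t to t + h by exp(K t) times
  the increment from 0 to h. The weak right derivative at t is therefore a bounded functional on
  \<open>D\<close>, which puts u t into \<open>D\<close>. Time T is excluded because room to the
  right is needed.\<close>

lemma lipschitz_solution_regular:
  assumes G: "K-lipschitz_on UNIV G" and u: "wsol G T u" and u0: "u 0 \<in> D" and t: "t \<in> {0..<T}"
  shows "u t \<in> D" "norm (A (u t) + G (u t)) \<le> exp (K * t) * norm (A (u 0) + G (u 0))"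
proof -
  let ?N = "norm (A (u 0) + G (u 0))"
  have ev: "\<forall>\<^sub>F h in at_right 0. norm (u (t + h) - u t) \<le> h * (exp (K * t) * (exp (K * h) * ?N))"
  proof -
    have "\<forall>\<^sub>F h in at_right 0. h \<in> {0<..<T - t}" using t by (intro eventually_at_right_real) auto
    then show ?thesis
    proof eventually_elim
      case (elim h)
      have "wsol G (T - h) (\<lambda>s. u (s + h))" using elim t by (intro wsol_shift[OF u]) auto
      moreover have "wsol G (T - h) u" using elim by (intro wsol_subset[OF u]) auto
      ultimately have "norm (u (t + h) - u t) \<le> exp (K * t) * norm (u (0 + h) - u 0)"
        using elim t by (intro lipschitz_compare[OF G]) auto
      also have "\<dots> \<le> exp (K * t) * (h * (exp (K * h) * ?N))"
        using lipschitz_solution_near_0[OF G u u0, of h] elim t by (intro mult_left_mono) auto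
      finally show ?case by (simp add: mult_ac)
    qed
  qed
  have lim: "((\<lambda>h. exp (K * t) * (exp (K * h) * ?N)) \<longlongrightarrow> exp (K * t) * (exp (K * 0) * ?N)) (at_right 0)"
    by (intro tendsto_intros)
  have le: "- (u t \<bullet> A \<phi>) + G (u t) \<bullet> \<phi> \<le> exp (K * t) * (exp (K * 0) * ?N) * norm \<phi>" if "\<phi> \<in> D" for \<phi>
    by (rule deriv_le_lipschitz[OF wsol_deriv[OF u that] t ev lim]) (use t in auto)
  show "u t \<in> D" "norm (A (u t) + G (u t)) \<le> exp (K * t) * norm (A (u 0) + G (u 0))"
    using D_if_lipschitz[OF _ le] by auto
qed

text \<open>The weak equation identifies the limit of the quotients on \<open>D\<close>, and the
  estimate near 0 keeps their norms below exp(K h) times the norm of that limit; together this is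
  strong convergence.\<close>

lemma lipschitz_solution_right_deriv:
  assumes G: "K-lipschitz_on UNIV G" and u: "wsol G T u" and u0: "u 0 \<in> D" and T: "0 < T"
  shows "((\<lambda>h. (1 / h) *\<^sub>R (u h - u 0)) \<longlongrightarrow> A (u 0) + G (u 0)) (at_right 0)"
proof (rule tendsto_if_weak_and_norm)
  let ?N = "norm (A (u 0) + G (u 0))"
  have "\<forall>\<^sub>F h in at_right 0. h \<in> {0<..<T}" using T by (rule eventually_at_right_real)
  then show "\<forall>\<^sub>F h in at_right 0. norm ((1 / h) *\<^sub>R (u h - u 0)) \<le> exp (K * h) * ?N"
  proof eventually_elim
    case (elim h)
    then show ?case using lipschitz_solution_near_0[OF G u u0, of h]
      by (simp add: pos_divide_le_eq mult.commute)
  qed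
  have "((\<lambda>h. exp (K * h) * ?N) \<longlongrightarrow> exp (K * 0) * ?N) (at_right 0)" by (intro tendsto_intros)
  then show "((\<lambda>h. exp (K * h) * ?N) \<longlongrightarrow> ?N) (at_right 0)" by simp
  fix \<phi> assume \<phi>: "\<phi> \<in> D"
  have "((\<lambda>s. u s \<bullet> \<phi>) has_real_derivative - (u 0 \<bullet> A \<phi>) + G (u 0) \<bullet> \<phi>) (at 0 within {0..T})"
    by (rule wsol_deriv[OF u \<phi>]) (use T in auto)
  from right_quotient_tendsto[OF this] T
  have "((\<lambda>h. (u h \<bullet> \<phi> - u 0 \<bullet> \<phi>) / h) \<longlongrightarrow> - (u 0 \<bullet> A \<phi>) + G (u 0) \<bullet> \<phi>) (at_right 0)" by simp
  then show "((\<lambda>h. (1 / h) *\<^sub>R (u h - u 0) \<bullet> \<phi>) \<longlongrightarrow> (A (u 0) + G (u 0)) \<bullet> \<phi>) (at_right 0)"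
    using skew[OF u0 \<phi>] by (simp add: inner_diff_left inner_add_left)
qed

text \<open>The norm of A u + G u grows at most by the factor exp(K h), which tends to 1, and weak
  right continuity on \<open>D\<close> is immediate from continuity of u; no direct continuity of A
  is available.\<close>

lemma lipschitz_solution_right_cont:
  assumes G: "K-lipschitz_on UNIV G" and u: "wsol G T u" and u0: "u 0 \<in> D" and T: "0 < T"
    and c: "continuous_on {0..T} u"
  shows "((\<lambda>h. A (u h) + G (u h)) \<longlongrightarrow> A (u 0) + G (u 0)) (at_right 0)"
proof (rule tendsto_if_weak_and_norm)
  let ?N = "norm (A (u 0) + G (u 0))"
  have ev: "\<forall>\<^sub>F h in at_right 0. h \<in> {0<..<T}" using T by (rule eventually_at_right_real)
  then show "\<forall>\<^sub>F h in at_right 0. norm (A (u h) + G (u h)) \<le> exp (K * h) * ?N"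
    by eventually_elim (rule lipschitz_solution_regular[OF G u u0], auto)
  have "((\<lambda>h. exp (K * h) * ?N) \<longlongrightarrow> exp (K * 0) * ?N) (at_right 0)" by (intro tendsto_intros)
  then show "((\<lambda>h. exp (K * h) * ?N) \<longlongrightarrow> ?N) (at_right 0)" by simp
  fix \<phi> assume \<phi>: "\<phi> \<in> D"
  have cont: "(u \<longlongrightarrow> u 0) (at_right 0)"
  proof -
    have "(u \<longlongrightarrow> u 0) (at 0 within {0..T})" using c T by (auto simp: continuous_on)
    then show ?thesis using at_within_Icc_at_right[OF T] by simp
  qed
  have Gc: "((\<lambda>h. G (u h)) \<longlongrightarrow> G (u 0)) (at_right 0)"
  proof -
    have "continuous_on UNIV G" by (rule lipschitz_on_continuous_on[OF G])
    then show ?thesis using cont by (simp add: continuous_on_eq_continuous_at isCont_tendsto_compose)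
  qed
  have "((\<lambda>h. - (u h \<bullet> A \<phi>) + G (u h) \<bullet> \<phi>) \<longlongrightarrow> - (u 0 \<bullet> A \<phi>) + G (u 0) \<bullet> \<phi>) (at_right 0)"
    by (intro tendsto_intros cont Gc)
  also have "- (u 0 \<bullet> A \<phi>) + G (u 0) \<bullet> \<phi> = (A (u 0) + G (u 0)) \<bullet> \<phi>"
    using skew[OF u0 \<phi>] by (simp add: inner_add_left)
  finally show "((\<lambda>h. (A (u h) + G (u h)) \<bullet> \<phi>) \<longlongrightarrow> (A (u 0) + G (u 0)) \<bullet> \<phi>) (at_right 0)"
  proof (rule Lim_transform_eventually)
    show "\<forall>\<^sub>F h in at_right 0. - (u h \<bullet> A \<phi>) + G (u h) \<bullet> \<phi> = (A (u h) + G (u h)) \<bullet> \<phi>"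
      using ev
    proof eventually_elim
      case (elim h)
      then have "u h \<in> D" by (intro lipschitz_solution_regular(1)[OF G u u0]) auto
      then show ?case using skew[OF _ \<phi>, of "u h"] by (simp add: inner_add_left)
    qed
  qed
qed

end

text \<open>The a priori bound is uniform over initial values in a ball and over all shorter
  existence times, so a solution of a truncated equation can be kept inside the region without
  truncation.\<close>

locale semilinear = skew_adjoint D A for D :: "'a::{real_inner,banach} set" and A +
  fixes F :: "'a \<Rightarrow> 'a"
  assumes F_lipschitz: "\<And>R. \<exists>K. K-lipschitz_on (cball 0 R) F"
    and a_priori: "\<And>r T. \<exists>M. \<forall>t y. 0 \<le> t \<and> t \<le> T \<and> wsol F t y \<and> continuous_on {0..t} y \<and> norm (y 0) \<le> r \<longrightarrow> norm (y t) \<le> M"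
begin

lemma wsol_unique:
  assumes y: "wsol F T y" and z: "wsol F T z" and eq: "y 0 = z 0" and t: "t \<in> {0..T}"
  shows "y t = z t"
proof -
  obtain B1 B2 where B: "\<And>t. t \<in> {0..T} \<Longrightarrow> norm (y t) \<le> B1" "\<And>t. t \<in> {0..T} \<Longrightarrow> norm (z t) \<le> B2"
    using wsol_bounded[OF y] wsol_bounded[OF z] by blast
  obtain K where K: "K-lipschitz_on (cball 0 (max B1 B2)) F" using F_lipschitz by blast
  have "norm (y t - z t) \<le> exp (K * t) * norm (y 0 - z 0)"
  proof (rule wsol_compare[OF y z lipschitz_on_nonneg[OF K] _ t])
    fix t assume "t \<in> {0..T}"
    then show "norm (F (y t) - F (z t)) \<le> K * norm (y t - z t)"
      using B[of t] by (intro lipschitz_on_normD[OF K]) auto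
  qed
  then show ?thesis using eq by simp
qed

text \<open>\<open>G\<close> is \<open>F\<close> composed with the radial retraction onto a ball given by the a priori bound.\<close>

lemma solution_exists:
  "\<exists>K G. K-lipschitz_on UNIV G \<and> (\<forall>y0. norm y0 \<le> r \<longrightarrow> (\<exists>y. y 0 = y0 \<and> continuous_on {0..T} y \<and>
    wsol F T y \<and> wsol G T y \<and> (\<forall>t\<in>{0..T}. F (y t) = G (y t))))"
proof -
  obtain M where M: "\<And>t y. 0 \<le> t \<Longrightarrow> t \<le> T \<Longrightarrow> wsol F t y \<Longrightarrow> continuous_on {0..t} y \<Longrightarrow> norm (y 0) \<le> r \<Longrightarrow> norm (y t) \<le> M"
    using a_priori[where r = r and T = T] by metis
  \<comment> \<open>Strictly larger than M, so that reaching norm R contradicts the a priori bound,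
    and strictly larger than r, so that the initial value lies inside.\<close>
  define R where "R = max (max M r) 0 + 1"
  have R: "0 < R" "M < R" "r < R" by (auto simp: R_def)
  obtain K where K: "K-lipschitz_on (cball 0 R) F" using F_lipschitz by blast
  let ?G = "\<lambda>x. F (radial R x)"
  have G: "(K * 2)-lipschitz_on UNIV ?G" by (rule lipschitz_radial[OF R(1) K])
  have "\<exists>y. y 0 = y0 \<and> continuous_on {0..T} y \<and> wsol F T y \<and> wsol ?G T y \<and> (\<forall>t\<in>{0..T}. F (y t) = ?G (y t))"
    if y0: "norm y0 \<le> r" for y0
  proof -
    obtain u where u: "u 0 = y0" "\<And>T. wsol ?G T u" "\<And>T. continuous_on {0..T} u"
      using lipschitz_solution[OF G, of y0] by blast
    have bd: "norm (u t) \<le> R" if t: "t \<in> {0..T}" for t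
    proof (rule ccontr)
      assume "\<not> norm (u t) \<le> R"
      then have gt: "R \<le> norm (u t)" by simp
      have nc: "continuous_on {0..s} (\<lambda>s. norm (u s))" for s by (intro continuous_on_norm u)
      \<comment> \<open>The times at norm R form a compact set. Up to the first of them the
        truncation is inactive, so u solves the original equation there and the bound M < R applies
        at that very time.\<close>
      define Z where "Z = {s \<in> {0..t}. norm (u s) = R}"
      have "\<exists>s\<ge>0. s \<le> t \<and> norm (u s) = R"
        using u(1) y0 R gt t by (intro IVT'[of "\<lambda>s. norm (u s)" 0 R t] nc) auto
      then have Z: "Z \<noteq> {}" by (auto simp: Z_def)
      have "compact Z"
      proof -
        have "Z = {0..t} \<inter> (\<lambda>s. norm (u s)) -` {R}" by (auto simp: Z_def)
        moreover have "closed ({0..t} \<inter> (\<lambda>s. norm (u s)) -` {R})"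
          by (rule continuous_closed_preimage[OF nc]) auto
        moreover have "bounded Z" by (rule bounded_subset[of "{0..t}"]) (auto simp: Z_def)
        ultimately show ?thesis by (simp add: compact_eq_bounded_closed)
      qed
      from compact_attains_inf[OF this Z]
      obtain s where s: "s \<in> Z" "\<And>s'. s' \<in> Z \<Longrightarrow> s \<le> s'" by blast
      then have st: "0 \<le> s" "s \<le> t" "norm (u s) = R" by (auto simp: Z_def)
      have le: "norm (u s') \<le> R" if s': "s' \<in> {0..s}" for s'
      proof (rule ccontr)
        assume n: "\<not> norm (u s') \<le> R"
        then have "\<exists>q\<ge>0. q \<le> s' \<and> norm (u q) = R"
          using u(1) y0 R s' by (intro IVT'[of "\<lambda>s. norm (u s)" 0 R s'] nc) auto
        then obtain q where q: "0 \<le> q" "q \<le> s'" "norm (u q) = R" by blast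
        then have "q \<in> Z" using s' st by (auto simp: Z_def)
        then have "s \<le> q" by (rule s(2))
        then have "q = s'" using q s' by auto
        then show False using q n by simp
      qed
      have "wsol F s u" by (rule wsol_cong[OF u(2)[of s]]) (simp add: radial_id le)
      then have "norm (u s) \<le> M" using M[of s u] st t u(1,3) y0 by auto
      then show False using st R by simp
    qed
    have "wsol F T u" by (rule wsol_cong[OF u(2)[of T]]) (simp add: radial_id bd)
    then show ?thesis using u(1) u(2)[of T] u(3)[of T] bd by (intro exI[of _ u]) (simp add: radial_id)
  qed
  then show ?thesis using G by blast
qed

text \<open>A solution is chosen separately for each t; uniqueness makes these choices agree with
  any solution on a longer interval.\<close>

definition S :: "real \<Rightarrow> 'a \<Rightarrow> 'a"
  where "S t y0 = (SOME y. y 0 = y0 \<and> wsol F t y) t"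

lemma S_eq: assumes y: "wsol F T y" and t: "t \<in> {0..T}" shows "S t (y 0) = y t"
proof -
  have yt: "wsol F t y" using wsol_subset[OF y] t by simp
  let ?P = "\<lambda>z. z 0 = y 0 \<and> wsol F t z"
  have "?P (Eps ?P)" by (rule someI[of ?P y]) (simp add: yt)
  then have "Eps ?P t = y t" using wsol_unique[of t "Eps ?P" y t] yt t by simp
  then show ?thesis by (simp add: S_def)
qed

text \<open>One globally Lipschitz G agrees with F along all orbits starting in the ball, so
  regularity and comparison for Lipschitz perturbations carry over to \<open>S\<close>.\<close>

lemma S_solution:
  "\<exists>K G. K-lipschitz_on UNIV G \<and> (\<forall>y0. norm y0 \<le> r \<longrightarrow> continuous_on {0..T} (\<lambda>t. S t y0) \<and>
    wsol F T (\<lambda>t. S t y0) \<and> wsol G T (\<lambda>t. S t y0) \<and> (\<forall>t\<in>{0..T}. F (S t y0) = G (S t y0)))"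
proof -
  obtain K G where KG: "K-lipschitz_on UNIV G" "\<And>y0. norm y0 \<le> r \<Longrightarrow> (\<exists>y. y 0 = y0 \<and> continuous_on {0..T} y \<and>
    wsol F T y \<and> wsol G T y \<and> (\<forall>t\<in>{0..T}. F (y t) = G (y t)))" using solution_exists by metis
  have "continuous_on {0..T} (\<lambda>t. S t y0) \<and>
    wsol F T (\<lambda>t. S t y0) \<and> wsol G T (\<lambda>t. S t y0) \<and> (\<forall>t\<in>{0..T}. F (S t y0) = G (S t y0))"
    if r: "norm y0 \<le> r" for y0
  proof -
    obtain y where y: "y 0 = y0" "continuous_on {0..T} y" "wsol F T y" "wsol G T y" "\<And>t. t \<in> {0..T} \<Longrightarrow> F (y t) = G (y t)"
      using KG(2)[OF r] by blast
    have eq: "S t y0 = y t" if "t \<in> {0..T}" for t using S_eq[OF y(3) that] y(1) by simp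
    have w: "wsol H T (\<lambda>t. S t y0)" if "wsol H T y" for H
      unfolding wsol_def
    proof (intro conjI ballI)
      have "(\<lambda>t. S t y0) ` {0..T} = y ` {0..T}" using eq by (intro image_cong) auto
      then show "bounded ((\<lambda>t. S t y0) ` {0..T})" using that by (simp add: wsol_def)
      fix \<phi> t assume \<phi>: "\<phi> \<in> D" and t: "t \<in> {0..T}"
      show "((\<lambda>s. S s y0 \<bullet> \<phi>) has_real_derivative - (S t y0 \<bullet> A \<phi>) + H (S t y0) \<bullet> \<phi>) (at t within {0..T})"
        unfolding eq[OF t]
        by (rule has_field_derivative_transform_within[OF wsol_deriv[OF that \<phi> t] zero_less_one t]) (simp add: eq)
    qed
    have "continuous_on {0..T} (\<lambda>t. S t y0)"
      using y(2) by (rule continuous_on_eq) (simp add: eq)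
    then show ?thesis using w[OF y(3)] w[OF y(4)] y(5) eq by simp
  qed
  then show ?thesis using KG(1) by blast
qed

lemma S_wsol: "wsol F T (\<lambda>t. S t y0)"
  and S_continuous: "continuous_on {0..T} (\<lambda>t. S t y0)"
  using S_solution[of "norm y0" T] by blast+

lemma S_0: "S 0 y0 = y0"
proof -
  obtain y where "y 0 = y0" "wsol F 0 y" using solution_exists[of "norm y0" 0] by blast
  then show ?thesis using S_eq[of 0 y 0] by simp
qed

lemma S_add: assumes "0 \<le> s" "0 \<le> t" shows "S (s + t) y0 = S s (S t y0)"
proof -
  have "wsol F (s + t - t) (\<lambda>q. S (q + t) y0)" using assms by (intro wsol_shift S_wsol) auto
  from S_eq[OF this, of s] assms show ?thesis by simp
qed

lemma S_shift: "0 \<le> t \<Longrightarrow> h \<ge> 0 \<Longrightarrow> S (t + h) y0 = S h (S t y0)"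
  using S_add[of h t y0] by (simp add: add.commute)

lemma S_lipschitz: "\<exists>C\<ge>0. \<forall>t\<in>{0..T}. \<forall>y z. norm y \<le> r \<longrightarrow> norm z \<le> r \<longrightarrow> norm (S t y - S t z) \<le> C * norm (y - z)"
proof -
  obtain K G where KG: "K-lipschitz_on UNIV G" "\<And>y0. norm y0 \<le> r \<Longrightarrow> wsol G T (\<lambda>t. S t y0)"
    using S_solution[of r T] by blast
  have K: "0 \<le> K" by (rule lipschitz_on_nonneg[OF KG(1)])
  have "norm (S t y - S t z) \<le> exp (K * \<bar>T\<bar>) * norm (y - z)" if t: "t \<in> {0..T}" and "norm y \<le> r" "norm z \<le> r" for t y z
  proof -
    have "norm (S t y - S t z) \<le> exp (K * t) * norm (y - z)"
      using lipschitz_compare[OF KG(1) KG(2) KG(2) t, of y z] that by (simp add: S_0)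
    also have "\<dots> \<le> exp (K * \<bar>T\<bar>) * norm (y - z)"
      using t K by (intro mult_right_mono) (auto intro: mult_left_mono)
    finally show ?thesis .
  qed
  then show ?thesis by (intro exI[of _ "exp (K * \<bar>T\<bar>)"]) auto
qed

lemma S_D: assumes y: "y \<in> D" and t: "0 \<le> t" shows "S t y \<in> D"
proof -
  \<comment> \<open>The horizon is t + 1 because membership in the domain is known only at times
    strictly before the end of the interval.\<close>
  obtain K G where KG: "K-lipschitz_on UNIV G" "wsol G (t + 1) (\<lambda>t. S t y)"
    using S_solution[of "norm y" "t + 1"] by blast
  show ?thesis
    by (rule lipschitz_solution_regular(1)[OF KG]) (use y t in \<open>auto simp: S_0\<close>)
qed

lemma S_D_bound: assumes y: "y \<in> D" shows "\<exists>C. \<forall>t\<in>{0..T}. norm (A (S t y) + F (S t y)) \<le> C"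
proof -
  obtain K G where KG: "K-lipschitz_on UNIV G" "wsol G (T + 1) (\<lambda>t. S t y)"
    and FG: "\<And>t. t \<in> {0..T + 1} \<Longrightarrow> F (S t y) = G (S t y)"
    using S_solution[of "norm y" "T + 1"] by blast
  have K: "0 \<le> K" by (rule lipschitz_on_nonneg[OF KG(1)])
  have "norm (A (S t y) + F (S t y)) \<le> exp (K * \<bar>T\<bar>) * norm (A y + G y)" if t: "t \<in> {0..T}" for t
  proof -
    have "norm (A (S t y) + G (S t y)) \<le> exp (K * t) * norm (A y + G y)"
      using lipschitz_solution_regular(2)[OF KG, of t] y t by (simp add: S_0)
    also have "\<dots> \<le> exp (K * \<bar>T\<bar>) * norm (A y + G y)"
      using t K by (intro mult_right_mono) (auto intro: mult_left_mono)
    finally show ?thesis using FG[of t] t by simp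
  qed
  then show ?thesis by blast
qed

lemma S_right_deriv_0:
  assumes y: "y \<in> D" shows "((\<lambda>h. (1 / h) *\<^sub>R (S h y - y)) \<longlongrightarrow> A y + F y) (at_right 0)"
proof -
  obtain K G where KG: "K-lipschitz_on UNIV G" "wsol G 1 (\<lambda>t. S t y)"
    and FG: "\<And>t. t \<in> {0..1} \<Longrightarrow> F (S t y) = G (S t y)"
    using S_solution[of "norm y" 1] by blast
  show ?thesis using lipschitz_solution_right_deriv[OF KG] FG[of 0] y by (simp add: S_0)
qed

lemma S_right_deriv:
  assumes y: "y \<in> D" and t: "0 \<le> t"
  shows "((\<lambda>h. (1 / h) *\<^sub>R (S (t + h) y - S t y)) \<longlongrightarrow> A (S t y) + F (S t y)) (at_right 0)"
proof (rule Lim_transform_eventually[OF S_right_deriv_0[OF S_D[OF y t]]])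
  have "\<forall>\<^sub>F h::real in at_right 0. 0 < h" by (simp add: eventually_at_filter)
  then show "\<forall>\<^sub>F h in at_right 0. (1 / h) *\<^sub>R (S h (S t y) - S t y) = (1 / h) *\<^sub>R (S (t + h) y - S t y)"
    by eventually_elim (simp add: S_shift t)
qed

lemma S_right_cont_0:
  assumes y: "y \<in> D"
  shows "((\<lambda>h. A (S h y) + F (S h y)) \<longlongrightarrow> A y + F y) (at_right 0)"
proof -
  obtain K G where KG: "K-lipschitz_on UNIV G" "wsol G 1 (\<lambda>t. S t y)"
    and FG: "\<And>t. t \<in> {0..1} \<Longrightarrow> F (S t y) = G (S t y)"
    using S_solution[of "norm y" 1] by blast
  have "((\<lambda>h. A (S h y) + G (S h y)) \<longlongrightarrow> A (S 0 y) + G (S 0 y)) (at_right 0)"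
    by (rule lipschitz_solution_right_cont[OF KG _ _ S_continuous]) (auto simp: S_0 y)
  then have "((\<lambda>h. A (S h y) + G (S h y)) \<longlongrightarrow> A y + F y) (at_right 0)"
    using FG[of 0] by (simp add: S_0)
  then show ?thesis
  proof (rule Lim_transform_eventually)
    have "\<forall>\<^sub>F h::real in at_right 0. h \<in> {0<..<1}" by (rule eventually_at_right_real) simp
    then show "\<forall>\<^sub>F h in at_right 0. A (S h y) + G (S h y) = A (S h y) + F (S h y)"
      by eventually_elim (simp add: FG)
  qed
qed

lemma S_right_cont:
  assumes y: "y \<in> D" and t: "0 \<le> t"
  shows "((\<lambda>s. A (S s y) + F (S s y)) \<longlongrightarrow> A (S t y) + F (S t y)) (at_right t)"
proof -
  have "((\<lambda>h. A (S (t + h) y) + F (S (t + h) y)) \<longlongrightarrow> A (S t y) + F (S t y)) (at_right 0)"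
  proof (rule Lim_transform_eventually[OF S_right_cont_0[OF S_D[OF y t]]])
    have "\<forall>\<^sub>F h::real in at_right 0. 0 < h" by (simp add: eventually_at_filter)
    then show "\<forall>\<^sub>F h in at_right 0. A (S h (S t y)) + F (S h (S t y)) = A (S (t + h) y) + F (S (t + h) y)"
      by eventually_elim (simp add: S_shift t)
  qed
  then show ?thesis
    unfolding filterlim_at_right_to_0[of "\<lambda>s. A (S s y) + F (S s y)" _ t] by (simp add: add.commute)
qed

text \<open>If the quotients converge to z, the increments are at most h times a quantity tending to
  |z|. So the weak derivative at 0 is a bounded functional on \<open>D\<close>.\<close>

lemma D_if_right_deriv:
  assumes z: "((\<lambda>h. (1 / h) *\<^sub>R (S h y - y)) \<longlongrightarrow> z) (at_right 0)"
  shows "y \<in> D"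
proof (rule D_if_lipschitz(1)[of "norm z"])
  have c: "((\<lambda>h. norm ((1 / h) *\<^sub>R (S h y - y))) \<longlongrightarrow> norm z) (at_right 0)"
    by (rule tendsto_norm[OF z])
  have "\<forall>\<^sub>F h::real in at_right 0. 0 < h" by (simp add: eventually_at_filter)
  then have ev: "\<forall>\<^sub>F h in at_right 0. norm (S (0 + h) y - S 0 y) \<le> h * norm ((1 / h) *\<^sub>R (S h y - y))"
    by eventually_elim (simp add: S_0)
  fix \<phi> assume \<phi>: "\<phi> \<in> D"
  show "- (y \<bullet> A \<phi>) + F y \<bullet> \<phi> \<le> norm z * norm \<phi>"
    using deriv_le_lipschitz[OF wsol_deriv[OF S_wsol[of 1 y] \<phi>] _ ev c] by (simp add: S_0)
qed simp

end

section \<open>Completeness of \<open>l2\<close>\<close>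

lemma sq_integrable_bound:
  assumes "f \<in> borel_measurable lborel" "sq_integrable g" "AE x in lborel. \<bar>f x\<bar> \<le> \<bar>g x\<bar>"
  shows "sq_integrable f"
  unfolding sq_integrable_def
proof
  show "f \<in> borel_measurable lborel" by fact
  show "integrable lborel (\<lambda>x. (f x)\<^sup>2)"
  proof (rule Bochner_Integration.integrable_bound)
    show "integrable lborel (\<lambda>x. (g x)\<^sup>2)" using assms(2) by (simp add: sq_integrable_def)
    show "(\<lambda>x. (f x)\<^sup>2) \<in> borel_measurable lborel" using assms(1) by simp
    show "AE x in lborel. norm ((f x)\<^sup>2) \<le> norm ((g x)\<^sup>2)"
      using assms(3) by eventually_elim (simp add: abs_le_square_iff)
  qed
qed

lemma rep_l2_measurable [measurable]: "rep_l2 f \<in> borel_measurable borel"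
  using sq_integrable_rep[of f] by (simp add: sq_integrable_def)

lemma rep_abs_l2: "sq_integrable f \<Longrightarrow> AE x in lborel. rep_l2 (abs_l2 f) x = f x"
  using Quotient_rep_abs[OF Quotient_l2, of f] by (simp add: l2_eq_self) (simp add: l2_eq_def)

lemma l2_eqI: "AE x in lborel. rep_l2 f x = rep_l2 g x \<Longrightarrow> f = g"
  using abs_l2_eq[OF sq_integrable_rep sq_integrable_rep, of f g] by (simp add: abs_rep_l2)

lemma rep_add: "AE x in lborel. rep_l2 (f + g) x = rep_l2 f x + rep_l2 g x"
  using rep_abs_l2[OF sq_integrable_add[OF sq_integrable_rep[of f] sq_integrable_rep[of g]]]
  by (simp add: abs_l2_add sq_integrable_rep abs_rep_l2)

lemma rep_scale: "AE x in lborel. rep_l2 (c *\<^sub>R f) x = c * rep_l2 f x"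
  using rep_abs_l2[OF sq_integrable_scale[OF sq_integrable_rep[of f], of c]]
  by (simp add: abs_l2_scale sq_integrable_rep abs_rep_l2)

lemma inner_l2_rep: "f \<bullet> g = (\<integral>x. rep_l2 f x * rep_l2 g x \<partial>lborel)"
  by (simp add: inner_l2_def)

lemma inner_abs_l2:
  assumes "sq_integrable f" shows "abs_l2 f \<bullet> g = (\<integral>x. f x * rep_l2 g x \<partial>lborel)"
proof -
  have fm: "f \<in> borel_measurable borel" using assms by (simp add: sq_integrable_def)
  have "(\<integral>x. rep_l2 (abs_l2 f) x * rep_l2 g x \<partial>lborel) = (\<integral>x. f x * rep_l2 g x \<partial>lborel)"
  proof (rule integral_cong_AE)
    show "AE x in lborel. rep_l2 (abs_l2 f) x * rep_l2 g x = f x * rep_l2 g x"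
      using rep_abs_l2[OF assms] by eventually_elim simp
  qed (use fm in measurable)
  then show ?thesis by (simp add: inner_l2_rep)
qed

lemma norm_l2_sq: "(norm f)\<^sup>2 = (\<integral>x. (rep_l2 f x)\<^sup>2 \<partial>lborel)"
  by (simp only: power2_norm_eq_inner inner_l2_rep) (simp only: power2_eq_square)

lemma norm_abs_l2_le:
  assumes f: "f \<in> borel_measurable borel" and b: "(\<integral>\<^sup>+x. ennreal ((f x)\<^sup>2) \<partial>lborel) \<le> ennreal (e\<^sup>2)" and e: "0 \<le> e"
  shows "sq_integrable f" "norm (abs_l2 f) \<le> e"
proof -
  have "integrable lborel (\<lambda>x. (f x)\<^sup>2)"
    using f b by (intro integrableI_bounded) (auto intro: le_less_trans)
  then show sq: "sq_integrable f" using f by (simp add: sq_integrable_def)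
  have "ennreal ((norm (abs_l2 f))\<^sup>2) = (\<integral>\<^sup>+x. ennreal ((f x)\<^sup>2) \<partial>lborel)"
    unfolding norm_abs_l2[OF sq] using sq by (intro nn_integral_eq_integral[symmetric]) (auto simp: sq_integrable_def)
  then have "ennreal ((norm (abs_l2 f))\<^sup>2) \<le> ennreal (e\<^sup>2)" using b by (rule ord_eq_le_trans)
  then have "(norm (abs_l2 f))\<^sup>2 \<le> e\<^sup>2" by (subst (asm) ennreal_le_iff) auto
  then show "norm (abs_l2 f) \<le> e" using e by (rule power2_le_imp_le)
qed

text \<open>Riesz--Fischer: a rapidly Cauchy subsequence converges almost everywhere, and Fatou's lemma
  turns this into convergence in norm.\<close>

instance l2 :: complete_space
proof
  fix X :: "nat \<Rightarrow> l2" assume X: "Cauchy X"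
  have "\<exists>N. \<forall>m\<ge>N. \<forall>n\<ge>N. norm (X m - X n) < (1/4) ^ k" for k
    using CauchyD[OF X, of "(1/4) ^ k"] by simp
  then obtain N where N: "\<And>k m n. N k \<le> m \<Longrightarrow> N k \<le> n \<Longrightarrow> norm (X m - X n) < (1/4) ^ k" by metis
  \<comment> \<open>Summing the thresholds makes r nondecreasing and the summand k makes it strictly
    increasing.\<close>
  define r where "r k = (\<Sum>j\<le>k. N j) + k" for k
  have r: "strict_mono r" unfolding strict_mono_Suc_iff by (simp add: r_def)
  have Nr: "N k \<le> r m" if "k \<le> m" for k m
  proof -
    have "N k \<le> (\<Sum>j\<le>m. N j)" using that by (intro member_le_sum) auto
    then show ?thesis by (simp add: r_def)
  qed
  define f where "f k = rep_l2 (X (r k))" for k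
  have fm [measurable]: "f k \<in> borel_measurable borel" for k by (simp add: f_def)
  have dist: "(\<integral>\<^sup>+x. ennreal ((f k x - f m x)\<^sup>2) \<partial>lborel) = ennreal ((norm (X (r k) - X (r m)))\<^sup>2)" for k m
  proof -
    have sq: "sq_integrable (\<lambda>x. f k x - f m x)" unfolding f_def by (intro sq_integrable_diff sq_integrable_rep)
    have "(norm (X (r k) - X (r m)))\<^sup>2 = (\<integral>x. (f k x - f m x)\<^sup>2 \<partial>lborel)"
      using norm_abs_l2[OF sq] by (simp add: f_def abs_l2_diff sq_integrable_rep abs_rep_l2)
    then show ?thesis using sq by (simp add: nn_integral_eq_integral sq_integrable_def)
  qed
  have "(\<integral>\<^sup>+x. (\<Sum>k. ennreal (4 ^ k * (f (Suc k) x - f k x)\<^sup>2)) \<partial>lborel) =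
      (\<Sum>k. \<integral>\<^sup>+x. ennreal (4 ^ k * (f (Suc k) x - f k x)\<^sup>2) \<partial>lborel)"
    by (intro nn_integral_suminf) simp
  also have "\<dots> \<le> (\<Sum>k. ennreal ((1/4) ^ k))"
  proof (intro suminf_le allI)
    fix k
    have "(\<integral>\<^sup>+x. ennreal (4 ^ k * (f (Suc k) x - f k x)\<^sup>2) \<partial>lborel) =
        (\<integral>\<^sup>+x. ennreal (4 ^ k) * ennreal ((f (Suc k) x - f k x)\<^sup>2) \<partial>lborel)"
      by (intro nn_integral_cong) (simp add: ennreal_mult)
    also have "\<dots> = ennreal (4 ^ k * (norm (X (r (Suc k)) - X (r k)))\<^sup>2)"
      by (simp add: nn_integral_cmult dist ennreal_mult)
    also have "\<dots> \<le> ennreal (4 ^ k * ((1/4) ^ k)\<^sup>2)"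
      by (intro ennreal_leI mult_left_mono power_mono less_imp_le[OF N] Nr) auto
    also have "4 ^ k * ((1/4) ^ k)\<^sup>2 = (1/4 :: real) ^ k" by (simp add: power2_eq_square field_simps)
    finally show "(\<integral>\<^sup>+x. ennreal (4 ^ k * (f (Suc k) x - f k x)\<^sup>2) \<partial>lborel) \<le> ennreal ((1/4) ^ k)" .
  qed auto
  also have "\<dots> < \<infinity>"
    by (subst suminf_ennreal2) (auto intro: summable_geometric)
  finally have "AE x in lborel. (\<Sum>k. ennreal (4 ^ k * (f (Suc k) x - f k x)\<^sup>2)) \<noteq> \<infinity>"
    by (intro nn_integral_PInf_AE) auto
  then have conv: "AE x in lborel. (\<lambda>k. f k x) \<longlonglongrightarrow> lim (\<lambda>k. f k x)"
  proof eventually_elim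
    case (elim x)
    define C where "C = enn2real (\<Sum>k. ennreal (4 ^ k * (f (Suc k) x - f k x)\<^sup>2))"
    have C: "0 \<le> C" "(\<Sum>k. ennreal (4 ^ k * (f (Suc k) x - f k x)\<^sup>2)) = ennreal C"
      using elim by (simp_all add: C_def ennreal_enn2real_if)
    \<comment> \<open>The weights 4^k were chosen for this: finiteness of the weighted sum of
      squares bounds each difference by a geometric sequence. The subsequence is so fast that the
      weighted integrals are still summable.\<close>
    have bd: "norm (f (Suc k) x - f k x) \<le> sqrt C * (1/2) ^ k" for k
    proof -
      have "(\<Sum>j\<in>{k}. ennreal (4 ^ j * (f (Suc j) x - f j x)\<^sup>2)) \<le> (\<Sum>k. ennreal (4 ^ k * (f (Suc k) x - f k x)\<^sup>2))"
        by (rule sum_le_suminf) auto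
      then have "ennreal (4 ^ k * (f (Suc k) x - f k x)\<^sup>2) \<le> ennreal C" unfolding C by simp
      then have "4 ^ k * (f (Suc k) x - f k x)\<^sup>2 \<le> C" using C by simp
      moreover have "(4::real) ^ k = (2 ^ k)\<^sup>2" by (simp add: power2_eq_square flip: power_mult_distrib)
      ultimately have "(2 ^ k * (f (Suc k) x - f k x))\<^sup>2 \<le> C" by (simp add: power_mult_distrib)
      then have "\<bar>2 ^ k * (f (Suc k) x - f k x)\<bar> \<le> sqrt C" using real_sqrt_le_mono by fastforce
      then show ?thesis by (simp add: abs_mult power_divide pos_le_divide_eq mult.commute)
    qed
    have "summable (\<lambda>k. f (Suc k) x - f k x)"
      by (rule summable_comparison_test'[OF summable_mult[OF summable_geometric] bd]) simp
    then have "convergent (\<lambda>n. \<Sum>k<n. f (Suc k) x - f k x)" by (simp add: summable_iff_convergent)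
    then have "convergent (\<lambda>n. f n x - f 0 x)" by (simp only: sum_lessThan_telescope[of "\<lambda>k. f k x"])
    then have "convergent (\<lambda>n. (f n x - f 0 x) + f 0 x)" by (intro convergent_add convergent_const)
    then have "convergent (\<lambda>n. f n x)" by simp
    then show ?case by (rule convergent_LIMSEQ_iff[THEN iffD1])
  qed
  define g where "g x = lim (\<lambda>k. f k x)" for x
  have gm [measurable]: "g \<in> borel_measurable borel" unfolding g_def by measurable
  have close: "sq_integrable (\<lambda>x. f k x - g x) \<and> norm (abs_l2 (\<lambda>x. f k x - g x)) \<le> (1/4) ^ k" for k
  proof -
    have "(\<integral>\<^sup>+x. ennreal ((f k x - g x)\<^sup>2) \<partial>lborel) = (\<integral>\<^sup>+x. liminf (\<lambda>m. ennreal ((f k x - f m x)\<^sup>2)) \<partial>lborel)"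
    proof (rule nn_integral_cong_AE)
      show "AE x in lborel. ennreal ((f k x - g x)\<^sup>2) = liminf (\<lambda>m. ennreal ((f k x - f m x)\<^sup>2))"
        using conv
      proof eventually_elim
        case (elim x)
        have "(\<lambda>m. ennreal ((f k x - f m x)\<^sup>2)) \<longlonglongrightarrow> ennreal ((f k x - g x)\<^sup>2)"
          unfolding g_def by (intro tendsto_ennrealI tendsto_intros elim)
        then show ?case by (intro lim_imp_Liminf[symmetric]) auto
      qed
    qed
    also have "\<dots> \<le> liminf (\<lambda>m. \<integral>\<^sup>+x. ennreal ((f k x - f m x)\<^sup>2) \<partial>lborel)"
      by (rule nn_integral_liminf) measurable
    also have "\<dots> \<le> ennreal (((1/4) ^ k)\<^sup>2)"
    proof (rule Liminf_le)
      have "\<forall>\<^sub>F m in sequentially. k \<le> m" by (rule eventually_ge_at_top)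
      then show "\<forall>\<^sub>F m in sequentially. (\<integral>\<^sup>+x. ennreal ((f k x - f m x)\<^sup>2) \<partial>lborel) \<le> ennreal (((1/4) ^ k)\<^sup>2)"
        by eventually_elim (unfold dist, intro ennreal_leI power_mono less_imp_le[OF N] Nr, auto)
    qed simp
    finally have "(\<integral>\<^sup>+x. ennreal ((f k x - g x)\<^sup>2) \<partial>lborel) \<le> ennreal (((1/4) ^ k)\<^sup>2)" .
    note b = this
    have m: "(\<lambda>x. f k x - g x) \<in> borel_measurable borel" by measurable
    show ?thesis
      using norm_abs_l2_le(1)[OF m b zero_le_power] norm_abs_l2_le(2)[OF m b zero_le_power] by fastforce
  qed
  have sg: "sq_integrable g"
    using sq_integrable_diff[OF sq_integrable_rep[of "X (r 0)", folded f_def] conjunct1[OF close[of 0]]] by simp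
  have "norm (X (r k) - abs_l2 g) \<le> (1/4) ^ k" for k
    using close[of k] abs_l2_diff[OF sq_integrable_rep[of "X (r k)"] sg] by (simp add: f_def abs_rep_l2)
  then have "(\<lambda>k. X (r k) - abs_l2 g) \<longlonglongrightarrow> 0"
    by (intro Lim_null_comparison[OF _ LIMSEQ_power_zero[of "1/4"]]) auto
  then have "(X \<circ> r) \<longlonglongrightarrow> abs_l2 g" unfolding o_def by (rule LIM_zero_cancel)
  from Cauchy_converges_subseq[OF X r this] show "convergent X" by (rule convergentI)
qed

instance l2 :: banach ..

section \<open>Volterra operators\<close>

lemma sq_integrable_interval [simp]: "sq_integrable (indicat_real {a<..<b::real})"
  by (rule sq_integrable_ind[of _ a b]) auto

lemma inner_ind: "A \<in> sets borel \<Longrightarrow> A \<subseteq> {a..b} \<Longrightarrow> ind_l2 A \<bullet> g = (\<integral>x. indicat_real A x * rep_l2 g x \<partial>lborel)"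
  by (rule inner_abs_l2[OF sq_integrable_ind])

lemma ind_empty [simp]: "ind_l2 {} = 0"
proof -
  have "indicat_real ({} :: real set) = (\<lambda>_. 0)" by auto
  then show ?thesis using abs_l2_zero by metis
qed

lemma norm_ind_diff:
  assumes "A \<in> sets borel" "A \<subseteq> {a..b}" "B \<in> sets borel" "B \<subseteq> {a..b}" and AB: "(A - B) \<union> (B - A) \<subseteq> {x..y}" and "x \<le> y"
  shows "norm (ind_l2 A - ind_l2 B) \<le> sqrt (y - x)"
proof -
  have sq: "sq_integrable (\<lambda>x. indicat_real A x - indicat_real B x)"
    using assms by (intro sq_integrable_diff sq_integrable_ind)
  have "(norm (ind_l2 A - ind_l2 B))\<^sup>2 = (\<integral>x. (indicat_real A x - indicat_real B x)\<^sup>2 \<partial>lborel)"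
    using norm_abs_l2[OF sq] abs_l2_diff[OF sq_integrable_ind[OF assms(1,2)] sq_integrable_ind[OF assms(3,4)]] by simp
  also have "\<dots> \<le> (\<integral>t. indicat_real {x..y} t \<partial>lborel)"
  proof (rule integral_mono)
    show "integrable lborel (\<lambda>x. (indicat_real A x - indicat_real B x)\<^sup>2)" using sq by (simp add: sq_integrable_def)
    show "integrable lborel (indicat_real {x..y})"
      by (rule integrable_real_indicator) (auto simp: emeasure_lborel_Icc_eq)
    fix t
    show "(indicat_real A t - indicat_real B t)\<^sup>2 \<le> indicat_real {x..y} t"
      using AB by (auto simp: indicator_def subset_iff)
  qed
  also have "\<dots> = y - x" using \<open>x \<le> y\<close> by simp
  finally show ?thesis by (simp add: real_le_rsqrt)
qed

text \<open>The distance of two indicators is the root of the measure of their symmetric difference,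
  so the curve is Hoelder continuous with exponent 1/2. Pairing with g gives continuity of
  primitives of L^2 functions.\<close>

lemma continuous_ind_curve:
  fixes A :: "real \<Rightarrow> real set"
  assumes "\<And>x. A x \<in> sets borel" "\<And>x. A x \<subseteq> {0..max L x}"
    and "\<And>x y. x \<le> y \<Longrightarrow> (A x - A y) \<union> (A y - A x) \<subseteq> {x..y}"
  shows "continuous_on UNIV (\<lambda>x. ind_l2 (A x))"
  unfolding continuous_on_iff
proof (intro ballI allI impI)
  fix x e :: real assume e: "0 < e"
  have *: "norm (ind_l2 (A x) - ind_l2 (A y)) \<le> sqrt (y - x)" if "x \<le> y" for x y
  proof (rule norm_ind_diff[of _ 0 "max L y"])
    have "{0..max L x} \<subseteq> {0..max L y}" using that by auto
    then show "A x \<subseteq> {0..max L y}" using assms(2) by blast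
  qed (use assms that in auto)
  show "\<exists>d>0. \<forall>y\<in>UNIV. dist y x < d \<longrightarrow> dist (ind_l2 (A y)) (ind_l2 (A x)) < e"
  proof (intro exI[of _ "e\<^sup>2"] conjI ballI impI)
    fix y assume d: "dist y x < e\<^sup>2"
    have "norm (ind_l2 (A y) - ind_l2 (A x)) \<le> sqrt \<bar>y - x\<bar>"
      using *[of x y] *[of y x] by (cases "x \<le> y") (auto simp: norm_minus_commute)
    also have "\<dots> < e" using d e by (simp add: dist_real_def real_less_lsqrt)
    finally show "dist (ind_l2 (A y)) (ind_l2 (A x)) < e" by (simp add: dist_norm)
  qed (use e in simp)
qed

text \<open>Pairing with \<open>low L x\<close> integrates from 0 to x, pairing with
  \<open>upp L x\<close> from x to L. The clipping by min and max makes both curves continuous on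
  the whole line.\<close>

definition low :: "real \<Rightarrow> real \<Rightarrow> l2" where "low L x = ind_l2 {0<..<min x L}"

definition upp :: "real \<Rightarrow> real \<Rightarrow> l2" where "upp L x = ind_l2 {max x 0<..<L}"

lemma low_continuous: "continuous_on UNIV (low L)" and upp_continuous: "continuous_on UNIV (upp L)"
  unfolding low_def[abs_def] upp_def[abs_def]
  by (rule continuous_ind_curve[where L = L]; auto)+

lemma norm_low_le: "0 \<le> L \<Longrightarrow> norm (low L x) \<le> sqrt L" and norm_upp_le: "0 \<le> L \<Longrightarrow> norm (upp L x) \<le> sqrt L"
proof -
  assume L: "0 \<le> L"
  show "norm (low L x) \<le> sqrt L"
    using norm_ind_diff[of "{0<..<min x L}" 0 L "{}" 0 L] L by (force simp: low_def)
  show "norm (upp L x) \<le> sqrt L"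
    using norm_ind_diff[of "{max x 0<..<L}" 0 L "{}" 0 L] L by (force simp: upp_def)
qed

lemma low_0: "x \<le> 0 \<Longrightarrow> low L x = 0" and upp_L: "L \<le> x \<Longrightarrow> upp L x = 0"
  by (auto simp: low_def upp_def)

text \<open>An integral operator whose kernel is a curve in L^2: \<open>low\<close> yields the
  Volterra operator V and \<open>upp\<close> its adjoint, with common proofs of measurability and
  boundedness.\<close>

definition curve_op :: "real \<Rightarrow> (real \<Rightarrow> l2) \<Rightarrow> l2 \<Rightarrow> l2"
  where "curve_op L e g = abs_l2 (\<lambda>x. indicat_real {0<..<L} x * (e x \<bullet> g))"

lemma curve_op_sq:
  assumes e: "continuous_on UNIV e"
  shows "sq_integrable (\<lambda>x. indicat_real {0<..<L} x * (e x \<bullet> g))"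
proof -
  have c: "continuous_on UNIV (\<lambda>x. e x \<bullet> g)" by (intro continuous_intros e)
  then have [measurable]: "(\<lambda>x. e x \<bullet> g) \<in> borel_measurable borel" by (rule borel_measurable_continuous_onI)
  have "bounded ((\<lambda>x. e x \<bullet> g) ` {0..L})"
    by (intro compact_imp_bounded compact_continuous_image continuous_on_subset[OF c]) auto
  then obtain B where B: "\<And>x. x \<in> {0..L} \<Longrightarrow> \<bar>e x \<bullet> g\<bar> \<le> B"
    unfolding bounded_iff real_norm_def by blast
  show ?thesis
  proof (rule sq_integrable_bound)
    show "(\<lambda>x. indicat_real {0<..<L} x * (e x \<bullet> g)) \<in> borel_measurable lborel" by measurable
    show "sq_integrable (\<lambda>x. B * indicat_real {0<..<L} x)" by (intro sq_integrable_scale) simp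
    show "AE x in lborel. \<bar>indicat_real {0<..<L} x * (e x \<bullet> g)\<bar> \<le> \<bar>B * indicat_real {0<..<L} x\<bar>"
    proof (intro AE_I2)
      fix x
      show "\<bar>indicat_real {0<..<L} x * (e x \<bullet> g)\<bar> \<le> \<bar>B * indicat_real {0<..<L} x\<bar>"
        using B[of x] by (cases "x \<in> {0<..<L}") auto
    qed
  qed
qed

lemma curve_op_rep:
  assumes "continuous_on UNIV e"
  shows "AE x in lborel. rep_l2 (curve_op L e g) x = indicat_real {0<..<L} x * (e x \<bullet> g)"
  unfolding curve_op_def by (rule rep_abs_l2[OF curve_op_sq[OF assms]])

text \<open>One root of L comes from the Cauchy-Schwarz inequality at each point, the other from
  integrating over an interval of length L.\<close>

lemma curve_op_bounded_linear:
  assumes e: "continuous_on UNIV e" and B: "\<And>x. norm (e x) \<le> sqrt L" and L: "0 \<le> L"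
  shows "bounded_linear (curve_op L e)" "norm (curve_op L e g) \<le> L * norm g"
proof -
  have bd: "norm (curve_op L e g) \<le> norm g * L" for g
  proof -
    have "(norm (curve_op L e g))\<^sup>2 = (\<integral>x. (indicat_real {0<..<L} x * (e x \<bullet> g))\<^sup>2 \<partial>lborel)"
      unfolding curve_op_def by (rule norm_abs_l2[OF curve_op_sq[OF e]])
    also have "\<dots> \<le> (\<integral>x. (L * (norm g)\<^sup>2) * indicat_real {0<..<L} x \<partial>lborel)"
    proof (rule integral_mono)
      show "integrable lborel (\<lambda>x. (indicat_real {0<..<L} x * (e x \<bullet> g))\<^sup>2)"
        using curve_op_sq[OF e] by (simp add: sq_integrable_def)
      show "integrable lborel (\<lambda>x. (L * (norm g)\<^sup>2) * indicat_real {0<..<L} x)"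
        by (intro integrable_mult_right integrable_real_indicator) (auto simp: emeasure_lborel_Ioo L)
      fix x
      have "\<bar>e x \<bullet> g\<bar> \<le> sqrt L * norm g"
        by (rule order_trans[OF Cauchy_Schwarz_ineq2 mult_right_mono[OF B]]) simp
      then have "(e x \<bullet> g)\<^sup>2 \<le> (sqrt L * norm g)\<^sup>2" using abs_le_square_iff[of "e x \<bullet> g" "sqrt L * norm g"] L by simp
      also have "\<dots> = L * (norm g)\<^sup>2" using L by (simp add: power_mult_distrib)
      finally show "(indicat_real {0<..<L} x * (e x \<bullet> g))\<^sup>2 \<le> (L * (norm g)\<^sup>2) * indicat_real {0<..<L} x"
        by (auto simp: indicator_def)
    qed
    also have "\<dots> = (norm g * L)\<^sup>2" using L by (simp add: power2_eq_square)
    finally show ?thesis by (rule power2_le_imp_le) (simp add: L)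
  qed
  then show "norm (curve_op L e g) \<le> L * norm g" by (simp add: mult.commute)
  show "bounded_linear (curve_op L e)"
  proof (rule bounded_linear_intro[OF _ _ bd])
    fix f g
    have "curve_op L e (f + g) = abs_l2 (\<lambda>x. indicat_real {0<..<L} x * (e x \<bullet> f) + indicat_real {0<..<L} x * (e x \<bullet> g))"
      by (simp add: curve_op_def inner_add_right distrib_left)
    then show "curve_op L e (f + g) = curve_op L e f + curve_op L e g"
      by (simp add: curve_op_def abs_l2_add curve_op_sq e)
    fix r :: real
    have "curve_op L e (r *\<^sub>R f) = abs_l2 (\<lambda>x. r * (indicat_real {0<..<L} x * (e x \<bullet> f)))"
      by (simp add: curve_op_def mult.left_commute)
    then show "curve_op L e (r *\<^sub>R f) = r *\<^sub>R curve_op L e f"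
      by (simp add: curve_op_def abs_l2_scale curve_op_sq e)
  qed
qed

definition vol :: "real \<Rightarrow> l2 \<Rightarrow> l2" where "vol L = curve_op L (low L)"

definition vol_adj :: "real \<Rightarrow> l2 \<Rightarrow> l2" where "vol_adj L = curve_op L (upp L)"

lemma bounded_linear_vol: "0 \<le> L \<Longrightarrow> bounded_linear (vol L)"
  and bounded_linear_vol_adj: "0 \<le> L \<Longrightarrow> bounded_linear (vol_adj L)"
  unfolding vol_def vol_adj_def
  by (intro curve_op_bounded_linear low_continuous upp_continuous norm_low_le norm_upp_le; assumption)+

lemma vol_rep: "AE x in lborel. rep_l2 (vol L g) x = indicat_real {0<..<L} x * (low L x \<bullet> g)"
  and vol_adj_rep: "AE x in lborel. rep_l2 (vol_adj L g) x = indicat_real {0<..<L} x * (upp L x \<bullet> g)"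
  unfolding vol_def vol_adj_def by (intro curve_op_rep low_continuous upp_continuous)+

text \<open>Fubini's theorem on the triangle y < x.\<close>

lemma vol_adjoint: "vol L f \<bullet> g = f \<bullet> vol_adj L g"
proof -
  let ?I = "indicat_real {0<..<L}"
  \<comment> \<open>k is integrable over the whole square, and c cuts out the triangle; both
    iterated integrals then have the same integrand.\<close>
  define k where "k x y = ?I x * rep_l2 g x * (?I y * rep_l2 f y)" for x y
  define c where "c x y = (if y < x then 1 else 0 :: real)" for x y :: real
  have int: "integrable lborel (\<lambda>x. ?I x * rep_l2 h x)" for h
    by (intro sq_integrable_mult sq_integrable_rep) simp
  have [measurable]: "(\<lambda>(x, y). c x y) \<in> borel_measurable (borel \<Otimes>\<^sub>M borel)" unfolding c_def by measurable
  have pair: "integrable (lborel \<Otimes>\<^sub>M lborel) (\<lambda>(x, y). k x y)"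
  proof (rule lborel_pair.Fubini_integrable)
    show "(\<lambda>(x, y). k x y) \<in> borel_measurable (lborel \<Otimes>\<^sub>M lborel)" unfolding k_def by measurable
    have "(\<lambda>x. \<integral>y. norm (case (x, y) of (x, y) \<Rightarrow> k x y) \<partial>lborel) = (\<lambda>x. \<bar>?I x * rep_l2 g x\<bar> * (\<integral>y. \<bar>?I y * rep_l2 f y\<bar> \<partial>lborel))"
      by (simp add: k_def abs_mult)
    then show "integrable lborel (\<lambda>x. \<integral>y. norm (case (x, y) of (x, y) \<Rightarrow> k x y) \<partial>lborel)"
      using integrable_abs[OF int[of g]] by simp
    show "AE x in lborel. integrable lborel (\<lambda>y. case (x, y) of (x, y) \<Rightarrow> k x y)"
      unfolding k_def by (auto intro!: integrable_mult_right int)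
  qed
  have pairc: "integrable (lborel \<Otimes>\<^sub>M lborel) (\<lambda>(x, y). c x y * k x y)"
  proof (rule Bochner_Integration.integrable_bound[OF pair])
    show "(\<lambda>(x, y). c x y * k x y) \<in> borel_measurable (lborel \<Otimes>\<^sub>M lborel)" unfolding k_def c_def by measurable
    show "AE x in lborel \<Otimes>\<^sub>M lborel. norm (case x of (x, y) \<Rightarrow> c x y * k x y) \<le> norm (case x of (x, y) \<Rightarrow> k x y)"
      by (auto simp: c_def)
  qed
  have low: "?I x * (low L x \<bullet> f) * rep_l2 g x = (\<integral>y. c x y * k x y \<partial>lborel)" for x
  proof (cases "x \<in> {0<..<L}")
    case True
    have "low L x \<bullet> f = (\<integral>y. indicat_real {0<..<min x L} y * rep_l2 f y \<partial>lborel)"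
      unfolding low_def by (rule inner_ind[of _ 0 L]) auto
    also have "\<dots> = (\<integral>y. c x y * (?I y * rep_l2 f y) \<partial>lborel)"
      using True by (intro Bochner_Integration.integral_cong) (auto simp: c_def indicator_def)
    finally have "?I x * (low L x \<bullet> f) * rep_l2 g x = (\<integral>y. (?I x * rep_l2 g x) * (c x y * (?I y * rep_l2 f y)) \<partial>lborel)"
      by simp
    then show ?thesis by (simp add: k_def mult_ac)
  qed (simp add: k_def)
  have upp: "?I y * (upp L y \<bullet> g) * rep_l2 f y = (\<integral>x. c x y * k x y \<partial>lborel)" for y
  proof (cases "y \<in> {0<..<L}")
    case True
    have "upp L y \<bullet> g = (\<integral>x. indicat_real {max y 0<..<L} x * rep_l2 g x \<partial>lborel)"
      unfolding upp_def by (rule inner_ind[of _ 0 L]) auto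
    also have "\<dots> = (\<integral>x. c x y * (?I x * rep_l2 g x) \<partial>lborel)"
      using True by (intro Bochner_Integration.integral_cong) (auto simp: c_def indicator_def)
    finally have "?I y * (upp L y \<bullet> g) * rep_l2 f y = (\<integral>x. (?I y * rep_l2 f y) * (c x y * (?I x * rep_l2 g x)) \<partial>lborel)"
      by simp
    then show ?thesis by (simp add: k_def mult_ac)
  qed (simp add: k_def)
  have "vol L f \<bullet> g = (\<integral>x. ?I x * (low L x \<bullet> f) * rep_l2 g x \<partial>lborel)"
    unfolding vol_def curve_op_def by (rule inner_abs_l2[OF curve_op_sq[OF low_continuous]])
  also have "\<dots> = (\<integral>x. (\<integral>y. c x y * k x y \<partial>lborel) \<partial>lborel)" unfolding low ..
  also have "\<dots> = (\<integral>y. (\<integral>x. c x y * k x y \<partial>lborel) \<partial>lborel)"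
    by (rule lborel_pair.Fubini_integral[symmetric, OF pairc])
  also have "\<dots> = (\<integral>y. ?I y * (upp L y \<bullet> g) * rep_l2 f y \<partial>lborel)" unfolding upp ..
  also have "\<dots> = vol_adj L g \<bullet> f"
    unfolding vol_adj_def curve_op_def by (rule inner_abs_l2[OF curve_op_sq[OF upp_continuous], symmetric])
  finally show ?thesis by (simp add: inner_commute)
qed

text \<open>The orthogonal projection onto \<open>L2_on L\<close>, which is its set of fixed points.
  Arbitrary test vectors are reduced by it to vectors on the beam.\<close>

definition cut :: "real \<Rightarrow> l2 \<Rightarrow> l2"
  where "cut L f = abs_l2 (\<lambda>x. indicat_real {0<..<L} x * rep_l2 f x)"

lemma sq_integrable_cut: "sq_integrable (\<lambda>x. indicat_real {0<..<L} x * rep_l2 f x)"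
  by (rule sq_integrable_bound[OF _ sq_integrable_rep[of f]]) (auto simp: indicator_def)

lemma cut_rep: "AE x in lborel. rep_l2 (cut L f) x = indicat_real {0<..<L} x * rep_l2 f x"
  unfolding cut_def by (rule rep_abs_l2[OF sq_integrable_cut])

lemma L2_on_iff_cut: "f \<in> L2_on L \<longleftrightarrow> cut L f = f"
proof
  assume "f \<in> L2_on L"
  then have "AE x in lborel. x \<notin> {0<..<L} \<longrightarrow> rep_l2 f x = 0" by (simp add: L2_on_def)
  with cut_rep[of L f] have "AE x in lborel. rep_l2 (cut L f) x = rep_l2 f x"
    by eventually_elim (auto simp: indicator_def)
  then show "cut L f = f" by (rule l2_eqI)
next
  assume "cut L f = f"
  then have "AE x in lborel. rep_l2 f x = indicat_real {0<..<L} x * rep_l2 f x" using cut_rep[of L f] by simp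
  then show "f \<in> L2_on L" unfolding L2_on_def by (auto elim!: eventually_mono simp: indicator_def)
qed

lemma cut_inner: "cut L f \<bullet> g = f \<bullet> cut L g"
proof -
  have "cut L f \<bullet> g = (\<integral>x. indicat_real {0<..<L} x * rep_l2 f x * rep_l2 g x \<partial>lborel)"
    unfolding cut_def by (rule inner_abs_l2[OF sq_integrable_cut])
  also have "\<dots> = (\<integral>x. indicat_real {0<..<L} x * rep_l2 g x * rep_l2 f x \<partial>lborel)" by (simp add: mult_ac)
  also have "\<dots> = cut L g \<bullet> f" unfolding cut_def by (rule inner_abs_l2[OF sq_integrable_cut, symmetric])
  finally show ?thesis by (simp add: inner_commute)
qed

lemma norm_cut_le: "norm (cut L f) \<le> norm f"
proof (rule power2_le_imp_le)
  have "(norm (cut L f))\<^sup>2 = (\<integral>x. (indicat_real {0<..<L} x * rep_l2 f x)\<^sup>2 \<partial>lborel)"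
    unfolding cut_def by (rule norm_abs_l2[OF sq_integrable_cut])
  also have "\<dots> \<le> (\<integral>x. (rep_l2 f x)\<^sup>2 \<partial>lborel)"
    using sq_integrable_cut[of L f] sq_integrable_rep[of f]
    by (intro integral_mono) (auto simp: sq_integrable_def indicator_def)
  finally show "(norm (cut L f))\<^sup>2 \<le> (norm f)\<^sup>2" by (simp add: norm_l2_sq)
qed simp

lemma bounded_linear_cut: "bounded_linear (cut L)"
proof (rule bounded_linear_intro[where K = 1])
  fix f g :: l2 and r :: real
  show "cut L (f + g) = cut L f + cut L g"
  proof (rule l2_eqI)
    show "AE x in lborel. rep_l2 (cut L (f + g)) x = rep_l2 (cut L f + cut L g) x"
      using cut_rep[of L "f + g"] rep_add[of f g] cut_rep[of L f] cut_rep[of L g] rep_add[of "cut L f" "cut L g"]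
      by eventually_elim (simp add: distrib_left)
  qed
  show "cut L (r *\<^sub>R f) = r *\<^sub>R cut L f"
  proof (rule l2_eqI)
    show "AE x in lborel. rep_l2 (cut L (r *\<^sub>R f)) x = rep_l2 (r *\<^sub>R cut L f) x"
      using cut_rep[of L "r *\<^sub>R f"] rep_scale[of r f] cut_rep[of L f] rep_scale[of r "cut L f"]
      by eventually_elim simp
  qed
  show "norm (cut L f) \<le> norm f * 1" using norm_cut_le by simp
qed

lemma cut_L2_on: "cut L f \<in> L2_on L"
  unfolding L2_on_def using cut_rep[of L f] by (auto elim!: eventually_mono)

lemma subspace_L2_on: "subspace (L2_on L)"
proof -
  interpret bounded_linear "cut L" by (rule bounded_linear_cut)
  show ?thesis unfolding subspace_def by (simp add: L2_on_iff_cut zero add scale)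
qed

lemma vol_L2_on: "vol L f \<in> L2_on L" and vol_adj_L2_on: "vol_adj L f \<in> L2_on L"
proof -
  show "vol L f \<in> L2_on L" unfolding L2_on_def using vol_rep[of L f] by (auto elim!: eventually_mono)
  show "vol_adj L f \<in> L2_on L" unfolding L2_on_def using vol_adj_rep[of L f] by (auto elim!: eventually_mono)
qed

section \<open>Test functions\<close>

text \<open>The class of functions \<open>p e^(-1/q) / q^k\<close> on \<open>q > 0\<close>, where \<open>p\<close> is a polynomial and
  \<open>q = N (x - c) (d - x)\<close>, is closed under differentiation.\<close>

definition quad :: "real \<Rightarrow> real \<Rightarrow> real \<Rightarrow> real poly"
  where "quad N c d = smult N ([:- c, 1:] * [:d, -1:])"

definition bumpf :: "real poly \<Rightarrow> nat \<Rightarrow> real poly \<Rightarrow> real \<Rightarrow> real"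
  where "bumpf q k p x = (if poly q x > 0 then poly p x / poly q x ^ k * exp (- 1 / poly q x) else 0)"

text \<open>The numerator of p'/q^k - k p q'/q^(k+1) + p q'/q^(k+2) over the common denominator
  q^(k+2).\<close>

definition bump_deriv :: "real poly \<Rightarrow> nat \<Rightarrow> real poly \<Rightarrow> real poly"
  where "bump_deriv q k p = pderiv p * q\<^sup>2 - smult (real k) (p * pderiv q * q) + p * pderiv q"

text \<open>A single term of the exponential series at 1 / q bounds exp(1 / q) from below.\<close>

lemma exp_neg_inverse_le:
  fixes q :: real assumes "0 < q" shows "exp (- 1 / q) \<le> fact m * q ^ m"
proof -
  have "(1 / q) ^ m / fact m \<le> exp (1 / q)"
  proof -
    have "(\<Sum>j\<in>{m}. (1 / q) ^ j /\<^sub>R fact j) \<le> exp (1 / q)"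
      unfolding exp_def using assms summable_exp_generic[of "1 / q"] by (intro sum_le_suminf) auto
    then show ?thesis by (simp add: divide_inverse mult.commute)
  qed
  then have "1 / exp (1 / q) \<le> 1 / ((1 / q) ^ m / fact m)"
    using assms by (intro divide_left_mono) auto
  then show ?thesis by (simp add: exp_minus power_divide field_simps)
qed

text \<open>Only zeros of q need an argument. There q has a factor y - x, and the exponential,
  estimated by the power k + 2 of q, leaves two powers after division by q^k. So the function is
  quadratically small and has derivative 0.\<close>

lemma bumpf_has_derivative:
  "(bumpf q k p has_real_derivative bumpf q (k + 2) (bump_deriv q k p) x) (at x)"
proof -
  consider "poly q x > 0" | "poly q x < 0" | "poly q x = 0" by linarith
  then show ?thesis
  proof cases
    case 1
    have op: "open {x. 0 < poly q x}" by (intro open_Collect_less continuous_intros)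
    have d1: "((\<lambda>x. exp (- 1 / poly q x)) has_real_derivative exp (- 1 / poly q x) * (poly (pderiv q) x / (poly q x * poly q x))) (at x)"
      using 1 by (auto intro!: derivative_eq_intros)
    have d2: "((\<lambda>x. poly p x / poly q x ^ k) has_real_derivative
      (poly (pderiv p) x * poly q x ^ k - poly p x * (real k * poly q x ^ (k - 1) * poly (pderiv q) x)) / (poly q x ^ k * poly q x ^ k)) (at x)"
      by (rule DERIV_cong[OF DERIV_divide[OF poly_DERIV DERIV_power[OF poly_DERIV]]])
        (use 1 in \<open>simp_all add: mult.commute mult.left_commute\<close>)
    from DERIV_mult[OF d2 d1] have "((\<lambda>x. poly p x / poly q x ^ k * exp (- 1 / poly q x)) has_real_derivative
      (poly (pderiv p) x * poly q x ^ k - poly p x * (real k * poly q x ^ (k - 1) * poly (pderiv q) x)) / (poly q x ^ k * poly q x ^ k) * exp (- 1 / poly q x)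
       + poly p x / poly q x ^ k * (exp (- 1 / poly q x) * (poly (pderiv q) x / (poly q x * poly q x)))) (at x)"
      by (simp only: mult.commute add.commute)
    moreover have "(poly (pderiv p) x * poly q x ^ k - poly p x * (real k * poly q x ^ (k - 1) * poly (pderiv q) x)) / (poly q x ^ k * poly q x ^ k) * exp (- 1 / poly q x)
       + poly p x / poly q x ^ k * (exp (- 1 / poly q x) * (poly (pderiv q) x / (poly q x * poly q x))) = bumpf q (k + 2) (bump_deriv q k p) x"
      using 1 by (cases k) (simp_all add: bumpf_def bump_deriv_def field_simps power2_eq_square)
    ultimately have "((\<lambda>x. poly p x / poly q x ^ k * exp (- 1 / poly q x)) has_real_derivative bumpf q (k + 2) (bump_deriv q k p) x) (at x)"
      by simp
    then show ?thesis
      by (rule has_field_derivative_transform_within_open[OF _ op]) (use 1 in \<open>auto simp: bumpf_def\<close>)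
  next
    case 2
    have op: "open {x. poly q x < 0}" by (intro open_Collect_less continuous_intros)
    have "bumpf q (k + 2) (bump_deriv q k p) x = 0" using 2 by (simp add: bumpf_def)
    then have "((\<lambda>x. 0) has_real_derivative bumpf q (k + 2) (bump_deriv q k p) x) (at x)" by simp
    then show ?thesis
      by (rule has_field_derivative_transform_within_open[OF _ op]) (use 2 in \<open>auto simp: bumpf_def\<close>)
  next
    case 3
    then obtain r where r: "q = [:- x, 1:] * r" using poly_eq_0_iff_dvd by (metis dvdE)
    let ?S = "{x - 1..x + 1}"
    have bd: "\<exists>B. \<forall>y\<in>?S. norm (poly s y) \<le> B" for s :: "real poly"
    proof -
      have "bounded (poly s ` ?S)"
        by (intro compact_imp_bounded compact_continuous_image continuous_intros) auto
      then show ?thesis unfolding bounded_iff by blast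
    qed
    obtain P where P: "\<And>y. y \<in> ?S \<Longrightarrow> \<bar>poly p y\<bar> \<le> P"
      using bd[of p] unfolding real_norm_def by blast
    obtain R where R: "\<And>y. y \<in> ?S \<Longrightarrow> \<bar>poly r y\<bar> \<le> R"
      using bd[of r] unfolding real_norm_def by blast
    have P0: "0 \<le> P" using P[of x] abs_ge_zero[of "poly p x"] by auto
    have "(bumpf q k p has_real_derivative 0) (at x within ?S)"
    proof (rule quadratic_bound_deriv_zero[where c = "P * (fact (k + 2) * R\<^sup>2)"])
      show "x \<in> ?S" by simp
      fix y assume y: "y \<in> ?S"
      show "\<bar>bumpf q k p y\<bar> \<le> P * (fact (k + 2) * R\<^sup>2) * (y - x)\<^sup>2"
      proof (cases "poly q y > 0")
        case True
        have qy: "(poly q y)\<^sup>2 \<le> R\<^sup>2 * (y - x)\<^sup>2"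
        proof -
          have "poly q y = poly r y * (y - x)" by (simp add: r algebra_simps)
          then have "(poly q y)\<^sup>2 = (poly r y)\<^sup>2 * (y - x)\<^sup>2" by (simp add: power_mult_distrib)
          moreover have "(poly r y)\<^sup>2 \<le> R\<^sup>2" using power_mono[OF R[OF y] abs_ge_zero, of 2] by simp
          ultimately show ?thesis by (simp add: mult_right_mono)
        qed
        have "exp (- 1 / poly q y) / poly q y ^ k \<le> fact (k + 2) * poly q y ^ (k + 2) / poly q y ^ k"
          by (intro divide_right_mono exp_neg_inverse_le True) (use True in auto)
        also have "\<dots> = fact (k + 2) * (poly q y)\<^sup>2" using True by (simp add: power_add power2_eq_square)
        also have "\<dots> \<le> fact (k + 2) * (R\<^sup>2 * (y - x)\<^sup>2)" by (intro mult_left_mono qy) simp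
        finally have e: "exp (- 1 / poly q y) / poly q y ^ k \<le> fact (k + 2) * (R\<^sup>2 * (y - x)\<^sup>2)" .
        have "\<bar>bumpf q k p y\<bar> = \<bar>poly p y\<bar> * (exp (- 1 / poly q y) / poly q y ^ k)"
          using True by (simp add: bumpf_def abs_mult)
        also have "\<dots> \<le> P * (fact (k + 2) * (R\<^sup>2 * (y - x)\<^sup>2))"
          by (intro mult_mono P y e P0) (use True in auto)
        finally show ?thesis by (simp add: mult_ac)
      next
        case False
        then show ?thesis using P0 by (simp add: bumpf_def)
      qed
    qed
    then have "(bumpf q k p has_real_derivative 0) (at x)" by (simp add: at_within_Icc_at)
    moreover have "bumpf q (k + 2) (bump_deriv q k p) x = 0" using 3 by (simp add: bumpf_def)
    ultimately show ?thesis by simp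
  qed
qed

text \<open>A sequence of successive derivatives is easy to exhibit for a family closed under
  differentiation and to extend by a primitive; \<open>smooth_iff\<close> connects it with iterated
  \<open>deriv\<close>.\<close>

definition smooth :: "(real \<Rightarrow> real) \<Rightarrow> bool"
  where "smooth f \<longleftrightarrow> (\<exists>F. F 0 = f \<and> (\<forall>n x. (F n has_real_derivative F (Suc n) x) (at x)))"

lemma smooth_bumpf: "smooth (bumpf q k p)"
proof -
  define F where "F n = (\<lambda>(k, p). bumpf q k p) (((\<lambda>(k, p). (k + 2, bump_deriv q k p)) ^^ n) (k, p))" for n
  have "(F n has_real_derivative F (Suc n) x) (at x)" for n x
    unfolding F_def using bumpf_has_derivative
    by (cases "((\<lambda>(k, p). (k + 2, bump_deriv q k p)) ^^ n) (k, p)") simp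
  moreover have "F 0 = bumpf q k p" by (simp add: F_def)
  ultimately show ?thesis unfolding smooth_def by blast
qed

lemma smooth_lincomb: assumes "smooth f" "smooth g" shows "smooth (\<lambda>x. f x - k * g x)"
proof -
  obtain F G where F: "F 0 = f" "\<And>n x. (F n has_real_derivative F (Suc n) x) (at x)"
    and G: "G 0 = g" "\<And>n x. (G n has_real_derivative G (Suc n) x) (at x)"
    using assms unfolding smooth_def by metis
  show ?thesis unfolding smooth_def
    by (rule exI[of _ "\<lambda>n x. F n x - k * G n x"]) (auto simp: F(1) G(1) intro!: DERIV_diff DERIV_cmult F(2) G(2))
qed

lemma smooth_primitive: assumes "smooth f" "\<And>x. (g has_real_derivative f x) (at x)" shows "smooth g"
proof -
  obtain F where F: "F 0 = f" "\<And>n x. (F n has_real_derivative F (Suc n) x) (at x)"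
    using assms(1) unfolding smooth_def by metis
  show ?thesis unfolding smooth_def
  proof (intro exI[of _ "\<lambda>n. case n of 0 \<Rightarrow> g | Suc m \<Rightarrow> F m"] conjI allI)
    fix n x
    show "((case n of 0 \<Rightarrow> g | Suc m \<Rightarrow> F m) has_real_derivative (case Suc n of 0 \<Rightarrow> g | Suc m \<Rightarrow> F m) x) (at x)"
      using assms(2) F by (cases n) auto
  qed simp
qed

lemma smooth_continuous: "smooth f \<Longrightarrow> continuous_on S f"
  unfolding smooth_def by (metis DERIV_isCont continuous_at_imp_continuous_on)

lemma smooth_iff: "smooth f \<longleftrightarrow> (\<forall>n x. (deriv ^^ n) f differentiable (at x))"
proof
  assume "smooth f"
  then obtain F where F: "F 0 = f" "\<And>n x. (F n has_real_derivative F (Suc n) x) (at x)"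
    unfolding smooth_def by metis
  have "(deriv ^^ n) f = F n" for n
  proof (induction n)
    case (Suc n)
    then show ?case using DERIV_imp_deriv[OF F(2)] by auto
  qed (simp add: F)
  then show "\<forall>n x. (deriv ^^ n) f differentiable (at x)"
    using F(2) by (auto simp: real_differentiable_def)
next
  assume "\<forall>n x. (deriv ^^ n) f differentiable (at x)"
  then have "((deriv ^^ n) f has_real_derivative (deriv ^^ Suc n) f x) (at x)" for n x
    using DERIV_deriv_iff_real_differentiable by simp
  then show "smooth f" unfolding smooth_def by (intro exI[of _ "\<lambda>n. (deriv ^^ n) f"]) simp
qed

lemma smooth_deriv: "smooth f \<Longrightarrow> (f has_real_derivative deriv f x) (at x)" and smooth_deriv_smooth: "smooth f \<Longrightarrow> smooth (deriv f)"
proof -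
  assume f: "smooth f"
  then have "(deriv ^^ 0) f differentiable (at x)" unfolding smooth_iff by blast
  then show "(f has_real_derivative deriv f x) (at x)" by (simp add: DERIV_deriv_iff_real_differentiable)
  have "(deriv ^^ n) (deriv f) = (deriv ^^ Suc n) f" for n by (simp only: funpow_Suc_right o_apply)
  then show "smooth (deriv f)" using f unfolding smooth_iff by metis
qed

lemma test_function_iff:
  "test_function a b \<phi> \<longleftrightarrow> smooth \<phi> \<and> (\<exists>c d. a < c \<and> d < b \<and> (\<forall>x. x \<notin> {c..d} \<longrightarrow> \<phi> x = 0))"
  by (simp add: test_function_def smooth_iff)

text \<open>As N grows, the values inside (c, d) tend to 1, so these functions approximate
  indicators of intervals from below.\<close>

definition bump :: "real \<Rightarrow> real \<Rightarrow> real \<Rightarrow> real \<Rightarrow> real"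
  where "bump N c d = bumpf (quad N c d) 0 1"

lemma bump_eq: "bump N c d x = (if 0 < N * ((x - c) * (d - x)) then exp (- 1 / (N * ((x - c) * (d - x)))) else 0)"
proof -
  have "poly (quad N c d) x = N * ((x - c) * (d - x))" by (simp add: quad_def algebra_simps)
  then show ?thesis by (simp add: bump_def bumpf_def)
qed

lemma bump_pos_iff: fixes N :: real assumes "0 < N" "c \<le> d" shows "0 < N * ((x - c) * (d - x)) \<longleftrightarrow> x \<in> {c<..<d}"
proof -
  have "0 < N * ((x - c) * (d - x)) \<longleftrightarrow> 0 < (x - c) * (d - x)" unfolding zero_less_mult_iff[of N] using assms(1) by auto
  also have "\<dots> \<longleftrightarrow> x \<in> {c<..<d}" unfolding zero_less_mult_iff using assms(2) by auto
  finally show ?thesis .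
qed

lemma bump_support: "0 < N \<Longrightarrow> c \<le> d \<Longrightarrow> x \<notin> {c<..<d} \<Longrightarrow> bump N c d x = 0"
  using bump_pos_iff[of N c d x] by (simp add: bump_eq)

lemma bump_bounds: "0 \<le> bump N c d x" "bump N c d x \<le> 1"
  by (auto simp: bump_eq)

lemma smooth_bump: "smooth (bump N c d)"
  unfolding bump_def by (rule smooth_bumpf)

lemma integral_bump_pos:
  assumes "c < d" shows "0 < integral {c..d} (bump 1 c d)"
proof -
  have c: "continuous_on {c..d} (bump 1 c d)" by (rule smooth_continuous[OF smooth_bump])
  have "integral {c..d} (bump 1 c d) \<noteq> 0"
  proof
    assume "integral {c..d} (bump 1 c d) = 0"
    then have "\<forall>x\<in>{c..d}. bump 1 c d x = 0"
      using integral_eq_0_iff[OF c] assms bump_bounds by auto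
    then have "bump 1 c d ((c + d) / 2) = 0" using assms by auto
    moreover have "0 < 1 * (((c + d) / 2 - c) * (d - (c + d) / 2))"
      by (subst bump_pos_iff) (use assms in auto)
    ultimately show False by (simp add: bump_eq)
  qed
  moreover have "0 \<le> integral {c..d} (bump 1 c d)"
    by (intro integral_nonneg integrable_continuous_real c) (simp add: bump_bounds)
  ultimately show ?thesis by simp
qed

lemma test_function_primitive:
  assumes s: "smooth \<xi>" and ab: "a < c" "d < b" and z: "\<And>x. x \<notin> {c..d} \<Longrightarrow> \<xi> x = 0"
    and i: "integral {c..d} \<xi> = 0"
  shows "\<exists>\<phi>. test_function a b \<phi> \<and> deriv \<phi> = \<xi>"
proof -
  \<comment> \<open>Starting at c - 1 leaves room for a two-sided derivative at c, and the vanishing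
    integral over [c, d] makes the primitive vanish to the right of d.\<close>
  define \<phi> where "\<phi> x = integral {c - 1..x} \<xi>" for x
  have cont: "continuous_on S \<xi>" for S by (rule smooth_continuous[OF s])
  have int: "\<xi> integrable_on {x..y}" for x y by (intro integrable_continuous_real cont)
  have low: "\<phi> x = 0" if "x < c" for x
  proof -
    have "integral {c - 1..x} \<xi> = integral {c - 1..x} (\<lambda>_. 0)"
      by (rule integral_cong) (use that z in auto)
    then show ?thesis by (simp add: \<phi>_def)
  qed
  have high: "\<phi> x = 0" if x: "d < x" "c \<le> x" for x
  proof -
    have "\<phi> x = integral {c - 1..c} \<xi> + integral {c..x} \<xi>"
      unfolding \<phi>_def using x by (intro Henstock_Kurzweil_Integration.integral_combine[symmetric] int) auto
    moreover have "integral {c - 1..c} \<xi> = integral {c - 1..c} (\<lambda>_. 0)"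
      by (rule integral_spike[of "{c}"]) (use z in auto)
    moreover have "integral {c..x} \<xi> = 0"
    proof (cases "c \<le> d")
      case True
      have "integral {c..x} \<xi> = integral {c..d} \<xi> + integral {d..x} \<xi>"
        using x True by (intro Henstock_Kurzweil_Integration.integral_combine[symmetric] int) auto
      moreover have "integral {d..x} \<xi> = integral {d..x} (\<lambda>_. 0)"
        by (rule integral_spike[of "{d}"]) (use z in auto)
      ultimately show ?thesis using i by simp
    next
      case False
      then have "integral {c..x} \<xi> = integral {c..x} (\<lambda>_. 0)" using z by (intro integral_cong) auto
      then show ?thesis by simp
    qed
    ultimately show ?thesis by simp
  qed
  have der: "(\<phi> has_real_derivative \<xi> x) (at x)" for x
  proof (cases "x < c")
    case True
    have "((\<lambda>_. 0) has_real_derivative \<xi> x) (at x)" using z[of x] True by simp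
    then show ?thesis
      by (rule has_field_derivative_transform_within_open[of _ _ _ "{..<c}"]) (use True low in auto)
  next
    case False
    have "(\<phi> has_vector_derivative \<xi> x) (at x within {c - 1..x + 1})"
      unfolding \<phi>_def using False by (intro integral_has_vector_derivative cont) auto
    then show ?thesis using False
      by (simp add: has_real_derivative_iff_has_vector_derivative at_within_Icc_at)
  qed
  have "smooth \<phi>" using s der by (rule smooth_primitive)
  moreover have "\<phi> x = 0" if "x \<notin> {c..d}" for x
    using that low[of x] high[of x] by (cases "x < c") auto
  ultimately have "test_function a b \<phi>" unfolding test_function_iff using ab by blast
  moreover have "deriv \<phi> = \<xi>" using der by (auto intro: DERIV_imp_deriv)
  ultimately show ?thesis by blast
qed

section \<open>Distributional derivatives in \<open>L\<^sup>2(0, L)\<close>\<close>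

lemma test_sq_integrable:
  assumes "test_function 0 L \<phi>"
  shows "sq_integrable \<phi>" "sq_integrable (deriv \<phi>)"
    "\<And>x. x \<notin> {0<..<L} \<Longrightarrow> \<phi> x = 0" "\<And>x. x \<notin> {0<..<L} \<Longrightarrow> deriv \<phi> x = 0"
proof -
  obtain c d where cd: "0 < c" "d < L" "\<And>x. x \<notin> {c..d} \<Longrightarrow> \<phi> x = 0" and s: "smooth \<phi>"
    using assms unfolding test_function_iff by blast
  show z: "\<phi> x = 0" if "x \<notin> {0<..<L}" for x using cd that by auto
  have z': "deriv \<phi> x = 0" if "x \<notin> {c..d}" for x
  proof -
    have "((\<lambda>_. 0) has_real_derivative 0) (at x)" by simp
    then have "(\<phi> has_real_derivative 0) (at x)"
      by (rule has_field_derivative_transform_within_open[of _ _ _ "- {c..d}"]) (use cd that in auto)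
    then show ?thesis by (rule DERIV_imp_deriv)
  qed
  then show "deriv \<phi> x = 0" if "x \<notin> {0<..<L}" for x using cd that by auto
  have sq: "sq_integrable f" if f: "smooth f" and fz: "\<And>x. x \<notin> {c..d} \<Longrightarrow> f x = 0" for f
  proof -
    have fc: "continuous_on S f" for S by (rule smooth_continuous[OF f])
    have "bounded (f ` {c..d})" by (intro compact_imp_bounded compact_continuous_image fc) auto
    then obtain B where B: "\<And>x. x \<in> {c..d} \<Longrightarrow> \<bar>f x\<bar> \<le> B" unfolding bounded_iff real_norm_def by blast
    show ?thesis
    proof (rule sq_integrable_bound)
      show "f \<in> borel_measurable lborel" using borel_measurable_continuous_onI[OF fc] by simp
      show "sq_integrable (\<lambda>x. B * indicat_real {c..d} x)"
        by (intro sq_integrable_scale sq_integrable_ind[of _ c d]) auto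
      show "AE x in lborel. \<bar>f x\<bar> \<le> \<bar>B * indicat_real {c..d} x\<bar>"
      proof (intro AE_I2)
        fix x show "\<bar>f x\<bar> \<le> \<bar>B * indicat_real {c..d} x\<bar>"
          using B[of x] fz[of x] by (cases "x \<in> {c..d}") auto
      qed
    qed
  qed
  show "sq_integrable \<phi>" by (rule sq[OF s cd(3)])
  show "sq_integrable (deriv \<phi>)" by (rule sq[OF smooth_deriv_smooth[OF s] z'])
qed

lemma ortho_intervals_zero:
  assumes "\<And>a b. ind_l2 {a..b} \<bullet> u = 0" shows "u = 0"
proof -
  have 1: "rat_step xs \<bullet> u = 0" for xs
    by (induction xs) (auto simp: rat_step_def inner_add_left assms)
  have "u \<in> closure (range rat_step)" using rat_step_dense by simp
  then obtain x where x: "\<And>n. x n \<in> range rat_step" "x \<longlonglongrightarrow> u" unfolding closure_sequential by blast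
  have "(\<lambda>n. x n \<bullet> u) \<longlonglongrightarrow> u \<bullet> u" by (intro tendsto_intros x)
  moreover have "x n \<bullet> u = 0" for n using x(1)[of n] 1 by auto
  ultimately have "(\<lambda>n. 0) \<longlonglongrightarrow> u \<bullet> u" by simp
  then show ?thesis by (simp add: LIMSEQ_const_iff)
qed

lemma ind_AE_eq:
  assumes "A \<in> sets borel" "A \<subseteq> {a..b}" "B \<in> sets borel" "B \<subseteq> {a..b}" "finite F" "A - F = B - F"
  shows "ind_l2 A = ind_l2 B"
proof (rule abs_l2_eq)
  show "sq_integrable (indicat_real A)" "sq_integrable (indicat_real B)" using assms by (auto intro: sq_integrable_ind)
  have "AE x in lborel. x \<notin> F" using AE_not_in finite_imp_null_set_lborel[OF assms(5)] by blast
  then show "AE x in lborel. indicat_real A x = indicat_real B x"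
    by eventually_elim (use assms(6) in \<open>auto simp: indicator_def\<close>)
qed

lemma ind_cut: "A \<in> sets borel \<Longrightarrow> A \<subseteq> {a..b} \<Longrightarrow> cut L (ind_l2 A) = ind_l2 (A \<inter> {0<..<L})"
proof (rule l2_eqI)
  assume A: "A \<in> sets borel" "A \<subseteq> {a..b}"
  have "sq_integrable (indicat_real A)" "sq_integrable (indicat_real (A \<inter> {0<..<L}))"
    using A by (auto intro: sq_integrable_ind)
  from rep_abs_l2[OF this(1)] rep_abs_l2[OF this(2)] cut_rep[of L "ind_l2 A"]
  show "AE x in lborel. rep_l2 (cut L (ind_l2 A)) x = rep_l2 (ind_l2 (A \<inter> {0<..<L})) x"
    by eventually_elim (auto simp: indicator_def)
qed

lemma L2_on_zero_if_ortho:
  assumes u: "u \<in> L2_on L" and o: "\<And>p q. 0 \<le> p \<Longrightarrow> p < q \<Longrightarrow> q \<le> L \<Longrightarrow> ind_l2 {p<..<q} \<bullet> u = 0"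
  shows "u = 0"
proof (rule ortho_intervals_zero)
  fix a b
  have "ind_l2 {a..b} \<bullet> u = ind_l2 ({a..b} \<inter> {0<..<L}) \<bullet> u"
    using u cut_inner[of L "ind_l2 {a..b}" u] ind_cut[of "{a..b}" a b L] by (simp add: L2_on_iff_cut)
  also have "ind_l2 ({a..b} \<inter> {0<..<L}) = ind_l2 {max a 0<..<min b L}"
    by (rule ind_AE_eq[of _ a b _ "{a, b}"]) auto
  also have "\<dots> \<bullet> u = 0"
    using o[of "max a 0" "min b L"] by (cases "max a 0 < min b L") auto
  finally show "ind_l2 {a..b} \<bullet> u = 0" .
qed

abbreviation one :: "real \<Rightarrow> l2" where "one L \<equiv> ind_l2 {0<..<L}"

lemma one_L2_on: "one L \<in> L2_on L"
proof -
  have "{0<..<L} \<subseteq> {0..L}" by auto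
  from ind_cut[OF _ this, of L] show ?thesis by (simp add: L2_on_iff_cut)
qed

text \<open>A bump minus the multiple of a fixed \<rho> with equal integral is the derivative of a
  test function. So h minus a constant is orthogonal to every bump, hence to every interval
  indicator, of which bumps are limits.\<close>

lemma du_bois_reymond:
  assumes L: "0 < L" and h: "h \<in> L2_on L"
    and z: "\<And>\<phi>. test_function 0 L \<phi> \<Longrightarrow> abs_l2 (deriv \<phi>) \<bullet> h = 0"
  shows "\<exists>c. h = c *\<^sub>R one L"
proof -
  \<comment> \<open>The middle third keeps the support away from both ends of the interval.\<close>
  define \<rho> where "\<rho> = bump 1 (L/3) (2*L/3)"
  have bump_int: "integral {c'..d'} (bump N c d) = abs_l2 (bump N c d) \<bullet> one L"
    and bump_sq: "sq_integrable (bump N c d)"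
    if "0 < N" "c \<le> d" "0 < c" "d < L" "c' \<le> c" "d \<le> d'" for N c d c' d'
  proof -
    have bc: "continuous_on S (bump N c d)" for S by (rule smooth_continuous[OF smooth_bump])
    have bm [measurable]: "bump N c d \<in> borel_measurable borel" by (rule borel_measurable_continuous_onI[OF bc])
    show sq: "sq_integrable (bump N c d)"
    proof (rule sq_integrable_bound)
      show "sq_integrable (indicat_real {c<..<d})" by simp
      show "AE x in lborel. \<bar>bump N c d x\<bar> \<le> \<bar>indicat_real {c<..<d} x\<bar>"
        using bump_bounds[of N c d] bump_support[of N c d] that by (auto simp: indicator_def)
    qed simp
    have "abs_l2 (bump N c d) \<bullet> one L = (\<integral>x. bump N c d x * rep_l2 (one L) x \<partial>lborel)" by (rule inner_abs_l2[OF sq])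
    also have "\<dots> = (\<integral>x. indicat_real {c'..d'} x * bump N c d x \<partial>lborel)"
    proof (rule integral_cong_AE)
      show "AE x in lborel. bump N c d x * rep_l2 (one L) x = indicat_real {c'..d'} x * bump N c d x"
        using rep_abs_l2[OF sq_integrable_interval[of 0 L]]
      proof eventually_elim
        case (elim x)
        show ?case
          using bump_support[of N c d x] that by (cases "x \<in> {c<..<d}") (auto simp: elim)
      qed
    qed measurable
    also have "\<dots> = integral {c'..d'} (bump N c d)"
      using set_borel_integral_eq_integral(2)[OF borel_integrable_atLeastAtMost'[OF bc[of "{c'..d'}"]]]
      by (simp add: set_lebesgue_integral_def)
    finally show "integral {c'..d'} (bump N c d) = abs_l2 (bump N c d) \<bullet> one L" by simp
  qed
  define s where "s = abs_l2 \<rho> \<bullet> one L"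
  have s: "0 < s"
    using integral_bump_pos[of "L/3" "2*L/3"] bump_int[of 1 "L/3" "2*L/3" "L/3" "2*L/3"] L by (simp add: s_def \<rho>_def)
  \<comment> \<open>The only possible constant: the mean of h with weight \<rho>.\<close>
  define c0 where "c0 = (abs_l2 \<rho> \<bullet> h) / s"
  have bump_h: "abs_l2 (bump N c d) \<bullet> (h - c0 *\<^sub>R one L) = 0"
    if N: "0 < N" and cd: "c \<le> d" "0 < c" "d < L" for N c d
  proof -
    let ?c = "min c (L/3)" and ?d = "max d (2*L/3)"
    define k where "k = (abs_l2 (bump N c d) \<bullet> one L) / s"
    let ?\<xi> = "\<lambda>x. bump N c d x - k * \<rho> x"
    have "\<exists>\<phi>. test_function 0 L \<phi> \<and> deriv \<phi> = ?\<xi>"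
    proof (rule test_function_primitive)
      show "smooth ?\<xi>" unfolding \<rho>_def
        by (rule smooth_lincomb[of "bump N c d" "bump 1 (L/3) (2*L/3)" k, OF smooth_bump smooth_bump])
      show "0 < ?c" "?d < L" using cd L by auto
      show "?\<xi> x = 0" if x: "x \<notin> {?c..?d}" for x
      proof -
        have "x \<notin> {c<..<d}" "x \<notin> {L/3<..<2*L/3}" using x by auto
        then have "bump N c d x = 0" "bump 1 (L/3) (2*L/3) x = 0"
          using N cd L by (auto intro!: bump_support)
        then show ?thesis by (simp add: \<rho>_def)
      qed
      have "integral {?c..?d} ?\<xi> = integral {?c..?d} (bump N c d) - k * integral {?c..?d} \<rho>"
      proof -
        have i: "bump N' c' d' integrable_on {?c..?d}" for N' c' d'
          by (intro integrable_continuous_real smooth_continuous smooth_bump)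
        have "(\<lambda>x. k * bump 1 (L/3) (2*L/3) x) integrable_on {?c..?d}"
          by (rule integrable_on_mult_right[OF i])
        from integral_diff[OF i[of N c d] this] show ?thesis by (simp add: \<rho>_def)
      qed
      also have "\<dots> = 0"
        using bump_int[of N c d ?c ?d] bump_int[of 1 "L/3" "2*L/3" ?c ?d] N cd L s
        by (simp add: k_def s_def[symmetric] \<rho>_def[symmetric])
      finally show "integral {?c..?d} ?\<xi> = 0" .
    qed
    then obtain \<phi> where \<phi>: "test_function 0 L \<phi>" "deriv \<phi> = ?\<xi>" by blast
    have sq: "sq_integrable (bump N c d)" "sq_integrable \<rho>"
      using bump_sq[of N c d c d] bump_sq[of 1 "L/3" "2*L/3" "L/3" "2*L/3"] N cd L by (auto simp: \<rho>_def)
    have "abs_l2 (deriv \<phi>) = abs_l2 (bump N c d) - k *\<^sub>R abs_l2 \<rho>"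
      unfolding \<phi> using sq by (simp add: abs_l2_diff sq_integrable_scale abs_l2_scale)
    then have "abs_l2 (bump N c d) \<bullet> h = k * (abs_l2 \<rho> \<bullet> h)"
      using z[OF \<phi>(1)] by (simp add: inner_diff_left)
    then show ?thesis using s by (simp add: inner_diff_right c0_def k_def)
  qed
  have "h - c0 *\<^sub>R one L = 0"
  proof (rule L2_on_zero_if_ortho)
    show "h - c0 *\<^sub>R one L \<in> L2_on L"
      using h one_L2_on subspace_L2_on by (intro subspace_diff subspace_scale)
    fix p q assume pq: "0 \<le> p" "p < q" "q \<le> L"
    \<comment> \<open>A margin that tends to 0 and always leaves p + m n < q - m n; it keeps the
      supports compact in (0, L) even when p = 0 or q = L.\<close>
    define m where "m n = (q - p) / (3 + real n)" for n
    have m: "0 < m n" "2 * m n < q - p" for n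
    proof -
      have "m n < (q - p) / 2" unfolding m_def using pq by (intro divide_strict_left_mono) auto
      then show "2 * m n < q - p" by simp
      show "0 < m n" using pq by (simp add: m_def add_pos_nonneg)
    qed
    have "(\<lambda>n. (q - p) * (1 / real (n + 3))) \<longlonglongrightarrow> (q - p) * 0"
      by (intro tendsto_intros LIMSEQ_ignore_initial_segment[OF lim_1_over_n])
    then have m0: "m \<longlonglongrightarrow> 0" by (simp add: m_def[abs_def] add.commute)
    let ?\<psi> = "\<lambda>n. bump (real (Suc n)) (p + m n) (q - m n)"
    have "(\<lambda>n. abs_l2 (?\<psi> n)) \<longlonglongrightarrow> ind_l2 {p<..<q}"
    proof (rule l2_dominated_convergence[where h = "indicat_real {p<..<q}"])
      show "?\<psi> n \<in> borel_measurable lborel" for n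
        using borel_measurable_continuous_onI[OF smooth_continuous[OF smooth_bump]] by simp
      show "\<bar>?\<psi> n x\<bar> \<le> indicat_real {p<..<q} x" for n x
      proof (cases "x \<in> {p<..<q}")
        case False
        then have "x \<notin> {p + m n<..<q - m n}" using m[of n] by auto
        then show ?thesis using bump_support[of "real (Suc n)" "p + m n" "q - m n" x] m[of n] by simp
      qed (use bump_bounds in simp)
      show "(\<lambda>n. ?\<psi> n x) \<longlonglongrightarrow> indicat_real {p<..<q} x" for x
      proof (cases "x \<in> {p<..<q}")
        case True
        define l where "l n = (x - (p + m n)) * ((q - m n) - x)" for n
        have l: "l \<longlonglongrightarrow> (x - (p + 0)) * ((q - 0) - x)" unfolding l_def by (intro tendsto_intros m0)
        have pos: "0 < (x - (p + 0)) * ((q - 0) - x)" using True by simp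
        have "filterlim (\<lambda>n. real (Suc n) * l n) at_top sequentially"
          using filterlim_at_top_mult_tendsto_pos[OF l pos filterlim_compose[OF filterlim_real_sequentially filterlim_Suc]]
          by (simp add: mult.commute)
        then have "(\<lambda>n. - (1 / (real (Suc n) * l n))) \<longlonglongrightarrow> - 0"
          by (intro tendsto_minus tendsto_divide_0[OF tendsto_const] filterlim_at_top_imp_at_infinity)
        then have "(\<lambda>n. exp (- (1 / (real (Suc n) * l n)))) \<longlonglongrightarrow> exp (- 0)" by (rule tendsto_exp)
        moreover have "\<forall>\<^sub>F n in sequentially. exp (- (1 / (real (Suc n) * l n))) = ?\<psi> n x"
          using order_tendstoD(1)[OF l pos]
          by eventually_elim (simp add: bump_eq l_def[symmetric] zero_less_mult_iff)
        ultimately have "(\<lambda>n. ?\<psi> n x) \<longlonglongrightarrow> exp (- 0)" by (rule Lim_transform_eventually)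
        then show ?thesis using True by simp
      next
        case False
        then have "x \<notin> {p + m n<..<q - m n}" for n using m[of n] by auto
        then have "?\<psi> n x = 0" for n using bump_support[of "real (Suc n)" "p + m n" "q - m n" x] m[of n] by simp
        then show ?thesis using False by simp
      qed
    qed simp_all
    then have "(\<lambda>n. abs_l2 (?\<psi> n) \<bullet> (h - c0 *\<^sub>R one L)) \<longlonglongrightarrow> ind_l2 {p<..<q} \<bullet> (h - c0 *\<^sub>R one L)"
      by (intro tendsto_intros)
    moreover have "abs_l2 (?\<psi> n) \<bullet> (h - c0 *\<^sub>R one L) = 0" for n
    proof (rule bump_h)
      show "0 < real (Suc n)" by simp
      show "p + m n \<le> q - m n" "0 < p + m n" "q - m n < L" using m[of n] pq by auto
    qed
    ultimately have "(\<lambda>n. 0) \<longlonglongrightarrow> ind_l2 {p<..<q} \<bullet> (h - c0 *\<^sub>R one L)" by simp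
    then show "ind_l2 {p<..<q} \<bullet> (h - c0 *\<^sub>R one L) = 0" by (simp add: LIMSEQ_const_iff)
  qed
  then show ?thesis by auto
qed

text \<open>Says that G is the distributional derivative of F on (0, L), expressed by inner products
  of classes instead of integrals of representatives.\<close>

definition dpair :: "real \<Rightarrow> l2 \<Rightarrow> l2 \<Rightarrow> bool"
  where "dpair L F G \<longleftrightarrow> (\<forall>\<phi>. test_function 0 L \<phi> \<longrightarrow> abs_l2 (deriv \<phi>) \<bullet> F = - (abs_l2 \<phi> \<bullet> G))"

lemma integral_lebesgue_on:
  fixes f :: "real \<Rightarrow> real"
  assumes S: "S \<in> sets borel" and f: "(\<lambda>x. indicat_real S x * f x) \<in> borel_measurable borel"
  shows "integral\<^sup>L (lebesgue_on S) f = (\<integral>x. indicat_real S x * f x \<partial>lborel)"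
    and "integrable (lebesgue_on S) f \<longleftrightarrow> integrable lborel (\<lambda>x. indicat_real S x * f x)"
proof -
  have S': "S \<inter> space lebesgue \<in> sets lebesgue" using S by simp
  have "integral\<^sup>L (lebesgue_on S) f = (\<integral>x. indicat_real S x * f x \<partial>lebesgue)"
    using integral_restrict_space[OF S', of f] by simp
  also have "\<dots> = (\<integral>x. indicat_real S x * f x \<partial>lborel)"
    using f by (intro integral_completion) simp
  finally show "integral\<^sup>L (lebesgue_on S) f = (\<integral>x. indicat_real S x * f x \<partial>lborel)" .
  have "integrable (lebesgue_on S) f \<longleftrightarrow> integrable lebesgue (\<lambda>x. indicat_real S x * f x)"
    using integrable_restrict_space[OF S', of f] by simp
  also have "\<dots> \<longleftrightarrow> integrable lborel (\<lambda>x. indicat_real S x * f x)"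
    using f by (intro integrable_completion) simp
  finally show "integrable (lebesgue_on S) f \<longleftrightarrow> integrable lborel (\<lambda>x. indicat_real S x * f x)" .
qed

lemma distr_deriv_iff_dpair:
  assumes u: "sq_integrable (\<lambda>x. indicat_real {0<..<L} x * u x)" and v: "sq_integrable (\<lambda>x. indicat_real {0<..<L} x * v x)"
  shows "distr_deriv 0 L u v \<longleftrightarrow>
    dpair L (abs_l2 (\<lambda>x. indicat_real {0<..<L} x * u x)) (abs_l2 (\<lambda>x. indicat_real {0<..<L} x * v x))"
proof -
  let ?I = "indicat_real {0<..<L}"
  have int: "integrable (lebesgue_on {c..d}) u" if u: "sq_integrable (\<lambda>x. ?I x * u x)" and cd: "0 < c" "d < L" for c d u
  proof -
    have eq: "indicat_real {c..d} x * u x = indicat_real {c..d} x * (?I x * u x)" for x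
      using cd by (auto simp: indicator_def)
    have m: "(\<lambda>x. indicat_real {c..d} x * (?I x * u x)) \<in> borel_measurable borel"
      using u by (auto simp: sq_integrable_def)
    have "integrable lborel (\<lambda>x. indicat_real {c..d} x * (?I x * u x))"
      by (intro sq_integrable_mult u sq_integrable_ind[of _ c d]) auto
    then show ?thesis
      using m by (subst integral_lebesgue_on(2)) (simp_all only: eq, simp)
  qed
  have pair: "(\<integral>x. f x * u x \<partial>lebesgue_on {0<..<L}) = abs_l2 f \<bullet> abs_l2 (\<lambda>x. ?I x * u x)"
    if u: "sq_integrable (\<lambda>x. ?I x * u x)" and f: "sq_integrable f" for f u
  proof -
    have fm: "f \<in> borel_measurable borel" "(\<lambda>x. ?I x * u x) \<in> borel_measurable borel"
      using u f by (auto simp: sq_integrable_def)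
    have m: "(\<lambda>x. f x * (?I x * u x)) \<in> borel_measurable borel" using fm by (rule borel_measurable_times)
    have "(\<integral>x. f x * u x \<partial>lebesgue_on {0<..<L}) = (\<integral>x. ?I x * (f x * u x) \<partial>lborel)"
      by (rule integral_lebesgue_on(1)) (use m in \<open>simp_all add: mult.left_commute\<close>)
    also have "\<dots> = (\<integral>x. f x * rep_l2 (abs_l2 (\<lambda>x. ?I x * u x)) x \<partial>lborel)"
    proof (rule integral_cong_AE)
      show "AE x in lborel. ?I x * (f x * u x) = f x * rep_l2 (abs_l2 (\<lambda>x. ?I x * u x)) x"
        using rep_abs_l2[OF u] by eventually_elim simp
      show "(\<lambda>x. ?I x * (f x * u x)) \<in> borel_measurable lborel" using m by (simp add: mult.left_commute)
      show "(\<lambda>x. f x * rep_l2 (abs_l2 (\<lambda>x. ?I x * u x)) x) \<in> borel_measurable lborel" using fm by simp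
    qed
    also have "\<dots> = abs_l2 f \<bullet> abs_l2 (\<lambda>x. ?I x * u x)" by (rule inner_abs_l2[OF f, symmetric])
    finally show ?thesis .
  qed
  show ?thesis
    unfolding distr_deriv_def dpair_def real_scaleR_def
    using int[OF u] int[OF v] pair[OF u test_sq_integrable(2)] pair[OF v test_sq_integrable(1)] by auto
qed

text \<open>Integrating the derivative from x to L gives - \<phi> x, since a test function vanishes
  at L; over the whole interval it gives 0.\<close>

lemma test_vol_adj:
  assumes t: "test_function 0 L \<phi>"
  shows "vol_adj L (abs_l2 (deriv \<phi>)) = - abs_l2 \<phi>" "abs_l2 (deriv \<phi>) \<bullet> one L = 0"
proof -
  have s: "smooth \<phi>" using t by (simp add: test_function_iff)
  have ftc: "upp L x \<bullet> abs_l2 (deriv \<phi>) = \<phi> L - \<phi> (max x 0)" if "x \<le> L" "0 \<le> L" for x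
  proof -
    have sq: "sq_integrable (deriv \<phi>)" by (rule test_sq_integrable[OF t])
    have "upp L x \<bullet> abs_l2 (deriv \<phi>) = abs_l2 (deriv \<phi>) \<bullet> upp L x" by (rule inner_commute)
    also have "\<dots> = (\<integral>y. deriv \<phi> y * rep_l2 (upp L x) y \<partial>lborel)" by (rule inner_abs_l2[OF sq])
    also have "\<dots> = (\<integral>y. indicat_real {max x 0..L} y *\<^sub>R deriv \<phi> y \<partial>lborel)"
    proof (rule integral_cong_AE)
      have "AE y in lborel. y \<notin> {max x 0, L}" using AE_not_in finite_imp_null_set_lborel[of "{max x 0, L}"] by blast
      with rep_abs_l2[OF sq_integrable_interval[of "max x 0" L]]
      show "AE y in lborel. deriv \<phi> y * rep_l2 (upp L x) y = indicat_real {max x 0..L} y *\<^sub>R deriv \<phi> y"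
        unfolding upp_def by eventually_elim (auto simp: indicator_def)
      have dm: "deriv \<phi> \<in> borel_measurable borel" using sq by (simp add: sq_integrable_def)
      show "(\<lambda>y. deriv \<phi> y * rep_l2 (upp L x) y) \<in> borel_measurable lborel"
        "(\<lambda>y. indicat_real {max x 0..L} y *\<^sub>R deriv \<phi> y) \<in> borel_measurable lborel" using dm by simp_all
    qed
    also have "\<dots> = \<phi> L - \<phi> (max x 0)"
    proof (rule integral_FTC_Icc)
      show "max x 0 \<le> L" using that by simp
      show "(\<phi> has_vector_derivative deriv \<phi> y) (at y within {max x 0..L})" for y
        using smooth_deriv[OF s, of y] unfolding has_real_derivative_iff_has_vector_derivative
        by (rule has_vector_derivative_at_within)
      show "continuous_on {max x 0..L} (deriv \<phi>)" by (rule smooth_continuous[OF smooth_deriv_smooth[OF s]])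
    qed
    finally show ?thesis .
  qed
  show "vol_adj L (abs_l2 (deriv \<phi>)) = - abs_l2 \<phi>"
  proof (rule l2_eqI)
    have "AE x in lborel. rep_l2 (- abs_l2 \<phi>) x = - \<phi> x"
      using rep_scale[of "-1" "abs_l2 \<phi>"] rep_abs_l2[OF test_sq_integrable(1)[OF t]] by eventually_elim simp
    with vol_adj_rep[of L "abs_l2 (deriv \<phi>)"]
    show "AE x in lborel. rep_l2 (vol_adj L (abs_l2 (deriv \<phi>))) x = rep_l2 (- abs_l2 \<phi>) x"
    proof eventually_elim
      case (elim x)
      show ?case
        using elim ftc[of x] test_sq_integrable(3)[OF t, of x] test_sq_integrable(3)[OF t, of L]
        by (cases "x \<in> {0<..<L}") auto
    qed
  qed
  show "abs_l2 (deriv \<phi>) \<bullet> one L = 0"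
  proof (cases "0 \<le> L")
    case True
    then have "abs_l2 (deriv \<phi>) \<bullet> one L = upp L 0 \<bullet> abs_l2 (deriv \<phi>)" by (simp add: upp_def inner_commute)
    also have "\<dots> = 0"
      using ftc[of 0] True test_sq_integrable(3)[OF t, of 0] test_sq_integrable(3)[OF t, of L] by simp
    finally show ?thesis .
  qed simp
qed

text \<open>By adjointness, F - V G annihilates the derivatives of all test functions exactly when
  the pairing relation holds, and then it is constant.\<close>

lemma dpair_iff:
  assumes L: "0 < L" and F: "F \<in> L2_on L"
  shows "dpair L F G \<longleftrightarrow> (\<exists>c. F = vol L G + c *\<^sub>R one L)"
proof
  assume d: "dpair L F G"
  have "\<exists>c. F - vol L G = c *\<^sub>R one L"
  proof (rule du_bois_reymond[OF L])
    show "F - vol L G \<in> L2_on L" by (intro subspace_diff subspace_L2_on F vol_L2_on)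
    fix \<phi> assume t: "test_function 0 L \<phi>"
    then show "abs_l2 (deriv \<phi>) \<bullet> (F - vol L G) = 0"
      using d vol_adjoint[of L G "abs_l2 (deriv \<phi>)"]
      by (simp add: dpair_def inner_diff_right test_vol_adj inner_commute[of _ "vol L G"] inner_commute[of G])
  qed
  then show "\<exists>c. F = vol L G + c *\<^sub>R one L" by (metis diff_eq_eq add.commute)
next
  assume "\<exists>c. F = vol L G + c *\<^sub>R one L"
  then obtain c where c: "F = vol L G + c *\<^sub>R one L" by blast
  show "dpair L F G" unfolding dpair_def c
  proof (intro allI impI)
    fix \<phi> assume t: "test_function 0 L \<phi>"
    have "abs_l2 (deriv \<phi>) \<bullet> vol L G = G \<bullet> vol_adj L (abs_l2 (deriv \<phi>))"
      using vol_adjoint[of L G "abs_l2 (deriv \<phi>)"] inner_commute by metis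
    then show "abs_l2 (deriv \<phi>) \<bullet> (vol L G + c *\<^sub>R one L) = - (abs_l2 \<phi> \<bullet> G)"
      using test_vol_adj[OF t] by (simp add: inner_add_right inner_commute[of G])
  qed
qed

text \<open>If the functions differ at x, they differ on a relative neighbourhood of x in [0, L];
  even at an end point this contains an open interval, which has positive measure.\<close>

lemma continuous_AE_eq:
  fixes u v :: "real \<Rightarrow> real"
  assumes L: "0 < L" and u: "continuous_on {0..L} u" and v: "continuous_on {0..L} v"
    and eq: "AE x in lborel. x \<in> {0<..<L} \<longrightarrow> u x = v x" and x: "x \<in> {0..L}"
  shows "u x = v x"
proof (rule ccontr)
  assume ne: "u x \<noteq> v x"
  have "continuous_on {0..L} (\<lambda>x. u x - v x)" using u v by (intro continuous_intros)
  then obtain e where e: "0 < e" "\<And>y. y \<in> {0..L} \<Longrightarrow> dist y x < e \<Longrightarrow> dist (u y - v y) (u x - v x) < \<bar>u x - v x\<bar>"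
    using x ne unfolding continuous_on_iff by (metis zero_less_abs_iff right_minus_eq)
  have ney: "u y \<noteq> v y" if "y \<in> {0..L}" "dist y x < e" for y
  proof
    assume "u y = v y"
    then show False using e(2)[OF that] by (simp add: dist_real_def)
  qed
  define p where "p = max 0 (x - e)"
  define q where "q = min L (x + e)"
  have pq: "p < q" using e x L by (auto simp: p_def q_def)
  have "AE y in lborel. y \<notin> {p<..<q}"
    using eq by eventually_elim (use ney in \<open>auto simp: p_def q_def dist_real_def\<close>)
  then have "emeasure lborel {p<..<q} = 0"
    using AE_iff_measurable[of "{p<..<q}" lborel "\<lambda>y. y \<notin> {p<..<q}"] by (simp add: set_eq_iff)
  then show False using pq by simp
qed

lemma sq_integrable_continuous:
  fixes u :: "real \<Rightarrow> real"
  assumes u: "continuous_on {0..T} u"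
  shows "sq_integrable (\<lambda>x. indicat_real {0<..<T} x * u x)"
proof -
  have "bounded (u ` {0..T})" by (intro compact_imp_bounded compact_continuous_image u) auto
  then obtain B where B: "\<And>x. x \<in> {0..T} \<Longrightarrow> \<bar>u x\<bar> \<le> B" unfolding bounded_iff real_norm_def by blast
  have "continuous_on {0<..<T} u" by (rule continuous_on_subset[OF u]) auto
  from borel_measurable_continuous_on_indicator[OF _ this]
  have m: "(\<lambda>x. indicat_real {0<..<T} x * u x) \<in> borel_measurable borel" by simp
  show ?thesis
  proof (rule sq_integrable_bound)
    show "(\<lambda>x. indicat_real {0<..<T} x * u x) \<in> borel_measurable lborel" using m by simp
    show "sq_integrable (\<lambda>x. B * indicat_real {0<..<T} x)" by (intro sq_integrable_scale) simp
    show "AE x in lborel. \<bar>indicat_real {0<..<T} x * u x\<bar> \<le> \<bar>B * indicat_real {0<..<T} x\<bar>"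
    proof (intro AE_I2)
      fix x show "\<bar>indicat_real {0<..<T} x * u x\<bar> \<le> \<bar>B * indicat_real {0<..<T} x\<bar>"
        using B[of x] by (cases "x \<in> {0<..<T}") auto
    qed
  qed
qed

lemma low_inner_continuous:
  assumes v: "continuous_on {0..T} v" and t: "t \<in> {0..T}"
  shows "low T t \<bullet> abs_l2 (\<lambda>x. indicat_real {0<..<T} x * v x) = integral {0..t} v"
proof -
  have sq: "sq_integrable (\<lambda>x. indicat_real {0<..<T} x * v x)" by (rule sq_integrable_continuous[OF v])
  have vt: "continuous_on {0..t} v" by (rule continuous_on_subset[OF v]) (use t in auto)
  have mt: "min t T = t" using t by simp
  have "low T t \<bullet> abs_l2 (\<lambda>x. indicat_real {0<..<T} x * v x)
      = (\<integral>x. (indicat_real {0<..<T} x * v x) * rep_l2 (low T t) x \<partial>lborel)"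
    unfolding inner_commute[of "low T t"] by (rule inner_abs_l2[OF sq])
  also have "\<dots> = (\<integral>x. indicat_real {0..t} x *\<^sub>R v x \<partial>lborel)"
  proof (rule integral_cong_AE)
    have "AE x in lborel. x \<notin> {0, t}" using AE_not_in finite_imp_null_set_lborel[of "{0, t}"] by blast
    with rep_abs_l2[OF sq_integrable_interval[of 0 t]]
    show "AE x in lborel. (indicat_real {0<..<T} x * v x) * rep_l2 (low T t) x = indicat_real {0..t} x *\<^sub>R v x"
      unfolding low_def mt by eventually_elim (use t in \<open>auto simp: indicator_def\<close>)
    show "(\<lambda>x. (indicat_real {0<..<T} x * v x) * rep_l2 (low T t) x) \<in> borel_measurable lborel"
      using sq by (auto simp: sq_integrable_def)
    show "(\<lambda>x. indicat_real {0..t} x *\<^sub>R v x) \<in> borel_measurable lborel"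
      using borel_measurable_continuous_on_indicator[OF _ vt] by simp
  qed
  also have "\<dots> = integral {0..t} v"
    using set_borel_integral_eq_integral(2)[OF borel_integrable_atLeastAtMost'[OF vt]]
    by (simp add: set_lebesgue_integral_def)
  finally show ?thesis .
qed

text \<open>The bridge between the distributional equation in time and the pointwise derivatives in
  \<open>wsol\<close>. The theory on the beam is reused with the time interval in place of (0,
  L).\<close>

lemma distr_deriv_continuous_iff:
  fixes u v :: "real \<Rightarrow> real"
  assumes T: "0 < T" and u: "continuous_on {0..T} u" and v: "continuous_on {0..T} v"
  shows "distr_deriv 0 T u v \<longleftrightarrow> (\<forall>t\<in>{0..T}. (u has_real_derivative v t) (at t within {0..T}))"
proof -
  let ?U = "abs_l2 (\<lambda>x. indicat_real {0<..<T} x * u x)" and ?V = "abs_l2 (\<lambda>x. indicat_real {0<..<T} x * v x)"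
  have sq: "sq_integrable (\<lambda>x. indicat_real {0<..<T} x * u x)" "sq_integrable (\<lambda>x. indicat_real {0<..<T} x * v x)"
    by (rule sq_integrable_continuous; fact)+
  have UE: "?U \<in> L2_on T" unfolding L2_on_def using rep_abs_l2[OF sq(1)] by (auto elim!: eventually_mono)
  have vi: "continuous_on {0..T} (\<lambda>t. integral {0..t} v)"
    by (intro indefinite_integral_continuous_1 integrable_continuous_real v)
  have "distr_deriv 0 T u v \<longleftrightarrow> (\<exists>c. ?U = vol T ?V + c *\<^sub>R one T)"
    using distr_deriv_iff_dpair[OF sq] dpair_iff[OF T UE] by simp
  also have "\<dots> \<longleftrightarrow> (\<exists>c. \<forall>t\<in>{0..T}. u t = integral {0..t} v + c)"
  proof (intro ex_cong1 iffI)
    fix c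
    have R: "AE x in lborel. rep_l2 (vol T ?V + c *\<^sub>R one T) x = indicat_real {0<..<T} x * (low T x \<bullet> ?V + c)"
      using rep_add[of "vol T ?V" "c *\<^sub>R one T"] vol_rep[of T ?V] rep_scale[of c "one T"] rep_abs_l2[OF sq_integrable_interval[of 0 T]]
      by eventually_elim (simp add: distrib_left)
    show "\<forall>t\<in>{0..T}. u t = integral {0..t} v + c" if eq: "?U = vol T ?V + c *\<^sub>R one T"
    proof
      fix t assume t: "t \<in> {0..T}"
      show "u t = integral {0..t} v + c"
      proof (rule continuous_AE_eq[OF T u _ _ t])
        show "continuous_on {0..T} (\<lambda>t. integral {0..t} v + c)" by (intro continuous_intros vi)
        show "AE x in lborel. x \<in> {0<..<T} \<longrightarrow> u x = integral {0..x} v + c"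
          using R rep_abs_l2[OF sq(1)] unfolding eq[symmetric]
        proof eventually_elim
          case (elim x)
          then show ?case using low_inner_continuous[OF v, of x] by (cases "x \<in> {0<..<T}") auto
        qed
      qed
    qed
    show "?U = vol T ?V + c *\<^sub>R one T" if eq: "\<forall>t\<in>{0..T}. u t = integral {0..t} v + c"
    proof (rule l2_eqI)
      show "AE x in lborel. rep_l2 ?U x = rep_l2 (vol T ?V + c *\<^sub>R one T) x"
        using R rep_abs_l2[OF sq(1)]
      proof eventually_elim
        case (elim x)
        then show ?case using low_inner_continuous[OF v, of x] eq by (cases "x \<in> {0<..<T}") simp_all
      qed
    qed
  qed
  also have "\<dots> \<longleftrightarrow> (\<forall>t\<in>{0..T}. (u has_real_derivative v t) (at t within {0..T}))"
  proof
    assume "\<exists>c. \<forall>t\<in>{0..T}. u t = integral {0..t} v + c"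
    then obtain c where c: "\<And>t. t \<in> {0..T} \<Longrightarrow> integral {0..t} v + c = u t" by auto
    show "\<forall>t\<in>{0..T}. (u has_real_derivative v t) (at t within {0..T})"
    proof
      fix t assume t: "t \<in> {0..T}"
      have "((\<lambda>t. integral {0..t} v + c) has_real_derivative v t + 0) (at t within {0..T})"
        unfolding has_real_derivative_iff_has_vector_derivative
        by (intro has_vector_derivative_add has_vector_derivative_const integral_has_vector_derivative v t)
      then have "((\<lambda>t. integral {0..t} v + c) has_real_derivative v t) (at t within {0..T})" by simp
      then show "(u has_real_derivative v t) (at t within {0..T})"
        by (rule has_field_derivative_transform_within[OF _ zero_less_one t]) (rule c)
    qed
  next
    assume d: "\<forall>t\<in>{0..T}. (u has_real_derivative v t) (at t within {0..T})"
    have "u t = integral {0..t} v + u 0" if t: "t \<in> {0..T}" for t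
    proof -
      have "(v has_integral (u t - u 0)) {0..t}"
      proof (rule fundamental_theorem_of_calculus)
        show "0 \<le> t" using t by simp
        fix s assume s: "s \<in> {0..t}"
        then have "(u has_real_derivative v s) (at s within {0..T})" using d t by auto
        then have "(u has_real_derivative v s) (at s within {0..t})" by (rule DERIV_subset) (use t in auto)
        then show "(u has_vector_derivative v s) (at s within {0..t})"
          by (simp add: has_real_derivative_iff_has_vector_derivative)
      qed
      then show ?thesis by (simp add: integral_unique)
    qed
    then show "\<exists>c. \<forall>t\<in>{0..T}. u t = integral {0..t} v + c" by blast
  qed
  finally show ?thesis .
qed

section \<open>Sobolev spaces as ranges of Volterra operators\<close>

text \<open>Reduces all Sobolev statements to the representation of f as a primitive plus a
  constant; the derivative and the value at 0 are then its two coordinates.\<close>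

lemma weak_deriv_iff:
  assumes L: "0 < L"
  shows "weak_deriv L f g \<longleftrightarrow> g \<in> L2_on L \<and> (\<exists>c. f = vol L g + c *\<^sub>R one L)"
proof -
  have E: "vol L g + c *\<^sub>R one L \<in> L2_on L" for c
    by (intro subspace_add subspace_scale subspace_L2_on vol_L2_on one_L2_on)
  have "distr_deriv 0 L (rep_l2 f) (rep_l2 g) \<longleftrightarrow> (\<exists>c. f = vol L g + c *\<^sub>R one L)"
    if f: "f \<in> L2_on L" and g: "g \<in> L2_on L"
  proof -
    have "abs_l2 (\<lambda>x. indicat_real {0<..<L} x * rep_l2 h x) = h" if "h \<in> L2_on L" for h
      using that by (simp add: L2_on_iff_cut flip: cut_def)
    then show ?thesis
      using distr_deriv_iff_dpair[OF sq_integrable_cut[of L f] sq_integrable_cut[of L g]] dpair_iff[OF L f, of g] f g by simp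
  qed
  then show ?thesis unfolding weak_deriv_def using E by blast
qed

lemma low_L: "low L L = one L" by (simp add: low_def)

text \<open>The continuous representative vanishes everywhere: its value at 0 is c, and its
  increments are the integrals of G over intervals.\<close>

lemma vol_repr_zero:
  assumes L: "0 < L" and G: "G \<in> L2_on L" and eq: "vol L G + c *\<^sub>R one L = 0"
  shows "G = 0 \<and> c = 0"
proof -
  have z: "low L x \<bullet> G + c = 0" if x: "x \<in> {0..L}" for x
  proof (rule continuous_AE_eq[OF L _ _ _ x])
    show "continuous_on {0..L} (\<lambda>x. low L x \<bullet> G + c)"
      by (intro continuous_intros continuous_on_subset[OF low_continuous]) auto
    have "AE x in lborel. rep_l2 0 x = 0" using rep_scale[of 0 0] by (auto elim!: eventually_mono)
    then show "AE x in lborel. x \<in> {0<..<L} \<longrightarrow> low L x \<bullet> G + c = 0"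
      using rep_add[of "vol L G" "c *\<^sub>R one L"] vol_rep[of L G] rep_scale[of c "one L"] rep_abs_l2[OF sq_integrable_interval[of 0 L]]
      unfolding eq by eventually_elim auto
  qed simp
  have c: "c = 0" using z[of 0] L by (simp add: low_0)
  have "G = 0"
  proof (rule L2_on_zero_if_ortho[OF G])
    fix p q assume pq: "0 \<le> p" "p < q" "q \<le> L"
    have "ind_l2 {p<..<q} = ind_l2 {p<..q}"
      by (rule ind_AE_eq[of _ p q _ "{q}"]) auto
    also have "\<dots> = ind_l2 {0<..q} - ind_l2 {0<..p}"
    proof -
      have "indicat_real {p<..q} = (\<lambda>x. indicat_real {0<..q} x - indicat_real {0<..p} x)"
        using pq by (auto simp: indicator_def fun_eq_iff)
      moreover have "sq_integrable (indicat_real {0<..q})" "sq_integrable (indicat_real {0<..p})"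
        by (rule sq_integrable_ind[of _ 0 q], auto, rule sq_integrable_ind[of _ 0 p], auto)
      ultimately show ?thesis by (simp add: abs_l2_diff)
    qed
    also have "ind_l2 {0<..q} = low L q"
      unfolding low_def using pq by (intro ind_AE_eq[of _ 0 q _ "{q}"]) auto
    also have "ind_l2 {0<..p} = low L p"
      unfolding low_def using pq by (intro ind_AE_eq[of _ 0 p _ "{p}"]) auto
    finally show "ind_l2 {p<..<q} \<bullet> G = 0"
      using z[of p] z[of q] pq c by (simp add: inner_diff_left)
  qed
  then show ?thesis using c by simp
qed

lemma vol_repr_unique:
  assumes L: "0 < L" and g: "g \<in> L2_on L" "g' \<in> L2_on L" and eq: "vol L g + c *\<^sub>R one L = vol L g' + c' *\<^sub>R one L"
  shows "g = g' \<and> c = c'"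
proof -
  interpret bounded_linear "vol L" by (rule bounded_linear_vol) (use L in simp)
  have "vol L (g - g') + (c - c') *\<^sub>R one L = 0" using eq by (simp add: diff algebra_simps)
  from vol_repr_zero[OF L _ this] show ?thesis using g subspace_L2_on by (simp add: subspace_diff)
qed

lemma Dx_repr: assumes L: "0 < L" and g: "g \<in> L2_on L" shows "Dx L (vol L g + c *\<^sub>R one L) = g"
  unfolding Dx_def
proof (rule the_equality)
  show "weak_deriv L (vol L g + c *\<^sub>R one L) g" unfolding weak_deriv_iff[OF L] using g by blast
  fix g' assume "weak_deriv L (vol L g + c *\<^sub>R one L) g'"
  then show "g' = g" unfolding weak_deriv_iff[OF L] using vol_repr_unique[OF L g] by metis
qed

lemma Dx_vol: "0 < L \<Longrightarrow> g \<in> L2_on L \<Longrightarrow> Dx L (vol L g) = g"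
  using Dx_repr[of L g 0] by simp

lemma point_value_repr:
  assumes L: "0 < L" and x: "x \<in> {0..L}"
  shows "point_value L (vol L g + c *\<^sub>R one L) x = low L x \<bullet> g + c"
  unfolding point_value_def
proof (rule the_equality)
  let ?u = "\<lambda>x. low L x \<bullet> g + c"
  have uc: "continuous_on {0..L} ?u" by (intro continuous_intros continuous_on_subset[OF low_continuous]) auto
  have ae: "AE y in lborel. y \<in> {0<..<L} \<longrightarrow> rep_l2 (vol L g + c *\<^sub>R one L) y = ?u y"
    using rep_add[of "vol L g" "c *\<^sub>R one L"] vol_rep[of L g] rep_scale[of c "one L"] rep_abs_l2[OF sq_integrable_interval[of 0 L]]
    by eventually_elim auto
  show "\<exists>u. continuous_on {0..L} u \<and> (AE y in lborel. y \<in> {0<..<L} \<longrightarrow> rep_l2 (vol L g + c *\<^sub>R one L) y = u y) \<and> u x = ?u x"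
    using uc ae by blast
  fix r assume "\<exists>u. continuous_on {0..L} u \<and> (AE y in lborel. y \<in> {0<..<L} \<longrightarrow> rep_l2 (vol L g + c *\<^sub>R one L) y = u y) \<and> u x = r"
  then obtain u where u: "continuous_on {0..L} u" "AE y in lborel. y \<in> {0<..<L} \<longrightarrow> rep_l2 (vol L g + c *\<^sub>R one L) y = u y" "u x = r" by blast
  have "u x = ?u x"
  proof (rule continuous_AE_eq[OF L u(1) uc _ x])
    show "AE y in lborel. y \<in> {0<..<L} \<longrightarrow> u y = ?u y" using u(2) ae by eventually_elim auto
  qed
  then show "r = ?u x" using u(3) by simp
qed

lemma sobolev_Suc_iff:
  assumes L: "0 < L"
  shows "f \<in> sobolev L (Suc k) \<longleftrightarrow> (\<exists>g c. g \<in> sobolev L k \<and> g \<in> L2_on L \<and> f = vol L g + c *\<^sub>R one L)"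
proof -
  have "vol L g + c *\<^sub>R one L \<in> L2_on L" for g c
    by (intro subspace_add subspace_scale subspace_L2_on vol_L2_on one_L2_on)
  then show ?thesis by (auto simp: weak_deriv_iff[OF L])
qed

lemma H1s_eq: assumes L: "0 < L" shows "H1s L = vol L ` L2_on L"
proof (intro set_eqI iffI)
  fix v assume v: "v \<in> H1s L"
  then obtain g c where g: "g \<in> L2_on L" "v = vol L g + c *\<^sub>R one L"
    unfolding H1s_def One_nat_def using sobolev_Suc_iff[OF L] by blast
  have "low L 0 \<bullet> g + c = 0" using v point_value_repr[OF L, of 0 g c] L by (simp add: H1s_def g(2))
  then show "v \<in> vol L ` L2_on L" using g by (auto simp: low_0)
next
  fix v assume "v \<in> vol L ` L2_on L"
  then obtain g where g: "g \<in> L2_on L" "v = vol L g + 0 *\<^sub>R one L" by auto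
  then have "v \<in> sobolev L (Suc 0)" unfolding sobolev_Suc_iff[OF L] by auto
  moreover have "point_value L v 0 = 0" unfolding g(2) point_value_repr[OF L atLeastAtMost_iff[THEN iffD2, OF conjI[OF order_refl less_imp_le[OF L]]]] by (simp add: low_0)
  ultimately show "v \<in> H1s L" by (simp add: H1s_def)
qed

lemma H2s_eq: assumes L: "0 < L" shows "H2s L = (\<lambda>g. vol L (vol L g)) ` L2_on L"
proof (intro set_eqI iffI)
  have 0: "0 \<in> {0..L}" using L by simp
  fix v assume v: "v \<in> H2s L"
  then have "v \<in> sobolev L (Suc 1)" "point_value L v 0 = 0" "point_value L (Dx L v) 0 = 0"
    by (auto simp: H2s_def numeral_2_eq_2)
  then obtain g c where g: "g \<in> sobolev L 1" "g \<in> L2_on L" "v = vol L g + c *\<^sub>R one L"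
    using sobolev_Suc_iff[OF L] by blast
  have c: "c = 0" using \<open>point_value L v 0 = 0\<close> unfolding g(3) point_value_repr[OF L 0] by (simp add: low_0)
  have "Dx L v = g" unfolding g(3) by (rule Dx_repr[OF L g(2)])
  then have "g \<in> H1s L" using g(1) \<open>point_value L (Dx L v) 0 = 0\<close> by (simp add: H1s_def)
  then show "v \<in> (\<lambda>g. vol L (vol L g)) ` L2_on L" using g(3) c by (auto simp: H1s_eq[OF L])
next
  have 0: "0 \<in> {0..L}" using L by simp
  fix v assume "v \<in> (\<lambda>g. vol L (vol L g)) ` L2_on L"
  then obtain g where g: "g \<in> L2_on L" "v = vol L (vol L g) + 0 *\<^sub>R one L" by auto
  have h: "vol L g \<in> H1s L" using g by (auto simp: H1s_eq[OF L])
  then have s: "vol L g \<in> sobolev L 1" "point_value L (vol L g) 0 = 0" by (auto simp: H1s_def)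
  have "v \<in> sobolev L (Suc 1)" unfolding sobolev_Suc_iff[OF L] using g(2) s(1) vol_L2_on by blast
  moreover have "point_value L v 0 = 0" unfolding g(2) point_value_repr[OF L 0] by (simp add: low_0)
  moreover have "Dx L v = vol L g" unfolding g(2) by (rule Dx_repr[OF L vol_L2_on])
  ultimately show "v \<in> H2s L" using s by (simp add: H2s_def numeral_2_eq_2)
qed

text \<open>The integral from x to L is the total integral minus the one from 0 to x. So the range
  of the adjoint on \<open>L2_on L\<close> consists of the H^1 functions that vanish at L.\<close>

lemma vol_adj_repr: "vol_adj L f = - vol L f + (one L \<bullet> f) *\<^sub>R one L" if L: "0 < L"
proof (rule l2_eqI)
  have u: "low L x \<bullet> f + upp L x \<bullet> f = one L \<bullet> f" if x: "x \<in> {0<..<L}" for x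
  proof -
    have "low L x + upp L x = one L"
    proof -
      have "low L x = ind_l2 {0<..x}" unfolding low_def using x by (intro ind_AE_eq[of _ 0 L _ "{x}"]) auto
      moreover have "upp L x = ind_l2 {x<..<L}" unfolding upp_def using x by simp
      moreover have "one L = abs_l2 (\<lambda>y. indicat_real {0<..x} y + indicat_real {x<..<L} y)"
        using x by (intro arg_cong[of _ _ abs_l2]) (auto simp: indicator_def fun_eq_iff)
      moreover have "sq_integrable (indicat_real {0<..x})" by (rule sq_integrable_ind[of _ 0 x]) auto
      ultimately show ?thesis by (simp add: abs_l2_add)
    qed
    then show ?thesis by (metis inner_add_left)
  qed
  show "AE x in lborel. rep_l2 (vol_adj L f) x = rep_l2 (- vol L f + (one L \<bullet> f) *\<^sub>R one L) x"
    using vol_adj_rep[of L f] vol_rep[of L f] rep_add[of "- vol L f" "(one L \<bullet> f) *\<^sub>R one L"]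
      rep_scale[of "-1" "vol L f"] rep_scale[of "one L \<bullet> f" "one L"] rep_abs_l2[OF sq_integrable_interval[of 0 L]]
  proof eventually_elim
    case (elim x)
    then show ?case using u[of x] by (cases "x \<in> {0<..<L}") (simp_all add: algebra_simps)
  qed
qed

text \<open>In w = V V g the conditions w in H^3 and w_xx(L) = 0 say that g is an H^1 function
  vanishing at L, that is g = V* f with f = - g_x.\<close>

lemma generator_space_iff:
  assumes L: "0 < L"
  shows "w \<in> H2s L \<inter> sobolev L 3 \<and> point_value L (Dx L (Dx L w)) L = 0 \<longleftrightarrow>
    (\<exists>f\<in>L2_on L. w = vol L (vol L (vol_adj L f)))" (is "?A \<longleftrightarrow> ?B")
proof -
  interpret V: bounded_linear "vol L" by (rule bounded_linear_vol) (use L in simp)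
  interpret V': bounded_linear "vol_adj L" by (rule bounded_linear_vol_adj) (use L in simp)
  have LL: "L \<in> {0..L}" using L by simp
  show ?thesis
  proof
    assume a: ?A
    then obtain g where g: "g \<in> L2_on L" "w = vol L (vol L g)" by (auto simp: H2s_eq[OF L])
    have D: "Dx L (Dx L w) = g" using g by (simp add: Dx_vol[OF L] vol_L2_on)
    from a have "w \<in> sobolev L (Suc 2)" by (simp add: numeral_3_eq_3 numeral_2_eq_2)
    then obtain g1 c1 where g1: "g1 \<in> sobolev L 2" "g1 \<in> L2_on L" "w = vol L g1 + c1 *\<^sub>R one L"
      unfolding sobolev_Suc_iff[OF L] by blast
    have "g1 = vol L g" using vol_repr_unique[OF L vol_L2_on g1(2), of g 0 c1] g1(3) g(2) by simp
    then have "vol L g \<in> sobolev L (Suc 1)" using g1(1) by (simp add: numeral_2_eq_2)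
    then obtain g2 c2 where g2: "g2 \<in> sobolev L 1" "g2 \<in> L2_on L" "vol L g = vol L g2 + c2 *\<^sub>R one L"
      unfolding sobolev_Suc_iff[OF L] by blast
    have "g2 = g" using vol_repr_unique[OF L g(1) g2(2), of 0 c2] g2(3) by simp
    then have "g \<in> sobolev L (Suc 0)" using g2(1) by simp
    then obtain g3 c3 where g3: "g3 \<in> L2_on L" "g = vol L g3 + c3 *\<^sub>R one L"
      unfolding sobolev_Suc_iff[OF L] by blast
    have "one L \<bullet> g3 + c3 = 0" using a unfolding D g3(2) point_value_repr[OF L LL] low_L by simp
    then have c3: "c3 = - (one L \<bullet> g3)" by simp
    have "g = vol_adj L (- g3)" unfolding g3(2) c3 vol_adj_repr[OF L] by (simp add: V.neg)
    moreover have "- g3 \<in> L2_on L" using g3(1) subspace_L2_on by (simp add: subspace_neg)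
    ultimately show ?B using g(2) by blast
  next
    assume ?B
    then obtain f where f: "f \<in> L2_on L" "w = vol L (vol L (vol_adj L f))" by blast
    have r: "vol_adj L f = vol L (- f) + (one L \<bullet> f) *\<^sub>R one L" by (simp add: vol_adj_repr[OF L] V.neg)
    have E: "- f \<in> L2_on L" using f(1) subspace_L2_on by (simp add: subspace_neg)
    have s1: "vol_adj L f \<in> sobolev L (Suc 0)" unfolding sobolev_Suc_iff[OF L] using r E by auto
    have s2: "vol L (vol_adj L f) \<in> sobolev L (Suc (Suc 0))"
      unfolding sobolev_Suc_iff[OF L, of _ "Suc 0"] using s1 vol_adj_L2_on[of L f]
      by (intro exI[of _ "vol_adj L f"] exI[of _ 0]) simp
    have s3: "w \<in> sobolev L (Suc (Suc (Suc 0)))"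
      unfolding sobolev_Suc_iff[OF L, of _ "Suc (Suc 0)"] f(2) using s2 vol_L2_on[of L "vol_adj L f"]
      by (intro exI[of _ "vol L (vol_adj L f)"] exI[of _ 0]) simp
    have D: "Dx L (Dx L w) = vol_adj L f" using f by (simp add: Dx_vol[OF L] vol_L2_on vol_adj_L2_on)
    have "point_value L (Dx L (Dx L w)) L = 0"
      unfolding D r point_value_repr[OF L LL] low_L by (simp add: inner_minus_right)
    moreover have "w \<in> H2s L" unfolding H2s_eq[OF L] f(2) using vol_adj_L2_on by blast
    ultimately show ?A using s3 by (simp add: numeral_3_eq_3)
  qed
qed

lemma Dx_vol_adj: assumes L: "0 < L" and f: "f \<in> L2_on L" shows "Dx L (vol_adj L f) = - f"
proof -
  interpret V: bounded_linear "vol L" by (rule bounded_linear_vol) (use L in simp)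
  have "vol_adj L f = vol L (- f) + (one L \<bullet> f) *\<^sub>R one L" by (simp add: vol_adj_repr[OF L] V.neg)
  then show ?thesis using Dx_repr[OF L, of "- f"] f subspace_L2_on by (simp add: subspace_neg)
qed

section \<open>The beam equation as an abstract evolution equation\<close>

text \<open>The Lax-Milgram theorem, by Banach's fixed point theorem for x - \<tau> (B x -
  f).\<close>

lemma coercive_inverse:
  fixes B :: "'a::{real_inner,banach} \<Rightarrow> 'a"
  assumes B: "bounded_linear B" and c: "0 < c" and co: "\<And>x. c * (norm x)\<^sup>2 \<le> B x \<bullet> x"
  shows "\<exists>!x. B x = f"
proof -
  interpret B: bounded_linear B by (rule B)
  obtain K0 where K0: "0 < K0" "\<And>x. norm (B x) \<le> norm x * K0" using B.pos_bounded by blast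
  \<comment> \<open>Adding c makes K strictly larger than the coercivity constant, so that c / K <
    1.\<close>
  define K where "K = K0 + c"
  have K: "0 < K" "c < K" using K0 c by (auto simp: K_def)
  have BK: "norm (B x) \<le> K * norm x" for x
    using K0(2)[of x] c norm_ge_zero[of x] by (simp add: K_def algebra_simps add_increasing2)
  \<comment> \<open>The minimiser of 1 - 2 \<tau> c + (\<tau> K)^2; the minimum is r.\<close>
  define \<tau> where "\<tau> = c / K\<^sup>2"
  have \<tau>: "0 < \<tau>" using c K by (simp add: \<tau>_def)
  define r where "r = 1 - (c / K)\<^sup>2"
  have r: "0 \<le> r" "r < 1"
  proof -
    have "0 < c / K" "c / K < 1" using c K by auto
    then show "0 \<le> r" "r < 1" by (auto simp: r_def power_le_one)
  qed
  have contr: "norm (x - \<tau> *\<^sub>R B x) \<le> sqrt r * norm x" for x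
  proof -
    have "(norm (x - \<tau> *\<^sub>R B x))\<^sup>2 = (norm x)\<^sup>2 + \<tau>\<^sup>2 * (norm (B x))\<^sup>2 - 2 * \<tau> * (B x \<bullet> x)"
      unfolding norm_diff_sq by (simp add: power_mult_distrib inner_commute)
    also have "\<dots> \<le> (norm x)\<^sup>2 + \<tau>\<^sup>2 * (K * norm x)\<^sup>2 - 2 * \<tau> * (c * (norm x)\<^sup>2)"
      using co[of x] \<tau> by (intro diff_mono add_left_mono mult_left_mono power_mono BK) auto
    also have "\<dots> = (1 + (\<tau> * K)\<^sup>2 - 2 * (\<tau> * c)) * (norm x)\<^sup>2"
      by (simp add: algebra_simps power_mult_distrib)
    also have "1 + (\<tau> * K)\<^sup>2 - 2 * (\<tau> * c) = r"
      using K by (simp add: \<tau>_def r_def power2_eq_square field_simps)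
    also have "r * (norm x)\<^sup>2 = (sqrt r * norm x)\<^sup>2" using r by (simp add: power_mult_distrib)
    finally show ?thesis by (rule power2_le_imp_le) (simp add: r)
  qed
  have "\<exists>!x. x - \<tau> *\<^sub>R (B x - f) = x"
  proof (rule banach_fix_type[where c = "sqrt r"])
    show "0 \<le> sqrt r" "sqrt r < 1" using r by auto
    show "\<forall>x y. dist (x - \<tau> *\<^sub>R (B x - f)) (y - \<tau> *\<^sub>R (B y - f)) \<le> sqrt r * dist x y"
    proof (intro allI)
      fix x y
      have "(x - \<tau> *\<^sub>R (B x - f)) - (y - \<tau> *\<^sub>R (B y - f)) = (x - y) - \<tau> *\<^sub>R B (x - y)"
        by (simp add: B.diff algebra_simps)
      then show "dist (x - \<tau> *\<^sub>R (B x - f)) (y - \<tau> *\<^sub>R (B y - f)) \<le> sqrt r * dist x y"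
        using contr[of "x - y"] by (simp only: dist_norm)
    qed
  qed
  moreover have "x - \<tau> *\<^sub>R (B x - f) = x \<longleftrightarrow> B x = f" for x using \<tau> by simp
  ultimately show ?thesis by simp
qed

section \<open>The state space of the beam and the linear part\<close>

locale beam =
  fixes L D \<alpha> b1 b2 U \<beta> k0 :: real and p0 :: l2
  assumes L: "0 < L" and D: "0 < D" and b2: "0 < b2" and \<beta>: "0 \<le> \<beta>" and k0: "0 \<le> k0" and \<alpha>: "0 < \<alpha>"
    and p0: "p0 \<in> L2_on L"
begin

abbreviation "V \<equiv> vol L"

abbreviation "W \<equiv> vol_adj L"

abbreviation "E \<equiv> L2_on L"

sublocale V: bounded_linear V by (rule bounded_linear_vol) (use L in simp)

sublocale W: bounded_linear W by (rule bounded_linear_vol_adj) (use L in simp)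

sublocale cut: bounded_linear "cut L" by (rule bounded_linear_cut)

lemma E_add: "f \<in> E \<Longrightarrow> g \<in> E \<Longrightarrow> f + g \<in> E" and E_diff: "f \<in> E \<Longrightarrow> g \<in> E \<Longrightarrow> f - g \<in> E"
  and E_scale: "f \<in> E \<Longrightarrow> c *\<^sub>R f \<in> E" and E_neg: "f \<in> E \<Longrightarrow> - f \<in> E" and E_0: "0 \<in> E"
  by (rule subspace_add[OF subspace_L2_on] subspace_diff[OF subspace_L2_on] subspace_scale[OF subspace_L2_on]
      subspace_neg[OF subspace_L2_on] subspace_0[OF subspace_L2_on]; assumption)+

lemma V_E: "V f \<in> E" and W_E: "W f \<in> E" by (rule vol_L2_on vol_adj_L2_on)+

lemma V_W: "V f \<bullet> g = f \<bullet> W g" by (rule vol_adjoint)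

text \<open>The inertia 1 - \<alpha> \<partial>_x^2 in the variable h = w_tx: its quadratic form is
  the inner product of \<open>L_\<alpha>\<close> carried over by V.\<close>

definition M :: "l2 \<Rightarrow> l2" where "M h = \<alpha> *\<^sub>R h + W (V h)"

lemma bounded_linear_M: "bounded_linear M"
  unfolding M_def[abs_def]
  by (intro bounded_linear_add bounded_linear_scaleR_right bounded_linear_compose[OF W.bounded_linear_axioms V.bounded_linear_axioms])

sublocale M: bounded_linear M by (rule bounded_linear_M)

lemma M_inner: "M h \<bullet> k = \<alpha> * (h \<bullet> k) + V h \<bullet> V k"
proof -
  have "W (V h) \<bullet> k = V h \<bullet> V k" using V_W[of k "V h"] by (metis inner_commute)
  then show ?thesis by (simp add: M_def inner_add_left)
qed

lemma M_sym: "M h \<bullet> k = h \<bullet> M k"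
  using M_inner[of h k] M_inner[of k h] by (simp add: inner_commute)

lemma M_coercive: "\<alpha> * (norm h)\<^sup>2 \<le> M h \<bullet> h"
  by (simp add: M_inner power2_norm_eq_inner)

lemma M_E: "h \<in> E \<Longrightarrow> M h \<in> E"
  unfolding M_def by (intro E_add E_scale W_E)

definition Mi :: "l2 \<Rightarrow> l2" where "Mi f = (THE h. M h = f)"

lemma M_Mi: "M (Mi f) = f"
  unfolding Mi_def by (rule theI'[OF coercive_inverse[OF bounded_linear_M \<alpha> M_coercive]])

lemma Mi_M: "Mi (M h) = h"
  unfolding Mi_def by (rule the1_equality[OF coercive_inverse[OF bounded_linear_M \<alpha> M_coercive] refl])

lemma bounded_linear_Mi: "bounded_linear Mi"
proof (rule bounded_linear_intro[where K = "1 / \<alpha>"])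
  fix f g r
  show "Mi (f + g) = Mi f + Mi g"
    using Mi_M[of "Mi f + Mi g"] by (simp add: M.add M_Mi)
  show "Mi (r *\<^sub>R f) = r *\<^sub>R Mi f"
    using Mi_M[of "r *\<^sub>R Mi f"] by (simp add: M.scaleR M_Mi)
  have "\<alpha> * norm (Mi f) * norm (Mi f) \<le> norm f * norm (Mi f)"
    using order_trans[OF M_coercive[of "Mi f"] norm_cauchy_schwarz[of "M (Mi f)" "Mi f"]]
    by (simp add: M_Mi power2_eq_square mult.assoc)
  then have "\<alpha> * norm (Mi f) \<le> norm f"
    by (cases "norm (Mi f) = 0") (auto simp: mult_le_cancel_right)
  then show "norm (Mi f) \<le> norm f * (1 / \<alpha>)" using \<alpha> by (simp add: pos_le_divide_eq mult.commute)
qed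

sublocale Mi: bounded_linear Mi by (rule bounded_linear_Mi)

lemma Mi_E: assumes "f \<in> E" shows "Mi f \<in> E"
proof -
  have "\<alpha> *\<^sub>R Mi f = f - W (V (Mi f))" using M_Mi[of f] by (simp add: M_def algebra_simps)
  then have "Mi f = (1 / \<alpha>) *\<^sub>R (f - W (V (Mi f)))" using \<alpha> by (simp flip: \<open>\<alpha> *\<^sub>R Mi f = f - W (V (Mi f))\<close>)
  moreover have "(1 / \<alpha>) *\<^sub>R (f - W (V (Mi f))) \<in> E" by (intro E_scale E_diff W_E assms)
  ultimately show ?thesis by simp
qed

text \<open>A state \<open>(w, w\<^sub>t)\<close> is represented by \<open>g = w\<^sub>x\<^sub>x\<close> and \<open>h = w\<^sub>t\<^sub>x\<close>, so that \<open>w = V (V g)\<close> and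
  \<open>w\<^sub>t = V h\<close>; \<open>\<iota>\<close> makes the energy norm a norm of \<open>L\<^sup>2 \<times> L\<^sup>2 \<times> L\<^sup>2\<close>.\<close>

definition \<iota> :: "l2 \<Rightarrow> l2 \<Rightarrow> l2 \<times> l2 \<times> l2"
  where "\<iota> g h = (sqrt D *\<^sub>R g, sqrt \<alpha> *\<^sub>R h, V h)"

text \<open>\<open>gg\<close> and \<open>hh\<close> are defined on the whole product, not only on
  the range of \<iota>: they are the coordinates of the orthogonal projection onto the states with g
  and h in \<open>E\<close>.\<close>

definition gg :: "l2 \<times> l2 \<times> l2 \<Rightarrow> l2" where "gg y = (1 / sqrt D) *\<^sub>R cut L (fst y)"

text \<open>The least-squares inverse of h \<mapsto> (sqrt \<alpha> h, V h): \<open>M\<close> is the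
  Gram operator of this map, and \<open>Mi\<close> solves the normal equation.\<close>

definition hh :: "l2 \<times> l2 \<times> l2 \<Rightarrow> l2"
  where "hh y = Mi (sqrt \<alpha> *\<^sub>R cut L (fst (snd y)) + W (snd (snd y)))"

lemma bounded_linear_gg: "bounded_linear gg"
  unfolding gg_def[abs_def]
  by (intro bounded_linear_compose[OF bounded_linear_scaleR_right] bounded_linear_compose[OF cut.bounded_linear_axioms] bounded_linear_fst)

lemma bounded_linear_hh: "bounded_linear hh"
  unfolding hh_def[abs_def]
  by (intro bounded_linear_compose[OF Mi.bounded_linear_axioms] bounded_linear_add
      bounded_linear_compose[OF bounded_linear_scaleR_right] bounded_linear_compose[OF cut.bounded_linear_axioms]
      bounded_linear_compose[OF W.bounded_linear_axioms] bounded_linear_compose[OF bounded_linear_fst bounded_linear_snd]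
      bounded_linear_compose[OF bounded_linear_snd bounded_linear_snd])

sublocale gg: bounded_linear gg by (rule bounded_linear_gg)

sublocale hh: bounded_linear hh by (rule bounded_linear_hh)

lemma gg_E: "gg y \<in> E" and hh_E: "hh y \<in> E"
  unfolding gg_def hh_def by (intro E_scale Mi_E E_add cut_L2_on W_E)+

lemma gg_\<iota>: "g \<in> E \<Longrightarrow> gg (\<iota> g h) = g" and hh_\<iota>: "h \<in> E \<Longrightarrow> hh (\<iota> g h) = h"
proof -
  show "g \<in> E \<Longrightarrow> gg (\<iota> g h) = g"
    using D by (simp add: gg_def \<iota>_def cut.scaleR L2_on_iff_cut)
  assume h: "h \<in> E"
  then have "sqrt \<alpha> *\<^sub>R cut L (sqrt \<alpha> *\<^sub>R h) = \<alpha> *\<^sub>R h"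
    using \<alpha> by (simp add: cut.scaleR L2_on_iff_cut)
  then show "hh (\<iota> g h) = h" using Mi_M[of h] by (simp add: hh_def \<iota>_def M_def)
qed

lemma M_hh: "M (hh y) = sqrt \<alpha> *\<^sub>R cut L (fst (snd y)) + W (snd (snd y))"
  by (simp add: hh_def M_Mi)

text \<open>Pairing with a state sees y only through \<open>gg y\<close> and \<open>hh y\<close>.
  This is the orthogonality of the projection, and the source of all later inner product
  computations.\<close>

lemma inner_\<iota>:
  assumes g: "g \<in> E" and h: "h \<in> E"
  shows "\<iota> g h \<bullet> y = D * (g \<bullet> gg y) + h \<bullet> M (hh y)"
proof -
  obtain a b c where y: "y = (a, b, c)" by (cases y) auto
  have "D * (g \<bullet> gg y) = sqrt D * (g \<bullet> a)"
  proof -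
    have "g \<bullet> cut L a = g \<bullet> a" using cut_inner[of L g a] g by (simp add: L2_on_iff_cut)
    then have "D * (g \<bullet> gg y) = (D / sqrt D) * (g \<bullet> a)" by (simp add: gg_def y)
    then show ?thesis using D by (simp add: real_div_sqrt)
  qed
  moreover have "h \<bullet> cut L b = h \<bullet> b" using cut_inner[of L h b] h by (simp add: L2_on_iff_cut)
  ultimately show ?thesis
    using V_W[of h c] by (simp add: y \<iota>_def inner_Pair M_hh inner_add_right)
qed

lemma inner_\<iota>_\<iota>:
  "g \<in> E \<Longrightarrow> h \<in> E \<Longrightarrow> g' \<in> E \<Longrightarrow> h' \<in> E \<Longrightarrow> \<iota> g h \<bullet> \<iota> g' h' = D * (g \<bullet> g') + h \<bullet> M h'"
  by (simp add: inner_\<iota> gg_\<iota> hh_\<iota>)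

lemma norm_\<iota>: "(norm (\<iota> g h))\<^sup>2 = D * (norm g)\<^sup>2 + \<alpha> * (norm h)\<^sup>2 + (norm (V h))\<^sup>2"
  using D \<alpha> by (simp add: \<iota>_def norm_Pair power_mult_distrib)

lemma \<iota>_add: "\<iota> g h + \<iota> g' h' = \<iota> (g + g') (h + h')"
  and \<iota>_diff: "\<iota> g h - \<iota> g' h' = \<iota> (g - g') (h - h')"
  and \<iota>_scale: "c *\<^sub>R \<iota> g h = \<iota> (c *\<^sub>R g) (c *\<^sub>R h)"
  and \<iota>_0: "\<iota> 0 0 = 0"
  by (simp_all add: \<iota>_def V.add V.diff V.scaleR V.zero scaleR_add_right scaleR_diff_right mult.commute zero_prod_def)

text \<open>h = V \<psi> puts w_t into H^2_*, and g = W f contains both w in H^3 and w_xx(L) = 0.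
  Components orthogonal to the states are unrestricted, and A ignores them; otherwise the domain
  would not be dense in the product.\<close>

definition Dom :: "(l2 \<times> l2 \<times> l2) set"
  where "Dom = {y. \<exists>\<psi>\<in>E. \<exists>f\<in>E. hh y = V \<psi> \<and> gg y = W f}"

text \<open>Since \<open>W f\<close> has derivative - f, this is g_t = h_x together with M h_t = - D
  f.\<close>

definition A :: "l2 \<times> l2 \<times> l2 \<Rightarrow> l2 \<times> l2 \<times> l2"
  where "A y = \<iota> (Dx L (hh y)) (D *\<^sub>R Mi (Dx L (gg y)))"

lemma A_eq: "\<psi> \<in> E \<Longrightarrow> f \<in> E \<Longrightarrow> hh y = V \<psi> \<Longrightarrow> gg y = W f \<Longrightarrow> A y = \<iota> \<psi> (- (D *\<^sub>R Mi f))"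
  unfolding A_def by (simp add: Dx_vol[OF L] Dx_vol_adj[OF L] Mi.neg)

text \<open>Skewness is the adjointness of V and W: \<open>M\<close> in the inner product cancels
  \<open>Mi\<close> in A. The resolvent equation reduces to a coercive equation for \<psi>
  alone.\<close>

lemma skew_adjoint_A: "skew_adjoint Dom A"
proof
  show "subspace Dom"
    unfolding subspace_def
  proof (intro conjI ballI allI)
    show "0 \<in> Dom" unfolding Dom_def
      by (intro CollectI bexI[of _ 0] E_0) (simp add: hh.zero gg.zero V.zero W.zero)
    fix x y c assume "x \<in> Dom"
    then obtain \<psi> f where x: "\<psi> \<in> E" "f \<in> E" "hh x = V \<psi>" "gg x = W f" by (auto simp: Dom_def)
    show "c *\<^sub>R x \<in> Dom" unfolding Dom_def
      by (intro CollectI bexI[of _ "c *\<^sub>R \<psi>"] bexI[of _ "c *\<^sub>R f"] E_scale x)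
        (simp add: hh.scaleR gg.scaleR V.scaleR W.scaleR x)
    assume "y \<in> Dom"
    then obtain \<psi>' f' where y: "\<psi>' \<in> E" "f' \<in> E" "hh y = V \<psi>'" "gg y = W f'" by (auto simp: Dom_def)
    show "x + y \<in> Dom" unfolding Dom_def
      by (intro CollectI bexI[of _ "\<psi> + \<psi>'"] bexI[of _ "f + f'"] E_add x y)
        (simp add: hh.add gg.add V.add W.add x y)
  qed
  fix x assume "x \<in> Dom"
  then obtain \<psi> f where x: "\<psi> \<in> E" "f \<in> E" "hh x = V \<psi>" "gg x = W f" by (auto simp: Dom_def)
  show "A (c *\<^sub>R x) = c *\<^sub>R A x" for c
  proof -
    have "A (c *\<^sub>R x) = \<iota> (c *\<^sub>R \<psi>) (- (D *\<^sub>R Mi (c *\<^sub>R f)))"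
      by (rule A_eq) (simp_all add: E_scale x hh.scaleR gg.scaleR V.scaleR W.scaleR)
    then show ?thesis by (simp add: A_eq[OF x] \<iota>_scale Mi.scaleR mult.commute)
  qed
  fix y assume "y \<in> Dom"
  then obtain \<psi>' f' where y: "\<psi>' \<in> E" "f' \<in> E" "hh y = V \<psi>'" "gg y = W f'" by (auto simp: Dom_def)
  show "A (x + y) = A x + A y"
  proof -
    have "A (x + y) = \<iota> (\<psi> + \<psi>') (- (D *\<^sub>R Mi (f + f')))"
      by (rule A_eq) (simp_all add: E_add x y hh.add gg.add V.add W.add)
    then show ?thesis by (simp add: A_eq[OF x] A_eq[OF y] \<iota>_add Mi.add scaleR_add_right)
  qed
  show "A x \<bullet> y = - (x \<bullet> A y)"
  proof -
    have "A x \<bullet> y = D * (\<psi> \<bullet> W f') - D * (f \<bullet> V \<psi>')"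
      unfolding A_eq[OF x] using x y
      by (simp add: inner_\<iota> E_neg E_scale Mi_E M_sym[symmetric] M_Mi M.neg M.scaleR)
    moreover have "A y \<bullet> x = D * (\<psi>' \<bullet> W f) - D * (f' \<bullet> V \<psi>)"
      unfolding A_eq[OF y] using x y
      by (simp add: inner_\<iota> E_neg E_scale Mi_E M_sym[symmetric] M_Mi M.neg M.scaleR)
    moreover have "x \<bullet> A y = A y \<bullet> x" by (rule inner_commute)
    ultimately show ?thesis
      using V_W[of \<psi> f'] V_W[of \<psi>' f] inner_commute[of f "V \<psi>'"] inner_commute[of f' "V \<psi>"] by simp
  qed
next
  fix l :: real and y0 assume l: "l \<noteq> 0"
  define g0 where "g0 = gg y0"
  define h0 where "h0 = hh y0"
  have E0: "g0 \<in> E" "h0 \<in> E" by (simp_all add: g0_def h0_def gg_E hh_E)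
  \<comment> \<open>In the resolvent equation the h-component gives f = M (h0 - V \<psi>) / (l D).
    Inserting this into the g-component W f = g0 + l \<psi> and multiplying by l D yields the
    equation for \<psi> below; l enters its left side only through l^2.\<close>
  define c where "c = l\<^sup>2 * D"
  have c: "0 < c" using l D by (simp add: c_def)
  have bl: "bounded_linear (\<lambda>\<psi>. c *\<^sub>R \<psi> + W (M (V \<psi>)))"
    by (intro bounded_linear_add bounded_linear_scaleR_right bounded_linear_compose[OF W.bounded_linear_axioms]
        bounded_linear_compose[OF M.bounded_linear_axioms] V.bounded_linear_axioms)
  have "\<exists>!\<psi>. c *\<^sub>R \<psi> + W (M (V \<psi>)) = W (M h0) - (l * D) *\<^sub>R g0"
  proof (rule coercive_inverse[OF bl c])
    fix \<psi>
    have "W (M (V \<psi>)) \<bullet> \<psi> = M (V \<psi>) \<bullet> V \<psi>" using V_W[of \<psi> "M (V \<psi>)"] by (simp add: inner_commute)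
    moreover have "0 \<le> M (V \<psi>) \<bullet> V \<psi>"
      using order_trans[OF _ M_coercive[of "V \<psi>"], of 0] \<alpha> by simp
    ultimately show "c * (norm \<psi>)\<^sup>2 \<le> (c *\<^sub>R \<psi> + W (M (V \<psi>))) \<bullet> \<psi>"
      by (simp add: inner_add_left power2_norm_eq_inner)
  qed
  then obtain \<psi> where \<psi>: "c *\<^sub>R \<psi> + W (M (V \<psi>)) = W (M h0) - (l * D) *\<^sub>R g0" by blast
  have c\<psi>: "c *\<^sub>R \<psi> = W (M h0) - (l * D) *\<^sub>R g0 - W (M (V \<psi>))" using \<psi> by (metis add_diff_cancel_right')
  have "\<psi> = (1 / c) *\<^sub>R (c *\<^sub>R \<psi>)" using c by simp
  also have "\<dots> \<in> E" unfolding c\<psi> by (intro E_scale E_diff W_E E0)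
  finally have \<psi>E: "\<psi> \<in> E" .
  define f where "f = (1 / (l * D)) *\<^sub>R M (h0 - V \<psi>)"
  have fE: "f \<in> E" unfolding f_def by (intro E_scale M_E E_diff E0 V_E)
  define z where "z = \<iota> \<psi> (- (D *\<^sub>R Mi f))"
  have zE: "- (D *\<^sub>R Mi f) \<in> E" by (intro E_neg E_scale Mi_E fE)
  define y where "y = y0 + l *\<^sub>R z"
  have Wf: "gg y = W f"
  proof -
    have "(l * D) *\<^sub>R W f = W (M h0) - W (M (V \<psi>))"
      using l D by (simp add: f_def W.scaleR M.diff W.diff)
    also have "\<dots> = c *\<^sub>R \<psi> + (l * D) *\<^sub>R g0" unfolding c\<psi> by simp
    also have "\<dots> = (l * D) *\<^sub>R (g0 + l *\<^sub>R \<psi>)" by (simp add: c_def power2_eq_square algebra_simps)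
    finally have "W f = g0 + l *\<^sub>R \<psi>" using l D by simp
    then show ?thesis by (simp add: y_def gg.add gg.scaleR z_def gg_\<iota>[OF \<psi>E] g0_def)
  qed
  have V\<psi>: "hh y = V \<psi>"
  proof -
    have "Mi f = (1 / (l * D)) *\<^sub>R (h0 - V \<psi>)" by (simp add: f_def Mi.scaleR Mi_M)
    then have "(l * D) *\<^sub>R Mi f = h0 - V \<psi>" using l D by simp
    then show ?thesis by (simp add: y_def hh.add hh.scaleR z_def hh_\<iota>[OF zE] h0_def)
  qed
  have "y \<in> Dom" unfolding Dom_def using \<psi>E fE Wf V\<psi> by blast
  moreover have "A y = z" unfolding z_def by (rule A_eq[OF \<psi>E fE V\<psi> Wf])
  ultimately show "\<exists>x\<in>Dom. x - l *\<^sub>R A x = y0" by (intro bexI[of _ y]) (simp_all add: y_def)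
qed

sublocale skew_adjoint Dom A by (rule skew_adjoint_A)

section \<open>The nonlinear perturbation\<close>

definition wx :: "l2 \<times> l2 \<times> l2 \<Rightarrow> l2" where "wx y = V (gg y)"

text \<open>The forces seen from the h-variable. Testing with \<phi> = V k, forces in L^2 are pulled
  back by W, while the stretching term, after integration by parts with the natural boundary
  condition, pairs with \<phi>_x = k directly.\<close>

definition load :: "l2 \<times> l2 \<times> l2 \<Rightarrow> l2"
  where "load y = W (p0 - \<beta> *\<^sub>R V (hh y) - (\<beta> * U) *\<^sub>R wx y) + (b1 - b2 * (norm (wx y))\<^sup>2) *\<^sub>R wx y"

text \<open>The damping k0 (1 - \<alpha> \<partial>_x^2) w_t is k0 M h, so it becomes k0 h after
  \<open>Mi\<close>.\<close>

definition F :: "l2 \<times> l2 \<times> l2 \<Rightarrow> l2 \<times> l2 \<times> l2"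
  where "F y = \<iota> 0 (Mi (load y) - k0 *\<^sub>R hh y)"

lemma bounded_linear_wx: "bounded_linear wx"
  unfolding wx_def[abs_def] by (rule bounded_linear_compose[OF V.bounded_linear_axioms gg.bounded_linear_axioms])

sublocale wx: bounded_linear wx by (rule bounded_linear_wx)

lemma wx_E: "wx y \<in> E" by (simp add: wx_def V_E)

lemma load_E: "load y \<in> E" unfolding load_def by (intro E_add E_scale W_E wx_E)

lemma F_inner: "F y \<bullet> z = load y \<bullet> hh z - k0 * (M (hh y) \<bullet> hh z)"
proof -
  have "F y \<bullet> z = (Mi (load y) - k0 *\<^sub>R hh y) \<bullet> M (hh z)"
    unfolding F_def by (subst inner_\<iota>) (simp_all add: E_0 E_diff E_scale Mi_E load_E hh_E)
  also have "\<dots> = M (Mi (load y) - k0 *\<^sub>R hh y) \<bullet> hh z" by (rule M_sym[symmetric])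
  finally show ?thesis by (simp add: inner_diff_left M_Mi M.diff M.scaleR)
qed

lemma cubic_lipschitz:
  fixes k :: "'a::real_normed_vector \<Rightarrow> 'b::real_normed_vector"
  assumes k: "bounded_linear k"
  shows "\<exists>C. C-lipschitz_on (cball 0 R) (\<lambda>y. (norm (k y))\<^sup>2 *\<^sub>R k y)"
proof -
  interpret k: bounded_linear k by (rule k)
  obtain K where K: "0 < K" "\<And>x. norm (k x) \<le> norm x * K" using k.pos_bounded by blast
  define B where "B = K * \<bar>R\<bar>"
  have B0: "0 \<le> B" using K by (simp add: B_def)
  have "(3 * B\<^sup>2 * K)-lipschitz_on (cball 0 R) (\<lambda>y. (norm (k y))\<^sup>2 *\<^sub>R k y)"
  proof (rule lipschitz_onI)
    show "0 \<le> 3 * B\<^sup>2 * K" using K by simp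
    fix x y :: 'a assume xy: "x \<in> cball 0 R" "y \<in> cball 0 R"
    have bd: "norm (k x) \<le> B" if "x \<in> cball 0 R" for x
    proof -
      have "norm (k x) \<le> norm x * K" by (rule K)
      also have "\<dots> \<le> \<bar>R\<bar> * K" using that K by (intro mult_right_mono) auto
      finally show ?thesis by (simp add: B_def mult.commute)
    qed
    define a b where "a = k x" and "b = k y"
    have ab: "norm a \<le> B" "norm b \<le> B" using bd xy by (auto simp: a_def b_def)
    have tri: "\<bar>norm a - norm b\<bar> \<le> norm (a - b)" by (rule norm_triangle_ineq3)
    have "(norm a)\<^sup>2 *\<^sub>R a - (norm b)\<^sup>2 *\<^sub>R b = (norm a)\<^sup>2 *\<^sub>R (a - b) + ((norm a)\<^sup>2 - (norm b)\<^sup>2) *\<^sub>R b"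
      by (simp add: algebra_simps)
    also have "norm \<dots> \<le> (norm a)\<^sup>2 * norm (a - b) + \<bar>(norm a)\<^sup>2 - (norm b)\<^sup>2\<bar> * norm b"
      by (rule order_trans[OF norm_triangle_ineq]) simp
    also have "\<bar>(norm a)\<^sup>2 - (norm b)\<^sup>2\<bar> = \<bar>norm a - norm b\<bar> * (norm a + norm b)"
    proof -
      have "(norm a)\<^sup>2 - (norm b)\<^sup>2 = (norm a - norm b) * (norm a + norm b)" by (simp add: power2_eq_square algebra_simps)
      then show ?thesis by (simp add: abs_mult)
    qed
    also have "(norm a)\<^sup>2 * norm (a - b) + \<bar>norm a - norm b\<bar> * (norm a + norm b) * norm b
        \<le> B\<^sup>2 * norm (a - b) + norm (a - b) * (B + B) * B"
      using ab tri B0 by (intro add_mono mult_mono power_mono) auto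
    also have "\<dots> = 3 * B\<^sup>2 * norm (a - b)" by (simp add: power2_eq_square algebra_simps)
    also have "\<dots> \<le> 3 * B\<^sup>2 * (norm (x - y) * K)"
      using K(2)[of "x - y"] by (intro mult_left_mono) (auto simp: a_def b_def k.diff)
    finally show "dist ((norm (k x))\<^sup>2 *\<^sub>R k x) ((norm (k y))\<^sup>2 *\<^sub>R k y) \<le> 3 * B\<^sup>2 * K * dist x y"
      by (simp add: dist_norm a_def b_def mult_ac)
  qed
  then show ?thesis by blast
qed

text \<open>F is an affine map plus a bounded linear image of the cubic term |w_x|^2 w_x; only the
  latter confines the Lipschitz bound to balls.\<close>

lemma F_lipschitz_ball: "\<exists>C. C-lipschitz_on (cball 0 R) F"
proof -
  define N where "N x = \<iota> 0 (Mi x)" for x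
  define T where "T y = \<iota> 0 (Mi (W (- (\<beta> *\<^sub>R V (hh y)) - (\<beta> * U) *\<^sub>R wx y) + b1 *\<^sub>R wx y) - k0 *\<^sub>R hh y)" for y
  have bl\<iota>: "bounded_linear (\<iota> 0)"
    unfolding \<iota>_def[abs_def] scaleR_zero_right
    by (intro bounded_linear_Pair bounded_linear_scaleR_right V.bounded_linear_axioms bounded_linear_zero)
  have blN: "bounded_linear N" unfolding N_def[abs_def] by (rule bounded_linear_compose[OF bl\<iota> Mi.bounded_linear_axioms])
  have blT: "bounded_linear T" unfolding T_def[abs_def]
    by (intro bounded_linear_compose[OF bl\<iota>] bounded_linear_sub bounded_linear_compose[OF Mi.bounded_linear_axioms]
        bounded_linear_add bounded_linear_compose[OF W.bounded_linear_axioms] bounded_linear_minus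
        bounded_linear_compose[OF bounded_linear_scaleR_right] bounded_linear_compose[OF V.bounded_linear_axioms]
        hh.bounded_linear_axioms wx.bounded_linear_axioms)
  interpret N: bounded_linear N by (rule blN)
  have eq: "F y = (\<iota> 0 (Mi (W p0)) + T y) - b2 *\<^sub>R N ((norm (wx y))\<^sup>2 *\<^sub>R wx y)" for y
  proof -
    have ld: "load y = W p0 + (W (- (\<beta> *\<^sub>R V (hh y)) - (\<beta> * U) *\<^sub>R wx y) + b1 *\<^sub>R wx y) - b2 *\<^sub>R ((norm (wx y))\<^sup>2 *\<^sub>R wx y)"
      by (simp add: load_def W.diff W.neg W.add algebra_simps)
    show ?thesis unfolding F_def T_def N_def ld by (simp add: \<iota>_add \<iota>_diff \<iota>_scale Mi.add Mi.diff Mi.scaleR algebra_simps)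
  qed
  obtain C1 where C1: "C1-lipschitz_on (cball 0 R) (\<lambda>y. (norm (wx y))\<^sup>2 *\<^sub>R wx y)"
    using cubic_lipschitz[OF bounded_linear_wx] by blast
  obtain C2 where C2: "C2-lipschitz_on ((\<lambda>y. (norm (wx y))\<^sup>2 *\<^sub>R wx y) ` cball 0 R) N"
    using bounded_linear.lipschitz_boundE[OF blN] by blast
  obtain C3 where C3: "C3-lipschitz_on (cball 0 R) T" using bounded_linear.lipschitz_boundE[OF blT] by blast
  note 1 = lipschitz_on_cmult[OF lipschitz_on_compose2[OF C1 C2], of b2]
  have "(0 + C3 + \<bar>b2\<bar> * (C2 * C1))-lipschitz_on (cball 0 R) F"
    unfolding eq[abs_def]
    by (intro lipschitz_on_diff lipschitz_on_add lipschitz_on_constant C3 1)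
  then show ?thesis by blast
qed

lemma F_continuous_on: "continuous_on UNIV F"
  using F_lipschitz_ball by (rule continuous_if_lipschitz_on_balls)

lemma E_inner_cut: "x \<in> E \<Longrightarrow> x \<bullet> f = x \<bullet> cut L f"
  using cut_inner[of L x f] by (simp add: L2_on_iff_cut)

text \<open>w_x is weakly differentiable in time along every weak solution, with derivative w_tx.
  This makes the stretching energy differentiable.\<close>

lemma wx_weak_deriv:
  assumes y: "wsol F T y" and t: "t \<in> {0..T}"
  shows "((\<lambda>s. wx (y s) \<bullet> f) has_real_derivative hh (y t) \<bullet> f) (at t within {0..T})"
proof -
  define f' where "f' = cut L f"
  have f': "f' \<in> E" by (simp add: f'_def cut_L2_on)
  \<comment> \<open>A test state with vanishing velocity: F does not contribute, and A turns it into
    a state on which the pairing is a multiple of (h, f').\<close>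
  define \<phi> where "\<phi> = \<iota> (W f') 0"
  have g\<phi>: "gg \<phi> = W f'" and h\<phi>: "hh \<phi> = V 0"
    by (simp_all add: \<phi>_def gg_\<iota> hh_\<iota> W_E E_0 V.zero)
  have \<phi>D: "\<phi> \<in> Dom" unfolding Dom_def using f' E_0 g\<phi> h\<phi> by blast
  have A\<phi>: "A \<phi> = \<iota> 0 (- (D *\<^sub>R Mi f'))" by (rule A_eq[OF E_0 f' h\<phi> g\<phi>])
  have "z \<bullet> A \<phi> = - (D * (hh z \<bullet> f'))" for z
  proof -
    have "z \<bullet> A \<phi> = A \<phi> \<bullet> z" by (rule inner_commute)
    also have "\<dots> = - (D * (Mi f' \<bullet> M (hh z)))"
      unfolding A\<phi> by (subst inner_\<iota>) (simp_all add: E_0 E_neg E_scale Mi_E f')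
    also have "Mi f' \<bullet> M (hh z) = hh z \<bullet> f'" using M_sym[of "Mi f'" "hh z"] by (simp add: M_Mi inner_commute)
    finally show ?thesis .
  qed
  moreover have "F z \<bullet> \<phi> = 0" for z unfolding F_inner h\<phi> by (simp add: V.zero)
  moreover have "y s \<bullet> \<phi> = D * (wx (y s) \<bullet> f)" for s
  proof -
    have "y s \<bullet> \<phi> = \<phi> \<bullet> y s" by (rule inner_commute)
    also have "\<dots> = D * (W f' \<bullet> gg (y s))" unfolding \<phi>_def by (subst inner_\<iota>) (simp_all add: W_E E_0)
    also have "W f' \<bullet> gg (y s) = wx (y s) \<bullet> f'" using V_W[of "gg (y s)" f'] by (simp add: wx_def inner_commute)
    finally show ?thesis using E_inner_cut[OF wx_E] by (simp add: f'_def)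
  qed
  ultimately have "((\<lambda>s. D * (wx (y s) \<bullet> f)) has_real_derivative D * (hh (y t) \<bullet> f')) (at t within {0..T})"
    using wsol_deriv[OF y \<phi>D t] by simp
  from DERIV_cmult[OF this, of "1 / D"] show ?thesis
    using D E_inner_cut[OF hh_E, of "y t" f] by (simp add: f'_def)
qed

lemma wx_norm_deriv:
  assumes y: "wsol F T y" and t: "t \<in> {0..T}"
  shows "((\<lambda>s. (norm (wx (y s)))\<^sup>2) has_real_derivative 2 * (hh (y t) \<bullet> wx (y t))) (at t within {0..T})"
proof -
  obtain B where B: "\<And>t. t \<in> {0..T} \<Longrightarrow> norm (y t) \<le> B" using wsol_bounded[OF y] by blast
  obtain K where K: "0 < K" "\<And>x. norm (hh x) \<le> norm x * K" using hh.pos_bounded by blast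
  show ?thesis
  proof (rule weak_deriv_norm_sq[OF wx_weak_deriv[OF y] _ t])
    fix t assume "t \<in> {0..T}"
    then show "norm (hh (y t)) \<le> B * K" using K B by (meson mult_right_mono order_trans less_imp_le)
  qed
qed

section \<open>Energy and the a priori bound\<close>

definition En :: "l2 \<times> l2 \<times> l2 \<Rightarrow> real"
  where "En y = (norm y)\<^sup>2 / 2 + b2 / 4 * ((norm (wx y))\<^sup>2)\<^sup>2 - b1 / 2 * (norm (wx y))\<^sup>2"

definition rate :: "l2 \<times> l2 \<times> l2 \<Rightarrow> real"
  where "rate y = (p0 - (\<beta> * U) *\<^sub>R wx y) \<bullet> V (hh y) - (k0 + \<beta>) * (norm (V (hh y)))\<^sup>2 - \<alpha> * k0 * (norm (hh y))\<^sup>2"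

text \<open>The stretching force in F pairs with h to the negative derivative of the quartic and
  quadratic terms in w_x, so these cancel and only forcing, flow and damping remain in
  \<open>rate\<close>.\<close>

lemma energy_deriv:
  assumes y: "wsol F T y" and yc: "continuous_on {0..T} y" and t: "t \<in> {0..T}"
  shows "((\<lambda>s. En (y s)) has_real_derivative rate (y t)) (at t within {0..T})"
proof -
  let ?q = "\<lambda>s. (norm (wx (y s)))\<^sup>2" and ?h = "hh (y t)"
  have "continuous_on {0..T} (\<lambda>t. F (y t))" by (rule continuous_on_compose2[OF F_continuous_on yc]) simp
  note 1 = wsol_norm_sq_deriv[OF y yc this t]
  note 2 = wx_norm_deriv[OF y t]
  have "((\<lambda>s. (norm (y s))\<^sup>2 / 2 + b2 / 4 * (?q s)\<^sup>2 - b1 / 2 * ?q s) has_real_derivative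
    2 * (F (y t) \<bullet> y t) / 2 + b2 / 4 * (of_nat 2 * (2 * (?h \<bullet> wx (y t)) * (?q t) ^ (2 - Suc 0))) - b1 / 2 * (2 * (?h \<bullet> wx (y t)))) (at t within {0..T})"
    by (intro DERIV_diff DERIV_add DERIV_cdivide DERIV_cmult DERIV_power 1 2)
  moreover have "2 * (F (y t) \<bullet> y t) / 2 + b2 / 4 * (of_nat 2 * (2 * (?h \<bullet> wx (y t)) * (?q t) ^ (2 - Suc 0))) - b1 / 2 * (2 * (?h \<bullet> wx (y t))) = rate (y t)"
  proof -
    have "F (y t) \<bullet> y t = load (y t) \<bullet> ?h - k0 * (M ?h \<bullet> ?h)" by (rule F_inner)
    also have "load (y t) \<bullet> ?h = (p0 - \<beta> *\<^sub>R V ?h - (\<beta> * U) *\<^sub>R wx (y t)) \<bullet> V ?h + (b1 - b2 * ?q t) * (?h \<bullet> wx (y t))"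
    proof -
      have "W x \<bullet> ?h = x \<bullet> V ?h" for x using V_W[of ?h x] by (simp add: inner_commute)
      then show ?thesis by (simp add: load_def inner_add_left inner_commute[of "wx (y t)" ?h])
    qed
    finally have "F (y t) \<bullet> y t = (p0 - \<beta> *\<^sub>R V ?h - (\<beta> * U) *\<^sub>R wx (y t)) \<bullet> V ?h + (b1 - b2 * ?q t) * (?h \<bullet> wx (y t)) - k0 * (M ?h \<bullet> ?h)" .
    moreover have "M ?h \<bullet> ?h = \<alpha> * (norm ?h)\<^sup>2 + (norm (V ?h))\<^sup>2" by (simp add: M_inner power2_norm_eq_inner)
    moreover have "(p0 - \<beta> *\<^sub>R V ?h - (\<beta> * U) *\<^sub>R wx (y t)) \<bullet> V ?h = (p0 - (\<beta> * U) *\<^sub>R wx (y t)) \<bullet> V ?h - \<beta> * (norm (V ?h))\<^sup>2"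
      by (simp add: inner_diff_left power2_norm_eq_inner)
    ultimately show ?thesis by (simp add: rate_def power2_norm_eq_inner inner_diff_left algebra_simps)
  qed
  ultimately show ?thesis by (simp add: En_def)
qed

lemma a_priori_bound:
  "\<exists>B. \<forall>t y. 0 \<le> t \<and> t \<le> T \<and> wsol F t y \<and> continuous_on {0..t} y \<and> norm (y 0) \<le> r \<longrightarrow> norm (y t) \<le> B"
proof -
  obtain Kw where Kw: "0 < Kw" "\<And>x. norm (wx x) \<le> norm x * Kw" using wx.pos_bounded by blast
  have "bounded_linear (\<lambda>y. V (hh y))" by (rule bounded_linear_compose[OF V.bounded_linear_axioms hh.bounded_linear_axioms])
  then obtain Kv where Kv: "0 < Kv" "\<And>x. norm (V (hh x)) \<le> norm x * Kv" using bounded_linear.pos_bounded by blast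
  define c1 where "c1 = norm p0 * Kv"
  define c2 where "c2 = \<bar>\<beta> * U\<bar> * Kw * Kv"
  define k where "k = 2 * (c1 + c2)"
  have c0: "0 \<le> c1" "0 \<le> c2" using Kw Kv by (simp_all add: c1_def c2_def)
  have k0': "0 \<le> k" using c0 by (simp add: k_def)
  \<comment> \<open>The constant completes the square in q = |w_x|^2: b2 q^2 / 2 - b1 q is at least
    - b1^2 / (2 b2). Hence N dominates the squared norm although the energy may be negative.\<close>
  define N where "N y = 2 * En y + b1\<^sup>2 / (2 * b2)" for y
  have N_ge: "(norm y)\<^sup>2 \<le> N y" for y
  proof -
    define q where "q = (norm (wx y))\<^sup>2"
    have "b2 / 2 * q\<^sup>2 - b1 * q + b1\<^sup>2 / (2 * b2) = b2 / 2 * (q - b1 / b2)\<^sup>2"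
      using b2 by (simp add: power2_eq_square field_simps)
    moreover have "0 \<le> b2 / 2 * (q - b1 / b2)\<^sup>2" using b2 by simp
    moreover have "N y = (norm y)\<^sup>2 + (b2 / 2 * q\<^sup>2 - b1 * q + b1\<^sup>2 / (2 * b2))"
      by (simp add: N_def En_def q_def field_simps)
    ultimately show ?thesis by linarith
  qed
  \<comment> \<open>The damping terms have a favourable sign; forcing and flow grow at most
    quadratically in the norm, thus at most linearly in N.\<close>
  have rate_le: "2 * rate y \<le> k * N y + k" for y
  proof -
    let ?n = "norm y"
    have "(p0 - (\<beta> * U) *\<^sub>R wx y) \<bullet> V (hh y) \<le> norm (p0 - (\<beta> * U) *\<^sub>R wx y) * norm (V (hh y))"
      by (rule norm_cauchy_schwarz)
    also have "\<dots> \<le> (norm p0 + \<bar>\<beta> * U\<bar> * (?n * Kw)) * (?n * Kv)"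
    proof (intro mult_mono Kv)
      show "norm (p0 - (\<beta> * U) *\<^sub>R wx y) \<le> norm p0 + \<bar>\<beta> * U\<bar> * (?n * Kw)"
        by (rule order_trans[OF norm_triangle_ineq4]) (simp add: mult_left_mono Kw)
    qed (use Kw in auto)
    also have "\<dots> = c1 * ?n + c2 * ?n\<^sup>2" by (simp add: c1_def c2_def power2_eq_square algebra_simps)
    also have "\<dots> \<le> c1 * (1 + ?n\<^sup>2) + c2 * (1 + ?n\<^sup>2)"
    proof (intro add_mono mult_left_mono c0)
      have "0 \<le> (?n - 1)\<^sup>2" by simp
      then have "2 * ?n \<le> 1 + ?n\<^sup>2" by (simp add: power2_eq_square algebra_simps)
      then show "?n \<le> 1 + ?n\<^sup>2" using norm_ge_zero[of y] by linarith
    qed simp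
    also have "\<dots> = k / 2 * (1 + ?n\<^sup>2)" by (simp add: k_def algebra_simps)
    also have "\<dots> \<le> k / 2 * (1 + N y)" using N_ge[of y] k0' by (intro mult_left_mono) auto
    finally have "(p0 - (\<beta> * U) *\<^sub>R wx y) \<bullet> V (hh y) \<le> k / 2 * (1 + N y)" .
    moreover have "0 \<le> (k0 + \<beta>) * (norm (V (hh y)))\<^sup>2" "0 \<le> \<alpha> * k0 * (norm (hh y))\<^sup>2"
      using k0 \<beta> \<alpha> by simp_all
    ultimately have "rate y \<le> k / 2 * (1 + N y)" unfolding rate_def by linarith
    then show ?thesis by (simp add: algebra_simps)
  qed
  define q0 where "q0 = (\<bar>r\<bar> * Kw)\<^sup>2"
  define N0 where "N0 = r\<^sup>2 + b2 / 2 * q0\<^sup>2 + \<bar>b1\<bar> * q0 + b1\<^sup>2 / (2 * b2)"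
  define B where "B = (N0 + k * \<bar>T\<bar>) * exp (k * \<bar>T\<bar>)"
  have "norm (y t) \<le> B + 1"
    if t: "0 \<le> t" "t \<le> T" and y: "wsol F t y" "continuous_on {0..t} y" and r: "norm (y 0) \<le> r" for t y
  proof -
    have q: "(norm (wx (y 0)))\<^sup>2 \<le> q0"
      unfolding q0_def using Kw r by (intro power_mono order_trans[OF Kw(2)] mult_right_mono) auto
    have N0: "N (y 0) \<le> N0"
    proof -
      have "(norm (y 0))\<^sup>2 \<le> r\<^sup>2" using r by (intro power_mono) auto
      moreover have "b2 / 2 * ((norm (wx (y 0)))\<^sup>2)\<^sup>2 \<le> b2 / 2 * q0\<^sup>2"
        using b2 q by (intro mult_left_mono power_mono) auto
      moreover have "- (b1 * (norm (wx (y 0)))\<^sup>2) \<le> \<bar>b1\<bar> * q0"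
      proof -
        have "- (b1 * (norm (wx (y 0)))\<^sup>2) \<le> \<bar>b1\<bar> * (norm (wx (y 0)))\<^sup>2"
          by (metis abs_ge_minus_self mult_minus_left mult_right_mono zero_le_power2)
        also have "\<dots> \<le> \<bar>b1\<bar> * q0" using q by (intro mult_left_mono) auto
        finally show ?thesis .
      qed
      ultimately show ?thesis by (simp add: N_def En_def N0_def)
    qed
    have N0': "0 \<le> N0" using N0 N_ge[of "y 0"] zero_le_power2[of "norm (y 0)"] by linarith
    have "N (y t) \<le> (N (y 0) + k * t) * exp (k * t)"
    proof (rule gronwall_deriv[of t t "\<lambda>s. N (y s)" "\<lambda>s. 2 * rate (y s)" k k])
      fix s assume s: "s \<in> {0..t}"
      have "((\<lambda>s. 2 * En (y s) + b1\<^sup>2 / (2 * b2)) has_real_derivative 2 * rate (y s) + 0) (at s within {0..t})"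
        by (intro DERIV_add DERIV_cmult DERIV_const energy_deriv y s)
      then show "((\<lambda>s. N (y s)) has_real_derivative 2 * rate (y s)) (at s within {0..t})" by (simp add: N_def)
    qed (use t k0' rate_le in auto)
    also have "\<dots> \<le> B"
      unfolding B_def using N0 N0' t k0' by (intro mult_mono add_mono mult_left_mono) (auto intro: mult_left_mono)
    finally have "(norm (y t))\<^sup>2 \<le> B" using N_ge[of "y t"] by linarith
    moreover have "2 * norm (y t) \<le> 1 + (norm (y t))\<^sup>2"
      using zero_le_power2[of "norm (y t) - 1"] by (simp add: power2_eq_square algebra_simps)
    moreover have "0 \<le> norm (y t)" by simp
    ultimately show ?thesis by linarith
  qed
  then show ?thesis by blast
qed

lemma semilinear_F: "semilinear Dom A F"
  by unfold_locales (rule F_lipschitz_ball, rule a_priori_bound)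

sublocale semilinear Dom A F by (rule semilinear_F)

text \<open>The orthogonal projection onto the states; \<open>P y = y\<close> holds exactly if y is
  \<iota> of a pair from \<open>E\<close>.\<close>

definition P :: "l2 \<times> l2 \<times> l2 \<Rightarrow> l2 \<times> l2 \<times> l2" where "P y = \<iota> (gg y) (hh y)"

lemma P_add: "P (x + y) = P x + P y" and P_diff: "P (x - y) = P x - P y" and P_scale: "P (c *\<^sub>R y) = c *\<^sub>R P y"
  by (simp_all add: P_def \<iota>_add \<iota>_diff \<iota>_scale gg.add gg.diff gg.scaleR hh.add hh.diff hh.scaleR)

lemma P_\<iota>: "g \<in> E \<Longrightarrow> h \<in> E \<Longrightarrow> P (\<iota> g h) = \<iota> g h"
  by (simp add: P_def gg_\<iota> hh_\<iota>)

lemma P_A: assumes "y \<in> Dom" shows "P (A y) = A y"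
proof -
  obtain \<psi> f where y: "\<psi> \<in> E" "f \<in> E" "hh y = V \<psi>" "gg y = W f" using assms unfolding Dom_def by blast
  show ?thesis unfolding A_eq[OF y] by (intro P_\<iota> E_neg E_scale Mi_E y)
qed

lemma P_F: "P (F y) = F y"
  unfolding F_def by (intro P_\<iota> E_0 E_diff E_scale Mi_E load_E hh_E)

text \<open>The component orthogonal to the states is conserved: it lies in \<open>Dom\<close>, is
  annihilated by A and is orthogonal to all values of F, so pairing with it is constant in
  time.\<close>

lemma P_wsol:
  assumes y: "wsol F T y" and y0: "P (y 0) = y 0" and t: "t \<in> {0..T}"
  shows "P (y t) = y t"
proof -
  define \<phi> where "\<phi> = y t - P (y t)"
  have g0: "gg \<phi> = 0" and h0: "hh \<phi> = 0"
    by (simp_all add: \<phi>_def P_def gg.diff hh.diff gg_\<iota> hh_\<iota> gg_E hh_E)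
  have \<phi>D: "\<phi> \<in> Dom" unfolding Dom_def
    by (intro CollectI bexI[of _ 0] E_0) (simp add: g0 h0 V.zero W.zero)
  have "A \<phi> = \<iota> 0 (- (D *\<^sub>R Mi 0))" by (rule A_eq) (simp_all add: E_0 g0 h0 V.zero W.zero)
  then have A0: "A \<phi> = 0" by (simp add: Mi.zero \<iota>_0)
  have F0: "F z \<bullet> \<phi> = 0" for z by (simp add: F_inner h0)
  have P0: "P z \<bullet> \<phi> = 0" for z
    unfolding P_def by (simp add: inner_\<iota> gg_E hh_E g0 h0 M.zero)
  have der: "((\<lambda>s. y s \<bullet> \<phi>) has_real_derivative 0) (at s within {0..t})" if s: "s \<in> {0..t}" for s
    using wsol_deriv[OF y \<phi>D, of s] s t by (auto simp: A0 F0 intro: DERIV_subset)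
  have t0: "0 \<le> t" using t by simp
  have "y t \<bullet> \<phi> \<le> y 0 \<bullet> \<phi>"
    by (rule deriv_within_nonincreasing[OF t0 der]) auto
  also have "y 0 \<bullet> \<phi> = 0" using P0[of "y 0"] y0 by simp
  finally have "\<phi> \<bullet> \<phi> \<le> 0" using P0[of "y t"] by (simp add: \<phi>_def inner_diff_left)
  then have "\<phi> = 0" using inner_ge_zero[of \<phi>] by simp
  then show ?thesis by (simp add: \<phi>_def)
qed

lemma P_S: "P y = y \<Longrightarrow> 0 \<le> t \<Longrightarrow> P (S t y) = S t y"
  using P_wsol[OF S_wsol[of t y], of t] by (simp add: S_0)

lemma P_J: "P y = y \<Longrightarrow> P (J (lam n) y) = J (lam n) y"
proof -
  assume y: "P y = y"
  have J: "J (lam n) y = y + lam n *\<^sub>R A (J (lam n) y)" using J_Yos[OF lam_nonzero, of n y] by (simp add: Yos_def)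
  have "P (J (lam n) y) = P (y + lam n *\<^sub>R A (J (lam n) y))" by (rule arg_cong[OF J])
  also have "\<dots> = y + lam n *\<^sub>R A (J (lam n) y)"
    unfolding P_add P_scale y P_A[OF J_D[OF lam_nonzero]] ..
  also have "\<dots> = J (lam n) y" by (rule J[symmetric])
  finally show ?thesis .
qed

end

section \<open>Functions of time\<close>

lemma continuous_on_at_right:
  fixes k :: "real \<Rightarrow> 'a::topological_space"
  assumes k: "continuous_on {0..T} k" and t: "t \<in> {0..<T}"
  shows "(k \<longlongrightarrow> k t) (at_right t)"
proof -
  have "continuous_on {t..T} k" by (rule continuous_on_subset[OF k]) (use t in auto)
  then have "(k \<longlongrightarrow> k t) (at t within {t..T})" using t by (auto simp: continuous_on)
  then show ?thesis using t at_within_Icc_at_right[of t T] by simp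
qed

text \<open>u is sampled at the next grid point strictly to the right. Right continuity is all that
  the right derivative of a strong solution offers, so left or midpoint sampling would not
  do.\<close>

lemma strongly_measurable_right_continuous:
  assumes T: "0 < T" and X: "\<And>t. t \<in> {0<..<T} \<Longrightarrow> u t \<in> X"
    and N: "\<And>t. t \<in> {0<..<T} \<Longrightarrow> ((\<lambda>s. N (u s - u t)) \<longlongrightarrow> 0) (at_right t)"
  shows "strongly_measurable T X N u"
proof -
  \<comment> \<open>The floor plus one gives a grid point strictly greater than t, also when t is
    itself a grid point.\<close>
  define q where "q n t = (of_int \<lfloor>real (Suc n) * t\<rfloor> + 1) / real (Suc n)" for n and t :: real
  \<comment> \<open>Sampling has to stay in (0, T); the default T / 2 is used only near T and, for
    fixed t, only for finitely many n.\<close>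
  define \<tau> where "\<tau> n t = (if q n t < T then q n t else T / 2)" for n t
  have q: "t < q n t" "q n t \<le> t + 1 / real (Suc n)" for n t
  proof -
    have "real (Suc n) * t < of_int \<lfloor>real (Suc n) * t\<rfloor> + 1" by linarith
    then show "t < q n t" unfolding q_def by (simp add: pos_less_divide_eq mult.commute del: of_nat_Suc)
    have "of_int \<lfloor>real (Suc n) * t\<rfloor> + 1 \<le> real (Suc n) * t + 1" by linarith
    then have "q n t \<le> (real (Suc n) * t + 1) / real (Suc n)" unfolding q_def by (rule divide_right_mono) simp
    also have "\<dots> = t + 1 / real (Suc n)" by (simp add: add_divide_distrib del: of_nat_Suc)
    finally show "q n t \<le> t + 1 / real (Suc n)" .
  qed
  have \<tau>: "\<tau> n t \<in> {0<..<T}" if "t \<in> {0<..<T}" for n t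
    using q(1)[of t n] that T by (auto simp: \<tau>_def)
  have simple: "simple_function (lebesgue_on {0<..<T}) (\<tau> n)" for n
  proof (rule simple_function_borel_measurable)
    have "\<tau> n \<in> borel_measurable borel" unfolding \<tau>_def q_def by measurable
    then have "\<tau> n \<in> borel_measurable lebesgue" by (intro measurable_completion) simp
    then show "\<tau> n \<in> borel_measurable (lebesgue_on {0<..<T})" by (rule measurable_restrict_space1)
    have "\<tau> n ` {0<..<T} \<subseteq> (\<lambda>k. (of_int k + 1) / real (Suc n)) ` {0..\<lfloor>real (Suc n) * T\<rfloor>} \<union> {T / 2}"
    proof
      fix s assume "s \<in> \<tau> n ` {0<..<T}"
      then obtain t where t: "t \<in> {0<..<T}" "s = \<tau> n t" by auto
      have "real (Suc n) * t \<le> real (Suc n) * T" using t by (intro mult_left_mono) auto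
      then have k: "\<lfloor>real (Suc n) * t\<rfloor> \<in> {0..\<lfloor>real (Suc n) * T\<rfloor>}" using t by (auto intro: floor_mono)
      show "s \<in> (\<lambda>k. (of_int k + 1) / real (Suc n)) ` {0..\<lfloor>real (Suc n) * T\<rfloor>} \<union> {T / 2}"
      proof (cases "q n t < T")
        case True
        then have "s = (\<lambda>k. (of_int k + 1) / real (Suc n)) \<lfloor>real (Suc n) * t\<rfloor>" by (simp only: t(2) \<tau>_def q_def if_True)
        then show ?thesis using k by blast
      qed (simp add: t(2) \<tau>_def)
    qed
    then show "finite (\<tau> n ` space (lebesgue_on {0<..<T}))"
      by (simp add: finite_subset)
  qed
  have lim: "filterlim (\<lambda>n. \<tau> n t) (at_right t) sequentially" if t: "t \<in> {0<..<T}" for t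
  proof -
    have l: "(\<lambda>n. t + 1 / real (Suc n)) \<longlonglongrightarrow> t + 0"
      by (intro tendsto_intros LIMSEQ_Suc[OF lim_1_over_n])
    have "(\<lambda>n. q n t) \<longlonglongrightarrow> t"
      by (rule tendsto_sandwich[OF _ _ tendsto_const[of t] l[unfolded add_0_right]])
        (rule always_eventually, rule allI, rule less_imp_le, rule q(1), rule always_eventually, rule allI, rule q(2))
    then have "\<forall>\<^sub>F n in sequentially. q n t < T" using t by (intro order_tendstoD) auto
    then have "\<forall>\<^sub>F n in sequentially. q n t = \<tau> n t" by eventually_elim (simp add: \<tau>_def)
    with \<open>(\<lambda>n. q n t) \<longlonglongrightarrow> t\<close> have 1: "(\<lambda>n. \<tau> n t) \<longlonglongrightarrow> t" by (rule Lim_transform_eventually)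
    have "\<forall>\<^sub>F n in sequentially. \<tau> n t \<in> {t<..} \<and> \<tau> n t \<noteq> t"
      using \<open>\<forall>\<^sub>F n in sequentially. q n t < T\<close>
    proof eventually_elim
      case (elim n)
      then show ?case using q(1)[of t n] by (simp add: \<tau>_def)
    qed
    with 1 show ?thesis unfolding filterlim_at by simp
  qed
  show ?thesis unfolding strongly_measurable_def
  proof (intro exI[of _ "\<lambda>n t. u (\<tau> n t)"] conjI allI AE_I2)
    show "simple_function (lebesgue_on {0<..<T}) (\<lambda>t. u (\<tau> n t))" for n
      using simple_function_compose[OF simple[of n], of u] by (simp add: o_def)
    show "(\<lambda>t. u (\<tau> n t)) ` {0<..<T} \<subseteq> X" for n using X \<tau> by auto
    fix t assume "t \<in> space (lebesgue_on {0<..<T})"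
    then have t: "t \<in> {0<..<T}" by simp
    then show "u t \<in> X" by (rule X)
    show "(\<lambda>n. N (u (\<tau> n t) - u t)) \<longlonglongrightarrow> 0" by (rule filterlim_compose[OF N[OF t] lim[OF t]])
  qed
qed

lemma Linf_timeI:
  assumes "0 < T" "\<And>t. t \<in> {0<..<T} \<Longrightarrow> u t \<in> X"
    and "\<And>t. t \<in> {0<..<T} \<Longrightarrow> ((\<lambda>s. N (u s - u t)) \<longlongrightarrow> 0) (at_right t)"
    and "\<And>t. t \<in> {0<..<T} \<Longrightarrow> N (u t) \<le> C"
  shows "Linf_time T X N u"
  unfolding Linf_time_def
proof
  show "strongly_measurable T X N u" by (rule strongly_measurable_right_continuous[OF assms(1-3)])
  show "\<exists>C. AE t in lebesgue_on {0<..<T}. N (u t) \<le> C"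
    using assms(4) by (intro exI[of _ C] AE_I2) simp
qed

lemma integrable_lebesgue_on_continuous:
  fixes u :: "real \<Rightarrow> 'b::{banach, second_countable_topology}"
  assumes u: "continuous_on {a..b} u" and S: "S \<in> sets borel" "S \<subseteq> {a..b}"
  shows "integrable (lebesgue_on S) u"
proof -
  have "integrable lborel (\<lambda>x. indicator {a..b} x *\<^sub>R u x)" by (rule borel_integrable_compact[OF _ u]) simp
  from integrable_mult_indicator[OF _ this, of S]
  have "integrable lborel (\<lambda>x. indicator S x *\<^sub>R (indicator {a..b} x *\<^sub>R u x))" using S(1) by simp
  moreover have "(\<lambda>x. indicator S x *\<^sub>R (indicator {a..b} x *\<^sub>R u x)) = (\<lambda>x. indicator S x *\<^sub>R u x)"
  proof (rule ext)
    fix x show "indicator S x *\<^sub>R (indicator {a..b} x *\<^sub>R u x) = indicator S x *\<^sub>R u x"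
      using S(2) by (cases "x \<in> S") auto
  qed
  ultimately have i: "integrable lborel (\<lambda>x. indicator S x *\<^sub>R u x)" by simp
  then have "(\<lambda>x. indicator S x *\<^sub>R u x) \<in> borel_measurable lborel" by (rule borel_measurable_integrable)
  then have "integrable lebesgue (\<lambda>x. indicator S x *\<^sub>R u x)" using i integrable_completion by blast
  then show ?thesis using S by (subst integrable_restrict_space) auto
qed

lemma test_support:
  assumes "test_function a b \<phi>"
  shows "\<exists>c d. a < c \<and> d < b \<and> (\<forall>x. x \<notin> {c..d} \<longrightarrow> \<phi> x = 0 \<and> deriv \<phi> x = 0)"
proof -
  obtain c d where cd: "a < c" "d < b" "\<And>x. x \<notin> {c..d} \<Longrightarrow> \<phi> x = 0"
    using assms unfolding test_function_iff by blast
  have "deriv \<phi> x = 0" if "x \<notin> {c..d}" for x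
  proof -
    have "((\<lambda>_. 0) has_real_derivative 0) (at x)" by simp
    then have "(\<phi> has_real_derivative 0) (at x)"
      by (rule has_field_derivative_transform_within_open[of _ _ _ "- {c..d}"]) (use cd that in auto)
    then show ?thesis by (rule DERIV_imp_deriv)
  qed
  then show ?thesis using cd by blast
qed

text \<open>A distributional derivative only provides local integrability; the compact support of
  the test function makes the products integrable over the whole interval.\<close>

lemma integrable_supported:
  fixes u :: "real \<Rightarrow> 'b::{banach, second_countable_topology}" and f :: "real \<Rightarrow> real"
  assumes f: "continuous_on UNIV f" and z: "\<And>x. x \<notin> {c..d} \<Longrightarrow> f x = (0::real)"
    and u: "integrable (lebesgue_on {c..d}) u"
  shows "integrable (lebesgue_on {a<..<b}) (\<lambda>x. f x *\<^sub>R u x)"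
proof -
  have i: "integrable lebesgue (\<lambda>x. indicator {c..d} x *\<^sub>R u x)"
    using u by (subst (asm) integrable_restrict_space) auto
  have "bounded (f ` {c..d})" by (intro compact_imp_bounded compact_continuous_image continuous_on_subset[OF f]) auto
  then obtain B where B: "\<And>x. x \<in> {c..d} \<Longrightarrow> \<bar>f x\<bar> \<le> B" unfolding bounded_iff real_norm_def by blast
  have fB: "\<bar>f x\<bar> \<le> \<bar>B\<bar>" for x using B[of x] z[of x] by (cases "x \<in> {c..d}") auto
  have fm: "f \<in> borel_measurable lebesgue"
    by (intro measurable_completion) (simp add: borel_measurable_continuous_onI[OF f])
  have "integrable lebesgue (\<lambda>x. f x *\<^sub>R (indicator {c..d} x *\<^sub>R u x))"
  proof (rule Bochner_Integration.integrable_bound)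
    show "integrable lebesgue (\<lambda>x. \<bar>B\<bar> * norm (indicator {c..d} x *\<^sub>R u x))"
      by (intro integrable_mult_right integrable_norm i)
    show "(\<lambda>x. f x *\<^sub>R (indicator {c..d} x *\<^sub>R u x)) \<in> borel_measurable lebesgue"
      by (intro borel_measurable_scaleR fm borel_measurable_integrable i)
    show "AE x in lebesgue. norm (f x *\<^sub>R (indicator {c..d} x *\<^sub>R u x)) \<le> norm (\<bar>B\<bar> * norm (indicator {c..d} x *\<^sub>R u x))"
    proof (intro AE_I2)
      fix x
      show "norm (f x *\<^sub>R (indicator {c..d} x *\<^sub>R u x)) \<le> norm (\<bar>B\<bar> * norm (indicator {c..d} x *\<^sub>R u x))"
        unfolding norm_scaleR[of "f x"] using fB[of x] by (simp add: abs_mult mult_right_mono)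
    qed
  qed
  moreover have "(\<lambda>x. f x *\<^sub>R (indicator {c..d} x *\<^sub>R u x)) = (\<lambda>x. f x *\<^sub>R u x)"
  proof (rule ext)
    fix x show "f x *\<^sub>R (indicator {c..d} x *\<^sub>R u x) = f x *\<^sub>R u x"
      using z[of x] by (cases "x \<in> {c..d}") auto
  qed
  ultimately have "integrable lebesgue (\<lambda>x. f x *\<^sub>R u x)" by simp
  from integrable_mult_indicator[OF _ this, of "{a<..<b}"]
  have "integrable lebesgue (\<lambda>x. indicator {a<..<b} x *\<^sub>R (f x *\<^sub>R u x))" by simp
  then show ?thesis by (subst integrable_restrict_space) auto
qed

lemma distr_deriv_inner:
  fixes u v :: "real \<Rightarrow> 'b::{real_inner, banach, second_countable_topology}"
  assumes d: "distr_deriv a b u v"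
  shows "distr_deriv a b (\<lambda>t. u t \<bullet> z) (\<lambda>t. v t \<bullet> z)"
  unfolding distr_deriv_def
proof (intro conjI allI impI)
  fix c d assume "a < c \<and> d < b"
  then have "integrable (lebesgue_on {c..d}) u" "integrable (lebesgue_on {c..d}) v"
    using d by (auto simp: distr_deriv_def)
  then show "integrable (lebesgue_on {c..d}) (\<lambda>t. u t \<bullet> z)" "integrable (lebesgue_on {c..d}) (\<lambda>t. v t \<bullet> z)"
    by (auto intro: integrable_inner_left)
next
  fix \<phi> assume t: "test_function a b \<phi>"
  obtain c d where cd: "a < c" "d < b" "\<And>x. x \<notin> {c..d} \<Longrightarrow> \<phi> x = 0" "\<And>x. x \<notin> {c..d} \<Longrightarrow> deriv \<phi> x = 0"
    using test_support[OF t] by blast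
  have s: "smooth \<phi>" using t by (simp add: test_function_iff)
  have i: "integrable (lebesgue_on {c..d}) u" "integrable (lebesgue_on {c..d}) v"
    using d cd by (auto simp: distr_deriv_def)
  have 1: "integrable (lebesgue_on {a<..<b}) (\<lambda>x. deriv \<phi> x *\<^sub>R u x)"
    by (rule integrable_supported[OF smooth_continuous[OF smooth_deriv_smooth[OF s]] cd(4) i(1)])
  have 2: "integrable (lebesgue_on {a<..<b}) (\<lambda>x. \<phi> x *\<^sub>R v x)"
    by (rule integrable_supported[OF smooth_continuous[OF s] cd(3) i(2)])
  have "(\<integral>x. deriv \<phi> x *\<^sub>R u x \<partial>lebesgue_on {a<..<b}) = - (\<integral>x. \<phi> x *\<^sub>R v x \<partial>lebesgue_on {a<..<b})"
    using d t by (simp add: distr_deriv_def)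
  from arg_cong[OF this, of "\<lambda>x. x \<bullet> z"]
  show "(\<integral>x. deriv \<phi> x *\<^sub>R (u x \<bullet> z) \<partial>lebesgue_on {a<..<b}) = - (\<integral>x. \<phi> x *\<^sub>R (v x \<bullet> z) \<partial>lebesgue_on {a<..<b})"
    using integral_inner_left[of z _ "\<lambda>x. deriv \<phi> x *\<^sub>R u x", OF 1] integral_inner_left[of z _ "\<lambda>x. \<phi> x *\<^sub>R v x", OF 2]
    by simp
qed

text \<open>Both sides of the defining identity are vectors, so they may be compared by pairing with
  every z, where the scalar criterion applies.\<close>

lemma distr_deriv_weakI:
  fixes u v :: "real \<Rightarrow> 'b::{real_inner, banach, second_countable_topology}"
  assumes T: "0 < T" and u: "continuous_on {0..T} u" and v: "continuous_on {0..T} v"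
    and d: "\<And>t z. t \<in> {0..T} \<Longrightarrow> ((\<lambda>s. u s \<bullet> z) has_real_derivative v t \<bullet> z) (at t within {0..T})"
  shows "distr_deriv 0 T u v"
  unfolding distr_deriv_def
proof (intro conjI allI impI)
  fix c d :: real assume "0 < c \<and> d < T"
  then have "{c..d} \<subseteq> {0..T}" by auto
  then show "integrable (lebesgue_on {c..d}) u" "integrable (lebesgue_on {c..d}) v"
    using integrable_lebesgue_on_continuous[OF u] integrable_lebesgue_on_continuous[OF v] by simp_all
next
  fix \<phi> assume t: "test_function 0 T \<phi>"
  have s: "smooth \<phi>" using t by (simp add: test_function_iff)
  have sub: "{0<..<T} \<subseteq> {0..T}" by auto
  have 1: "integrable (lebesgue_on {0<..<T}) (\<lambda>x. deriv \<phi> x *\<^sub>R u x)"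
    by (rule integrable_lebesgue_on_continuous[OF _ _ sub])
      (intro continuous_on_scaleR smooth_continuous smooth_deriv_smooth s u, simp)
  have 2: "integrable (lebesgue_on {0<..<T}) (\<lambda>x. \<phi> x *\<^sub>R v x)"
    by (rule integrable_lebesgue_on_continuous[OF _ _ sub]) (intro continuous_on_scaleR smooth_continuous s v, simp)
  show "(\<integral>x. deriv \<phi> x *\<^sub>R u x \<partial>lebesgue_on {0<..<T}) = - (\<integral>x. \<phi> x *\<^sub>R v x \<partial>lebesgue_on {0<..<T})"
  proof (rule vector_eq_ldot[THEN iffD1], intro allI)
    fix z
    have "distr_deriv 0 T (\<lambda>t. u t \<bullet> z) (\<lambda>t. v t \<bullet> z)"
      using distr_deriv_continuous_iff[OF T, of "\<lambda>t. u t \<bullet> z" "\<lambda>t. v t \<bullet> z"] d u v by (simp add: continuous_on_inner)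
    then have "(\<integral>x. deriv \<phi> x *\<^sub>R (u x \<bullet> z) \<partial>lebesgue_on {0<..<T}) = - (\<integral>x. \<phi> x *\<^sub>R (v x \<bullet> z) \<partial>lebesgue_on {0<..<T})"
      using t unfolding distr_deriv_def by blast
    then show "z \<bullet> (\<integral>x. deriv \<phi> x *\<^sub>R u x \<partial>lebesgue_on {0<..<T}) = z \<bullet> (- (\<integral>x. \<phi> x *\<^sub>R v x \<partial>lebesgue_on {0<..<T}))"
      using integral_inner_left[of z _ "\<lambda>x. deriv \<phi> x *\<^sub>R u x", OF 1] integral_inner_left[of z _ "\<lambda>x. \<phi> x *\<^sub>R v x", OF 2]
      by (simp add: inner_commute[of z])
  qed
qed

lemma AE_lebesgue_on_interval:
  fixes T :: real
  assumes "AE t in lebesgue_on {0<..<T}. Q t"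
  shows "AE t in lborel. t \<in> {0<..<T} \<longrightarrow> Q t"
proof -
  have "{0<..<T} \<inter> space lebesgue \<in> sets lebesgue" using sets_completionI_sets[of "{0<..<T}" lborel] by simp
  from AE_restrict_space_iff[OF this, of Q] assms show ?thesis by (simp add: AE_completion_iff)
qed

text \<open>An almost everywhere bound on the norm of a weakly continuous function holds everywhere, since
  the norm is weakly lower semicontinuous.\<close>

lemma weakly_continuous_bound:
  fixes g :: "real \<Rightarrow> 'a::real_inner"
  assumes T: "0 < T" and c: "\<And>z. continuous_on {0..T} (\<lambda>t. g t \<bullet> z)"
    and b: "AE t in lebesgue_on {0<..<T}. norm (g t) \<le> C" and C: "0 \<le> C" and t: "t \<in> {0..T}"
  shows "norm (g t) \<le> C"
proof (rule norm_le_if_inner_le[OF _ C])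
  \<comment> \<open>The positive part turns an inequality holding almost everywhere into an equality
    of continuous functions holding almost everywhere, which extends to every time including the end
    points.\<close>
  let ?f = "\<lambda>s. max (g s \<bullet> g t - C * norm (g t)) 0"
  have "?f t = 0"
  proof (rule continuous_AE_eq[of T ?f "\<lambda>_. 0" t, OF T _ _ _ t])
    show "continuous_on {0..T} ?f" by (intro continuous_intros c)
    show "AE x in lborel. x \<in> {0<..<T} \<longrightarrow> ?f x = 0"
      using AE_lebesgue_on_interval[OF b]
    proof eventually_elim
      case (elim x)
      show ?case
      proof
        assume "x \<in> {0<..<T}"
        then have "norm (g x) \<le> C" using elim by blast
        then have "g x \<bullet> g t \<le> C * norm (g t)"
          using norm_cauchy_schwarz[of "g x" "g t"] mult_right_mono[OF _ norm_ge_zero, of "norm (g x)" C "g t"] by linarith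
        then show "?f x = 0" by simp
      qed
    qed
  qed simp
  then show "g t \<bullet> g t \<le> C * norm (g t)" by linarith
qed

section \<open>Solutions of the beam problem\<close>

context beam
begin

text \<open>\<open>dec\<close> after \<open>enc\<close> is the identity on the energy space, while
  \<open>enc\<close> after \<open>dec\<close> is \<open>P\<close>; the two are inverse isometries
  only on states with \<open>P y = y\<close>.\<close>

definition dec :: "l2 \<times> l2 \<times> l2 \<Rightarrow> l2 \<times> l2" where "dec y = (V (V (gg y)), V (hh y))"

definition enc :: "l2 \<times> l2 \<Rightarrow> l2 \<times> l2 \<times> l2"
  where "enc x = \<iota> (Dx L (Dx L (fst x))) (Dx L (snd x))"

lemma Dx_V: "g \<in> E \<Longrightarrow> Dx L (V g) = g" by (rule Dx_vol[OF L])

lemma DxDx_V: "g \<in> E \<Longrightarrow> Dx L (Dx L (V (V g))) = g" by (simp add: Dx_V V_E)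

lemma enc_dec: "enc (dec y) = P y"
  by (simp add: enc_def dec_def P_def Dx_V V_E gg_E hh_E)

lemma H_space_cases:
  assumes "x \<in> H_space L" obtains g h where "g \<in> E" "h \<in> E" "x = (V (V g), V h)"
  using assms by (auto simp: H_space_def H1s_eq[OF L] H2s_eq[OF L])

lemma H_spaceI: "g \<in> E \<Longrightarrow> h \<in> E \<Longrightarrow> (V (V g), V h) \<in> H_space L"
  by (auto simp: H_space_def H1s_eq[OF L] H2s_eq[OF L])

lemma enc_V: "g \<in> E \<Longrightarrow> h \<in> E \<Longrightarrow> enc (V (V g), V h) = \<iota> g h"
  by (simp add: enc_def Dx_V V_E)

lemma dec_\<iota>: "g \<in> E \<Longrightarrow> h \<in> E \<Longrightarrow> dec (\<iota> g h) = (V (V g), V h)"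
  by (simp add: dec_def gg_\<iota> hh_\<iota>)

lemma dec_enc: assumes "x \<in> H_space L" shows "dec (enc x) = x" and P_enc: "P (enc x) = enc x"
  using assms by (auto elim!: H_space_cases simp: enc_V dec_\<iota> P_\<iota>)

lemma dec_H: "dec y \<in> H_space L"
  unfolding dec_def by (intro H_spaceI gg_E hh_E)

lemma dec_diff: "dec x - dec y = dec (x - y)" and dec_scale: "c *\<^sub>R dec x = dec (c *\<^sub>R x)"
  by (simp_all add: dec_def gg.diff hh.diff V.diff gg.scaleR hh.scaleR V.scaleR)

lemma H_norm_dec: "H_norm L D \<alpha> (dec y) = norm (P y)"
proof -
  have "H_norm L D \<alpha> (dec y) = sqrt ((norm (\<iota> (gg y) (hh y)))\<^sup>2)"
    unfolding norm_\<iota> H_norm_def dec_def by (simp add: Dx_V V_E gg_E hh_E)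
  then show ?thesis by (simp add: P_def)
qed

lemma H_norm_dec_diff: "P y = y \<Longrightarrow> P z = z \<Longrightarrow> H_norm L D \<alpha> (dec y - dec z) = norm (y - z)"
  by (simp add: dec_diff H_norm_dec P_diff)

lemma H_norm_enc: "x \<in> H_space L \<Longrightarrow> H_norm L D \<alpha> x = norm (enc x)"
  using H_norm_dec[of "enc x"] by (simp add: dec_enc P_enc)

lemma H_norm_enc_diff: "x \<in> H_space L \<Longrightarrow> z \<in> H_space L \<Longrightarrow> H_norm L D \<alpha> (x - z) = norm (enc x - enc z)"
  using H_norm_dec_diff[of "enc x" "enc z"] by (simp add: dec_enc P_enc)

lemma H2s_inner_V: "g \<in> E \<Longrightarrow> g' \<in> E \<Longrightarrow> H2s_inner L D (V (V g)) (V (V g')) = D * (g \<bullet> g')"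
  by (simp add: H2s_inner_def Dx_V V_E)

lemma H2s_norm_V: "g \<in> E \<Longrightarrow> H2s_norm L D (V (V g)) = sqrt D * norm g"
  by (simp add: H2s_norm_def H2s_inner_V real_sqrt_mult norm_eq_sqrt_inner)

lemma La_inner_V: "h \<in> E \<Longrightarrow> h' \<in> E \<Longrightarrow> La_inner L \<alpha> (V h) (V h') = M h \<bullet> h'"
  by (simp add: La_inner_def Dx_V M_inner)

lemma La_norm_V: "h \<in> E \<Longrightarrow> La_norm L \<alpha> (V h) = sqrt (\<alpha> * (norm h)\<^sup>2 + (norm (V h))\<^sup>2)"
  by (simp add: La_norm_def Dx_V)

lemma bounded_image:
  assumes y: "\<And>t. t \<in> {0..T} \<Longrightarrow> norm (y t) \<le> B" and f: "bounded_linear f"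
  shows "\<exists>C. \<forall>t\<in>{0..T}. norm (f (y t)) \<le> C"
proof -
  obtain K where K: "0 < K" "\<And>x. norm (f x) \<le> norm x * K" using bounded_linear.pos_bounded[OF f] by blast
  have "norm (f (y t)) \<le> B * K" if "t \<in> {0..T}" for t
    using K(2)[of "y t"] mult_right_mono[OF y[OF that], of K] K(1) by linarith
  then show ?thesis by blast
qed

lemma load_inner:
  "load y \<bullet> V \<psi> = p0 \<bullet> V (V \<psi>) - \<beta> * (V (hh y) \<bullet> V (V \<psi>)) - \<beta> * U * (wx y \<bullet> V (V \<psi>))
    - (b2 * (norm (wx y))\<^sup>2 - b1) * (wx y \<bullet> V \<psi>)"
proof -
  have "W x \<bullet> V \<psi> = x \<bullet> V (V \<psi>)" for x using V_W[of "V \<psi>" x] by (simp add: inner_commute)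
  then show ?thesis by (simp add: load_def inner_add_left inner_diff_left algebra_simps)
qed

lemma weak_solution_dec:
  assumes T: "0 < T" and y: "wsol F T y" and yc: "continuous_on {0..T} y"
  shows "weak_solution L D \<alpha> b1 b2 U \<beta> k0 p0 T (dec (y 0)) (\<lambda>t. fst (dec (y t))) (\<lambda>t. snd (dec (y t)))"
proof -
  define g where "g t = gg (y t)" for t
  define h where "h t = hh (y t)" for t
  have gE: "g t \<in> E" and hE: "h t \<in> E" for t by (simp_all add: g_def h_def gg_E hh_E)
  have w: "fst (dec (y t)) = V (V (g t))" and v: "snd (dec (y t)) = V (h t)" for t
    by (simp_all add: dec_def g_def h_def)
  have gc: "continuous_on {0..T} g" and hc: "continuous_on {0..T} h"
    unfolding g_def h_def by (intro gg.continuous_on hh.continuous_on yc)+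
  have Vgc: "continuous_on {0..T} (\<lambda>t. V (V (g t)))" and Vhc: "continuous_on {0..T} (\<lambda>t. V (h t))"
    and V1c: "continuous_on {0..T} (\<lambda>t. V (g t))"
    by (intro V.continuous_on gc hc)+
  have wxy: "wx (y t) = V (g t)" for t by (simp add: wx_def g_def)
  obtain B where B: "\<And>t. t \<in> {0..T} \<Longrightarrow> norm (y t) \<le> B" using wsol_bounded[OF y] by blast
  obtain Bg where Bg: "\<And>t. t \<in> {0..T} \<Longrightarrow> norm (g t) \<le> Bg"
    using bounded_image[of T y B gg, OF B bounded_linear_gg] unfolding g_def by blast
  obtain Bh where Bh: "\<And>t. t \<in> {0..T} \<Longrightarrow> norm (h t) \<le> Bh"
    using bounded_image[of T y B hh, OF B bounded_linear_hh] unfolding h_def by blast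
  obtain Bv where Bv: "\<And>t. t \<in> {0..T} \<Longrightarrow> norm (V (h t)) \<le> Bv"
    using bounded_image[of T h Bh V, OF Bh V.bounded_linear_axioms] by blast
  have L2: "L2_time T E norm u" if uc: "continuous_on {0..T} u" and uE: "\<And>t. u t \<in> E" for u
    unfolding L2_time_def
  proof
    show "strongly_measurable T E norm u"
    proof (rule strongly_measurable_right_continuous[OF T uE])
      fix t assume "t \<in> {0<..<T}"
      then have "(u \<longlongrightarrow> u t) (at_right t)" by (intro continuous_on_at_right[OF uc]) auto
      then show "((\<lambda>s. norm (u s - u t)) \<longlongrightarrow> 0) (at_right t)" by (intro tendsto_norm_zero LIM_zero)
    qed
    show "integrable (lebesgue_on {0<..<T}) (\<lambda>t. (norm (u t))\<^sup>2)"
      by (rule integrable_lebesgue_on_continuous[of 0 T]) (auto intro!: continuous_intros uc)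
  qed
  have deriv_w: "((\<lambda>s. V (V (g s)) \<bullet> z) has_real_derivative V (h t) \<bullet> z) (at t within {0..T})" if t: "t \<in> {0..T}" for t z
    using wx_weak_deriv[OF y t, of "W z"] by (simp add: wxy V_W h_def)
  have H1: "H1_time_L2 L T (\<lambda>t. V (V (g t))) (\<lambda>t. V (h t))"
    unfolding H1_time_L2_def using L2[OF Vgc V_E] L2[OF Vhc V_E] distr_deriv_weakI[OF T Vgc Vhc deriv_w] by blast
  have Linf_w: "Linf_time T (H2s L) (H2s_norm L D) (\<lambda>t. V (V (g t)))"
  proof (rule Linf_timeI[OF T])
    show "V (V (g t)) \<in> H2s L" for t using gE by (auto simp: H2s_eq[OF L])
    fix t assume t: "t \<in> {0<..<T}"
    have "((\<lambda>s. sqrt D * norm (g s - g t)) \<longlongrightarrow> sqrt D * norm (g t - g t)) (at_right t)"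
      using t by (intro tendsto_intros continuous_on_at_right[OF gc]) auto
    then show "((\<lambda>s. H2s_norm L D (V (V (g s)) - V (V (g t)))) \<longlongrightarrow> 0) (at_right t)"
      by (simp add: H2s_norm_V E_diff gE flip: V.diff)
    show "H2s_norm L D (V (V (g t))) \<le> sqrt D * Bg" using Bg[of t] t by (simp add: H2s_norm_V gE D)
  qed
  have Linf_v: "Linf_time T (H1s L) (La_norm L \<alpha>) (\<lambda>t. V (h t))"
  proof (rule Linf_timeI[OF T])
    show "V (h t) \<in> H1s L" for t using hE by (auto simp: H1s_eq[OF L])
    fix t assume t: "t \<in> {0<..<T}"
    have "((\<lambda>s. sqrt (\<alpha> * (norm (h s - h t))\<^sup>2 + (norm (V (h s - h t)))\<^sup>2)) \<longlongrightarrow>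
        sqrt (\<alpha> * (norm (h t - h t))\<^sup>2 + (norm (V (h t - h t)))\<^sup>2)) (at_right t)"
      using t by (intro tendsto_intros V.tendsto continuous_on_at_right[OF hc]) auto
    then show "((\<lambda>s. La_norm L \<alpha> (V (h s) - V (h t))) \<longlongrightarrow> 0) (at_right t)"
      by (simp add: La_norm_V E_diff hE V.zero flip: V.diff)
    have "t \<in> {0..T}" using t by simp
    then show "La_norm L \<alpha> (V (h t)) \<le> sqrt (\<alpha> * Bh\<^sup>2 + Bv\<^sup>2)"
      using \<alpha> unfolding La_norm_V[OF hE] by (intro real_sqrt_le_mono add_mono mult_left_mono power_mono Bh Bv) auto
  qed
  have wc_w: "weakly_continuous T (H2s L) (H2s_inner L D) (\<lambda>t. V (V (g t)))"
    unfolding weakly_continuous_def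
  proof (intro conjI ballI)
    show "V (V (g t)) \<in> H2s L" for t using gE by (auto simp: H2s_eq[OF L])
    fix k assume "k \<in> H2s L"
    then obtain g' where g': "g' \<in> E" "k = V (V g')" by (auto simp: H2s_eq[OF L])
    show "continuous_on {0..T} (\<lambda>t. H2s_inner L D (V (V (g t))) k)"
      unfolding g'(2) H2s_inner_V[OF gE g'(1)] by (intro continuous_intros gc)
  qed
  have wc_v: "weakly_continuous T (H1s L) (La_inner L \<alpha>) (\<lambda>t. V (h t))"
    unfolding weakly_continuous_def
  proof (intro conjI ballI)
    show "V (h t) \<in> H1s L" for t using hE by (auto simp: H1s_eq[OF L])
    fix k assume "k \<in> H1s L"
    then obtain h' where h': "h' \<in> E" "k = V h'" by (auto simp: H1s_eq[OF L])
    show "continuous_on {0..T} (\<lambda>t. La_inner L \<alpha> (V (h t)) k)"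
      unfolding h'(2) La_inner_V[OF hE h'(1)] by (intro continuous_intros M.continuous_on hc)
  qed
  have eqn: "distr_deriv 0 T
      (\<lambda>t. V (h t) \<bullet> \<phi> + \<alpha> * (Dx L (V (h t)) \<bullet> Dx L \<phi>))
      (\<lambda>t. p0 \<bullet> \<phi> - \<beta> * (V (h t) \<bullet> \<phi>) - \<beta> * U * (Dx L (V (V (g t))) \<bullet> \<phi>) -
        (H2s_inner L D (V (V (g t))) \<phi> +
         (b2 * (norm (Dx L (V (V (g t)))))\<^sup>2 - b1) * (Dx L (V (V (g t))) \<bullet> Dx L \<phi>) +
         k0 * (V (h t) \<bullet> \<phi>) + \<alpha> * k0 * (Dx L (V (h t)) \<bullet> Dx L \<phi>)))" (is "distr_deriv 0 T ?l ?r")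
    if \<phi>H: "\<phi> \<in> H2s L" for \<phi>
  proof -
    obtain \<psi> where \<psi>: "\<psi> \<in> E" "\<phi> = V (V \<psi>)" using \<phi>H by (auto simp: H2s_eq[OF L])
    \<comment> \<open>The state with velocity \<phi> and no displacement. It lies in
      \<open>Dom\<close> and A sends it to \<iota> \<psi> 0, so the abstract weak equation for it is
      the variational identity for \<phi>.\<close>
    define \<Phi> where "\<Phi> = \<iota> 0 (V \<psi>)"
    have g\<Phi>: "gg \<Phi> = W 0" and h\<Phi>: "hh \<Phi> = V \<psi>" by (simp_all add: \<Phi>_def gg_\<iota> hh_\<iota> V_E E_0 W.zero)
    have \<Phi>D: "\<Phi> \<in> Dom" unfolding Dom_def using \<psi>(1) E_0 g\<Phi> h\<Phi> by blast
    have A\<Phi>: "A \<Phi> = \<iota> \<psi> 0" using A_eq[OF \<psi>(1) E_0 h\<Phi> g\<Phi>] by (simp add: Mi.zero)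
    have l: "?l t = y t \<bullet> \<Phi>" for t
    proof -
      have "y t \<bullet> \<Phi> = V \<psi> \<bullet> M (h t)"
        unfolding inner_commute[of "y t"] \<Phi>_def by (simp add: inner_\<iota> E_0 V_E h_def)
      also have "\<dots> = M (h t) \<bullet> V \<psi>" by (rule inner_commute)
      finally show ?thesis by (simp add: \<psi>(2) Dx_V V_E hE M_inner)
    qed
    have r: "?r t = - (y t \<bullet> A \<Phi>) + F (y t) \<bullet> \<Phi>" for t
    proof -
      have "y t \<bullet> A \<Phi> = D * (\<psi> \<bullet> g t)"
        unfolding inner_commute[of "y t"] A\<Phi> by (simp add: inner_\<iota> E_0 \<psi>(1) g_def)
      moreover have "F (y t) \<bullet> \<Phi> = load (y t) \<bullet> V \<psi> - k0 * (M (h t) \<bullet> V \<psi>)" by (simp add: F_inner h\<Phi> h_def)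
      ultimately show ?thesis
        using inner_commute[of \<psi> "g t"]
        by (simp add: load_inner M_inner \<psi>(2) H2s_inner_V gE \<psi>(1) Dx_V V_E hE wxy flip: h_def) (simp add: algebra_simps)
    qed
    have lc: "continuous_on {0..T} ?l" unfolding l by (intro continuous_intros yc)
    have rc: "continuous_on {0..T} ?r" unfolding r
      by (intro continuous_intros yc continuous_on_compose2[OF F_continuous_on yc]) auto
    show ?thesis
      using distr_deriv_continuous_iff[OF T lc rc] wsol_deriv[OF y \<Phi>D] unfolding l r by blast
  qed
  have ic_w: "((\<lambda>t. H2s_inner L D (V (V (g t))) \<eta>) \<longlongrightarrow> H2s_inner L D (V (V (g 0))) \<eta>) (at_right 0)" if "\<eta> \<in> H2s L" for \<eta>
  proof -
    obtain g' where g': "g' \<in> E" "\<eta> = V (V g')" using \<open>\<eta> \<in> H2s L\<close> by (auto simp: H2s_eq[OF L])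
    show ?thesis unfolding g'(2) H2s_inner_V[OF gE g'(1)]
      using T by (intro tendsto_intros continuous_on_at_right[OF gc]) auto
  qed
  have ic_v: "((\<lambda>t. V (h t) \<bullet> \<psi>) \<longlongrightarrow> V (h 0) \<bullet> \<psi>) (at_right 0)" for \<psi>
    using T by (intro tendsto_intros continuous_on_at_right[OF Vhc]) auto
  show ?thesis
    unfolding weak_solution_def w v
    using H1 Linf_w wc_w Linf_v wc_v eqn ic_w ic_v by blast
qed

text \<open>Density of \<open>Dom\<close>, read off in the first component.\<close>

lemma W_dense: assumes f: "f \<in> E" shows "\<exists>\<xi>. (\<forall>n. \<xi> n \<in> E) \<and> (\<lambda>n. W (\<xi> n)) \<longlonglongrightarrow> f"
proof -
  obtain x where x: "\<And>n. x n \<in> Dom" "x \<longlonglongrightarrow> \<iota> f 0" using D_dense by blast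
  have "\<exists>k\<in>E. gg (x n) = W k" for n using x(1)[of n] unfolding Dom_def by blast
  then obtain \<xi> where \<xi>: "\<And>n. \<xi> n \<in> E" "\<And>n. gg (x n) = W (\<xi> n)" by metis
  have "(\<lambda>n. gg (x n)) \<longlonglongrightarrow> gg (\<iota> f 0)" by (intro gg.tendsto x)
  then have "(\<lambda>n. W (\<xi> n)) \<longlonglongrightarrow> f" unfolding \<xi> gg_\<iota>[OF f] .
  then show ?thesis using \<xi> by blast
qed

text \<open>Shows that g = w_xx and h = w_tx of an arbitrary weak solution form a
  \<open>wsol\<close>, whose uniqueness is known. The delicate point is the coefficient |w_x|^2: it
  must be continuous before the distributional equation can be read pointwise.\<close>

lemma weak_solution_unique:
  assumes T: "0 < T" and y0: "y0 \<in> H_space L"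
    and ws: "weak_solution L D \<alpha> b1 b2 U \<beta> k0 p0 T y0 w v" and tT: "t \<in> {0..T}"
  shows "(w t, v t) = dec (S t (enc y0))"
proof -
  have H1: "H1_time_L2 L T w v" and LiW: "Linf_time T (H2s L) (H2s_norm L D) w"
    and wcW: "weakly_continuous T (H2s L) (H2s_inner L D) w"
    and LiV: "Linf_time T (H1s L) (La_norm L \<alpha>) v" and wcV: "weakly_continuous T (H1s L) (La_inner L \<alpha>) v"
    and eqn: "\<And>\<phi>. \<phi> \<in> H2s L \<Longrightarrow> distr_deriv 0 T
      (\<lambda>t. v t \<bullet> \<phi> + \<alpha> * (Dx L (v t) \<bullet> Dx L \<phi>))
      (\<lambda>t. p0 \<bullet> \<phi> - \<beta> * (v t \<bullet> \<phi>) - \<beta> * U * (Dx L (w t) \<bullet> \<phi>) -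
        (H2s_inner L D (w t) \<phi> +
         (b2 * (norm (Dx L (w t)))\<^sup>2 - b1) * (Dx L (w t) \<bullet> Dx L \<phi>) +
         k0 * (v t \<bullet> \<phi>) + \<alpha> * k0 * (Dx L (v t) \<bullet> Dx L \<phi>)))"
    and icw: "\<And>\<eta>. \<eta> \<in> H2s L \<Longrightarrow> ((\<lambda>t. H2s_inner L D (w t) \<eta>) \<longlongrightarrow> H2s_inner L D (fst y0) \<eta>) (at_right 0)"
    and icv: "\<And>\<psi>. \<psi> \<in> E \<Longrightarrow> ((\<lambda>t. v t \<bullet> \<psi>) \<longlongrightarrow> snd y0 \<bullet> \<psi>) (at_right 0)"
    using ws unfolding weak_solution_def by blast+
  define g where "g t = Dx L (Dx L (w t))" for t
  define h where "h t = Dx L (v t)" for t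
  have g: "g t \<in> E \<and> w t = V (V (g t))" if "t \<in> {0..T}" for t
  proof -
    have "w t \<in> H2s L" using wcW that unfolding weakly_continuous_def by blast
    then obtain g' where "g' \<in> E" "w t = V (V g')" by (auto simp: H2s_eq[OF L])
    then show ?thesis by (simp add: g_def DxDx_V)
  qed
  have h: "h t \<in> E \<and> v t = V (h t)" if "t \<in> {0..T}" for t
  proof -
    have "v t \<in> H1s L" using wcV that unfolding weakly_continuous_def by blast
    then obtain h' where "h' \<in> E" "v t = V h'" by (auto simp: H1s_eq[OF L])
    then show ?thesis by (simp add: h_def Dx_V)
  qed
  have gE: "g t \<in> E" and wV: "w t = V (V (g t))" and hE: "h t \<in> E" and vV: "v t = V (h t)" if "t \<in> {0..T}" for t
    using g[OF that] h[OF that] by simp_all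
  have gw: "continuous_on {0..T} (\<lambda>t. g t \<bullet> z)" for z
  proof (rule continuous_on_eq)
    have "V (V (cut L z)) \<in> H2s L" using cut_L2_on by (auto simp: H2s_eq[OF L])
    then have "continuous_on {0..T} (\<lambda>t. H2s_inner L D (w t) (V (V (cut L z))))"
      using wcW unfolding weakly_continuous_def by blast
    then show "continuous_on {0..T} (\<lambda>t. 1 / D * H2s_inner L D (w t) (V (V (cut L z))))" by (intro continuous_intros)
    show "1 / D * H2s_inner L D (w t) (V (V (cut L z))) = g t \<bullet> z" if "t \<in> {0..T}" for t
      using gE[OF that] E_inner_cut[OF gE[OF that], of z] D by (simp add: wV[OF that] H2s_inner_V cut_L2_on)
  qed
  have hw: "continuous_on {0..T} (\<lambda>t. h t \<bullet> z)" for z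
  proof (rule continuous_on_eq)
    \<comment> \<open>Weak continuity is given for the inner product of \<open>L_\<alpha>\<close>,
      that is for pairings with M; \<open>Mi\<close> converts it to plain pairings of h.\<close>
    have E: "Mi (cut L z) \<in> E" by (intro Mi_E cut_L2_on)
    then have "V (Mi (cut L z)) \<in> H1s L" by (auto simp: H1s_eq[OF L])
    then show "continuous_on {0..T} (\<lambda>t. La_inner L \<alpha> (v t) (V (Mi (cut L z))))"
      using wcV unfolding weakly_continuous_def by blast
    show "La_inner L \<alpha> (v t) (V (Mi (cut L z))) = h t \<bullet> z" if "t \<in> {0..T}" for t
      using E_inner_cut[OF hE[OF that], of z] hE[OF that] E
      by (simp add: vV[OF that] La_inner_V M_sym M_Mi)
  qed
  obtain Cg where Cg: "\<And>t. t \<in> {0..T} \<Longrightarrow> norm (g t) \<le> Cg"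
  proof -
    obtain C where C: "AE t in lebesgue_on {0<..<T}. H2s_norm L D (w t) \<le> C"
      using LiW unfolding Linf_time_def by blast
    have sp: "AE t in lebesgue_on {0<..<T}. t \<in> {0<..<T}" by (rule AE_I2) simp
    have "AE t in lebesgue_on {0<..<T}. norm (g t) \<le> \<bar>C\<bar> / sqrt D"
      using C sp
    proof eventually_elim
      case (elim t)
      then have t: "t \<in> {0..T}" by simp
      have "sqrt D * norm (g t) \<le> \<bar>C\<bar>" using elim(1) by (simp add: wV[OF t] H2s_norm_V[OF gE[OF t]])
      then show ?case using D by (simp add: pos_le_divide_eq mult.commute)
    qed
    from weakly_continuous_bound[OF T gw this] have "norm (g t) \<le> \<bar>C\<bar> / sqrt D" if "t \<in> {0..T}" for t
      using that D by simp
    then show thesis by (rule that)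
  qed
  obtain Ch where Ch: "\<And>t. t \<in> {0..T} \<Longrightarrow> norm (h t) \<le> Ch"
  proof -
    obtain C where C: "AE t in lebesgue_on {0<..<T}. La_norm L \<alpha> (v t) \<le> C"
      using LiV unfolding Linf_time_def by blast
    have sp: "AE t in lebesgue_on {0<..<T}. t \<in> {0<..<T}" by (rule AE_I2) simp
    have "AE t in lebesgue_on {0<..<T}. norm (h t) \<le> \<bar>C\<bar> / sqrt \<alpha>"
      using C sp
    proof eventually_elim
      case (elim t)
      then have t: "t \<in> {0..T}" by simp
      have "sqrt \<alpha> * norm (h t) = sqrt (\<alpha> * (norm (h t))\<^sup>2)" using \<alpha> by (simp add: real_sqrt_mult)
      also have "\<dots> \<le> La_norm L \<alpha> (v t)" unfolding vV[OF t] La_norm_V[OF hE[OF t]] by (intro real_sqrt_le_mono) simp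
      also have "\<dots> \<le> \<bar>C\<bar>" using elim(1) by simp
      finally show ?case using \<alpha> by (simp add: pos_le_divide_eq mult.commute)
    qed
    from weakly_continuous_bound[OF T hw this] have "norm (h t) \<le> \<bar>C\<bar> / sqrt \<alpha>" if "t \<in> {0..T}" for t
      using that \<alpha> by simp
    then show thesis by (rule that)
  qed
  \<comment> \<open>The relation between w and its time derivative tested with z is a relation
    between V g and h tested with W z, so at first only elements of the range of W are
    available.\<close>
  have d1: "((\<lambda>s. V (g s) \<bullet> W z) has_real_derivative h t \<bullet> W z) (at t within {0..T})" if t: "t \<in> {0..T}" for t z
  proof -
    have dw: "distr_deriv 0 T (\<lambda>t. w t \<bullet> z) (\<lambda>t. v t \<bullet> z)"
      using H1 unfolding H1_time_L2_def by (intro distr_deriv_inner) blast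
    have ew: "V (g t) \<bullet> W z = w t \<bullet> z" if "t \<in> {0..T}" for t
      unfolding wV[OF that] by (simp add: V_W)
    have ev: "h t \<bullet> W z = v t \<bullet> z" if "t \<in> {0..T}" for t
      unfolding vV[OF that] by (simp add: V_W)
    have "continuous_on {0..T} (\<lambda>t. w t \<bullet> z)"
      by (rule continuous_on_eq[OF gw[of "W (W z)"]]) (simp add: wV V_W)
    moreover have "continuous_on {0..T} (\<lambda>t. v t \<bullet> z)"
      by (rule continuous_on_eq[OF hw[of "W z"]]) (simp add: ev)
    ultimately have "((\<lambda>s. w s \<bullet> z) has_real_derivative v t \<bullet> z) (at t within {0..T})"
      using distr_deriv_continuous_iff[OF T] dw t by blast
    then show ?thesis unfolding ev[OF t]
      by (rule has_field_derivative_transform_within[OF _ zero_less_one t]) (rule ew[symmetric])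
  qed
  \<comment> \<open>The range of W is dense and h is bounded uniformly in time, so the derivatives
    converge uniformly and the limit theorem applies.\<close>
  have d2: "((\<lambda>s. V (g s) \<bullet> f) has_real_derivative h t \<bullet> f) (at t within {0..T})" if t: "t \<in> {0..T}" and f: "f \<in> E" for t f
  proof -
    obtain \<xi> where \<xi>: "\<And>n. \<xi> n \<in> E" "(\<lambda>n. W (\<xi> n)) \<longlonglongrightarrow> f" using W_dense[OF f] by blast
    show ?thesis
    proof (rule limit_has_real_derivative[OF d1 _ _ t])
      show "(\<lambda>n. V (g s) \<bullet> W (\<xi> n)) \<longlonglongrightarrow> V (g s) \<bullet> f" for s by (intro tendsto_intros \<xi>)
      show "uniform_limit {0..T} (\<lambda>n t. h t \<bullet> W (\<xi> n)) (\<lambda>t. h t \<bullet> f) sequentially"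
      proof (rule uniform_limitI)
        fix e :: real assume e: "0 < e"
        have C: "0 < \<bar>Ch\<bar> + 1" by simp
        then have "0 < e / (\<bar>Ch\<bar> + 1)" using e by (rule divide_pos_pos[rotated])
        from tendstoD[OF \<xi>(2) this] show "\<forall>\<^sub>F n in sequentially. \<forall>t\<in>{0..T}. dist (h t \<bullet> W (\<xi> n)) (h t \<bullet> f) < e"
        proof (eventually_elim, intro ballI)
          fix n t assume n: "dist (W (\<xi> n)) f < e / (\<bar>Ch\<bar> + 1)" and t: "t \<in> {0..T}"
          have "dist (h t \<bullet> W (\<xi> n)) (h t \<bullet> f) = \<bar>h t \<bullet> (W (\<xi> n) - f)\<bar>" by (simp add: dist_real_def inner_diff_right)
          also have "\<dots> \<le> norm (h t) * norm (W (\<xi> n) - f)" by (rule Cauchy_Schwarz_ineq2)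
          also have "\<dots> \<le> (\<bar>Ch\<bar> + 1) * norm (W (\<xi> n) - f)" using Ch[OF t] by (intro mult_right_mono) auto
          also have "\<dots> < e" using n C by (simp add: dist_norm pos_less_divide_eq mult.commute)
          finally show "dist (h t \<bullet> W (\<xi> n)) (h t \<bullet> f) < e" .
        qed
      qed
    qed
  qed
  have d3: "((\<lambda>s. V (g s) \<bullet> z) has_real_derivative h t \<bullet> z) (at t within {0..T})" if t: "t \<in> {0..T}" for t z
    using d2[OF t cut_L2_on[of L z]] E_inner_cut[OF V_E] E_inner_cut[OF hE[OF t], of z] by simp
  \<comment> \<open>The bounded weak derivative makes w_x Lipschitz in norm, so |w_x|^2 is
    continuous, which weak continuity of w alone would not give so directly.\<close>
  have Vgc: "continuous_on {0..T} (\<lambda>t. V (g t))"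
  proof (rule lipschitz_on_continuous_on[where L = "\<bar>Ch\<bar>"], rule lipschitz_onI)
    fix s t assume st: "s \<in> {0..T}" "t \<in> {0..T}"
    have "norm (V (g s) - V (g t)) \<le> \<bar>Ch\<bar> * \<bar>s - t\<bar>"
      by (rule weak_deriv_lipschitz[OF d3 _ st(2) st(1)]) (use Ch in force)+
    then show "dist (V (g s)) (V (g t)) \<le> \<bar>Ch\<bar> * dist s t" by (simp add: dist_norm)
  qed simp
  define y where "y t = \<iota> (g t) (h t)" for t
  have gy: "gg (y t) = g t" and hy: "hh (y t) = h t" and wy: "wx (y t) = V (g t)" if "t \<in> {0..T}" for t
    using gE[OF that] hE[OF that] by (simp_all add: y_def gg_\<iota> hh_\<iota> wx_def)
  have sol: "wsol F T y"
    unfolding wsol_def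
  proof (intro conjI ballI)
    obtain Cv where Cv: "\<And>t. t \<in> {0..T} \<Longrightarrow> norm (V (h t)) \<le> Cv"
      using bounded_image[of T h Ch V, OF Ch V.bounded_linear_axioms] by blast
    have "norm (y t) \<le> sqrt (D * Cg\<^sup>2 + \<alpha> * Ch\<^sup>2 + Cv\<^sup>2)" if t: "t \<in> {0..T}" for t
    proof (rule real_le_rsqrt)
      show "(norm (y t))\<^sup>2 \<le> D * Cg\<^sup>2 + \<alpha> * Ch\<^sup>2 + Cv\<^sup>2"
        unfolding y_def norm_\<iota> using D \<alpha> by (intro add_mono mult_left_mono power_mono Cg Ch Cv t) auto
    qed
    then show "bounded (y ` {0..T})" unfolding bounded_iff by blast
    fix \<phi> t assume \<phi>: "\<phi> \<in> Dom" and t: "t \<in> {0..T}"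
    obtain \<psi> f where \<psi>f: "\<psi> \<in> E" "f \<in> E" "hh \<phi> = V \<psi>" "gg \<phi> = W f" using \<phi> unfolding Dom_def by blast
    let ?\<Phi> = "V (V \<psi>)"
    have \<Phi>: "?\<Phi> \<in> H2s L" using \<psi>f(1) by (auto simp: H2s_eq[OF L])
    define R where "R s = p0 \<bullet> ?\<Phi> - \<beta> * (h s \<bullet> W ?\<Phi>) - \<beta> * U * (V (g s) \<bullet> ?\<Phi>) -
      (D * (g s \<bullet> \<psi>) + (b2 * (norm (V (g s)))\<^sup>2 - b1) * (V (g s) \<bullet> V \<psi>) + k0 * (h s \<bullet> M (V \<psi>)))" for s
    let ?l = "\<lambda>t. v t \<bullet> ?\<Phi> + \<alpha> * (Dx L (v t) \<bullet> Dx L ?\<Phi>)"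
    let ?r = "\<lambda>t. p0 \<bullet> ?\<Phi> - \<beta> * (v t \<bullet> ?\<Phi>) - \<beta> * U * (Dx L (w t) \<bullet> ?\<Phi>) -
        (H2s_inner L D (w t) ?\<Phi> +
         (b2 * (norm (Dx L (w t)))\<^sup>2 - b1) * (Dx L (w t) \<bullet> Dx L ?\<Phi>) +
         k0 * (v t \<bullet> ?\<Phi>) + \<alpha> * k0 * (Dx L (v t) \<bullet> Dx L ?\<Phi>))"
    have hM: "h s \<bullet> M (V \<psi>) = V (h s) \<bullet> ?\<Phi> + \<alpha> * (h s \<bullet> V \<psi>)" for s
      using M_inner[of "h s" "V \<psi>"] M_sym[of "h s" "V \<psi>"] by simp
    have l: "h s \<bullet> M (V \<psi>) = ?l s" if s: "s \<in> {0..T}" for s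
      unfolding hM vV[OF s] Dx_V[OF hE[OF s]] Dx_V[OF V_E] ..
    have r: "R s = ?r s" if s: "s \<in> {0..T}" for s
      unfolding R_def hM vV[OF s] wV[OF s] Dx_V[OF hE[OF s]] Dx_V[OF V_E] H2s_inner_V[OF gE[OF s] \<psi>f(1)] V_W[of "h s" ?\<Phi>, symmetric]
      by (simp add: algebra_simps)
    have lc: "continuous_on {0..T} ?l" by (rule continuous_on_eq[OF hw[of "M (V \<psi>)"]]) (rule l)
    have "continuous_on {0..T} R" unfolding R_def by (intro continuous_intros hw gw Vgc)
    then have rc: "continuous_on {0..T} ?r" by (rule continuous_on_eq) (rule r)
    have "(?l has_real_derivative ?r t) (at t within {0..T})"
      using distr_deriv_continuous_iff[OF T lc rc] eqn[OF \<Phi>] t by blast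
    then have "(?l has_real_derivative R t) (at t within {0..T})" unfolding r[OF t] .
    then have "((\<lambda>s. h s \<bullet> M (V \<psi>)) has_real_derivative R t) (at t within {0..T})"
      by (rule has_field_derivative_transform_within[OF _ zero_less_one t]) (rule l[symmetric])
    from DERIV_add[OF DERIV_cmult[OF d3[OF t, of f], of D] this]
    have der: "((\<lambda>s. D * (V (g s) \<bullet> f) + h s \<bullet> M (V \<psi>)) has_real_derivative D * (h t \<bullet> f) + R t) (at t within {0..T})" .
    have "D * (h t \<bullet> f) + R t = - (y t \<bullet> A \<phi>) + F (y t) \<bullet> \<phi>"
    proof -
      have E: "- (D *\<^sub>R Mi f) \<in> E" by (intro E_neg E_scale Mi_E \<psi>f)
      have "y t \<bullet> A \<phi> = D * (g t \<bullet> \<psi>) - D * (h t \<bullet> f)"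
        unfolding y_def A_eq[OF \<psi>f] inner_\<iota>_\<iota>[OF gE[OF t] hE[OF t] \<psi>f(1) E]
        by (simp add: M.neg M.scaleR M_Mi)
      moreover have "F (y t) \<bullet> \<phi> = load (y t) \<bullet> V \<psi> - k0 * (h t \<bullet> M (V \<psi>))"
        unfolding F_inner \<psi>f(3) hy[OF t] M_sym ..
      ultimately show ?thesis
        unfolding load_inner hy[OF t] wy[OF t] R_def V_W[of "h t" ?\<Phi>, symmetric] by (simp add: algebra_simps)
    qed
    with der have "((\<lambda>s. D * (V (g s) \<bullet> f) + h s \<bullet> M (V \<psi>)) has_real_derivative - (y t \<bullet> A \<phi>) + F (y t) \<bullet> \<phi>) (at t within {0..T})"
      by simp
    then show "((\<lambda>s. y s \<bullet> \<phi>) has_real_derivative - (y t \<bullet> A \<phi>) + F (y t) \<bullet> \<phi>) (at t within {0..T})"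
    proof (rule has_field_derivative_transform_within[OF _ zero_less_one t])
      fix s assume "s \<in> {0..T}"
      then show "D * (V (g s) \<bullet> f) + h s \<bullet> M (V \<psi>) = y s \<bullet> \<phi>"
        unfolding y_def by (simp add: inner_\<iota> gE hE \<psi>f V_W)
    qed
  qed
  obtain g0 h0 where y0': "g0 \<in> E" "h0 \<in> E" "y0 = (V (V g0), V h0)" using y0 by (rule H_space_cases)
  have z: "0 \<in> {0..T}" "0 \<in> {0..<T}" using T by auto
  have ev0: "\<forall>\<^sub>F t in at_right 0. t \<in> {0<..<T}" using T by (rule eventually_at_right_real)
  \<comment> \<open>The initial condition is tested with the difference of both candidates, which
    lies in \<open>E\<close>.\<close>
  have "g 0 = g0"
  proof -
    let ?z = "g 0 - g0"
    have zE: "?z \<in> E" by (intro E_diff gE[OF z(1)] y0')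
    have "((\<lambda>t. D * (g t \<bullet> ?z)) \<longlongrightarrow> D * (g 0 \<bullet> ?z)) (at_right 0)"
      by (intro tendsto_intros continuous_on_at_right[OF gw z(2)])
    moreover have "((\<lambda>t. D * (g t \<bullet> ?z)) \<longlongrightarrow> D * (g0 \<bullet> ?z)) (at_right 0)"
    proof -
      have "V (V ?z) \<in> H2s L" using zE by (auto simp: H2s_eq[OF L])
      from icw[OF this] have "((\<lambda>t. H2s_inner L D (w t) (V (V ?z))) \<longlongrightarrow> D * (g0 \<bullet> ?z)) (at_right 0)"
        unfolding y0'(3) fst_conv H2s_inner_V[OF y0'(1) zE] .
      then show ?thesis
      proof (rule Lim_transform_eventually)
        show "\<forall>\<^sub>F t in at_right 0. H2s_inner L D (w t) (V (V ?z)) = D * (g t \<bullet> ?z)"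
          using ev0
        proof eventually_elim
          case (elim t)
          then have tt: "t \<in> {0..T}" by simp
          show ?case unfolding wV[OF tt] H2s_inner_V[OF gE[OF tt] zE] ..
        qed
      qed
    qed
    ultimately have "D * (g 0 \<bullet> ?z) = D * (g0 \<bullet> ?z)" by (rule tendsto_unique[rotated]) simp
    then have "?z \<bullet> ?z = 0" using D by (simp add: inner_diff_left)
    then show ?thesis by simp
  qed
  moreover have "h 0 = h0"
  proof -
    let ?z = "V (h 0) - V h0"
    have zE: "?z \<in> E" by (intro E_diff V_E)
    have "((\<lambda>t. h t \<bullet> W ?z) \<longlongrightarrow> h 0 \<bullet> W ?z) (at_right 0)"
      by (rule continuous_on_at_right[OF hw z(2)])
    moreover have "((\<lambda>t. h t \<bullet> W ?z) \<longlongrightarrow> V h0 \<bullet> ?z) (at_right 0)"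
    proof (rule Lim_transform_eventually)
      show "((\<lambda>t. v t \<bullet> ?z) \<longlongrightarrow> V h0 \<bullet> ?z) (at_right 0)" using icv[OF zE] unfolding y0'(3) snd_conv .
      show "\<forall>\<^sub>F t in at_right 0. v t \<bullet> ?z = h t \<bullet> W ?z"
        using ev0
      proof eventually_elim
        case (elim t)
        then have tt: "t \<in> {0..T}" by simp
        show ?case by (subst vV[OF tt]) (rule V_W)
      qed
    qed
    ultimately have "h 0 \<bullet> W ?z = V h0 \<bullet> ?z" by (rule tendsto_unique[rotated]) simp
    then have "V (h 0) \<bullet> ?z = V h0 \<bullet> ?z" by (simp only: V_W)
    then have "?z \<bullet> ?z = 0" by (subst inner_diff_left) simp
    then have "V (h 0) = V h0" by simp
    \<comment> \<open>The initial velocity is prescribed only in L^2, which determines V h;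
      injectivity of V gives h.\<close>
    then have "Dx L (V (h 0)) = Dx L (V h0)" by (rule arg_cong)
    then show ?thesis unfolding Dx_V[OF hE[OF z(1)]] Dx_V[OF y0'(2)] .
  qed
  ultimately have "y 0 = enc y0" by (simp add: y_def y0' enc_V)
  then have "S t (enc y0) = y t" using S_eq[OF sol tT] by simp
  then show ?thesis using gE[OF tT] hE[OF tT] wV[OF tT] vV[OF tT] by (simp add: y_def dec_\<iota>)
qed

section \<open>Strong solutions\<close>

lemma sobolev_norm_3: "f \<in> E \<Longrightarrow> sobolev_norm L 3 (V (V (W f))) =
    sqrt ((norm (V (V (W f))))\<^sup>2 + (norm (V (W f)))\<^sup>2 + (norm (W f))\<^sup>2 + (norm f)\<^sup>2)"
  unfolding sobolev_norm_def by (simp add: eval_nat_numeral Dx_V V_E W_E Dx_vol_adj[OF L])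

lemma sobolev_norm_1: "k \<in> E \<Longrightarrow> sobolev_norm L 1 (V k) = sqrt ((norm (V k))\<^sup>2 + (norm k)\<^sup>2)"
  unfolding sobolev_norm_def by (simp add: eval_nat_numeral Dx_V)

lemma sobolev_norm_1_tendsto:
  assumes k: "\<And>s. k s \<in> E" and l: "(k \<longlongrightarrow> 0) G"
  shows "((\<lambda>s. sobolev_norm L 1 (V (k s))) \<longlongrightarrow> 0) G"
proof -
  have "((\<lambda>s. sqrt ((norm (V (k s)))\<^sup>2 + (norm (k s))\<^sup>2)) \<longlongrightarrow> sqrt ((norm (V 0))\<^sup>2 + (norm (0::l2))\<^sup>2)) G"
    by (intro tendsto_intros V.tendsto l)
  then have "((\<lambda>s. sqrt ((norm (V (k s)))\<^sup>2 + (norm (k s))\<^sup>2)) \<longlongrightarrow> 0) G" by (simp add: V.zero)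
  then show ?thesis unfolding sobolev_norm_1[OF k] .
qed

text \<open>w_xxx and w_txx are bounded linear images of A along the orbit. Boundedness and right
  continuity of A + F on the orbit, together with continuity of F, therefore yield all the extra
  regularity.\<close>

lemma strong_solution_dec:
  assumes x: "x \<in> Dom" and T: "0 < T"
  shows "strong_solution L D \<alpha> b1 b2 U \<beta> k0 p0 T (dec x) (\<lambda>t. fst (dec (S t x))) (\<lambda>t. snd (dec (S t x)))"
proof -
  define a where "a t = A (S t x)" for t
  define G where "G t = A (S t x) + F (S t x)" for t
  \<comment> \<open>The second coordinate of A is - D Mi f; \<open>M\<close> and division by - D
    recover f from it, so f inherits right continuity from A along the orbit.\<close>
  define f where "f t = - ((1 / D) *\<^sub>R M (hh (a t)))" for t
  define \<psi> where "\<psi> t = gg (a t)" for t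
  have fE: "f t \<in> E" and \<psi>E: "\<psi> t \<in> E" for t
    unfolding f_def \<psi>_def by (intro E_neg E_scale M_E hh_E gg_E)+
  have rep: "gg (S t x) = W (f t) \<and> hh (S t x) = V (\<psi> t)" if t0: "0 \<le> t" for t
  proof -
    obtain \<psi>' f' where s: "\<psi>' \<in> E" "f' \<in> E" "hh (S t x) = V \<psi>'" "gg (S t x) = W f'"
      using S_D[OF x t0] unfolding Dom_def by blast
    have "- (D *\<^sub>R Mi f') \<in> E" by (intro E_neg E_scale Mi_E s)
    then have "f t = f'" "\<psi> t = \<psi>'"
      using s D by (simp_all add: f_def \<psi>_def a_def A_eq[OF s] gg_\<iota> hh_\<iota> M.neg M.scaleR M_Mi)
    then show ?thesis using s by simp
  qed
  have w: "fst (dec (S t x)) = V (V (W (f t)))" and v: "snd (dec (S t x)) = V (V (\<psi> t))" if "0 \<le> t" for t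
    using rep[OF that] by (simp_all add: dec_def)
  have Glim: "(G \<longlongrightarrow> G t) (at_right t)" if "0 \<le> t" for t
    using S_right_cont[OF x that] by (simp add: G_def[abs_def])
  have alim: "(a \<longlongrightarrow> a t) (at_right t)" if t: "0 \<le> t" for t
  proof -
    have "continuous_on {0..t + 1} (\<lambda>s. F (S s x))"
      by (rule continuous_on_compose2[OF F_continuous_on S_continuous]) simp
    then have "((\<lambda>s. F (S s x)) \<longlongrightarrow> F (S t x)) (at_right t)"
      by (rule continuous_on_at_right) (use t in simp)
    from tendsto_diff[OF Glim[OF t] this] show ?thesis by (simp add: G_def[abs_def] a_def[abs_def])
  qed
  have flim: "(f \<longlongrightarrow> f t) (at_right t)" and \<psi>lim: "(\<psi> \<longlongrightarrow> \<psi> t) (at_right t)" if "0 \<le> t" for t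
    unfolding f_def[abs_def] \<psi>_def[abs_def] by (intro tendsto_intros M.tendsto hh.tendsto gg.tendsto alim that)+
  obtain CG where CG: "\<And>t. t \<in> {0..T} \<Longrightarrow> norm (G t) \<le> CG" using S_D_bound[OF x, of T] unfolding G_def by blast
  obtain CF where CF: "\<And>t. t \<in> {0..T} \<Longrightarrow> norm (F (S t x)) \<le> CF"
  proof -
    have "continuous_on {0..T} (\<lambda>s. F (S s x))"
      by (rule continuous_on_compose2[OF F_continuous_on S_continuous]) simp
    then have "bounded ((\<lambda>s. F (S s x)) ` {0..T})" by (intro compact_imp_bounded compact_continuous_image) auto
    then show thesis unfolding bounded_iff using that by blast
  qed
  have Ca: "norm (a t) \<le> CG + CF" if "t \<in> {0..T}" for t
    using norm_triangle_ineq4[of "G t" "F (S t x)"] CG[OF that] CF[OF that] by (simp add: G_def a_def)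
  have "bounded_linear (\<lambda>a. - ((1 / D) *\<^sub>R M (hh a)))"
    by (intro bounded_linear_minus bounded_linear_compose[OF bounded_linear_scaleR_right]
        bounded_linear_compose[OF bounded_linear_M bounded_linear_hh])
  from bounded_image[of T a "CG + CF", OF Ca this] obtain Cf where Cf: "\<And>t. t \<in> {0..T} \<Longrightarrow> norm (f t) \<le> Cf"
    unfolding f_def by blast
  obtain C\<psi> where C\<psi>: "\<And>t. t \<in> {0..T} \<Longrightarrow> norm (\<psi> t) \<le> C\<psi>"
    using bounded_image[of T a "CG + CF" gg, OF Ca bounded_linear_gg] unfolding \<psi>_def by blast
  obtain C1 where C1: "\<And>t. t \<in> {0..T} \<Longrightarrow> norm (W (f t)) \<le> C1"
    using bounded_image[of T f Cf W, OF Cf W.bounded_linear_axioms] by blast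
  obtain C2 where C2: "\<And>t. t \<in> {0..T} \<Longrightarrow> norm (V (W (f t))) \<le> C2"
    using bounded_image[of T "\<lambda>t. W (f t)" C1 V, OF C1 V.bounded_linear_axioms] by blast
  obtain C3 where C3: "\<And>t. t \<in> {0..T} \<Longrightarrow> norm (V (V (W (f t)))) \<le> C3"
    using bounded_image[of T "\<lambda>t. V (W (f t))" C2 V, OF C2 V.bounded_linear_axioms] by blast
  have ws: "weak_solution L D \<alpha> b1 b2 U \<beta> k0 p0 T (dec x) (\<lambda>t. fst (dec (S t x))) (\<lambda>t. snd (dec (S t x)))"
    using weak_solution_dec[OF T S_wsol S_continuous, of x] by (simp add: S_0)
  have Lw: "Linf_time T (W_space L) (sobolev_norm L 3) (\<lambda>t. fst (dec (S t x)))"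
  proof (rule Linf_timeI[OF T])
    fix t assume t: "t \<in> {0<..<T}"
    then have t0: "0 \<le> t" and tT: "t \<in> {0..T}" by auto
    have "V (V (W (f t))) \<in> W_space L"
      using generator_space_iff[OF L, of "V (V (W (f t)))"] fE[of t] unfolding W_space_def by blast
    then show "fst (dec (S t x)) \<in> W_space L" by (simp add: w[OF t0])
    let ?n = "\<lambda>k. sqrt ((norm (V (V (W k))))\<^sup>2 + (norm (V (W k)))\<^sup>2 + (norm (W k))\<^sup>2 + (norm k)\<^sup>2)"
    have "((\<lambda>s. ?n (f s - f t)) \<longlongrightarrow> ?n (f t - f t)) (at_right t)"
      by (intro tendsto_intros V.tendsto W.tendsto flim[OF t0])
    then have "((\<lambda>s. ?n (f s - f t)) \<longlongrightarrow> 0) (at_right t)" by (simp add: V.zero W.zero)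
    then show "((\<lambda>s. sobolev_norm L 3 (fst (dec (S s x)) - fst (dec (S t x)))) \<longlongrightarrow> 0) (at_right t)"
    proof (rule Lim_transform_eventually)
      have "\<forall>\<^sub>F s in at_right t. t < s" by (simp add: eventually_at_filter)
      then show "\<forall>\<^sub>F s in at_right t. ?n (f s - f t) = sobolev_norm L 3 (fst (dec (S s x)) - fst (dec (S t x)))"
      proof eventually_elim
        case (elim s)
        then have "fst (dec (S s x)) - fst (dec (S t x)) = V (V (W (f s - f t)))"
          using w[of s] w[of t] t0 by (simp add: V.diff W.diff)
        then show ?case by (simp add: sobolev_norm_3 E_diff fE)
      qed
    qed
    show "sobolev_norm L 3 (fst (dec (S t x))) \<le> sqrt (C3\<^sup>2 + C2\<^sup>2 + C1\<^sup>2 + Cf\<^sup>2)"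
      unfolding w[OF t0] sobolev_norm_3[OF fE] by (intro real_sqrt_le_mono add_mono power_mono C1 C2 C3 Cf tT) auto
  qed
  have Lv: "Linf_time T (H2s L) (H2s_norm L D) (\<lambda>t. snd (dec (S t x)))"
  proof (rule Linf_timeI[OF T])
    fix t assume t: "t \<in> {0<..<T}"
    then have t0: "0 \<le> t" and tT: "t \<in> {0..T}" by auto
    show "snd (dec (S t x)) \<in> H2s L" using \<psi>E by (auto simp: v[OF t0] H2s_eq[OF L])
    have "((\<lambda>s. sqrt D * norm (\<psi> s - \<psi> t)) \<longlongrightarrow> sqrt D * norm (\<psi> t - \<psi> t)) (at_right t)"
      by (intro tendsto_intros \<psi>lim[OF t0])
    then have "((\<lambda>s. sqrt D * norm (\<psi> s - \<psi> t)) \<longlongrightarrow> 0) (at_right t)" by simp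
    then show "((\<lambda>s. H2s_norm L D (snd (dec (S s x)) - snd (dec (S t x)))) \<longlongrightarrow> 0) (at_right t)"
    proof (rule Lim_transform_eventually)
      have "\<forall>\<^sub>F s in at_right t. t < s" by (simp add: eventually_at_filter)
      then show "\<forall>\<^sub>F s in at_right t. sqrt D * norm (\<psi> s - \<psi> t) = H2s_norm L D (snd (dec (S s x)) - snd (dec (S t x)))"
      proof eventually_elim
        case (elim s)
        then have "snd (dec (S s x)) - snd (dec (S t x)) = V (V (\<psi> s - \<psi> t))"
          using v[of s] v[of t] t0 by (simp add: V.diff)
        then show ?case by (simp add: H2s_norm_V E_diff \<psi>E)
      qed
    qed
    show "H2s_norm L D (snd (dec (S t x))) \<le> sqrt D * C\<psi>"
      using C\<psi>[OF tT] by (simp add: v[OF t0] H2s_norm_V \<psi>E D)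
  qed
  \<comment> \<open>G is the right derivative of the abstract orbit, so its velocity component is
    the right derivative of w_t.\<close>
  define z where "z t = V (hh (G t))" for t
  have zH: "z t \<in> H1s L" for t using hh_E by (auto simp: z_def H1s_eq[OF L])
  have z1: "((\<lambda>h. sobolev_norm L 1 ((1 / h) *\<^sub>R (snd (dec (S (t + h) x)) - snd (dec (S t x))) - z t)) \<longlongrightarrow> 0) (at_right 0)"
    if t: "0 \<le> t" for t
  proof -
    have "((\<lambda>h. hh ((1 / h) *\<^sub>R (S (t + h) x - S t x) - G t)) \<longlongrightarrow> hh (G t - G t)) (at_right 0)"
      using S_right_deriv[OF x t] unfolding G_def by (intro hh.tendsto tendsto_intros)
    then have "((\<lambda>h. hh ((1 / h) *\<^sub>R (S (t + h) x - S t x) - G t)) \<longlongrightarrow> 0) (at_right 0)" by (simp add: hh.zero)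
    from sobolev_norm_1_tendsto[OF hh_E this] show ?thesis
      by (simp add: dec_def z_def hh.diff hh.scaleR V.diff V.scaleR)
  qed
  have z2: "((\<lambda>s. sobolev_norm L 1 (z s - z t)) \<longlongrightarrow> 0) (at_right t)" if t: "0 \<le> t" for t
  proof -
    have "((\<lambda>s. hh (G s - G t)) \<longlongrightarrow> hh (G t - G t)) (at_right t)" by (intro hh.tendsto tendsto_intros Glim t)
    then have "((\<lambda>s. hh (G s - G t)) \<longlongrightarrow> 0) (at_right t)" by (simp add: hh.zero)
    from sobolev_norm_1_tendsto[OF hh_E this] show ?thesis by (simp add: z_def hh.diff V.diff)
  qed
  obtain K1 where K1: "\<And>t. t \<in> {0..T} \<Longrightarrow> norm (hh (G t)) \<le> K1"
    using bounded_image[of T G CG hh, OF CG bounded_linear_hh] by blast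
  obtain K2 where K2: "\<And>t. t \<in> {0..T} \<Longrightarrow> norm (V (hh (G t))) \<le> K2"
    using bounded_image[of T "\<lambda>t. hh (G t)" K1 V, OF K1 V.bounded_linear_axioms] by blast
  have Lz: "Linf_time T (H1s L) (sobolev_norm L 1) z"
  proof (rule Linf_timeI[OF T zH])
    fix t assume "t \<in> {0<..<T}"
    then have t0: "0 \<le> t" and tT: "t \<in> {0..T}" by auto
    show "((\<lambda>s. sobolev_norm L 1 (z s - z t)) \<longlongrightarrow> 0) (at_right t)" by (rule z2[OF t0])
    show "sobolev_norm L 1 (z t) \<le> sqrt (K2\<^sup>2 + K1\<^sup>2)"
      unfolding z_def sobolev_norm_1[OF hh_E] by (intro real_sqrt_le_mono add_mono power_mono K1 K2 tT) auto
  qed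
  show ?thesis
    unfolding strong_solution_def
    using ws Lw Lv zH z1 z2 Lz by (intro conjI exI[of _ z] ballI) auto
qed

section \<open>The flow and its generator\<close>

definition flow :: "real \<Rightarrow> l2 \<times> l2 \<Rightarrow> l2 \<times> l2" where "flow t x = dec (S t (enc x))"

lemma enc_flow: "x \<in> H_space L \<Longrightarrow> 0 \<le> t \<Longrightarrow> enc (flow t x) = S t (enc x)"
  by (simp add: flow_def enc_dec P_S P_enc)

lemma flow_H: "flow t x \<in> H_space L"
  unfolding flow_def by (rule dec_H)

lemma flow_diff:
  assumes "x \<in> H_space L" "z \<in> H_space L" "0 \<le> s" "0 \<le> t"
  shows "H_norm L D \<alpha> (flow s x - flow t z) = norm (S s (enc x) - S t (enc z))"
  unfolding H_norm_enc_diff[OF flow_H flow_H] using assms by (simp add: enc_flow)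

lemma is_semigroup_flow: "is_semigroup L flow"
  unfolding is_semigroup_def
proof (intro conjI ballI allI impI)
  fix y assume y: "y \<in> H_space L"
  show "flow 0 y = y" by (simp add: flow_def S_0 dec_enc[OF y])
  fix s t :: real assume st: "0 \<le> s" "0 \<le> t"
  show "flow (s + t) y = flow s (flow t y)"
    unfolding flow_def[of s] enc_flow[OF y st(2)] by (simp add: flow_def S_add[OF st])
qed (rule flow_H)

lemma flow_lipschitz:
  "\<exists>C\<ge>0. \<forall>t\<in>{0..T}. \<forall>y\<in>H_space L. \<forall>z\<in>H_space L. H_norm L D \<alpha> y \<le> r \<longrightarrow> H_norm L D \<alpha> z \<le> r \<longrightarrow>
    H_norm L D \<alpha> (flow t y - flow t z) \<le> C * H_norm L D \<alpha> (y - z)"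
proof -
  obtain C where C: "0 \<le> C" "\<And>t y z. t \<in> {0..T} \<Longrightarrow> norm y \<le> r \<Longrightarrow> norm z \<le> r \<Longrightarrow> norm (S t y - S t z) \<le> C * norm (y - z)"
    using S_lipschitz[of T r] by blast
  show ?thesis
  proof (intro exI[of _ C] conjI ballI impI)
    fix t y z assume "t \<in> {0..T}" "y \<in> H_space L" "z \<in> H_space L" "H_norm L D \<alpha> y \<le> r" "H_norm L D \<alpha> z \<le> r"
    then show "H_norm L D \<alpha> (flow t y - flow t z) \<le> C * H_norm L D \<alpha> (y - z)"
      using C(2)[of t "enc y" "enc z"] by (simp add: flow_diff H_norm_enc H_norm_enc_diff)
  qed (rule C(1))
qed

lemma C_H_flow: assumes y: "y \<in> H_space L" shows "C_H L D \<alpha> T (\<lambda>t. flow t y)"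
  unfolding C_H_def
proof (intro conjI ballI)
  fix t assume t: "t \<in> {0..T}"
  show "flow t y \<in> H_space L" by (rule flow_H)
  have "((\<lambda>s. S s (enc y)) \<longlongrightarrow> S t (enc y)) (at t within {0..T})"
    using S_continuous t unfolding continuous_on by blast
  then have "((\<lambda>s. norm (S s (enc y) - S t (enc y))) \<longlongrightarrow> 0) (at t within {0..T})"
    by (intro tendsto_norm_zero LIM_zero)
  then show "((\<lambda>s. H_norm L D \<alpha> (flow s y - flow t y)) \<longlongrightarrow> 0) (at t within {0..T})"
  proof (rule Lim_transform_within[OF _ zero_less_one])
    fix s assume "s \<in> {0..T}"
    then show "norm (S s (enc y) - S t (enc y)) = H_norm L D \<alpha> (flow s y - flow t y)"
      using t by (simp add: flow_diff y)
  qed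
qed

lemma weak_solution_flow:
  assumes "y \<in> H_space L" "0 < T"
  shows "weak_solution L D \<alpha> b1 b2 U \<beta> k0 p0 T y (\<lambda>t. fst (flow t y)) (\<lambda>t. snd (flow t y))"
  using weak_solution_dec[OF assms(2) S_wsol S_continuous, of "enc y"]
  by (simp add: S_0 dec_enc[OF assms(1)] flow_def)

lemma strong_solution_flow:
  assumes "y \<in> H_space L" "enc y \<in> Dom" "0 < T"
  shows "strong_solution L D \<alpha> b1 b2 U \<beta> k0 p0 T y (\<lambda>t. fst (flow t y)) (\<lambda>t. snd (flow t y))"
  using strong_solution_dec[OF assms(2,3)] by (simp add: dec_enc[OF assms(1)] flow_def)

text \<open>The resolvents of the initial state lie in the domain, remain states, and do not exceed
  it in norm, so a single Lipschitz constant of the flow on a ball gives uniform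
  convergence.\<close>

lemma flow_approximation:
  assumes y: "y \<in> H_space L"
  shows "\<exists>x. (\<forall>n. x n \<in> H_space L \<and> enc (x n) \<in> Dom) \<and>
    (\<forall>\<epsilon>>0. \<forall>\<^sub>F n in sequentially. \<forall>t\<in>{0..T}. H_norm L D \<alpha> (flow t (x n) - flow t y) < \<epsilon>)"
proof -
  define x where "x n = dec (J (lam n) (enc y))" for n
  have x: "x n \<in> H_space L" for n unfolding x_def by (rule dec_H)
  have ex: "enc (x n) = J (lam n) (enc y)" for n
    unfolding x_def enc_dec by (rule P_J[OF P_enc[OF y]])
  obtain C where C: "\<And>t y' z. t \<in> {0..T} \<Longrightarrow> y' \<in> H_space L \<Longrightarrow> z \<in> H_space L \<Longrightarrow> H_norm L D \<alpha> y' \<le> norm (enc y) \<Longrightarrow>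
      H_norm L D \<alpha> z \<le> norm (enc y) \<Longrightarrow> H_norm L D \<alpha> (flow t y' - flow t z) \<le> C * H_norm L D \<alpha> (y' - z)"
    using flow_lipschitz[of T "norm (enc y)"] by blast
  have "(\<lambda>n. C * norm (J (lam n) (enc y) - enc y)) \<longlonglongrightarrow> C * 0"
    by (intro tendsto_mult tendsto_const tendsto_norm_zero LIM_zero J_tendsto)
  then have lim: "(\<lambda>n. C * norm (J (lam n) (enc y) - enc y)) \<longlonglongrightarrow> 0" by simp
  have "\<forall>\<^sub>F n in sequentially. \<forall>t\<in>{0..T}. H_norm L D \<alpha> (flow t (x n) - flow t y) < \<epsilon>" if "0 < \<epsilon>" for \<epsilon>
    using order_tendstoD(2)[OF lim that]
  proof eventually_elim
    case (elim n)
    have "H_norm L D \<alpha> (flow t (x n) - flow t y) \<le> C * H_norm L D \<alpha> (x n - y)" if "t \<in> {0..T}" for t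
      by (intro C x y that) (simp_all add: H_norm_enc x y ex norm_J)
    with elim show ?case by (force simp: H_norm_enc_diff x y ex)
  qed
  then show ?thesis using x J_D[OF lam_nonzero] by (intro exI[of _ x]) (simp add: ex)
qed

lemma flow_continuous_dependence:
  assumes y: "y \<in> H_space L" and e: "0 < \<epsilon>"
  shows "\<exists>\<delta>>0. \<forall>z\<in>H_space L. H_norm L D \<alpha> (z - y) < \<delta> \<longrightarrow> (\<forall>t\<in>{0..T}. H_norm L D \<alpha> (flow t z - flow t y) < \<epsilon>)"
proof -
  obtain C where C0: "0 \<le> C" and C: "\<And>t y' z. t \<in> {0..T} \<Longrightarrow> y' \<in> H_space L \<Longrightarrow> z \<in> H_space L \<Longrightarrow> H_norm L D \<alpha> y' \<le> norm (enc y) + 1 \<Longrightarrow>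
      H_norm L D \<alpha> z \<le> norm (enc y) + 1 \<Longrightarrow> H_norm L D \<alpha> (flow t y' - flow t z) \<le> C * H_norm L D \<alpha> (y' - z)"
    using flow_lipschitz[of T "norm (enc y) + 1"] by blast
  show ?thesis
  \<comment> \<open>The 1 keeps z in the ball for which C was chosen; C + 1 avoids division by
    zero.\<close>
  proof (intro exI[of _ "min 1 (\<epsilon> / (C + 1))"] conjI ballI impI)
    show "0 < min 1 (\<epsilon> / (C + 1))" using e C0 by simp
    fix z t assume z: "z \<in> H_space L" and d: "H_norm L D \<alpha> (z - y) < min 1 (\<epsilon> / (C + 1))" and t: "t \<in> {0..T}"
    have d': "norm (enc z - enc y) < 1" "norm (enc z - enc y) < \<epsilon> / (C + 1)" using d by (simp_all add: H_norm_enc_diff z y)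
    have "norm (enc z) \<le> norm (enc y) + 1" using norm_triangle_ineq2[of "enc z" "enc y"] d' by linarith
    then have "H_norm L D \<alpha> (flow t z - flow t y) \<le> C * norm (enc z - enc y)"
      using C[OF t z y] by (simp add: H_norm_enc H_norm_enc_diff z y)
    also have "\<dots> \<le> (C + 1) * norm (enc z - enc y)" by (intro mult_right_mono) auto
    also have "\<dots> < \<epsilon>" using d'(2) C0 by (simp add: pos_less_divide_eq mult.commute)
    finally show "H_norm L D \<alpha> (flow t z - flow t y) < \<epsilon>" .
  qed
qed

definition DA :: "(l2 \<times> l2) set"
  where "DA = {(w, v). w \<in> H2s L \<inter> sobolev L 3 \<and> point_value L (Dx L (Dx L w)) L = 0 \<and> v \<in> H2s L}"

text \<open>Identifies the set described by boundary conditions with the abstract domain, through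
  the description of w by V V W f and of v by V V \<psi>.\<close>

lemma DA_iff: "x \<in> DA \<longleftrightarrow> x \<in> H_space L \<and> enc x \<in> Dom"
proof
  assume "x \<in> DA"
  then obtain w v where x: "x = (w, v)" and v: "v \<in> H2s L"
    and w: "w \<in> H2s L \<inter> sobolev L 3 \<and> point_value L (Dx L (Dx L w)) L = 0" unfolding DA_def by blast
  obtain f where f: "f \<in> E" "w = V (V (W f))" using generator_space_iff[OF L, of w] w by blast
  obtain \<psi> where \<psi>: "\<psi> \<in> E" "v = V (V \<psi>)" using v by (auto simp: H2s_eq[OF L])
  have "enc x = \<iota> (W f) (V \<psi>)" unfolding x f \<psi> by (rule enc_V) (intro W_E V_E)+
  then have "gg (enc x) = W f" "hh (enc x) = V \<psi>" by (simp_all add: gg_\<iota> hh_\<iota> W_E V_E)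
  then show "x \<in> H_space L \<and> enc x \<in> Dom"
    unfolding Dom_def using f \<psi> x H_spaceI[OF W_E V_E] by blast
next
  assume x: "x \<in> H_space L \<and> enc x \<in> Dom"
  then obtain f \<psi> where f: "f \<in> E" "gg (enc x) = W f" and \<psi>: "\<psi> \<in> E" "hh (enc x) = V \<psi>" unfolding Dom_def by blast
  have "x = dec (enc x)" using x dec_enc by simp
  also have "\<dots> = (V (V (W f)), V (V \<psi>))" unfolding dec_def f \<psi> ..
  finally have x: "x = (V (V (W f)), V (V \<psi>))" .
  have "V (V \<psi>) \<in> H2s L" using \<psi>(1) by (auto simp: H2s_eq[OF L])
  moreover have "V (V (W f)) \<in> H2s L \<inter> sobolev L 3 \<and> point_value L (Dx L (Dx L (V (V (W f))))) L = 0"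
    using generator_space_iff[OF L, of "V (V (W f))"] f(1) by blast
  ultimately show "x \<in> DA" unfolding DA_def x by blast
qed

lemma generator_quotient:
  assumes y: "y \<in> H_space L" and z: "z \<in> H_space L" and h: "0 < h"
  shows "H_norm L D \<alpha> ((1 / h) *\<^sub>R (flow h y - y) - z) = norm ((1 / h) *\<^sub>R (S h (enc y) - enc y) - enc z)"
proof -
  have P: "P (S h (enc y)) = S h (enc y)" using h by (intro P_S P_enc y) simp
  have "(1 / h) *\<^sub>R (flow h y - y) = (1 / h) *\<^sub>R (dec (S h (enc y)) - dec (enc y))"
    by (simp add: flow_def dec_enc[OF y])
  then have "(1 / h) *\<^sub>R (flow h y - y) - z = dec ((1 / h) *\<^sub>R (S h (enc y) - enc y)) - dec (enc z)"
    by (simp only: dec_enc[OF z] dec_diff dec_scale)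
  then show ?thesis by (simp add: H_norm_dec_diff P_scale P_diff P P_enc y z)
qed

text \<open>Elements of the domain have a right derivative at 0, and conversely the mere existence
  of such a derivative forces the state into \<open>Dom\<close>; the isometry between states
  transfers both directions.\<close>

lemma DA_generator: "DA = generator_domain L D \<alpha> flow"
proof (intro set_eqI iffI)
  have pos: "\<forall>\<^sub>F h::real in at_right 0. 0 < h" by (simp add: eventually_at_filter)
  fix y
  {
    assume "y \<in> DA"
    then have y: "y \<in> H_space L" and yD: "enc y \<in> Dom" by (auto simp: DA_iff)
    define q where "q = A (enc y) + F (enc y)"
    have Pq: "P q = q" unfolding q_def P_add P_A[OF yD] P_F ..
    have "((\<lambda>h. norm ((1 / h) *\<^sub>R (S h (enc y) - enc y) - q)) \<longlongrightarrow> 0) (at_right 0)"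
      using S_right_deriv_0[OF yD] unfolding q_def by (rule tendsto_norm_zero[OF LIM_zero])
    then have "((\<lambda>h. H_norm L D \<alpha> ((1 / h) *\<^sub>R (flow h y - y) - dec q)) \<longlongrightarrow> 0) (at_right 0)"
    proof (rule Lim_transform_eventually)
      show "\<forall>\<^sub>F h in at_right 0. norm ((1 / h) *\<^sub>R (S h (enc y) - enc y) - q) = H_norm L D \<alpha> ((1 / h) *\<^sub>R (flow h y - y) - dec q)"
        using pos by eventually_elim (simp add: generator_quotient[OF y dec_H] enc_dec Pq)
    qed
    then show "y \<in> generator_domain L D \<alpha> flow" unfolding generator_domain_def using y dec_H by blast
  next
    assume "y \<in> generator_domain L D \<alpha> flow"
    then obtain z where y: "y \<in> H_space L" and z: "z \<in> H_space L"
      and l: "((\<lambda>h. H_norm L D \<alpha> ((1 / h) *\<^sub>R (flow h y - y) - z)) \<longlongrightarrow> 0) (at_right 0)"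
      unfolding generator_domain_def by blast
    have "((\<lambda>h. norm ((1 / h) *\<^sub>R (S h (enc y) - enc y) - enc z)) \<longlongrightarrow> 0) (at_right 0)"
      using l
    proof (rule Lim_transform_eventually)
      show "\<forall>\<^sub>F h in at_right 0. H_norm L D \<alpha> ((1 / h) *\<^sub>R (flow h y - y) - z) = norm ((1 / h) *\<^sub>R (S h (enc y) - enc y) - enc z)"
        using pos by eventually_elim (rule generator_quotient[OF y z])
    qed
    then have "((\<lambda>h. (1 / h) *\<^sub>R (S h (enc y) - enc y)) \<longlongrightarrow> enc z) (at_right 0)"
      by (rule LIM_zero_cancel[OF tendsto_norm_zero_cancel])
    then have "enc y \<in> Dom" by (rule D_if_right_deriv)
    then show "y \<in> DA" using y by (simp add: DA_iff)
  }
qed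

lemma flow_well_posed: "semigroup_well_posed L D \<alpha> b1 b2 U \<beta> k0 p0 flow DA"
  unfolding semigroup_well_posed_def
proof (intro conjI)
  show "is_semigroup L flow" by (rule is_semigroup_flow)
  show "\<forall>t\<ge>0. locally_Lipschitz_H L D \<alpha> (flow t)"
    unfolding locally_Lipschitz_H_def
  proof (intro allI impI)
    fix t R :: real assume t: "0 \<le> t"
    then have "t \<in> {0..t}" by simp
    then show "\<exists>K. \<forall>y\<in>H_space L. \<forall>z\<in>H_space L. H_norm L D \<alpha> y \<le> R \<longrightarrow> H_norm L D \<alpha> z \<le> R \<longrightarrow>
        H_norm L D \<alpha> (flow t y - flow t z) \<le> K * H_norm L D \<alpha> (y - z)"
      using flow_lipschitz[of t R] by blast
  qed
  show "\<forall>y0\<in>H_space L. \<forall>T>0.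
      C_H L D \<alpha> T (\<lambda>t. flow t y0) \<and>
      weak_solution L D \<alpha> b1 b2 U \<beta> k0 p0 T y0 (\<lambda>t. fst (flow t y0)) (\<lambda>t. snd (flow t y0)) \<and>
      (\<exists>(x :: nat \<Rightarrow> l2 \<times> l2) w v.
        (\<forall>n. x n \<in> H_space L \<and>
          strong_solution L D \<alpha> b1 b2 U \<beta> k0 p0 T (x n) (w n) (v n) \<and>
          C_H L D \<alpha> T (\<lambda>t. (w n t, v n t))) \<and>
        (\<forall>\<epsilon>>0. \<forall>\<^sub>F n in sequentially. \<forall>t\<in>{0..T}. H_norm L D \<alpha> ((w n t, v n t) - flow t y0) < \<epsilon>))"
  proof (intro ballI allI impI conjI)
    fix y0 and T :: real assume y0: "y0 \<in> H_space L" and T: "0 < T"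
    show "C_H L D \<alpha> T (\<lambda>t. flow t y0)" by (rule C_H_flow[OF y0])
    show "weak_solution L D \<alpha> b1 b2 U \<beta> k0 p0 T y0 (\<lambda>t. fst (flow t y0)) (\<lambda>t. snd (flow t y0))"
      by (rule weak_solution_flow[OF y0 T])
    obtain x where x: "\<And>n. x n \<in> H_space L" "\<And>n. enc (x n) \<in> Dom"
      and l: "\<forall>\<epsilon>>0. \<forall>\<^sub>F n in sequentially. \<forall>t\<in>{0..T}. H_norm L D \<alpha> (flow t (x n) - flow t y0) < \<epsilon>"
      using flow_approximation[OF y0] by blast
    show "\<exists>(x :: nat \<Rightarrow> l2 \<times> l2) w v.
        (\<forall>n. x n \<in> H_space L \<and>
          strong_solution L D \<alpha> b1 b2 U \<beta> k0 p0 T (x n) (w n) (v n) \<and>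
          C_H L D \<alpha> T (\<lambda>t. (w n t, v n t))) \<and>
        (\<forall>\<epsilon>>0. \<forall>\<^sub>F n in sequentially. \<forall>t\<in>{0..T}. H_norm L D \<alpha> ((w n t, v n t) - flow t y0) < \<epsilon>)"
      by (rule exI[of _ x], rule exI[of _ "\<lambda>n t. fst (flow t (x n))"], rule exI[of _ "\<lambda>n t. snd (flow t (x n))"])
        (simp only: prod.collapse x strong_solution_flow[OF x T] C_H_flow simp_thms, rule l)
  qed
  show "\<forall>y0\<in>H_space L. \<forall>T>0. \<forall>w v.
      weak_solution L D \<alpha> b1 b2 U \<beta> k0 p0 T y0 w v \<longrightarrow> (\<forall>t\<in>{0..T}. (w t, v t) = flow t y0)"
    unfolding flow_def using weak_solution_unique by blast
  show "\<forall>y0\<in>H_space L. \<forall>T>0. \<forall>\<epsilon>>0. \<exists>\<delta>>0. \<forall>z0\<in>H_space L.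
      H_norm L D \<alpha> (z0 - y0) < \<delta> \<longrightarrow> (\<forall>t\<in>{0..T}. H_norm L D \<alpha> (flow t z0 - flow t y0) < \<epsilon>)"
    using flow_continuous_dependence by blast
  show "DA \<subseteq> H_space L" by (auto simp: DA_iff)
  show "DA = generator_domain L D \<alpha> flow" by (rule DA_generator)
  show "\<forall>t\<ge>0. \<forall>y\<in>DA. flow t y \<in> DA" by (simp add: DA_iff flow_H enc_flow S_D)
  show "\<forall>y\<in>DA. \<forall>T>0. strong_solution L D \<alpha> b1 b2 U \<beta> k0 p0 T y (\<lambda>t. fst (flow t y)) (\<lambda>t. snd (flow t y))"
    by (simp add: DA_iff strong_solution_flow)
qed

section \<open>The energy identity\<close>

lemma energy_dec: assumes "P y = y" shows "energy L D \<alpha> b1 b2 (dec y) = En y"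
proof -
  have "(norm y)\<^sup>2 = D * (norm (gg y))\<^sup>2 + \<alpha> * (norm (hh y))\<^sup>2 + (norm (V (hh y)))\<^sup>2"
    using norm_\<iota>[of "gg y" "hh y"] assms by (simp add: P_def)
  moreover have "(norm (wx y)) ^ 4 = ((norm (wx y))\<^sup>2)\<^sup>2" by (simp flip: power_mult)
  ultimately show ?thesis
    unfolding energy_def En_def dec_def by (simp add: Dx_V V_E gg_E hh_E wx_def algebra_simps)
qed

text \<open>The energy is differentiable along every orbit, so the fundamental theorem gives the
  identity for all initial states at once, without approximation by strong solutions. The integral
  is then split into its continuous, hence integrable, parts.\<close>

lemma energy_identity:
  assumes y: "y \<in> H_space L" and T: "0 \<le> T"
  shows "energy L D \<alpha> b1 b2 (flow T y) +
      (k0 + \<beta>) * (\<integral>s. (norm (snd (flow s y)))\<^sup>2 \<partial>lebesgue_on {0..T}) +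
      \<alpha> * k0 * (\<integral>s. (norm (Dx L (snd (flow s y))))\<^sup>2 \<partial>lebesgue_on {0..T}) =
    energy L D \<alpha> b1 b2 (flow 0 y) +
      (\<integral>s. (p0 - (\<beta> * U) *\<^sub>R Dx L (fst (flow s y))) \<bullet> snd (flow s y) \<partial>lebesgue_on {0..T})"
proof -
  define c where "c s = S s (enc y)" for s
  have cc: "continuous_on {0..T} c" unfolding c_def[abs_def] by (rule S_continuous)
  have v: "snd (flow s y) = V (hh (c s))" and vx: "Dx L (V (hh (c s))) = hh (c s)"
    and w: "Dx L (fst (flow s y)) = wx (c s)" for s
    by (simp_all add: flow_def dec_def c_def Dx_V hh_E gg_E V_E wx_def)
  let ?i1 = "\<lambda>s. (norm (V (hh (c s))))\<^sup>2" and ?i2 = "\<lambda>s. (norm (hh (c s)))\<^sup>2"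
    and ?i3 = "\<lambda>s. (p0 - (\<beta> * U) *\<^sub>R wx (c s)) \<bullet> V (hh (c s))"
  have cont: "continuous_on {0..T} ?i1" "continuous_on {0..T} ?i2" "continuous_on {0..T} ?i3"
    by (intro continuous_intros V.continuous_on hh.continuous_on wx.continuous_on cc)+
  have int: "integrable (lebesgue_on {0..T}) ?i1" "integrable (lebesgue_on {0..T}) ?i2" "integrable (lebesgue_on {0..T}) ?i3"
    by (intro integrable_lebesgue_on_continuous[of 0 T] cont; simp)+
  have "((\<lambda>s. rate (c s)) has_integral En (c T) - En (c 0)) {0..T}"
  proof (rule fundamental_theorem_of_calculus[OF T])
    fix s assume "s \<in> {0..T}"
    then show "((\<lambda>s. En (c s)) has_vector_derivative rate (c s)) (at s within {0..T})"
      using energy_deriv[OF S_wsol S_continuous, of s T "enc y"]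
      by (simp add: c_def has_real_derivative_iff_has_vector_derivative)
  qed
  moreover have "((\<lambda>s. rate (c s)) has_integral (\<integral>s. rate (c s) \<partial>lebesgue_on {0..T})) {0..T}"
    by (rule has_integral_integral_lebesgue_on) (use int in \<open>simp_all add: rate_def\<close>)
  ultimately have "En (c T) - En (c 0) = (\<integral>s. rate (c s) \<partial>lebesgue_on {0..T})" by (rule has_integral_unique)
  also have "\<dots> = integral\<^sup>L (lebesgue_on {0..T}) ?i3 - (k0 + \<beta>) * integral\<^sup>L (lebesgue_on {0..T}) ?i1
      - \<alpha> * k0 * integral\<^sup>L (lebesgue_on {0..T}) ?i2"
    unfolding rate_def by (simp add: int)
  finally have e: "En (c T) - En (c 0) = \<dots>" .
  have "energy L D \<alpha> b1 b2 (flow s y) = En (c s)" if "0 \<le> s" for s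
    unfolding flow_def c_def by (intro energy_dec P_S P_enc y that)
  then show ?thesis unfolding v vx w using e T by simp
qed

end

theorem theorem2p2:
  fixes L D b1 b2 U \<beta> k0 \<alpha> :: real and p0 :: l2
  assumes "L > 0" and "D > 0" and "b2 > 0" and "U \<ge> 0" and "\<beta> \<ge> 0" and "k0 \<ge> 0"
    and "p0 \<in> L2_on L" and "\<alpha> > 0"
  shows "\<exists>S.
    semigroup_well_posed L D \<alpha> b1 b2 U \<beta> k0 p0 S
      {(w, v). w \<in> H2s L \<inter> sobolev L 3 \<and> point_value L (Dx L (Dx L w)) L = 0 \<and> v \<in> H2s L} \<and>
    (\<forall>y0\<in>H_space L. \<forall>T\<ge>0.
      energy L D \<alpha> b1 b2 (S T y0) +
        (k0 + \<beta>) * (\<integral>s. (norm (snd (S s y0)))\<^sup>2 \<partial>lebesgue_on {0..T}) +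
        \<alpha> * k0 * (\<integral>s. (norm (Dx L (snd (S s y0))))\<^sup>2 \<partial>lebesgue_on {0..T}) =
      energy L D \<alpha> b1 b2 (S 0 y0) +
        (\<integral>s. (p0 - (\<beta> * U) *\<^sub>R Dx L (fst (S s y0))) \<bullet> snd (S s y0) \<partial>lebesgue_on {0..T}))"
proof -
  interpret beam L D \<alpha> b1 b2 U \<beta> k0 p0 by unfold_locales (use assms in auto)
  show ?thesis
    using flow_well_posed energy_identity unfolding DA_def by (intro exI[of _ flow] conjI ballI allI impI)
qed

end
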